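(* Let $U_1$ be the unit distance graph of $\mathbb R$. The quantum automorphism group $\mathrm{Qut}_\delta(U_1)$ is isomorphic to the free wreath product $\mathrm{Aut}(L)\,\mathrm{Wr}_*\,\mathrm{Sym}^+(\mathbb R/\mathbb Z)$.
   Context: The graph $U_1$ has vertex set $\mathbb R$, with $x,y$ connected by an edge iff $|x-y|=1$. The graph $L$ has vertex set $\mathbb Z$, with $i,j$ connected by an edge iff $|i-j|=1$; $\mathrm{Aut}(L)$ is its classical automorphism group, viewed as a discrete group and hence as a discrete quantum group. $\mathbb R/\mathbb Z$ is regarded just as a set. Graphs are undirected, simple, without loops. Quantum permutations and automorphisms. A quantum permutation of a set $Y$ is a pair $\sigma=(\mathcal H_\sigma,u^\sigma)$ of a Hilbert space and a family $(u^\sigma_{xy})_{x,y\in Y}$ of projections in $B(\mathcal H_\sigma)$ such that each row and each column consists of pairwise orthogonal projections summing to $1$ (strongly). Intertwiners are bounded operators $T$ with $Tu^\sigma_{xy}=u^\tau_{xy}T$. The tensor product has entries $\sum_z u^\sigma_{xz}\otimes u^\tau_{zy}$, and contragredients act on the conjugate Hilbert space by $u^{\overline\sigma}_{xy}(\overline\xi)=\overline{u^\sigma_{yx}(\xi)}$. A quantum automorphism of a graph $X$ is a quantum permutation of its vertex set with $u_{x_1y_1}u_{x_2y_2}=0$ whenever the adjacency relation (equal / adjacent / distinct and non-adjacent) of $(x_1,x_2)$ differs from that of $(y_1,y_2)$. Quantum groups. A rigid $C^*$-tensor category with a fiber functor to Hilbert spaces determines a discrete quantum group $G$ by Tannaka-Krein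 reconstruction, whose category of finite dimensional corepresentations (finite dimensional representations of $\hat G$) is the given category; $C_0(G)$ is the $C^*$-direct sum of the matrix algebras $B(\mathcal H_\sigma)$ over isomorphism classes of irreducible objects, with comultiplication $\Delta:C_0(G)\to M(C_0(G)\otimes C_0(G))$ encoding the tensor product. $\mathrm{Qut}_\delta(X)$ is the discrete quantum group associated to the rigid $C^*$-tensor category of finite dimensional quantum automorphisms of the graph $X$ with its tautological fiber functor. Free wreath products. Let $G$ be a discrete quantum group and $I$ a set. An $I$-free wreath corepresentation of $G$ is a pair $\pi=(\pi^G,\pi^I)$ consisting of a family $(\pi^G_i)_{i\in I}$ of nondegenerate $*$-representations of $C_0(G)$ on a common Hilbert space $\mathcal H_\pi$ and a quantum permutation $\pi^I=(\pi^I_{ij})$ of $I$ on $\mathcal H_\pi$, such that $\pi^G_i(f)\pi^I_{ij}=\pi^I_{ij}\pi^G_i(f)$ for all $f\in C_0(G)$, $i,j\in I$. Intertwiners are bounded operators intertwining all $\pi^G_i$ and all $\pi^I_{ij}$. The tensor product of $\pi$ and $\rho$ acts on $\mathcal H_\pi\otimes\mathcal H_\rho$, with representations $f\mapsto\sum_{j\in I}(\pi^I_{ij}\otimes1)(\pi^G_i\otimes\rho^G_j)\Delta(f)$ for $i\in I$, and with quantum permutation the tensor product of $\pi^I$ and $\rho^I$. The tensor unit is $\mathbb C$ with all $\pi_i^G$ equal to the counit of $C_0(G)$ and $\pi^I_{ij}=\delta_{ij}$. The unrestricted free wreath product $G\,\mathrm{Wr}_*\,\mathrm{Sym}^+(I)$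 is the discrete quantum group associated via Tannaka-Krein reconstruction to the rigid $C^*$-tensor category of all dualisable $I$-free wreath corepresentations of $G$ with its tautological fiber functor. *)

theory Defs
  imports
    "HOL-Analysis.Infinite_Sum"
    "HOL-Algebra.Bij"
    "Jordan_Normal_Form.Schur_Decomposition"
begin

section \<open>Operators between finite dimensional Hilbert spaces\<close>

text \<open>
  A finite dimensional Hilbert space is \<open>\<complex>\<^sup>n\<close> for some \<open>n\<close> and operators are matrices. The tensor
  product of \<open>\<complex>\<^sup>m\<close> and \<open>\<complex>\<^sup>n\<close> is \<open>\<complex>\<^sup>m\<^sup>n\<close> with its lexicographically ordered basis. With this choice
  the Kronecker product is strictly associative, and \<open>\<complex>\<^sup>1\<close> is a strict unit for it.
\<close>

definition kron :: "complex mat \<Rightarrow> complex mat \<Rightarrow> complex mat" where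
  "kron A B = mat (dim_row A * dim_row B) (dim_col A * dim_col B)
     (\<lambda>(i, j). A $$ (i div dim_row B, j div dim_col B) * B $$ (i mod dim_row B, j mod dim_col B))"

definition hnorm :: "complex vec \<Rightarrow> real" where
  "hnorm v = sqrt (Re (v \<bullet>c v))"

definition op_norm :: "complex mat \<Rightarrow> real" where
  "op_norm A = (SUP v \<in> {v \<in> carrier_vec (dim_col A). hnorm v \<le> 1}. hnorm (A *\<^sub>v v))"

definition is_projection :: "nat \<Rightarrow> complex mat \<Rightarrow> bool" where
  "is_projection n p \<longleftrightarrow> p \<in> carrier_mat n n \<and> p * p = p \<and> mat_adjoint p = p"

text \<open>
  On \<open>\<complex>\<^sup>n\<close>, strong (unordered) convergence of a family of operators is convergence of all matrix entries.
\<close>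

definition strong_has_sum :: "('y \<Rightarrow> complex mat) \<Rightarrow> complex mat \<Rightarrow> 'y set \<Rightarrow> bool" where
  "strong_has_sum p S Y \<longleftrightarrow>
     (\<forall>r<dim_row S. \<forall>s<dim_col S. ((\<lambda>y. p y $$ (r, s)) has_sum S $$ (r, s)) Y)"

definition strong_sum :: "nat \<Rightarrow> ('y \<Rightarrow> complex mat) \<Rightarrow> 'y set \<Rightarrow> complex mat" where
  "strong_sum n p Y = mat n n (\<lambda>(r, s). \<Sum>\<^sub>\<infinity>y\<in>Y. p y $$ (r, s))"


section \<open>Star algebras\<close>

record 'a star_alg =
  elems :: "'a set"
  plus_of :: "'a \<Rightarrow> 'a \<Rightarrow> 'a"
  times_of :: "'a \<Rightarrow> 'a \<Rightarrow> 'a"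
  scale_of :: "complex \<Rightarrow> 'a \<Rightarrow> 'a"
  star_of :: "'a \<Rightarrow> 'a"

definition star_hom :: "'a star_alg \<Rightarrow> 'b star_alg \<Rightarrow> ('a \<Rightarrow> 'b) \<Rightarrow> bool" where
  "star_hom A B \<phi> \<longleftrightarrow>
     \<phi> \<in> elems A \<rightarrow> elems B \<and>
     (\<forall>a\<in>elems A. \<forall>b\<in>elems A. \<phi> (plus_of A a b) = plus_of B (\<phi> a) (\<phi> b)) \<and>
     (\<forall>a\<in>elems A. \<forall>b\<in>elems A. \<phi> (times_of A a b) = times_of B (\<phi> a) (\<phi> b)) \<and>
     (\<forall>z. \<forall>a\<in>elems A. \<phi> (scale_of A z a) = scale_of B z (\<phi> a)) \<and>
     (\<forall>a\<in>elems A. \<phi> (star_of A a) = star_of B (\<phi> a))"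

definition matrix_alg :: "nat \<Rightarrow> complex mat star_alg" where
  "matrix_alg n =
     \<lparr> elems = carrier_mat n n, plus_of = (+), times_of = (*), scale_of = (\<cdot>\<^sub>m), star_of = mat_adjoint \<rparr>"

text \<open>An element of a direct sum or product of matrix algebras, one block for each index.\<close>

type_synonym 'j blocks = "'j \<Rightarrow> complex mat"

definition block_alg :: "'j set \<Rightarrow> 'j blocks set \<Rightarrow> 'j blocks star_alg" where
  "block_alg J E =
     \<lparr> elems = E,
       plus_of = (\<lambda>a b. \<lambda>j\<in>J. a j + b j),
       times_of = (\<lambda>a b. \<lambda>j\<in>J. a j * b j),
       scale_of = (\<lambda>z a. \<lambda>j\<in>J. z \<cdot>\<^sub>m a j),
       star_of = (\<lambda>a. \<lambda>j\<in>J. mat_adjoint (a j)) \<rparr>"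

definition c0_sum :: "'j set \<Rightarrow> ('j \<Rightarrow> nat) \<Rightarrow> 'j blocks star_alg" where
  "c0_sum J d = block_alg J
     {a \<in> (\<Pi>\<^sub>E j\<in>J. carrier_mat (d j) (d j)). \<forall>\<epsilon>>0. finite {j\<in>J. op_norm (a j) \<ge> \<epsilon>}}"

definition linf_prod :: "'j set \<Rightarrow> ('j \<Rightarrow> nat) \<Rightarrow> 'j blocks star_alg" where
  "linf_prod J d = block_alg J
     {a \<in> (\<Pi>\<^sub>E j\<in>J. carrier_mat (d j) (d j)). \<exists>C. \<forall>j\<in>J. op_norm (a j) \<le> C}"


section \<open>Discrete quantum groups\<close>

text \<open>
  The data of a discrete quantum group \<open>G\<close>: the index set of the blocks of \<open>C\<^sub>0(G)\<close>, their sizes, the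
  comultiplication, and the counit.
\<close>

record 'i dqg =
  irr :: "'i set"
  bdim :: "'i \<Rightarrow> nat"
  comult :: "'i blocks \<Rightarrow> ('i \<times> 'i) blocks"
  counit :: "'i blocks \<Rightarrow> complex"

definition C0 :: "'i dqg \<Rightarrow> 'i blocks star_alg" where
  "C0 G = c0_sum (irr G) (bdim G)"

text \<open>
  \<open>C\<^sub>0(G) \<otimes> C\<^sub>0(G)\<close> is the \<open>c\<^sub>0\<close>-sum of the algebras \<open>M\<^bsub>d(i)\<^esub> \<otimes> M\<^bsub>d(j)\<^esub>\<close>, so that its multiplier algebra is
  their \<open>\<ell>\<^sup>\<infinity>\<close>-product.
\<close>

definition M2 :: "'i dqg \<Rightarrow> ('i \<times> 'i) blocks star_alg" where
  "M2 G = linf_prod (irr G \<times> irr G) (\<lambda>(i, j). bdim G i * bdim G j)"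

definition elem_tensor :: "'i dqg \<Rightarrow> 'i blocks \<Rightarrow> 'i blocks \<Rightarrow> ('i \<times> 'i) blocks" where
  "elem_tensor G a b = (\<lambda>(i, j) \<in> irr G \<times> irr G. kron (a i) (b j))"

text \<open>
  An isomorphism is a star isomorphism \<open>\<phi>\<close> with \<open>(\<phi> \<otimes> \<phi>) \<circ> \<Delta> = \<Delta> \<circ> \<phi>\<close>. The extension \<open>\<theta>\<close> of \<open>\<phi> \<otimes> \<phi>\<close> to multiplier
  algebras is the unique star homomorphism with the prescribed values on elementary tensors: for finitely
  supported \<open>a\<close> and \<open>b\<close> and any \<open>m\<close>, the product \<open>m (a \<otimes> b)\<close> is a sum of elementary tensors, and
  \<open>\<theta>(m) (\<phi>(a) \<otimes> \<phi>(b)) = \<theta>(m (a \<otimes> b))\<close>.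
\<close>

definition dqg_isomorphic :: "'i dqg \<Rightarrow> 'j dqg \<Rightarrow> bool" where
  "dqg_isomorphic G H \<longleftrightarrow>
     (\<exists>\<phi> \<theta>. star_hom (C0 G) (C0 H) \<phi> \<and> bij_betw \<phi> (elems (C0 G)) (elems (C0 H)) \<and>
        star_hom (M2 G) (M2 H) \<theta> \<and>
        (\<forall>a\<in>elems (C0 G). \<forall>b\<in>elems (C0 G).
           \<theta> (elem_tensor G a b) = elem_tensor H (\<phi> a) (\<phi> b)) \<and>
        (\<forall>a\<in>elems (C0 G). \<theta> (comult G a) = comult H (\<phi> a)))"

text \<open>Here \<open>C\<^sub>0(G)\<close> is the algebra of functions on the group vanishing at infinity, and \<open>\<Delta>(f)(g, h) = f(gh)\<close>.\<close>

definition dqg_of_group :: "('g, 'm) monoid_scheme \<Rightarrow> 'g dqg" where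
  "dqg_of_group \<Gamma> =
     \<lparr> irr = carrier \<Gamma>, bdim = (\<lambda>_. 1),
       comult = (\<lambda>f. \<lambda>(g, h) \<in> carrier \<Gamma> \<times> carrier \<Gamma>. f (g \<otimes>\<^bsub>\<Gamma>\<^esub> h)),
       counit = (\<lambda>f. f \<one>\<^bsub>\<Gamma>\<^esub> $$ (0, 0)) \<rparr>"


section \<open>Tannaka-Krein reconstruction\<close>

text \<open>
  A tensor category with a fiber functor to finite dimensional Hilbert spaces. The fiber functor is faithful,
  so morphisms from \<open>\<sigma>\<close> to \<open>\<tau>\<close> are recorded as matrices with \<open>hdim \<tau>\<close> rows and \<open>hdim \<sigma>\<close> columns. Composition,
  the star operation and the tensor product of morphisms are those of matrices.
\<close>

record 'o fiber_cat =
  objs :: "'o set"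
  hdim :: "'o \<Rightarrow> nat"
  mor :: "'o \<Rightarrow> 'o \<Rightarrow> complex mat set"
  tens :: "'o \<Rightarrow> 'o \<Rightarrow> 'o"
  tunit :: "'o"

definition isomorphic_objs :: "'o fiber_cat \<Rightarrow> 'o \<Rightarrow> 'o \<Rightarrow> bool" where
  "isomorphic_objs C \<sigma> \<tau> \<longleftrightarrow>
     (\<exists>T\<in>mor C \<sigma> \<tau>. \<exists>S\<in>mor C \<tau> \<sigma>. S * T = 1\<^sub>m (hdim C \<sigma>) \<and> T * S = 1\<^sub>m (hdim C \<tau>))"

definition irreducible_obj :: "'o fiber_cat \<Rightarrow> 'o \<Rightarrow> bool" where
  "irreducible_obj C \<sigma> \<longleftrightarrow>
     \<sigma> \<in> objs C \<and> hdim C \<sigma> > 0 \<and> mor C \<sigma> \<sigma> = {z \<cdot>\<^sub>m 1\<^sub>m (hdim C \<sigma>) |z. True}"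

definition irr_classes :: "'o fiber_cat \<Rightarrow> 'o set set" where
  "irr_classes C = {{\<tau> \<in> objs C. isomorphic_objs C \<sigma> \<tau>} |\<sigma>. irreducible_obj C \<sigma>}"

definition rep_of :: "'o set \<Rightarrow> 'o" where
  "rep_of c = (SOME \<sigma>. \<sigma> \<in> c)"

text \<open>
  The action of \<open>a = (a\<^sub>c)\<^sub>c\<close> on \<open>\<H>\<^sub>\<rho>\<close> for an arbitrary object \<open>\<rho>\<close>, obtained by decomposing \<open>\<rho>\<close> into irreducible objects.
\<close>

definition tk_action :: "'o fiber_cat \<Rightarrow> 'o set blocks \<Rightarrow> 'o \<Rightarrow> complex mat" where
  "tk_action C a \<rho> =
     (THE A. A \<in> carrier_mat (hdim C \<rho>) (hdim C \<rho>) \<and>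
        (\<forall>c\<in>irr_classes C. \<forall>T\<in>mor C (rep_of c) \<rho>. A * T = T * a c))"

definition tannaka_krein :: "'o fiber_cat \<Rightarrow> 'o set dqg" where
  "tannaka_krein C =
     \<lparr> irr = irr_classes C,
       bdim = (\<lambda>c. hdim C (rep_of c)),
       comult = (\<lambda>a. \<lambda>(c, d) \<in> irr_classes C \<times> irr_classes C.
                   tk_action C a (tens C (rep_of c) (rep_of d))),
       counit = (\<lambda>a. tk_action C a (tunit C) $$ (0, 0)) \<rparr>"

text \<open>Existence of a conjugate object, with solutions \<open>R\<close> and \<open>R'\<close> of the conjugate equations.\<close>

definition dualisable :: "'o fiber_cat \<Rightarrow> 'o \<Rightarrow> bool" where
  "dualisable C \<sigma> \<longleftrightarrow>
     (\<exists>\<tau>\<in>objs C. \<exists>R\<in>mor C (tunit C) (tens C \<tau> \<sigma>). \<exists>R'\<in>mor C (tunit C) (tens C \<sigma> \<tau>).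
        kron (mat_adjoint R') (1\<^sub>m (hdim C \<sigma>)) * kron (1\<^sub>m (hdim C \<sigma>)) R = 1\<^sub>m (hdim C \<sigma>) \<and>
        kron (mat_adjoint R) (1\<^sub>m (hdim C \<tau>)) * kron (1\<^sub>m (hdim C \<tau>)) R' = 1\<^sub>m (hdim C \<tau>))"


section \<open>Quantum permutations\<close>

record 'y qperm =
  qdim :: nat
  qent :: "'y \<Rightarrow> 'y \<Rightarrow> complex mat"

definition quantum_permutation :: "'y set \<Rightarrow> ('y, 'm) qperm_scheme \<Rightarrow> bool" where
  "quantum_permutation Y \<sigma> \<longleftrightarrow>
     (\<forall>x\<in>Y. \<forall>y\<in>Y. is_projection (qdim \<sigma>) (qent \<sigma> x y)) \<and>
     (\<forall>x\<in>Y. \<forall>y\<in>Y. \<forall>z\<in>Y. y \<noteq> z \<longrightarrow> qent \<sigma> x y * qent \<sigma> x z = 0\<^sub>m (qdim \<sigma>) (qdim \<sigma>)) \<and>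
     (\<forall>x\<in>Y. \<forall>y\<in>Y. \<forall>z\<in>Y. y \<noteq> z \<longrightarrow> qent \<sigma> y x * qent \<sigma> z x = 0\<^sub>m (qdim \<sigma>) (qdim \<sigma>)) \<and>
     (\<forall>x\<in>Y. strong_has_sum (\<lambda>y. qent \<sigma> x y) (1\<^sub>m (qdim \<sigma>)) Y) \<and>
     (\<forall>x\<in>Y. strong_has_sum (\<lambda>y. qent \<sigma> y x) (1\<^sub>m (qdim \<sigma>)) Y)"

definition qperm_intertwiners ::
  "'y set \<Rightarrow> ('y, 'm) qperm_scheme \<Rightarrow> ('y, 'm) qperm_scheme \<Rightarrow> complex mat set" where
  "qperm_intertwiners Y \<sigma> \<tau> =
     {T \<in> carrier_mat (qdim \<tau>) (qdim \<sigma>). \<forall>x\<in>Y. \<forall>y\<in>Y. T * qent \<sigma> x y = qent \<tau> x y * T}"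

definition qent_tensor ::
  "'y set \<Rightarrow> ('y, 'm) qperm_scheme \<Rightarrow> ('y, 'm) qperm_scheme \<Rightarrow> 'y \<Rightarrow> 'y \<Rightarrow> complex mat" where
  "qent_tensor Y \<sigma> \<tau> x y =
     strong_sum (qdim \<sigma> * qdim \<tau>) (\<lambda>z. kron (qent \<sigma> x z) (qent \<tau> z y)) Y"

definition qent_unit :: "'y \<Rightarrow> 'y \<Rightarrow> complex mat" where
  "qent_unit x y = (if x = y then 1\<^sub>m 1 else 0\<^sub>m 1 1)"


section \<open>Quantum automorphisms of graphs\<close>

record 'v graph =
  verts :: "'v set"
  adj :: "'v \<Rightarrow> 'v \<Rightarrow> bool"

datatype adj_rel = Equal | Adjacent | Distinct_Nonadjacent

definition rel_of :: "'v graph \<Rightarrow> 'v \<Rightarrow> 'v \<Rightarrow> adj_rel" where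
  "rel_of X x y = (if x = y then Equal else if adj X x y then Adjacent else Distinct_Nonadjacent)"

definition quantum_automorphism :: "'v graph \<Rightarrow> 'v qperm \<Rightarrow> bool" where
  "quantum_automorphism X \<sigma> \<longleftrightarrow>
     quantum_permutation (verts X) \<sigma> \<and>
     (\<forall>x1\<in>verts X. \<forall>x2\<in>verts X. \<forall>y1\<in>verts X. \<forall>y2\<in>verts X.
        rel_of X x1 x2 \<noteq> rel_of X y1 y2 \<longrightarrow>
        qent \<sigma> x1 y1 * qent \<sigma> x2 y2 = 0\<^sub>m (qdim \<sigma>) (qdim \<sigma>))"

definition Qut_cat :: "'v graph \<Rightarrow> 'v qperm fiber_cat" where
  "Qut_cat X =
     \<lparr> objs = {\<sigma>. quantum_automorphism X \<sigma>},
       hdim = qdim,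
       mor = qperm_intertwiners (verts X),
       tens = (\<lambda>\<sigma> \<tau>. \<lparr> qdim = qdim \<sigma> * qdim \<tau>, qent = qent_tensor (verts X) \<sigma> \<tau> \<rparr>),
       tunit = \<lparr> qdim = 1, qent = qent_unit \<rparr> \<rparr>"

definition Qut :: "'v graph \<Rightarrow> 'v qperm set dqg" where
  "Qut X = tannaka_krein (Qut_cat X)"

definition Aut :: "'v graph \<Rightarrow> ('v \<Rightarrow> 'v) monoid" where
  "Aut X = (BijGroup (verts X))
     \<lparr> carrier := {g \<in> Bij (verts X).
         \<forall>x\<in>verts X. \<forall>y\<in>verts X. adj X (g x) (g y) \<longleftrightarrow> adj X x y} \<rparr>"


section \<open>Free wreath products\<close>

definition nondegenerate_rep :: "'g dqg \<Rightarrow> nat \<Rightarrow> ('g blocks \<Rightarrow> complex mat) \<Rightarrow> bool" where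
  "nondegenerate_rep G n \<pi> \<longleftrightarrow>
     star_hom (C0 G) (matrix_alg n) \<pi> \<and>
     (\<forall>w\<in>carrier_vec n. \<exists>(m::nat) f v.
        (\<forall>k<m. f k \<in> elems (C0 G) \<and> v k \<in> carrier_vec n) \<and>
        (\<forall>r<n. w $ r = (\<Sum>k<m. (\<pi> (f k) *\<^sub>v v k) $ r)))"

text \<open>
  The extension of \<open>\<pi> \<otimes> \<rho>\<close> to \<open>M(C\<^sub>0(G) \<otimes> C\<^sub>0(G))\<close>. For nondegenerate \<open>\<pi>\<close> and \<open>\<rho>\<close> it is the unique star homomorphism
  with the prescribed values on elementary tensors, for the same reason as in the definition of isomorphisms.
\<close>

definition rep_tensor ::
  "'g dqg \<Rightarrow> nat \<Rightarrow> nat \<Rightarrow> ('g blocks \<Rightarrow> complex mat) \<Rightarrow> ('g blocks \<Rightarrow> complex mat)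
    \<Rightarrow> ('g \<times> 'g) blocks \<Rightarrow> complex mat" where
  "rep_tensor G m n \<pi> \<rho> =
     (SOME \<theta>. star_hom (M2 G) (matrix_alg (m * n)) \<theta> \<and>
        (\<forall>a\<in>elems (C0 G). \<forall>b\<in>elems (C0 G). \<theta> (elem_tensor G a b) = kron (\<pi> a) (\<rho> b)))"

text \<open>
  In the record below \<open>\<pi>\<^sup>I\<close> is the underlying quantum permutation and \<open>\<pi>\<^sup>G\<^sub>i\<close> is \<open>wrep \<pi> i\<close>. Corepresentations are only
  considered on finite dimensional Hilbert spaces: the forgetful functor to Hilbert spaces is a tensor functor,
  so that a dualisable corepresentation and its conjugate act on dualisable, that is, finite dimensional,
  Hilbert spaces.
\<close>

record ('i, 'g) wcorep = "'i qperm" +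
  wrep :: "'i \<Rightarrow> 'g blocks \<Rightarrow> complex mat"

definition wreath_corep :: "'g dqg \<Rightarrow> 'i set \<Rightarrow> ('i, 'g) wcorep \<Rightarrow> bool" where
  "wreath_corep G I \<pi> \<longleftrightarrow>
     quantum_permutation I \<pi> \<and>
     (\<forall>i\<in>I. nondegenerate_rep G (qdim \<pi>) (wrep \<pi> i)) \<and>
     (\<forall>f\<in>elems (C0 G). \<forall>i\<in>I. \<forall>j\<in>I. wrep \<pi> i f * qent \<pi> i j = qent \<pi> i j * wrep \<pi> i f)"

definition wreath_intertwiners ::
  "'g dqg \<Rightarrow> 'i set \<Rightarrow> ('i, 'g) wcorep \<Rightarrow> ('i, 'g) wcorep \<Rightarrow> complex mat set" where
  "wreath_intertwiners G I \<pi> \<rho> =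
     {T \<in> qperm_intertwiners I \<pi> \<rho>. \<forall>i\<in>I. \<forall>f\<in>elems (C0 G). T * wrep \<pi> i f = wrep \<rho> i f * T}"

definition wreath_tensor ::
  "'g dqg \<Rightarrow> 'i set \<Rightarrow> ('i, 'g) wcorep \<Rightarrow> ('i, 'g) wcorep \<Rightarrow> ('i, 'g) wcorep" where
  "wreath_tensor G I \<pi> \<rho> =
     \<lparr> qdim = qdim \<pi> * qdim \<rho>,
       qent = qent_tensor I \<pi> \<rho>,
       wrep = (\<lambda>i f. strong_sum (qdim \<pi> * qdim \<rho>)
         (\<lambda>j. kron (qent \<pi> i j) (1\<^sub>m (qdim \<rho>)) *
              rep_tensor G (qdim \<pi>) (qdim \<rho>) (wrep \<pi> i) (wrep \<rho> j) (comult G f)) I) \<rparr>"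

definition wreath_unit :: "'g dqg \<Rightarrow> ('i, 'g) wcorep" where
  "wreath_unit G = \<lparr> qdim = 1, qent = qent_unit, wrep = (\<lambda>i f. counit G f \<cdot>\<^sub>m 1\<^sub>m 1) \<rparr>"

definition wreath_cat :: "'g dqg \<Rightarrow> 'i set \<Rightarrow> ('i, 'g) wcorep fiber_cat" where
  "wreath_cat G I =
     \<lparr> objs = {\<pi>. wreath_corep G I \<pi>},
       hdim = qdim,
       mor = wreath_intertwiners G I,
       tens = wreath_tensor G I,
       tunit = wreath_unit G \<rparr>"

definition free_wreath :: "'g dqg \<Rightarrow> 'i set \<Rightarrow> ('i, 'g) wcorep set dqg" where
  "free_wreath G I =
     tannaka_krein ((wreath_cat G I)\<lparr> objs := {\<pi> \<in> objs (wreath_cat G I). dualisable (wreath_cat G I) \<pi>} \<rparr>)"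


section \<open>The graphs\<close>

definition U1 :: "real graph" where
  "U1 = \<lparr> verts = UNIV, adj = (\<lambda>x y. \<bar>x - y\<bar> = 1) \<rparr>"

definition L :: "int graph" where
  "L = \<lparr> verts = UNIV, adj = (\<lambda>i j. \<bar>i - j\<bar> = 1) \<rparr>"

definition R_mod_Z :: "real set set" where
  "R_mod_Z = UNIV // {(x, y). x - y \<in> \<int>}"

end

(*
The proof compares tensor categories. A finite dimensional quantum automorphism u of the unit distance graph
on the line and a wreath corepresentation (p, P) on the same Hilbert space correspond to each other when
u((i,k),(j,l)) = P_ij p_i(chi_kl), where the real number (i,k) is the k-th point of the coset i and chi_kl is the
indicator of {g. g l = k} in Aut(L), a set with two elements. Corresponding objects have the same intertwiners and
tensor products of corresponding objects correspond, so that the reconstructed quantum groups agree. Irreducible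
objects can only be matched up to a unitary, so the action of C_0 on tensor products has to be well defined: this
needs complete reducibility on one side.

All identities between sums of projections are checked on the members of a finite family of orthogonal projections
with sum 1.
*)
theory Submission
  imports Defs "Jordan_Normal_Form.Spectral_Radius"
begin

section \<open>Matrices\<close>

text \<open>Points in different cosets are always distinct and non-adjacent, so the graph imposes
  nothing between cosets beyond the row and column relations: the p_i for different i need not
  commute, which is the freeness of the wreath product. All rigidity lies inside one coset. There
  finite dimension is decisive: a row has finite support, so a far enough point of the coset fixes
  the orientation of the line, and all entries u((i,k),z) with i fixed become diagonal in one finite
  family. P_ij and p_i are read off from the labels of its members, a target coset and an affine map
  of slope 1 or -1. The column relations of P are not visible in that family and are tested on a
  column of u. Conversely, a symmetry of the line is determined by its values at 0 and 1, so a delta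
  function in C_0 is a product of two indicators chi; hence the projections P_ij p_i(delta_g) are
  products of two entries of u, which makes the intertwiners agree. Representations of C_0 are not
  assumed continuous, so it has to be proved that finitely many points carry them. Contragredients
  show that dualisability excludes nothing.\<close>

lemma mat_adjoint_dim [simp]:
  "dim_row (mat_adjoint A) = dim_col A" "dim_col (mat_adjoint A) = dim_row A"
  by (simp_all add: mat_adjoint_def)

lemma mat_adjoint_carrier [simp, intro]:
  "A \<in> carrier_mat m n \<Longrightarrow> mat_adjoint A \<in> carrier_mat n m"
  by (metis carrier_matD carrier_matI mat_adjoint_dim)

lemma mat_adjoint_index [simp]:
  fixes A :: "complex mat"
  assumes "i < dim_col A" "j < dim_row A"
  shows "mat_adjoint A $$ (i, j) = cnj (A $$ (j, i))"
  using assms unfolding mat_adjoint_def mat_of_rows_def by simp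

lemma mult_index_sum:
  assumes "i < dim_row A" "j < dim_col B" "dim_col A = dim_row B"
  shows "(A * B) $$ (i, j) = (\<Sum>k<dim_row B. A $$ (i, k) * B $$ (k, j))"
  using assms by (simp add: scalar_prod_def atLeast0LessThan)

text \<open>This and the following laws take equations between dimensions as side conditions; the
  simplifier discharges them from the dimension facts that each proof declares locally.\<close>

lemma mat_assoc:
  fixes A B C :: "complex mat"
  assumes "dim_col A = dim_row B" "dim_col B = dim_row C"
  shows "A * B * C = A * (B * C)"
  by (rule assoc_mult_mat[of _ "dim_row A" "dim_row B" _ "dim_row C" _ "dim_col C"]) (use assms in auto)

lemma mat_add_mult:
  fixes A B C :: "complex mat"
  assumes "dim_row A = dim_row B" "dim_col A = dim_col B" "dim_col B = dim_row C"
  shows "(A + B) * C = A * C + B * C"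
  by (rule add_mult_distrib_mat[of _ "dim_row A" "dim_row C" _ _ "dim_col C"]) (use assms in auto)

lemma mat_mult_add:
  fixes A B C :: "complex mat"
  assumes "dim_row B = dim_row C" "dim_col B = dim_col C" "dim_col A = dim_row C"
  shows "A * (B + C) = A * B + A * C"
  by (rule mult_add_distrib_mat[of _ "dim_row A" "dim_row C" _ "dim_col C"]) (use assms in auto)

lemma mat_minus_mult:
  fixes A B C :: "complex mat"
  assumes "dim_row A = dim_row B" "dim_col A = dim_col B" "dim_col B = dim_row C"
  shows "(A - B) * C = A * C - B * C"
  by (rule minus_mult_distrib_mat[of _ "dim_row A" "dim_row C" _ _ "dim_col C"]) (use assms in auto)

lemma mat_mult_minus:
  fixes A B C :: "complex mat"
  assumes "dim_row B = dim_row C" "dim_col B = dim_col C" "dim_col A = dim_row C"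
  shows "A * (B - C) = A * B - A * C"
  by (rule mult_minus_distrib_mat[of _ "dim_row A" "dim_row C" _ "dim_col C"]) (use assms in auto)

lemma mat_smult_mult:
  fixes A B :: "complex mat"
  assumes "dim_col A = dim_row B"
  shows "(z \<cdot>\<^sub>m A) * B = z \<cdot>\<^sub>m (A * B)"
  by (rule mult_smult_assoc_mat[of _ "dim_row A" "dim_row B" _ "dim_col B"]) (use assms in auto)

lemma mat_mult_smult:
  fixes A B :: "complex mat"
  assumes "dim_col A = dim_row B"
  shows "A * (z \<cdot>\<^sub>m B) = z \<cdot>\<^sub>m (A * B)"
  by (rule mult_smult_distrib[of _ "dim_row A" "dim_row B" _ "dim_col B"]) (use assms in auto)

lemma mat_one_mult:
  fixes A :: "complex mat"
  assumes "dim_row A = n" shows "1\<^sub>m n * A = A"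
  by (rule left_mult_one_mat[of _ n "dim_col A"]) (use assms in auto)

lemma mat_mult_one:
  fixes A :: "complex mat"
  assumes "dim_col A = n" shows "A * 1\<^sub>m n = A"
  by (rule right_mult_one_mat[of _ "dim_row A" n]) (use assms in auto)

lemma mat_zero_mult:
  fixes A :: "complex mat"
  assumes "dim_row A = n" shows "0\<^sub>m m n * A = 0\<^sub>m m (dim_col A)"
  by (rule left_mult_zero_mat[of _ n "dim_col A"]) (use assms in auto)

lemma mat_mult_zero:
  fixes A :: "complex mat"
  assumes "dim_col A = n" shows "A * 0\<^sub>m n m = 0\<^sub>m (dim_row A) m"
  by (rule right_mult_zero_mat[of _ "dim_row A" n]) (use assms in auto)

lemmas mat_simps = mat_smult_mult mat_mult_smult mat_one_mult mat_mult_one mat_zero_mult mat_mult_zero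

lemma mat_adjoint_mult:
  fixes A B :: "complex mat"
  assumes "dim_col A = dim_row B"
  shows "mat_adjoint (A * B) = mat_adjoint B * mat_adjoint A"
  by (rule eq_matI) (use assms in \<open>auto simp: mult_index_sum mult.commute simp del: index_mult_mat(1) intro!: sum.cong\<close>)

lemma mat_adjoint_adjoint [simp]: "mat_adjoint (mat_adjoint (A :: complex mat)) = A"
  by (rule eq_matI) auto

lemma mat_adjoint_one [simp]: "mat_adjoint (1\<^sub>m n :: complex mat) = 1\<^sub>m n"
  by (rule eq_matI) auto

lemma mat_adjoint_zero [simp]: "mat_adjoint (0\<^sub>m m n :: complex mat) = 0\<^sub>m n m"
  by (rule eq_matI) auto

lemma mat_adjoint_minus:
  fixes A B :: "complex mat"
  assumes "dim_row A = dim_row B" "dim_col A = dim_col B"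
  shows "mat_adjoint (A - B) = mat_adjoint A - mat_adjoint B"
  by (rule eq_matI) (use assms in auto)

lemma mat_adjoint_smult: "mat_adjoint (z \<cdot>\<^sub>m A :: complex mat) = cnj z \<cdot>\<^sub>m mat_adjoint A"
  by (rule eq_matI) auto

lemma mat_smult_smult [simp]: "a \<cdot>\<^sub>m (b \<cdot>\<^sub>m A) = (a * b :: complex) \<cdot>\<^sub>m A"
  by (rule eq_matI) auto

lemma mat_smult_one [simp]: "(1 :: complex) \<cdot>\<^sub>m A = A"
  by (rule eq_matI) auto

lemma mat_smult_zero: "A \<in> carrier_mat m n \<Longrightarrow> (0 :: complex) \<cdot>\<^sub>m A = 0\<^sub>m m n"
  by (rule eq_matI) auto

lemma mat_eq_minus_zero:
  fixes A B :: "complex mat"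
  assumes "A \<in> carrier_mat m n" "B \<in> carrier_mat m n" "A - B = 0\<^sub>m m n"
  shows "A = B"
proof (rule eq_matI)
  fix i j assume "i < dim_row B" "j < dim_col B"
  then have ij: "i < m" "j < n" using assms by auto
  then have "(A - B) $$ (i, j) = 0" using assms(3) by simp
  moreover have "(A - B) $$ (i, j) = A $$ (i, j) - B $$ (i, j)" using ij assms(2) by auto
  ultimately show "A $$ (i, j) = B $$ (i, j)" by simp
qed (use assms in auto)

text \<open>The diagonal entries of the product of the adjoint with \<open>A\<close> are the squared
  norms of the columns of \<open>A\<close>.\<close>

lemma frobenius_zero:
  fixes A :: "complex mat"
  assumes A: "A \<in> carrier_mat m n" and z: "mat_adjoint A * A = 0\<^sub>m n n"
  shows "A = 0\<^sub>m m n"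
proof (rule eq_matI)
  fix i j assume ij: "i < dim_row (0\<^sub>m m n)" "j < dim_col (0\<^sub>m m n)"
  have "0 = (mat_adjoint A * A) $$ (j, j)" using z ij by auto
  also have "\<dots> = (\<Sum>k<m. cnj (A $$ (k, j)) * A $$ (k, j))"
    using A ij by (subst mult_index_sum) (auto intro!: sum.cong)
  also have "\<dots> = of_real (\<Sum>k<m. (cmod (A $$ (k, j)))\<^sup>2)"
    by (simp add: complex_norm_square[symmetric] mult.commute del: of_real_power)
  finally have "(\<Sum>k<m. (cmod (A $$ (k, j)))\<^sup>2) = 0"
    by (metis of_real_eq_0_iff)
  then show "A $$ (i, j) = 0\<^sub>m m n $$ (i, j)"
    using ij by (subst (asm) sum_nonneg_eq_0_iff) auto
qed (use A in auto)

section \<open>Finite sums of matrices and their relation to strong sums\<close>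

text \<open>The dimensions are parameters so that the empty sum is a zero matrix of a definite
  shape.\<close>

definition msum :: "nat \<Rightarrow> nat \<Rightarrow> ('t \<Rightarrow> complex mat) \<Rightarrow> 't set \<Rightarrow> complex mat" where
  "msum m n f X = mat m n (\<lambda>(r, s). \<Sum>t\<in>X. f t $$ (r, s))"

lemma msum_carrier [simp, intro]: "msum m n f X \<in> carrier_mat m n"
  by (simp add: msum_def)

lemma msum_dim [simp]: "dim_row (msum m n f X) = m" "dim_col (msum m n f X) = n"
  by (simp_all add: msum_def)

lemma msum_index [simp]: "r < m \<Longrightarrow> s < n \<Longrightarrow> msum m n f X $$ (r, s) = (\<Sum>t\<in>X. f t $$ (r, s))"
  by (simp add: msum_def)

lemma msum_cong: "(\<And>t. t \<in> X \<Longrightarrow> f t = g t) \<Longrightarrow> msum m n f X = msum m n g X"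
  by (rule eq_matI) auto

lemma msum_mult_left:
  assumes "A \<in> carrier_mat k m" "\<And>t. t \<in> X \<Longrightarrow> f t \<in> carrier_mat m n"
  shows "A * msum m n f X = msum k n (\<lambda>t. A * f t) X"
proof (rule eq_matI)
  fix i j assume ij: "i < dim_row (msum k n (\<lambda>t. A * f t) X)" "j < dim_col (msum k n (\<lambda>t. A * f t) X)"
  have "(A * msum m n f X) $$ (i, j) = (\<Sum>a<m. A $$ (i, a) * (\<Sum>t\<in>X. f t $$ (a, j)))"
    using ij assms by (subst mult_index_sum) auto
  also have "\<dots> = (\<Sum>t\<in>X. \<Sum>a<m. A $$ (i, a) * f t $$ (a, j))"
    by (simp add: sum_distrib_left) (rule sum.swap)
  also have "\<dots> = (\<Sum>t\<in>X. (A * f t) $$ (i, j))"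
  proof (rule sum.cong)
    fix t assume t: "t \<in> X"
    show "(\<Sum>a<m. A $$ (i, a) * f t $$ (a, j)) = (A * f t) $$ (i, j)"
      using ij assms(1) carrier_matD[OF assms(2)[OF t]] by (subst mult_index_sum) auto
  qed simp
  finally show "(A * msum m n f X) $$ (i, j) = msum k n (\<lambda>t. A * f t) X $$ (i, j)"
    using ij by simp
qed (use assms in auto)

lemma msum_mult_right:
  assumes "A \<in> carrier_mat n k" "\<And>t. t \<in> X \<Longrightarrow> f t \<in> carrier_mat m n"
  shows "msum m n f X * A = msum m k (\<lambda>t. f t * A) X"
proof (rule eq_matI)
  fix i j assume ij: "i < dim_row (msum m k (\<lambda>t. f t * A) X)" "j < dim_col (msum m k (\<lambda>t. f t * A) X)"
  have "(msum m n f X * A) $$ (i, j) = (\<Sum>a<n. (\<Sum>t\<in>X. f t $$ (i, a)) * A $$ (a, j))"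
    using ij assms by (subst mult_index_sum) auto
  also have "\<dots> = (\<Sum>t\<in>X. \<Sum>a<n. f t $$ (i, a) * A $$ (a, j))"
    by (simp add: sum_distrib_right) (rule sum.swap)
  also have "\<dots> = (\<Sum>t\<in>X. (f t * A) $$ (i, j))"
  proof (rule sum.cong)
    fix t assume t: "t \<in> X"
    show "(\<Sum>a<n. f t $$ (i, a) * A $$ (a, j)) = (f t * A) $$ (i, j)"
      using ij assms(1) carrier_matD[OF assms(2)[OF t]] by (subst mult_index_sum) auto
  qed simp
  finally show "(msum m n f X * A) $$ (i, j) = msum m k (\<lambda>t. f t * A) X $$ (i, j)"
    using ij by simp
qed (use assms in auto)

lemma msum_zero:
  assumes "\<And>t. t \<in> X \<Longrightarrow> f t = 0\<^sub>m m n" shows "msum m n f X = 0\<^sub>m m n"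
  by (rule eq_matI) (use assms in auto)

lemma msum_single:
  assumes "finite X" "t \<in> X" "f t \<in> carrier_mat m n" "\<And>s. s \<in> X \<Longrightarrow> s \<noteq> t \<Longrightarrow> f s = 0\<^sub>m m n"
  shows "msum m n f X = f t"
proof (rule eq_matI)
  fix i j assume ij: "i < dim_row (f t)" "j < dim_col (f t)"
  have "(\<Sum>s\<in>X. f s $$ (i, j)) = (\<Sum>s\<in>X. if s = t then f t $$ (i, j) else 0)"
    using assms ij by (intro sum.cong) auto
  then show "msum m n f X $$ (i, j) = f t $$ (i, j)" using assms ij by simp
qed (use assms in auto)

lemma msum_adjoint:
  assumes "\<And>t. t \<in> X \<Longrightarrow> f t \<in> carrier_mat m n"
  shows "mat_adjoint (msum m n f X) = msum n m (\<lambda>t. mat_adjoint (f t)) X"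
proof (rule eq_matI)
  fix i j assume ij: "i < dim_row (msum n m (\<lambda>t. mat_adjoint (f t)) X)" "j < dim_col (msum n m (\<lambda>t. mat_adjoint (f t)) X)"
  have "(\<Sum>t\<in>X. cnj (f t $$ (j, i))) = (\<Sum>t\<in>X. mat_adjoint (f t) $$ (i, j))"
  proof (rule sum.cong)
    fix t assume "t \<in> X"
    then show "cnj (f t $$ (j, i)) = mat_adjoint (f t) $$ (i, j)"
      using ij carrier_matD[OF assms[of t]] by auto
  qed simp
  then show "mat_adjoint (msum m n f X) $$ (i, j) = msum n m (\<lambda>t. mat_adjoint (f t)) X $$ (i, j)"
    using ij by simp
qed auto

lemma msum_Sigma:
  assumes "finite X" "\<And>t. t \<in> X \<Longrightarrow> finite (Y t)"
  shows "msum m n (\<lambda>(t, s). f t s) (Sigma X Y) = msum m n (\<lambda>t. msum m n (f t) (Y t)) X"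
  by (rule eq_matI) (use assms in \<open>auto simp: sum.Sigma split_def\<close>)

lemma msum_neutral:
  assumes "finite Z" "X \<subseteq> Z" "\<And>t. t \<in> Z - X \<Longrightarrow> f t = 0\<^sub>m m n"
  shows "msum m n f Z = msum m n f X"
proof (rule eq_matI)
  fix i j assume "i < dim_row (msum m n f X)" "j < dim_col (msum m n f X)"
  then show "msum m n f Z $$ (i, j) = msum m n f X $$ (i, j)"
    using assms by (auto intro!: sum.mono_neutral_right)
qed auto

text \<open>Bridge from the unordered sums of the definitions to finite sums. It applies throughout,
  because at most n mutually orthogonal projections on an n-dimensional space are nonzero.\<close>

lemma strong_sum_finite:
  assumes "finite F" "F \<subseteq> Y" "\<And>y. y \<in> Y - F \<Longrightarrow> f y = 0\<^sub>m n n"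
  shows "strong_sum n f Y = msum n n f F"
proof (rule eq_matI)
  fix i j assume "i < dim_row (msum n n f F)" "j < dim_col (msum n n f F)"
  then have ij: "i < n" "j < n" by auto
  have "(\<Sum>\<^sub>\<infinity>y\<in>Y. f y $$ (i, j)) = (\<Sum>\<^sub>\<infinity>y\<in>F. f y $$ (i, j))"
    using assms ij by (intro infsum_cong_neutral) auto
  then show "strong_sum n f Y $$ (i, j) = msum n n f F $$ (i, j)"
    using ij assms by (simp add: strong_sum_def)
qed (auto simp: strong_sum_def)

lemma strong_sum_carrier [simp, intro]: "strong_sum n f Y \<in> carrier_mat n n"
  by (simp add: strong_sum_def)

lemma strong_has_sum_finite:
  assumes "finite F" "F \<subseteq> Y" "\<And>y. y \<in> Y - F \<Longrightarrow> f y = 0\<^sub>m n n"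
  shows "strong_has_sum f (msum n n f F) Y"
  unfolding strong_has_sum_def
proof (intro allI impI)
  fix r s assume "r < dim_row (msum n n f F)" "s < dim_col (msum n n f F)"
  then have rs: "r < n" "s < n" by auto
  have "((\<lambda>y. f y $$ (r, s)) has_sum (\<Sum>y\<in>F. f y $$ (r, s))) F"
    using assms(1) by (rule has_sum_finite)
  then have "((\<lambda>y. f y $$ (r, s)) has_sum (\<Sum>y\<in>F. f y $$ (r, s))) Y"
    by (subst has_sum_cong_neutral[where T = F and g = "\<lambda>y. f y $$ (r, s)"]) (use assms rs in auto)
  then show "((\<lambda>y. f y $$ (r, s)) has_sum msum n n f F $$ (r, s)) Y" using rs by simp
qed

lemma strong_has_sum_finite_unique:
  assumes "strong_has_sum f S Y" "S \<in> carrier_mat n n"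
    "finite F" "F \<subseteq> Y" "\<And>y. y \<in> Y - F \<Longrightarrow> f y = 0\<^sub>m n n"
  shows "msum n n f F = S"
proof (rule eq_matI)
  fix i j assume "i < dim_row S" "j < dim_col S"
  then have ij: "i < n" "j < n" using assms by auto
  have "((\<lambda>y. f y $$ (i, j)) has_sum msum n n f F $$ (i, j)) Y"
    using strong_has_sum_finite[OF assms(3-5), simplified] ij unfolding strong_has_sum_def by simp
  moreover have "((\<lambda>y. f y $$ (i, j)) has_sum S $$ (i, j)) Y"
    using assms ij unfolding strong_has_sum_def by auto
  ultimately show "msum n n f F $$ (i, j) = S $$ (i, j)" using has_sum_unique by blast
qed (use assms in auto)

text \<open>This is how tensor products are evaluated: on a suitable test operator \<open>B\<close>
  only one summand of the strong sum survives.\<close>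

lemma strong_sum_mult_select:
  assumes F: "finite F" "F \<subseteq> Y" "\<And>y. y \<in> Y - F \<Longrightarrow> f y = 0\<^sub>m n n"
    and f: "\<And>y. y \<in> Y \<Longrightarrow> f y \<in> carrier_mat n n" and B: "B \<in> carrier_mat n k"
    and y0: "y0 \<in> Y" "\<And>y. y \<in> Y \<Longrightarrow> y \<noteq> y0 \<Longrightarrow> f y * B = 0\<^sub>m n k"
  shows "strong_sum n f Y * B = f y0 * B"
proof -
  have c: "f y * B \<in> carrier_mat n k" if "y \<in> Y" for y
    using f[OF that] B by simp
  have "strong_sum n f Y * B = msum n n f F * B"
    using strong_sum_finite[OF F] by simp
  also have "\<dots> = msum n k (\<lambda>y. f y * B) F"
    using f F(2) B by (intro msum_mult_right) auto
  \<comment> \<open>\<open>y0\<close> may lie outside \<open>F\<close>, where its term vanishes;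
    inserting it makes the surviving term present in either case.\<close>
  also have "\<dots> = msum n k (\<lambda>y. f y * B) (insert y0 F)"
  proof (rule msum_neutral[symmetric])
    fix y assume "y \<in> insert y0 F - F"
    then show "f y * B = 0\<^sub>m n k" using F(3)[of y] y0(1) B by (auto simp: mat_zero_mult)
  qed (use F in auto)
  also have "\<dots> = f y0 * B"
  proof (rule msum_single)
    fix s assume "s \<in> insert y0 F" "s \<noteq> y0"
    then show "f s * B = 0\<^sub>m n k" using F(2) y0 by auto
  qed (use F c[OF y0(1)] in auto)
  finally show ?thesis .
qed

section \<open>Finite resolutions of the identity by orthogonal projections\<close>

text \<open>A projection-valued measure on a finite set. Members may be zero, so products of
  commuting families qualify without removing indices.\<close>

definition resol :: "nat \<Rightarrow> 't set \<Rightarrow> ('t \<Rightarrow> complex mat) \<Rightarrow> bool" where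
  "resol n X q \<longleftrightarrow> finite X \<and> (\<forall>t\<in>X. is_projection n (q t)) \<and>
     (\<forall>s\<in>X. \<forall>t\<in>X. s \<noteq> t \<longrightarrow> q s * q t = 0\<^sub>m n n) \<and> msum n n q X = 1\<^sub>m n"

lemma is_projectionD:
  assumes "is_projection n p"
  shows "p \<in> carrier_mat n n" "p * p = p" "mat_adjoint p = p" "dim_row p = n" "dim_col p = n"
  using assms by (auto simp: is_projection_def)

lemma resolD:
  assumes "resol n X q"
  shows "finite X" "\<And>t. t \<in> X \<Longrightarrow> is_projection n (q t)"
    "\<And>s t. s \<in> X \<Longrightarrow> t \<in> X \<Longrightarrow> s \<noteq> t \<Longrightarrow> q s * q t = 0\<^sub>m n n" "msum n n q X = 1\<^sub>m n"
    "\<And>t. t \<in> X \<Longrightarrow> q t \<in> carrier_mat n n"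
  using assms by (auto simp: resol_def is_projection_def)

text \<open>Both sides are multiplied by 1, written as the sum of the members. This test principle
  carries most of the operator identities below.\<close>

lemma resol_eqI:
  assumes r: "resol n X q" and A: "A \<in> carrier_mat m n" "B \<in> carrier_mat m n"
    and eq: "\<And>t. t \<in> X \<Longrightarrow> A * q t = B * q t"
  shows "A = B"
proof -
  note rD = resolD[OF r]
  have "A = A * msum n n q X" using A rD(4) by simp
  also have "\<dots> = msum m n (\<lambda>t. A * q t) X" using rD A by (intro msum_mult_left)
  also have "\<dots> = msum m n (\<lambda>t. B * q t) X" using eq by (rule msum_cong)
  also have "\<dots> = B * msum n n q X" using rD A by (intro msum_mult_left[symmetric])
  also have "\<dots> = B" using A rD(4) by simp
  finally show ?thesis .
qed

text \<open>Functional calculus of the resolution: the operators that act on each member as a scalar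
  are exactly these.\<close>

definition diag :: "nat \<Rightarrow> 't set \<Rightarrow> ('t \<Rightarrow> complex mat) \<Rightarrow> ('t \<Rightarrow> complex) \<Rightarrow> complex mat" where
  "diag n X q c = msum n n (\<lambda>t. c t \<cdot>\<^sub>m q t) X"

lemma diag_carrier [simp, intro]: "diag n X q c \<in> carrier_mat n n"
  by (simp add: diag_def)

lemma diag_dim [simp]: "dim_row (diag n X q c) = n" "dim_col (diag n X q c) = n"
  by (simp_all add: diag_def)

lemma diag_mult:
  assumes r: "resol n X q" and t: "t \<in> X"
  shows "diag n X q c * q t = c t \<cdot>\<^sub>m q t"
proof -
  note rD = resolD[OF r]
  have "diag n X q c * q t = msum n n (\<lambda>s. (c s \<cdot>\<^sub>m q s) * q t) X"
    unfolding diag_def using rD(5) t by (intro msum_mult_right) auto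
  also have "\<dots> = (c t \<cdot>\<^sub>m q t) * q t"
  proof (rule msum_single)
    fix s assume s: "s \<in> X" "s \<noteq> t" 
    show "(c s \<cdot>\<^sub>m q s) * q t = 0\<^sub>m n n"
      using rD(3)[OF s(1) t s(2)] carrier_matD[OF rD(5)[OF s(1)]] carrier_matD[OF rD(5)[OF t]]
      by (simp add: mat_smult_mult)
  next
    show "(c t \<cdot>\<^sub>m q t) * q t \<in> carrier_mat n n" by (rule mult_carrier_mat[OF smult_carrier_mat[OF rD(5)[OF t]] rD(5)[OF t]])
  qed (use rD(1) t in auto)
  also have "\<dots> = c t \<cdot>\<^sub>m q t"
    using is_projectionD[OF rD(2)[OF t]] by (simp add: mat_smult_mult)
  finally show ?thesis .
qed

lemma eq_diagI:
  assumes "resol n X q" "A \<in> carrier_mat n n" "\<And>t. t \<in> X \<Longrightarrow> A * q t = c t \<cdot>\<^sub>m q t"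
  shows "A = diag n X q c"
  by (rule resol_eqI[OF assms(1,2)]) (simp_all add: assms(3) diag_mult[OF assms(1)])

lemma diag_adjoint:
  assumes "resol n X q"
  shows "mat_adjoint (diag n X q c) = diag n X q (\<lambda>t. cnj (c t))"
  unfolding diag_def using resolD(2,5)[OF assms]
  by (subst msum_adjoint) (auto intro!: msum_cong simp: mat_adjoint_smult is_projection_def)

lemma diag_times:
  assumes r: "resol n X q"
  shows "diag n X q c * diag n X q d = diag n X q (\<lambda>t. c t * d t)"
proof (rule eq_diagI[OF r])
  fix t assume t: "t \<in> X"
  note p = is_projectionD[OF resolD(2)[OF r t]]
  show "diag n X q c * diag n X q d * q t = (c t * d t) \<cdot>\<^sub>m q t"
    using p by (simp add: mat_assoc diag_mult[OF r t] mat_mult_smult mult.commute)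
qed auto

text \<open>An operator that keeps or kills each member is a \<open>diag\<close> with coefficients 0
  and 1, hence self-adjoint and idempotent.\<close>

lemma projection_of_resol:
  assumes r: "resol n X q" and u: "u \<in> carrier_mat n n"
    and t: "\<And>t. t \<in> X \<Longrightarrow> u * q t = (if P t then q t else 0\<^sub>m n n)"
  shows "is_projection n u"
proof -
  have "u = diag n X q (\<lambda>t. if P t then 1 else 0)"
    using r u by (rule eq_diagI) (use t resolD(5)[OF r] mat_smult_zero in force)
  then show ?thesis
    using diag_adjoint[OF r, of "\<lambda>t. if P t then 1 else 0"]
      diag_times[OF r, of "\<lambda>t. if P t then 1 else 0" "\<lambda>t. if P t then 1 else 0"]
    by (auto simp: is_projection_def if_distrib cong: if_cong)
qed

lemma orthogonal_of_resol:
  assumes r: "resol n X q" and u: "u \<in> carrier_mat n n" "v \<in> carrier_mat n n"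
    and t: "\<And>t. t \<in> X \<Longrightarrow> u * q t = (if P t then q t else 0\<^sub>m n n)"
      "\<And>t. t \<in> X \<Longrightarrow> v * q t = (if Q t then q t else 0\<^sub>m n n)"
    and PQ: "\<And>t. t \<in> X \<Longrightarrow> \<not> (P t \<and> Q t)"
  shows "u * v = 0\<^sub>m n n"
proof (rule resol_eqI[OF r])
  fix s assume s: "s \<in> X"
  note c = resolD(5)[OF r s]
  show "u * v * q s = 0\<^sub>m n n * q s"
    using u c t(1)[OF s] t(2)[OF s] PQ[OF s]
    by (auto simp: mat_assoc mat_zero_mult mat_mult_zero split: if_splits)
qed (use u in auto)

text \<open>Each member is kept by the operator at its label and killed by all others. So only the
  finitely many labels contribute, and their sum fixes every member.\<close>

lemma strong_has_sum_of_resol: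
  assumes r: "resol n X q" and u: "\<And>y. y \<in> Y \<Longrightarrow> u y \<in> carrier_mat n n"
    and lab: "\<And>t. t \<in> X \<Longrightarrow> lab t \<in> Y"
    and t: "\<And>t y. t \<in> X \<Longrightarrow> y \<in> Y \<Longrightarrow> u y * q t = (if lab t = y then q t else 0\<^sub>m n n)"
  shows "strong_has_sum u (1\<^sub>m n) Y"
proof -
  note rD = resolD[OF r]
  have "u y = 0\<^sub>m n n" if "y \<in> Y - lab ` X" for y
  proof (rule resol_eqI[OF r])
    fix s assume s: "s \<in> X"
    show "u y * q s = 0\<^sub>m n n * q s" using that t[OF s, of y] s rD(5)[OF s] by (auto simp: mat_zero_mult)
  next
    show "u y \<in> carrier_mat n n" using that u by auto
  qed auto
  then have "strong_has_sum u (msum n n u (lab ` X)) Y"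
    using rD(1) lab by (intro strong_has_sum_finite) auto
  moreover have "msum n n u (lab ` X) = 1\<^sub>m n"
  proof (rule resol_eqI[OF r])
    fix s assume s: "s \<in> X"
    have "msum n n u (lab ` X) * q s = msum n n (\<lambda>y. u y * q s) (lab ` X)"
      using u lab rD(5)[OF s] by (intro msum_mult_right) auto
    also have "\<dots> = u (lab s) * q s"
      using rD(1) rD(5)[OF s] s lab t u by (intro msum_single) auto
    also have "\<dots> = 1\<^sub>m n * q s" using rD(5)[OF s] s t lab by auto
    finally show "msum n n u (lab ` X) * q s = 1\<^sub>m n * q s" .
  qed auto
  ultimately show ?thesis by simp
qed

text \<open>The second family may depend on the index of the first, and commutation is asked only
  within one index. Columns of a wreath corepresentation need this form: there the representation
  varies with the row, and different ones do not commute.\<close>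

lemma resol_Sigma:
  assumes r: "resol n X e" and rt: "\<And>t. t \<in> X \<Longrightarrow> resol n (Y t) (f t)"
    and comm: "\<And>t s. t \<in> X \<Longrightarrow> s \<in> Y t \<Longrightarrow> e t * f t s = f t s * e t"
  shows "resol n (Sigma X Y) (\<lambda>(t, s). e t * f t s)"
proof -
  note rD = resolD[OF r]
  note fD = resolD[OF rt]
  have p: "is_projection n (e t * f t s)" if ts: "t \<in> X" "s \<in> Y t" for t s
  proof -
    note [simp] = is_projectionD[OF rD(2)[OF ts(1)]] is_projectionD[OF fD(2)[OF ts]]
    have "(e t * f t s) * (e t * f t s) = e t * (f t s * e t) * f t s" by (simp add: mat_assoc)
    also have "\<dots> = (e t * e t) * (f t s * f t s)"
      by (subst comm[OF ts, symmetric]) (simp add: mat_assoc del: is_projectionD(2)[OF rD(2)[OF ts(1)]] is_projectionD(2)[OF fD(2)[OF ts]])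
    finally have "(e t * f t s) * (e t * f t s) = e t * f t s" by simp
    moreover have "mat_adjoint (e t * f t s) = e t * f t s"
      using comm[OF ts] by (simp add: mat_adjoint_mult)
    ultimately show ?thesis by (simp add: is_projection_def carrier_matI)
  qed
  have o: "(e t * f t s) * (e t' * f t' s') = 0\<^sub>m n n"
    if ts: "t \<in> X" "s \<in> Y t" "t' \<in> X" "s' \<in> Y t'" "(t, s) \<noteq> (t', s')" for t s t' s'
  proof (cases "t = t'")
    case False
    note [simp] = is_projectionD[OF rD(2)[OF ts(1)]] is_projectionD[OF fD(2)[OF ts(1,2)]]
      is_projectionD[OF rD(2)[OF ts(3)]] is_projectionD[OF fD(2)[OF ts(3,4)]]
    \<comment> \<open>Moving \<open>e t\<close> to the right puts it next to \<open>e t'\<close>, so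
      \<open>f t\<close> and \<open>f t'\<close> never have to be exchanged.\<close>
    have "(e t * f t s) * (e t' * f t' s') = f t s * (e t * e t') * f t' s'"
      by (simp add: comm[OF ts(1,2)] mat_assoc)
    then show ?thesis using rD(3)[OF ts(1,3) False] by (simp add: mat_simps)
  next
    case True
    then have s': "s' \<in> Y t" "s \<noteq> s'" using ts by auto
    note [simp] = is_projectionD[OF rD(2)[OF ts(1)]] is_projectionD[OF fD(2)[OF ts(1,2)]]
      is_projectionD[OF fD(2)[OF ts(1) s'(1)]]
    have "(e t * f t s) * (e t * f t s') = (e t * f t s) * (f t s' * e t)"
      by (simp add: comm[OF ts(1) s'(1)])
    also have "\<dots> = e t * (f t s * f t s') * e t" by (simp add: mat_assoc)
    finally have "(e t * f t s) * (e t * f t s') = 0\<^sub>m n n" using fD(3)[OF ts(1,2) s'] by (simp add: mat_simps)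
    then show ?thesis using True by simp
  qed
  have "msum n n (\<lambda>(t, s). e t * f t s) (Sigma X Y) = msum n n (\<lambda>t. msum n n (\<lambda>s. e t * f t s) (Y t)) X"
    using rD(1) fD(1) by (intro msum_Sigma) auto
  also have "\<dots> = msum n n e X"
  proof (rule msum_cong)
    fix t assume t: "t \<in> X"
    have "msum n n (\<lambda>s. e t * f t s) (Y t) = e t * msum n n (f t) (Y t)"
      using rD(5) fD(5) t by (intro msum_mult_left[symmetric]) auto
    then show "msum n n (\<lambda>s. e t * f t s) (Y t) = e t" using fD(4)[OF t] rD(5)[OF t] by simp
  qed
  finally show ?thesis using rD(1,4) fD(1) p o by (auto simp: resol_def)
qed

text \<open>\<open>D\<close> and \<open>D'\<close> have the same eigenvalue on corresponding
  members, and \<open>T\<close> carries one family to the other.\<close>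

lemma resol_intertwine:
  assumes r: "resol n X q" and T: "T \<in> carrier_mat m n"
    and D: "D \<in> carrier_mat n n" "D' \<in> carrier_mat m m" "\<And>t. t \<in> X \<Longrightarrow> q' t \<in> carrier_mat m m"
    and t: "\<And>t. t \<in> X \<Longrightarrow> D * q t = c t \<cdot>\<^sub>m q t" "\<And>t. t \<in> X \<Longrightarrow> D' * q' t = c t \<cdot>\<^sub>m q' t"
      "\<And>t. t \<in> X \<Longrightarrow> T * q t = q' t * T"
  shows "T * D = D' * T"
proof (rule resol_eqI[OF r])
  fix s assume s: "s \<in> X"
  note [simp] = carrier_matD[OF resolD(5)[OF r s]] carrier_matD[OF T] carrier_matD[OF D(1)]
    carrier_matD[OF D(2)] carrier_matD[OF D(3)[OF s]]
  have "T * D * q s = c s \<cdot>\<^sub>m (q' s * T)" using t[OF s] by (simp add: mat_assoc mat_mult_smult)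
  also have "\<dots> = (D' * q' s) * T" using t(2)[OF s] by (simp add: mat_smult_mult)
  also have "\<dots> = D' * T * q s" using t(3)[OF s] by (simp add: mat_assoc)
  finally show "T * D * q s = D' * T * q s" .
qed (use T D in auto)

section \<open>Kronecker products\<close>

lemma kron_dim [simp]:
  "dim_row (kron A B) = dim_row A * dim_row B" "dim_col (kron A B) = dim_col A * dim_col B"
  by (simp_all add: kron_def)

lemma kron_carrier [simp, intro]:
  "A \<in> carrier_mat m n \<Longrightarrow> B \<in> carrier_mat k l \<Longrightarrow> kron A B \<in> carrier_mat (m * k) (n * l)"
  by (metis carrier_matD carrier_matI kron_dim)

lemma kron_index:
  assumes "i < dim_row A * dim_row B" "j < dim_col A * dim_col B"
  shows "kron A B $$ (i, j) = A $$ (i div dim_row B, j div dim_col B) * B $$ (i mod dim_row B, j mod dim_col B)"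
  using assms by (simp add: kron_def)

lemma div_mod_less:
  fixes i m n :: nat
  assumes "i < m * n" shows "i div n < m" "i mod n < n"
  using assms by (auto simp: less_mult_imp_div_less) (metis mod_less_divisor mult_0_right not_gr_zero not_less_zero)

text \<open>Splits the lexicographic index of a tensor product into its two coordinates.\<close>

lemma sum_div_mod:
  fixes f :: "nat \<Rightarrow> nat \<Rightarrow> 'a :: comm_monoid_add"
  shows "(\<Sum>k<m * n. f (k div n) (k mod n)) = (\<Sum>a<m. \<Sum>b<n. f a b)"
proof -
  have "(\<Sum>k<m * n. f (k div n) (k mod n)) = (\<Sum>a<m. sum (\<lambda>k. f (k div n) (k mod n)) {a * n..<a * n + n})"
    by (rule sum.nat_group[symmetric])
  also have "\<dots> = (\<Sum>a<m. \<Sum>b<n. f a b)"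
  proof (rule sum.cong)
    fix a
    have "sum (\<lambda>k. f (k div n) (k mod n)) {0 + a * n..<n + a * n} = sum (\<lambda>b. f ((b + a * n) div n) ((b + a * n) mod n)) {0..<n}"
      by (rule sum.shift_bounds_nat_ivl)
    also have "\<dots> = (\<Sum>b<n. f a b)"
      by (auto simp: atLeast0LessThan intro!: sum.cong)
    finally show "sum (\<lambda>k. f (k div n) (k mod n)) {a * n..<a * n + n} = (\<Sum>b<n. f a b)"
      by (simp add: add.commute)
  qed simp
  finally show ?thesis .
qed

lemma kron_mult:
  assumes "dim_col A = dim_row C" "dim_col B = dim_row D"
  shows "kron A B * kron C D = kron (A * C) (B * D)"
proof (rule eq_matI)
  fix i j assume "i < dim_row (kron (A * C) (B * D))" "j < dim_col (kron (A * C) (B * D))"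
  then have ij: "i < dim_row A * dim_row B" "j < dim_col C * dim_col D" by auto
  note [simp] = div_mod_less[OF ij(1)] div_mod_less[OF ij(2)]
  let ?a = "\<lambda>k. A $$ (i div dim_row B, k)" and ?b = "\<lambda>k. B $$ (i mod dim_row B, k)"
  let ?c = "\<lambda>k. C $$ (k, j div dim_col D)" and ?d = "\<lambda>k. D $$ (k, j mod dim_col D)"
  have "(kron A B * kron C D) $$ (i, j) =
      (\<Sum>k<dim_row C * dim_row D. ?a (k div dim_row D) * ?b (k mod dim_row D) * (?c (k div dim_row D) * ?d (k mod dim_row D)))"
    using ij assms by (subst mult_index_sum) (auto simp: kron_index)
  also have "\<dots> = (\<Sum>x<dim_row C. \<Sum>y<dim_row D. ?a x * ?b y * (?c x * ?d y))"
    by (rule sum_div_mod)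
  also have "\<dots> = (\<Sum>x<dim_row C. ?a x * ?c x) * (\<Sum>y<dim_row D. ?b y * ?d y)"
    by (simp add: sum_product mult_ac)
  also have "\<dots> = kron (A * C) (B * D) $$ (i, j)"
    using ij assms by (simp add: kron_index mult_index_sum del: index_mult_mat(1))
  finally show "(kron A B * kron C D) $$ (i, j) = kron (A * C) (B * D) $$ (i, j)" .
qed auto

lemma kron_adjoint: "mat_adjoint (kron A B) = kron (mat_adjoint A) (mat_adjoint B)"
proof (rule eq_matI)
  fix i j assume "i < dim_row (kron (mat_adjoint A) (mat_adjoint B))" "j < dim_col (kron (mat_adjoint A) (mat_adjoint B))"
  then have ij: "i < dim_col A * dim_col B" "j < dim_row A * dim_row B" by auto
  show "mat_adjoint (kron A B) $$ (i, j) = kron (mat_adjoint A) (mat_adjoint B) $$ (i, j)"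
    using ij div_mod_less[OF ij(1)] div_mod_less[OF ij(2)] by (simp add: kron_index)
qed auto

lemma kron_one: "kron (1\<^sub>m m) (1\<^sub>m n) = 1\<^sub>m (m * n)"
proof (rule eq_matI)
  fix i j assume "i < dim_row (1\<^sub>m (m * n) :: complex mat)" "j < dim_col (1\<^sub>m (m * n) :: complex mat)"
  then have ij: "i < m * n" "j < m * n" by auto
  have "i = j \<longleftrightarrow> i div n = j div n \<and> i mod n = j mod n"
    by (metis div_mult_mod_eq)
  then show "kron (1\<^sub>m m) (1\<^sub>m n) $$ (i, j) = 1\<^sub>m (m * n) $$ (i, j)"
    using ij div_mod_less[OF ij(1)] div_mod_less[OF ij(2)] by (auto simp: kron_index)
qed auto

lemma kron_zero_left: "kron (0\<^sub>m m n) B = 0\<^sub>m (m * dim_row B) (n * dim_col B)"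
  by (rule eq_matI) (auto simp: kron_index div_mod_less)

lemma kron_zero_right: "kron A (0\<^sub>m m n) = 0\<^sub>m (dim_row A * m) (dim_col A * n)"
  by (rule eq_matI) (auto simp: kron_index div_mod_less)

lemma kron_smult_left: "kron (z \<cdot>\<^sub>m A) B = z \<cdot>\<^sub>m kron A B"
  by (rule eq_matI) (auto simp: kron_index div_mod_less)

lemma kron_smult_right: "kron A (z \<cdot>\<^sub>m B) = z \<cdot>\<^sub>m kron A B"
  by (rule eq_matI) (auto simp: kron_index div_mod_less)

lemma kron_msum_left:
  assumes "\<And>t. t \<in> X \<Longrightarrow> f t \<in> carrier_mat m n"
  shows "kron (msum m n f X) B = msum (m * dim_row B) (n * dim_col B) (\<lambda>t. kron (f t) B) X"
proof (rule eq_matI)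
  fix i j assume "i < dim_row (msum (m * dim_row B) (n * dim_col B) (\<lambda>t. kron (f t) B) X)"
    "j < dim_col (msum (m * dim_row B) (n * dim_col B) (\<lambda>t. kron (f t) B) X)"
  then have ij: "i < m * dim_row B" "j < n * dim_col B" by auto
  have "kron (f t) B $$ (i, j) = f t $$ (i div dim_row B, j div dim_col B) * B $$ (i mod dim_row B, j mod dim_col B)"
    if "t \<in> X" for t
    using ij carrier_matD[OF assms[OF that]] by (simp add: kron_index)
  then show "kron (msum m n f X) B $$ (i, j) = msum (m * dim_row B) (n * dim_col B) (\<lambda>t. kron (f t) B) X $$ (i, j)"
    using ij div_mod_less[OF ij(1)] div_mod_less[OF ij(2)] by (simp add: kron_index sum_distrib_right)
qed auto

lemma kron_msum_right:
  assumes "\<And>t. t \<in> X \<Longrightarrow> f t \<in> carrier_mat m n"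
  shows "kron B (msum m n f X) = msum (dim_row B * m) (dim_col B * n) (\<lambda>t. kron B (f t)) X"
proof (rule eq_matI)
  fix i j assume "i < dim_row (msum (dim_row B * m) (dim_col B * n) (\<lambda>t. kron B (f t)) X)"
    "j < dim_col (msum (dim_row B * m) (dim_col B * n) (\<lambda>t. kron B (f t)) X)"
  then have ij: "i < dim_row B * m" "j < dim_col B * n" by auto
  have "kron B (f t) $$ (i, j) = B $$ (i div m, j div n) * f t $$ (i mod m, j mod n)"
    if "t \<in> X" for t
    using ij carrier_matD[OF assms[OF that]] by (simp add: kron_index)
  then show "kron B (msum m n f X) $$ (i, j) = msum (dim_row B * m) (dim_col B * n) (\<lambda>t. kron B (f t)) X $$ (i, j)"
    using ij div_mod_less[OF ij(1)] div_mod_less[OF ij(2)] by (simp add: kron_index sum_distrib_left)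
qed auto

lemma projection_kron:
  assumes "is_projection m p" "is_projection n q"
  shows "is_projection (m * n) (kron p q)"
proof -
  note [simp] = is_projectionD[OF assms(1)] is_projectionD[OF assms(2)]
  show ?thesis unfolding is_projection_def by (simp add: kron_mult kron_adjoint carrier_matI)
qed

lemma projection_one: "is_projection n (1\<^sub>m n)"
  by (simp add: is_projection_def)

lemma resol_cong:
  assumes "resol n X q" "\<And>t. t \<in> X \<Longrightarrow> q t = q' t"
  shows "resol n X q'"
proof -
  have "msum n n q' X = msum n n q X" using assms(2) by (intro msum_cong) simp
  then show ?thesis using assms by (simp add: resol_def)
qed

lemma resol_kron_one:
  assumes "resol m X q"
  shows "resol (m * n) X (\<lambda>t. kron (q t) (1\<^sub>m n))"
proof -
  note rD = resolD[OF assms]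
  have "kron (q s) (1\<^sub>m n) * kron (q t) (1\<^sub>m n) = 0\<^sub>m (m * n) (m * n)"
    if "s \<in> X" "t \<in> X" "s \<noteq> t" for s t
    using rD(3)[OF that] carrier_matD[OF rD(5)[OF that(1)]] carrier_matD[OF rD(5)[OF that(2)]]
    by (simp add: kron_mult kron_zero_left)
  moreover have "msum (m * n) (m * n) (\<lambda>t. kron (q t) (1\<^sub>m n)) X = 1\<^sub>m (m * n)"
    using kron_msum_left[of X q, OF rD(5), where B = "1\<^sub>m n"] rD(4) by (simp add: kron_one)
  ultimately show ?thesis
    using rD(1,2) by (auto simp: resol_def intro!: projection_kron projection_one)
qed

lemma resol_one_kron:
  assumes "resol n X q"
  shows "resol (m * n) X (\<lambda>t. kron (1\<^sub>m m) (q t))"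
proof -
  note rD = resolD[OF assms]
  have "kron (1\<^sub>m m) (q s) * kron (1\<^sub>m m) (q t) = 0\<^sub>m (m * n) (m * n)"
    if "s \<in> X" "t \<in> X" "s \<noteq> t" for s t
    using rD(3)[OF that] carrier_matD[OF rD(5)[OF that(1)]] carrier_matD[OF rD(5)[OF that(2)]]
    by (simp add: kron_mult kron_zero_right)
  moreover have "msum (m * n) (m * n) (\<lambda>t. kron (1\<^sub>m m) (q t)) X = 1\<^sub>m (m * n)"
    using kron_msum_right[of X q, OF rD(5), where B = "1\<^sub>m m"] rD(4) by (simp add: kron_one)
  ultimately show ?thesis
    using rD(1,2) by (auto simp: resol_def intro!: projection_kron projection_one)
qed

text \<open>Operators on different tensor legs commute, so this is an instance of
  \<open>resol_Sigma\<close>.\<close>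

lemma resol_kron_Sigma:
  assumes r: "resol m X e" and f: "\<And>t. t \<in> X \<Longrightarrow> resol n (Y t) (f t)"
  shows "resol (m * n) (Sigma X Y) (\<lambda>(t, s). kron (e t) (f t s))"
proof -
  note e = carrier_matD[OF resolD(5)[OF r]]
  have "resol (m * n) (Sigma X Y) (\<lambda>(t, s). kron (e t) (1\<^sub>m n) * kron (1\<^sub>m m) (f t s))"
  proof (rule resol_Sigma[OF resol_kron_one[OF r] resol_one_kron[OF f]])
    fix t s assume ts: "t \<in> X" "s \<in> Y t"
    note [simp] = e[OF ts(1)] carrier_matD[OF resolD(5)[OF f[OF ts(1)] ts(2)]]
    show "kron (e t) (1\<^sub>m n) * kron (1\<^sub>m m) (f t s) = kron (1\<^sub>m m) (f t s) * kron (e t) (1\<^sub>m n)"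
      by (simp add: kron_mult mat_simps)
  qed
  moreover have "kron (e t) (1\<^sub>m n) * kron (1\<^sub>m m) (f t s) = kron (e t) (f t s)"
    if ts: "t \<in> X" "s \<in> Y t" for t s
    using e[OF ts(1)] carrier_matD[OF resolD(5)[OF f[OF ts(1)] ts(2)]] by (simp add: kron_mult mat_simps)
  ultimately show ?thesis by (auto elim!: resol_cong)
qed

section \<open>Block algebras conjugated by unitaries\<close>

text \<open>Vectors become one-column matrices, so that norms and eigenvectors fall under the same
  matrix calculus.\<close>

definition col_mat :: "complex vec \<Rightarrow> complex mat" where
  "col_mat v = mat (dim_vec v) 1 (\<lambda>(i, _). v $ i)"

lemma col_mat_carrier: "v \<in> carrier_vec n \<Longrightarrow> col_mat v \<in> carrier_mat n 1"
  by (auto simp: col_mat_def)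

lemma col_mat_mult: "A \<in> carrier_mat m n \<Longrightarrow> v \<in> carrier_vec n \<Longrightarrow> col_mat (A *\<^sub>v v) = A * col_mat v"
  by (rule eq_matI) (auto simp: col_mat_def scalar_prod_def)

lemma hnorm_col_mat: "hnorm v = sqrt (Re ((mat_adjoint (col_mat v) * col_mat v) $$ (0, 0)))"
  by (auto simp: hnorm_def col_mat_def scalar_prod_def mult.commute intro!: sum.cong)

lemma hnorm_isometry:
  assumes V: "V \<in> carrier_mat m n" "mat_adjoint V * V = 1\<^sub>m n" and v: "v \<in> carrier_vec n"
  shows "hnorm (V *\<^sub>v v) = hnorm v"
proof -
  note [simp] = carrier_matD[OF V(1)] carrier_matD[OF col_mat_carrier[OF v]]
  have "mat_adjoint (V * col_mat v) * (V * col_mat v) = mat_adjoint (col_mat v) * (mat_adjoint V * V) * col_mat v"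
    by (simp add: mat_adjoint_mult mat_assoc)
  then show ?thesis
    by (simp add: hnorm_col_mat col_mat_mult[OF V(1) v] V(2) mat_simps)
qed

text \<open>The adjoint of \<open>V\<close> maps one unit ball onto the other and \<open>V\<close>
  preserves norms, so the two suprema are taken over the same set of real numbers.\<close>

lemma op_norm_conj:
  assumes V: "V \<in> carrier_mat m n" "mat_adjoint V * V = 1\<^sub>m n" "V * mat_adjoint V = 1\<^sub>m m"
    and a: "a \<in> carrier_mat n n"
  shows "op_norm (V * a * mat_adjoint V) = op_norm a"
proof -
  have Vs: "mat_adjoint V \<in> carrier_mat n m" using V by simp
  have V3: "mat_adjoint (mat_adjoint V) * mat_adjoint V = 1\<^sub>m m" using V by simp
  have eq: "hnorm ((V * a * mat_adjoint V) *\<^sub>v v) = hnorm (a *\<^sub>v (mat_adjoint V *\<^sub>v v))"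
    if v: "v \<in> carrier_vec m" for v
  proof -
    have "(V * a * mat_adjoint V) *\<^sub>v v = V *\<^sub>v (a *\<^sub>v (mat_adjoint V *\<^sub>v v))"
      using V(1) a Vs v assoc_mult_mat_vec[OF mult_carrier_mat[OF V(1) a] Vs v]
        assoc_mult_mat_vec[OF V(1) a mult_mat_vec_carrier[OF Vs v]] by simp
    then show ?thesis
      using hnorm_isometry[OF V(1,2), of "a *\<^sub>v (mat_adjoint V *\<^sub>v v)"] a Vs v by simp
  qed
  have "(\<lambda>v. hnorm ((V * a * mat_adjoint V) *\<^sub>v v)) ` {v \<in> carrier_vec m. hnorm v \<le> 1}
      = (\<lambda>v. hnorm (a *\<^sub>v v)) ` {v \<in> carrier_vec n. hnorm v \<le> 1}" (is "?f ` ?A = ?g ` ?B")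
  proof (intro equalityI subsetI)
    fix y assume "y \<in> ?f ` ?A"
    then obtain v where v: "v \<in> carrier_vec m" "hnorm v \<le> 1" "y = ?f v" by auto
    have "mat_adjoint V *\<^sub>v v \<in> ?B" using hnorm_isometry[OF Vs V3 v(1)] v Vs by auto
    then show "y \<in> ?g ` ?B" using v eq by auto
  next
    fix y assume "y \<in> ?g ` ?B"
    then obtain w where w: "w \<in> carrier_vec n" "hnorm w \<le> 1" "y = ?g w" by auto
    have "V *\<^sub>v w \<in> ?A" using hnorm_isometry[OF V(1,2) w(1)] w V by auto
    moreover have "mat_adjoint V *\<^sub>v (V *\<^sub>v w) = w"
      using V Vs w assoc_mult_mat_vec[OF Vs V(1) w(1)] by simp
    ultimately show "y \<in> ?f ` ?A" using w eq[of "V *\<^sub>v w"] by (intro image_eqI[of _ _ "V *\<^sub>v w"]) auto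
  qed
  then show ?thesis using V a unfolding op_norm_def by simp
qed

text \<open>Contravariant in the index: the algebra map goes from blocks over the target of
  \<open>\<Psi>\<close> to blocks over its source.\<close>

definition conj_blocks :: "'k set \<Rightarrow> ('k \<Rightarrow> 'j) \<Rightarrow> ('k \<Rightarrow> complex mat) \<Rightarrow> 'j blocks \<Rightarrow> 'k blocks" where
  "conj_blocks K \<Psi> V a = (\<lambda>k\<in>K. V k * a (\<Psi> k) * mat_adjoint (V k))"

locale unitary_blocks =
  fixes K :: "'k set" and J :: "'j set" and \<Psi> :: "'k \<Rightarrow> 'j" and V :: "'k \<Rightarrow> complex mat"
    and e :: "'k \<Rightarrow> nat" and d :: "'j \<Rightarrow> nat"
  assumes bij: "bij_betw \<Psi> K J"
    and V: "\<And>k. k \<in> K \<Longrightarrow> V k \<in> carrier_mat (e k) (d (\<Psi> k))"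
      "\<And>k. k \<in> K \<Longrightarrow> mat_adjoint (V k) * V k = 1\<^sub>m (d (\<Psi> k))"
      "\<And>k. k \<in> K \<Longrightarrow> V k * mat_adjoint (V k) = 1\<^sub>m (e k)"
begin

lemma \<Psi>_in: "k \<in> K \<Longrightarrow> \<Psi> k \<in> J"
  using bij by (auto simp: bij_betw_def)

lemma conj_carrier:
  assumes "a \<in> (\<Pi>\<^sub>E j\<in>J. carrier_mat (d j) (d j))"
  shows "conj_blocks K \<Psi> V a \<in> (\<Pi>\<^sub>E k\<in>K. carrier_mat (e k) (e k))"
proof -
  have "V k * a (\<Psi> k) * mat_adjoint (V k) \<in> carrier_mat (e k) (e k)" if "k \<in> K" for k
    using V(1)[OF that] by (intro carrier_matI) auto
  then show ?thesis by (auto simp: conj_blocks_def)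
qed

lemma conj_op_norm:
  assumes "a \<in> (\<Pi>\<^sub>E j\<in>J. carrier_mat (d j) (d j))" "k \<in> K"
  shows "op_norm (conj_blocks K \<Psi> V a k) = op_norm (a (\<Psi> k))"
  using op_norm_conj[OF V[OF assms(2)], of "a (\<Psi> k)"] assms \<Psi>_in[OF assms(2)] by (auto simp: conj_blocks_def)

text \<open>Stated for arbitrary sets of block families, so that it serves both the c_0-sum and the
  bounded product.\<close>

lemma star_hom_conj:
  assumes E: "E \<subseteq> (\<Pi>\<^sub>E j\<in>J. carrier_mat (d j) (d j))" and E': "\<And>a. a \<in> E \<Longrightarrow> conj_blocks K \<Psi> V a \<in> E'"
  shows "star_hom (block_alg J E) (block_alg K E') (conj_blocks K \<Psi> V)"
  unfolding star_hom_def
proof (intro conjI ballI allI)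
  show "conj_blocks K \<Psi> V \<in> elems (block_alg J E) \<rightarrow> elems (block_alg K E')"
    using E' by (auto simp: block_alg_def)
next
  fix a b assume ab: "a \<in> elems (block_alg J E)" "b \<in> elems (block_alg J E)"
  have c: "a (\<Psi> k) \<in> carrier_mat (d (\<Psi> k)) (d (\<Psi> k))" "b (\<Psi> k) \<in> carrier_mat (d (\<Psi> k)) (d (\<Psi> k))"
    if "k \<in> K" for k
    using that ab E \<Psi>_in[OF that] by (auto simp: block_alg_def)
  show "conj_blocks K \<Psi> V (plus_of (block_alg J E) a b) =
      plus_of (block_alg K E') (conj_blocks K \<Psi> V a) (conj_blocks K \<Psi> V b)"
  proof (rule ext)
    fix k
    show "conj_blocks K \<Psi> V (plus_of (block_alg J E) a b) k =
      plus_of (block_alg K E') (conj_blocks K \<Psi> V a) (conj_blocks K \<Psi> V b) k"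
    proof (cases "k \<in> K")
      case True
      note [simp] = carrier_matD[OF V(1)[OF True]] carrier_matD[OF c(1)[OF True]] carrier_matD[OF c(2)[OF True]]
      show ?thesis using True \<Psi>_in[OF True] by (simp add: conj_blocks_def block_alg_def mat_add_mult mat_mult_add)
    qed (auto simp: conj_blocks_def block_alg_def)
  qed
  show "conj_blocks K \<Psi> V (times_of (block_alg J E) a b) =
      times_of (block_alg K E') (conj_blocks K \<Psi> V a) (conj_blocks K \<Psi> V b)"
  proof (rule ext)
    fix k
    show "conj_blocks K \<Psi> V (times_of (block_alg J E) a b) k =
      times_of (block_alg K E') (conj_blocks K \<Psi> V a) (conj_blocks K \<Psi> V b) k"
    proof (cases "k \<in> K")
      case True
      note [simp] = carrier_matD[OF V(1)[OF True]] carrier_matD[OF c(1)[OF True]] carrier_matD[OF c(2)[OF True]]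
      have "V k * a (\<Psi> k) * mat_adjoint (V k) * (V k * b (\<Psi> k) * mat_adjoint (V k))
          = V k * (a (\<Psi> k) * ((mat_adjoint (V k) * V k) * (b (\<Psi> k) * mat_adjoint (V k))))"
        by (simp add: mat_assoc)
      also have "\<dots> = V k * (a (\<Psi> k) * b (\<Psi> k)) * mat_adjoint (V k)"
        unfolding V(2)[OF True] by (simp add: mat_simps mat_assoc)
      finally show ?thesis using True \<Psi>_in[OF True] by (simp add: conj_blocks_def block_alg_def)
    qed (auto simp: conj_blocks_def block_alg_def)
  qed
next
  fix a assume a: "a \<in> elems (block_alg J E)"
  have c: "a (\<Psi> k) \<in> carrier_mat (d (\<Psi> k)) (d (\<Psi> k))" if "k \<in> K" for k
    using that a E \<Psi>_in[OF that] by (auto simp: block_alg_def)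
  { fix z
    show "conj_blocks K \<Psi> V (scale_of (block_alg J E) z a) = scale_of (block_alg K E') z (conj_blocks K \<Psi> V a)"
    proof (rule ext)
      fix k
      show "conj_blocks K \<Psi> V (scale_of (block_alg J E) z a) k = scale_of (block_alg K E') z (conj_blocks K \<Psi> V a) k"
      proof (cases "k \<in> K")
        case True
        note [simp] = carrier_matD[OF V(1)[OF True]] carrier_matD[OF c(1)[OF True]]
        show ?thesis using True \<Psi>_in[OF True] by (simp add: conj_blocks_def block_alg_def mat_mult_smult mat_smult_mult)
      qed (auto simp: conj_blocks_def block_alg_def)
    qed }
  show "conj_blocks K \<Psi> V (star_of (block_alg J E) a) = star_of (block_alg K E') (conj_blocks K \<Psi> V a)"
  proof (rule ext)
    fix k
    show "conj_blocks K \<Psi> V (star_of (block_alg J E) a) k = star_of (block_alg K E') (conj_blocks K \<Psi> V a) k"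
    proof (cases "k \<in> K")
      case True
      note [simp] = carrier_matD[OF V(1)[OF True]] carrier_matD[OF c(1)[OF True]]
      show ?thesis using True \<Psi>_in[OF True] by (simp add: conj_blocks_def block_alg_def mat_adjoint_mult mat_assoc)
    qed (auto simp: conj_blocks_def block_alg_def)
  qed
qed

lemma conj_c0:
  assumes "a \<in> elems (c0_sum J d)" shows "conj_blocks K \<Psi> V a \<in> elems (c0_sum K e)"
proof -
  have a: "a \<in> (\<Pi>\<^sub>E j\<in>J. carrier_mat (d j) (d j))" and f: "\<And>\<epsilon>. \<epsilon> > 0 \<Longrightarrow> finite {j\<in>J. op_norm (a j) \<ge> \<epsilon>}"
    using assms by (auto simp: c0_sum_def block_alg_def)
  have "finite {k\<in>K. op_norm (conj_blocks K \<Psi> V a k) \<ge> \<epsilon>}" if "\<epsilon> > 0" for \<epsilon>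
  proof (rule finite_imageD)
    show "finite (\<Psi> ` {k\<in>K. op_norm (conj_blocks K \<Psi> V a k) \<ge> \<epsilon>})"
      by (rule finite_subset[OF _ f[OF that]]) (auto simp: conj_op_norm[OF a] \<Psi>_in)
    show "inj_on \<Psi> {k\<in>K. op_norm (conj_blocks K \<Psi> V a k) \<ge> \<epsilon>}"
      using bij by (auto simp: bij_betw_def inj_on_def)
  qed
  then show ?thesis using conj_carrier[OF a] by (simp add: c0_sum_def block_alg_def)
qed

lemma conj_linf:
  assumes "a \<in> elems (linf_prod J d)" shows "conj_blocks K \<Psi> V a \<in> elems (linf_prod K e)"
proof -
  obtain C where a: "a \<in> (\<Pi>\<^sub>E j\<in>J. carrier_mat (d j) (d j))" and C: "\<And>j. j \<in> J \<Longrightarrow> op_norm (a j) \<le> C"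
    using assms by (auto simp: linf_prod_def block_alg_def)
  have "\<forall>k\<in>K. op_norm (conj_blocks K \<Psi> V a k) \<le> C"
    using C \<Psi>_in by (simp add: conj_op_norm[OF a])
  then show ?thesis using conj_carrier[OF a] by (auto simp: linf_prod_def block_alg_def)
qed

lemma star_hom_c0: "star_hom (c0_sum J d) (c0_sum K e) (conj_blocks K \<Psi> V)"
  unfolding c0_sum_def by (rule star_hom_conj) (use conj_c0 in \<open>auto simp: c0_sum_def block_alg_def\<close>)

lemma star_hom_linf: "star_hom (linf_prod J d) (linf_prod K e) (conj_blocks K \<Psi> V)"
  unfolding linf_prod_def by (rule star_hom_conj) (use conj_linf in \<open>auto simp: linf_prod_def block_alg_def\<close>)

text \<open>Conjugation by the adjoints along the inverse bijection is again of this kind, so every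
  property of the map holds for its inverse.\<close>

lemma inverse_blocks:
  "unitary_blocks J K (inv_into K \<Psi>) (\<lambda>j. mat_adjoint (V (inv_into K \<Psi> j))) d e"
proof
  show "bij_betw (inv_into K \<Psi>) J K" using bij by (rule bij_betw_inv_into)
  fix j assume j: "j \<in> J"
  then have k: "inv_into K \<Psi> j \<in> K" "\<Psi> (inv_into K \<Psi> j) = j"
    using bij by (metis bij_betw_def inv_into_into, metis bij_betw_inv_into_right)
  show "mat_adjoint (V (inv_into K \<Psi> j)) \<in> carrier_mat (d j) (e (inv_into K \<Psi> j))"
    "mat_adjoint (mat_adjoint (V (inv_into K \<Psi> j))) * mat_adjoint (V (inv_into K \<Psi> j)) = 1\<^sub>m (e (inv_into K \<Psi> j))"
    "mat_adjoint (V (inv_into K \<Psi> j)) * mat_adjoint (mat_adjoint (V (inv_into K \<Psi> j))) = 1\<^sub>m (d j)"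
    using V[OF k(1)] k by auto
qed

lemma bij_betw_c0: "bij_betw (conj_blocks K \<Psi> V) (elems (c0_sum J d)) (elems (c0_sum K e))"
proof -
  interpret I: unitary_blocks J K "inv_into K \<Psi>" "\<lambda>j. mat_adjoint (V (inv_into K \<Psi> j))" d e
    by (rule inverse_blocks)
  let ?g = "conj_blocks J (inv_into K \<Psi>) (\<lambda>j. mat_adjoint (V (inv_into K \<Psi> j)))"
  show ?thesis
  proof (rule bij_betw_byWitness[where f' = ?g])
    show "\<forall>a\<in>elems (c0_sum J d). ?g (conj_blocks K \<Psi> V a) = a"
    proof (intro ballI ext)
      fix a j assume "a \<in> elems (c0_sum J d)"
      then have a: "a \<in> (\<Pi>\<^sub>E j\<in>J. carrier_mat (d j) (d j))" by (auto simp: c0_sum_def block_alg_def)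
      show "?g (conj_blocks K \<Psi> V a) j = a j"
      proof (cases "j \<in> J")
        case True
        define k where "k = inv_into K \<Psi> j"
        have k: "k \<in> K" "\<Psi> k = j" using True I.\<Psi>_in bij by (auto simp: k_def bij_betw_inv_into_right)
        note [simp] = carrier_matD[OF V(1)[OF k(1)]]
        have aj: "a j \<in> carrier_mat (d j) (d j)" using a True by auto
        have [simp]: "dim_row (a j) = d j" "dim_col (a j) = d j" using aj by auto
        have "?g (conj_blocks K \<Psi> V a) j = mat_adjoint (V k) * (V k * a j * mat_adjoint (V k)) * V k"
          using True k by (simp add: conj_blocks_def k_def[symmetric])
        also have "\<dots> = (mat_adjoint (V k) * V k) * a j * (mat_adjoint (V k) * V k)"
          using k by (simp add: mat_assoc)
        finally show ?thesis using V(2)[OF k(1)] k by (simp add: mat_simps)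
      qed (use a in \<open>auto simp: conj_blocks_def\<close>)
    qed
    show "\<forall>b\<in>elems (c0_sum K e). conj_blocks K \<Psi> V (?g b) = b"
    proof (intro ballI ext)
      fix b k assume "b \<in> elems (c0_sum K e)"
      then have b: "b \<in> (\<Pi>\<^sub>E k\<in>K. carrier_mat (e k) (e k))" by (auto simp: c0_sum_def block_alg_def)
      show "conj_blocks K \<Psi> V (?g b) k = b k"
      proof (cases "k \<in> K")
        case True
        have k: "\<Psi> k \<in> J" "inv_into K \<Psi> (\<Psi> k) = k" using True \<Psi>_in bij by (auto simp: bij_betw_inv_into_left)
        note [simp] = carrier_matD[OF V(1)[OF True]]
        have bk: "b k \<in> carrier_mat (e k) (e k)" using b True by auto
        have [simp]: "dim_row (b k) = e k" "dim_col (b k) = e k" using bk by auto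
        have "conj_blocks K \<Psi> V (?g b) k = V k * (mat_adjoint (V k) * b k * V k) * mat_adjoint (V k)"
          using True k by (simp add: conj_blocks_def)
        also have "\<dots> = (V k * mat_adjoint (V k)) * b k * (V k * mat_adjoint (V k))"
          by (simp add: mat_assoc)
        finally show ?thesis using V(3)[OF True] by (simp add: mat_simps)
      qed (use b in \<open>auto simp: conj_blocks_def\<close>)
    qed
    show "conj_blocks K \<Psi> V ` elems (c0_sum J d) \<subseteq> elems (c0_sum K e)" using conj_c0 by auto
    show "?g ` elems (c0_sum K e) \<subseteq> elems (c0_sum J d)" using I.conj_c0 by auto
  qed
qed

end

section \<open>Reconstruction from a semisimple fiber category\<close>

text \<open>The condition inside the definite description of \<open>tk_action\<close>, isolated so
  that existence and uniqueness can be proved separately.\<close>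

definition acts :: "'o fiber_cat \<Rightarrow> 'o set blocks \<Rightarrow> 'o \<Rightarrow> complex mat \<Rightarrow> bool" where
  "acts C a \<rho> A \<longleftrightarrow> A \<in> carrier_mat (hdim C \<rho>) (hdim C \<rho>) \<and>
     (\<forall>c\<in>irr_classes C. \<forall>T\<in>mor C (rep_of c) \<rho>. A * T = T * a c)"

lemma tk_action_acts: "tk_action C a \<rho> = (THE A. acts C a \<rho> A)"
  by (simp add: tk_action_def acts_def)

text \<open>What is demanded of the semisimple side. The assumption \<open>split\<close> packages
  complete reducibility as one induction step on the dimension: the identity of a reducible object
  factors through two objects of smaller dimension.\<close>

locale fiber_star_cat =
  fixes C :: "'o fiber_cat"
  assumes mor_carrier: "T \<in> mor C \<sigma> \<tau> \<Longrightarrow> T \<in> carrier_mat (hdim C \<tau>) (hdim C \<sigma>)"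
    and mor_id: "\<sigma> \<in> objs C \<Longrightarrow> 1\<^sub>m (hdim C \<sigma>) \<in> mor C \<sigma> \<sigma>"
    and mor_comp: "\<lbrakk>\<sigma> \<in> objs C; \<tau> \<in> objs C; \<rho> \<in> objs C; T \<in> mor C \<sigma> \<tau>; S \<in> mor C \<tau> \<rho>\<rbrakk> \<Longrightarrow> S * T \<in> mor C \<sigma> \<rho>"
    and mor_adj: "\<lbrakk>\<sigma> \<in> objs C; \<tau> \<in> objs C; T \<in> mor C \<sigma> \<tau>\<rbrakk> \<Longrightarrow> mat_adjoint T \<in> mor C \<tau> \<sigma>"
    and mor_smult: "\<lbrakk>\<sigma> \<in> objs C; \<tau> \<in> objs C; T \<in> mor C \<sigma> \<tau>\<rbrakk> \<Longrightarrow> z \<cdot>\<^sub>m T \<in> mor C \<sigma> \<tau>"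
    and tens_obj: "\<lbrakk>\<sigma> \<in> objs C; \<tau> \<in> objs C\<rbrakk> \<Longrightarrow> tens C \<sigma> \<tau> \<in> objs C"
    and tens_dim: "hdim C (tens C \<sigma> \<tau>) = hdim C \<sigma> * hdim C \<tau>"
    and mor_tens: "\<lbrakk>\<sigma> \<in> objs C; \<sigma>' \<in> objs C; \<tau> \<in> objs C; \<tau>' \<in> objs C; T \<in> mor C \<sigma> \<sigma>'; S \<in> mor C \<tau> \<tau>'\<rbrakk>
      \<Longrightarrow> kron T S \<in> mor C (tens C \<sigma> \<tau>) (tens C \<sigma>' \<tau>')"
    and split: "\<lbrakk>\<rho> \<in> objs C; hdim C \<rho> > 0; \<not> irreducible_obj C \<rho>\<rbrakk> \<Longrightarrow>
      \<exists>\<rho>1\<in>objs C. \<exists>\<rho>2\<in>objs C. \<exists>V1\<in>mor C \<rho>1 \<rho>. \<exists>V2\<in>mor C \<rho>2 \<rho>.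
        hdim C \<rho>1 < hdim C \<rho> \<and> hdim C \<rho>2 < hdim C \<rho> \<and>
        V1 * mat_adjoint V1 + V2 * mat_adjoint V2 = 1\<^sub>m (hdim C \<rho>)"
begin

lemmas mor_dim = carrier_matD[OF mor_carrier]

lemma irr_objs: "irreducible_obj C \<sigma> \<Longrightarrow> \<sigma> \<in> objs C"
  by (simp add: irreducible_obj_def)

lemma iso_refl: "\<sigma> \<in> objs C \<Longrightarrow> isomorphic_objs C \<sigma> \<sigma>"
  unfolding isomorphic_objs_def using mor_id[of \<sigma>] by (intro bexI[of _ "1\<^sub>m (hdim C \<sigma>)"]) auto

lemma iso_sym: "isomorphic_objs C \<sigma> \<tau> \<Longrightarrow> isomorphic_objs C \<tau> \<sigma>"
  unfolding isomorphic_objs_def by blast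

lemma iso_trans:
  assumes o: "\<sigma> \<in> objs C" "\<tau> \<in> objs C" "\<rho> \<in> objs C"
    and iso: "isomorphic_objs C \<sigma> \<tau>" "isomorphic_objs C \<tau> \<rho>"
  shows "isomorphic_objs C \<sigma> \<rho>"
proof -
  obtain T S where T: "T \<in> mor C \<sigma> \<tau>" "S \<in> mor C \<tau> \<sigma>" "S * T = 1\<^sub>m (hdim C \<sigma>)" "T * S = 1\<^sub>m (hdim C \<tau>)"
    using iso(1) by (auto simp: isomorphic_objs_def)
  obtain T' S' where T': "T' \<in> mor C \<tau> \<rho>" "S' \<in> mor C \<rho> \<tau>" "S' * T' = 1\<^sub>m (hdim C \<tau>)" "T' * S' = 1\<^sub>m (hdim C \<rho>)"
    using iso(2) by (auto simp: isomorphic_objs_def)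
  note [simp] = mor_dim[OF T(1)] mor_dim[OF T(2)] mor_dim[OF T'(1)] mor_dim[OF T'(2)]
  have "(S * S') * (T' * T) = S * (S' * T') * T" "(T' * T) * (S * S') = T' * (T * S) * S'"
    by (simp_all add: mat_assoc)
  then have "(S * S') * (T' * T) = 1\<^sub>m (hdim C \<sigma>)" "(T' * T) * (S * S') = 1\<^sub>m (hdim C \<rho>)"
    using T T' by (simp_all add: mat_simps)
  then show ?thesis
    unfolding isomorphic_objs_def using mor_comp[OF o T(1) T'(1)] mor_comp[OF o(3,2,1) T'(2) T(2)] by blast
qed

text \<open>The products of \<open>Z\<close> with its adjoint in both orders are scalars by
  irreducibility. Computing Z Z* Z in two ways makes the two scalars equal, and their common value
  is the squared norm of a nonzero column. Dividing \<open>Z\<close> by its square root gives a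
  unitary.\<close>

lemma unitary_of_nonzero:
  assumes irr: "irreducible_obj C \<sigma>" "irreducible_obj C \<tau>" and Z: "Z \<in> mor C \<sigma> \<tau>"
    and nz: "Z \<noteq> 0\<^sub>m (hdim C \<tau>) (hdim C \<sigma>)"
  shows "\<exists>U\<in>mor C \<sigma> \<tau>. mat_adjoint U * U = 1\<^sub>m (hdim C \<sigma>) \<and> U * mat_adjoint U = 1\<^sub>m (hdim C \<tau>)"
proof -
  note o = irr_objs[OF irr(1)] irr_objs[OF irr(2)]
  note [simp] = mor_dim[OF Z]
  have "mat_adjoint Z * Z \<in> mor C \<sigma> \<sigma>" by (rule mor_comp[OF o(1) o(2) o(1) Z mor_adj[OF o Z]])
  then obtain z where z: "mat_adjoint Z * Z = z \<cdot>\<^sub>m 1\<^sub>m (hdim C \<sigma>)" using irr(1) by (auto simp: irreducible_obj_def)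
  have "Z * mat_adjoint Z \<in> mor C \<tau> \<tau>" by (rule mor_comp[OF o(2) o(1) o(2) mor_adj[OF o Z] Z])
  then obtain w where w: "Z * mat_adjoint Z = w \<cdot>\<^sub>m 1\<^sub>m (hdim C \<tau>)" using irr(2) by (auto simp: irreducible_obj_def)
  have "z \<cdot>\<^sub>m Z = Z * (mat_adjoint Z * Z)" by (simp add: z mat_simps)
  also have "\<dots> = (Z * mat_adjoint Z) * Z" by (simp add: mat_assoc)
  also have "\<dots> = w \<cdot>\<^sub>m Z" by (simp add: w mat_simps)
  finally have zw: "z \<cdot>\<^sub>m Z = w \<cdot>\<^sub>m Z" .
  obtain i j where ij: "i < hdim C \<tau>" "j < hdim C \<sigma>" "Z $$ (i, j) \<noteq> 0"
    using nz eq_matI[of "0\<^sub>m (hdim C \<tau>) (hdim C \<sigma>)" Z] by auto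
  have "(z \<cdot>\<^sub>m Z) $$ (i, j) = (w \<cdot>\<^sub>m Z) $$ (i, j)" using zw by simp
  then have "z = w" using ij by simp
  have "z = (mat_adjoint Z * Z) $$ (j, j)" using z ij by simp
  also have "\<dots> = (\<Sum>k<hdim C \<tau>. cnj (Z $$ (k, j)) * Z $$ (k, j))"
    using ij by (subst mult_index_sum) auto
  also have "\<dots> = of_real (\<Sum>k<hdim C \<tau>. (cmod (Z $$ (k, j)))\<^sup>2)"
    by (simp add: complex_norm_square[symmetric] mult.commute del: of_real_power)
  finally have zr: "z = of_real (\<Sum>k<hdim C \<tau>. (cmod (Z $$ (k, j)))\<^sup>2)" .
  define r where "r = (\<Sum>k<hdim C \<tau>. (cmod (Z $$ (k, j)))\<^sup>2)"
  have "r > 0" unfolding r_def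
    by (rule sum_pos2[of _ i]) (use ij in auto)
  define U where "U = of_real (1 / sqrt r) \<cdot>\<^sub>m Z"
  have U: "U \<in> mor C \<sigma> \<tau>" unfolding U_def by (rule mor_smult[OF o Z])
  have s: "complex_of_real (1 / sqrt r) * (complex_of_real (1 / sqrt r) * of_real r) = 1"
    using \<open>r > 0\<close> by (simp flip: of_real_mult add: real_div_sqrt)
  have "mat_adjoint U * U = 1\<^sub>m (hdim C \<sigma>)" "U * mat_adjoint U = 1\<^sub>m (hdim C \<tau>)"
    using s z w zr \<open>z = w\<close> unfolding U_def r_def[symmetric]
    by (simp_all add: mat_adjoint_smult mat_smult_mult mat_mult_smult mult.assoc del: of_real_divide)
  then show ?thesis using U by blast
qed

lemma unitary_of_iso:
  assumes irr: "irreducible_obj C \<sigma>" "irreducible_obj C \<tau>" and iso: "isomorphic_objs C \<sigma> \<tau>"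
  shows "\<exists>U\<in>mor C \<sigma> \<tau>. mat_adjoint U * U = 1\<^sub>m (hdim C \<sigma>) \<and> U * mat_adjoint U = 1\<^sub>m (hdim C \<tau>)"
proof -
  obtain T S where T: "T \<in> mor C \<sigma> \<tau>" "S \<in> mor C \<tau> \<sigma>" "S * T = 1\<^sub>m (hdim C \<sigma>)"
    using iso by (auto simp: isomorphic_objs_def)
  have "T \<noteq> 0\<^sub>m (hdim C \<tau>) (hdim C \<sigma>)"
  proof
    assume "T = 0\<^sub>m (hdim C \<tau>) (hdim C \<sigma>)"
    then have "(1\<^sub>m (hdim C \<sigma>) :: complex mat) = 0\<^sub>m (hdim C \<sigma>) (hdim C \<sigma>)"
      using T(3) mor_dim[OF T(2)] by (simp add: mat_simps)
    then have "(1\<^sub>m (hdim C \<sigma>) :: complex mat) $$ (0, 0) = 0\<^sub>m (hdim C \<sigma>) (hdim C \<sigma>) $$ (0, 0)" by simp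
    then show False using irr(1) by (simp add: irreducible_obj_def)
  qed
  then show ?thesis using unitary_of_nonzero[OF irr T(1)] by blast
qed

lemma irreducible_iso:
  assumes irr: "irreducible_obj C \<sigma>" and o: "\<tau> \<in> objs C" and iso: "isomorphic_objs C \<sigma> \<tau>"
  shows "irreducible_obj C \<tau>"
proof -
  note os = irr_objs[OF irr]
  obtain T S where T: "T \<in> mor C \<sigma> \<tau>" "S \<in> mor C \<tau> \<sigma>" "S * T = 1\<^sub>m (hdim C \<sigma>)" "T * S = 1\<^sub>m (hdim C \<tau>)"
    using iso by (auto simp: isomorphic_objs_def)
  note [simp] = mor_dim[OF T(1)] mor_dim[OF T(2)]
  have "hdim C \<tau> > 0"
  proof (rule ccontr)
    assume "\<not> hdim C \<tau> > 0"
    then have "(S * T) $$ (0, 0) = 0" using irr by (subst mult_index_sum) (auto simp: irreducible_obj_def)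
    then show False using T(3) irr by (simp add: irreducible_obj_def)
  qed
  moreover have "\<exists>z. Z = z \<cdot>\<^sub>m 1\<^sub>m (hdim C \<tau>)" if Z: "Z \<in> mor C \<tau> \<tau>" for Z
  proof -
    note [simp] = mor_dim[OF Z]
    have "S * (Z * T) \<in> mor C \<sigma> \<sigma>" using mor_comp[OF os o os mor_comp[OF os o o T(1) Z] T(2)] .
    then obtain z where z: "S * (Z * T) = z \<cdot>\<^sub>m 1\<^sub>m (hdim C \<sigma>)" using irr by (auto simp: irreducible_obj_def)
    have "Z = (T * S) * Z * (T * S)" using T(4) by (simp add: mat_simps)
    also have "\<dots> = T * (S * (Z * T)) * S" by (simp add: mat_assoc)
    also have "\<dots> = z \<cdot>\<^sub>m 1\<^sub>m (hdim C \<tau>)" unfolding z using T(4) by (simp add: mat_simps)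
    finally show ?thesis by blast
  qed
  ultimately show ?thesis using o mor_smult[OF o o mor_id[OF o]] by (auto simp: irreducible_obj_def)
qed

lemma irr_classes_eq:
  assumes "c \<in> irr_classes C" "\<sigma> \<in> c"
  shows "irreducible_obj C \<sigma>" "c = {\<tau> \<in> objs C. isomorphic_objs C \<sigma> \<tau>}"
proof -
  obtain \<sigma>0 where s0: "irreducible_obj C \<sigma>0" "c = {\<tau> \<in> objs C. isomorphic_objs C \<sigma>0 \<tau>}"
    using assms by (auto simp: irr_classes_def)
  have o: "\<sigma> \<in> objs C" "isomorphic_objs C \<sigma>0 \<sigma>" using assms s0 by auto
  show "irreducible_obj C \<sigma>" using irreducible_iso[OF s0(1) o] .
  show "c = {\<tau> \<in> objs C. isomorphic_objs C \<sigma> \<tau>}"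
    using s0 o irr_objs[OF s0(1)] iso_trans iso_sym by blast
qed

lemma irr_class_mem:
  assumes "irreducible_obj C \<sigma>"
  shows "{\<tau> \<in> objs C. isomorphic_objs C \<sigma> \<tau>} \<in> irr_classes C" "\<sigma> \<in> {\<tau> \<in> objs C. isomorphic_objs C \<sigma> \<tau>}"
  using assms iso_refl[OF irr_objs[OF assms]] irr_objs[OF assms] by (auto simp: irr_classes_def)

lemma rep_of_mem:
  assumes "c \<in> irr_classes C"
  shows "rep_of c \<in> c" "rep_of c \<in> objs C" "irreducible_obj C (rep_of c)"
proof -
  have "\<exists>\<sigma>. \<sigma> \<in> c" using assms irr_class_mem(2) by (auto simp: irr_classes_def)
  then show r: "rep_of c \<in> c" unfolding rep_of_def by (rule someI_ex)
  show "irreducible_obj C (rep_of c)" using irr_classes_eq(1)[OF assms r] .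
  then show "rep_of c \<in> objs C" by (rule irr_objs)
qed

text \<open>A nonzero \<open>Z\<close> makes the two representatives isomorphic, hence their classes
  equal, and then \<open>Z\<close> is a scalar. So the blocks of \<open>a\<close> can be prescribed
  independently of each other.\<close>

lemma schur:
  assumes c: "c \<in> irr_classes C" "d \<in> irr_classes C" and Z: "Z \<in> mor C (rep_of c) (rep_of d)"
    and a: "\<And>c. c \<in> irr_classes C \<Longrightarrow> a c \<in> carrier_mat (hdim C (rep_of c)) (hdim C (rep_of c))"
  shows "a d * Z = Z * a c"
proof (cases "Z = 0\<^sub>m (hdim C (rep_of d)) (hdim C (rep_of c))")
  case True
  then show ?thesis using a[OF c(1)] a[OF c(2)] by simp
next
  case False
  then obtain U where "U \<in> mor C (rep_of c) (rep_of d)" "mat_adjoint U * U = 1\<^sub>m (hdim C (rep_of c))"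
      "U * mat_adjoint U = 1\<^sub>m (hdim C (rep_of d))"
    using unitary_of_nonzero[OF rep_of_mem(3)[OF c(1)] rep_of_mem(3)[OF c(2)] Z] by auto
  then have "isomorphic_objs C (rep_of c) (rep_of d)"
    unfolding isomorphic_objs_def using mor_adj[OF rep_of_mem(2)[OF c(1)] rep_of_mem(2)[OF c(2)]] by blast
  then have "rep_of d \<in> c"
    using rep_of_mem(2)[OF c(2)] by (subst irr_classes_eq(2)[OF c(1) rep_of_mem(1)[OF c(1)]]) simp
  then have "c = d"
    using irr_classes_eq(2)[OF c(1), of "rep_of d"] irr_classes_eq(2)[OF c(2) rep_of_mem(1)[OF c(2)]]
    by (metis (no_types))
  then obtain z where "Z = z \<cdot>\<^sub>m 1\<^sub>m (hdim C (rep_of c))"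
    using Z rep_of_mem(3)[OF c(1)] by (auto simp: irreducible_obj_def)
  then show ?thesis using a[OF c(1)] \<open>c = d\<close> by (simp add: mat_simps)
qed

lemma irreducible_rep:
  assumes "irreducible_obj C \<rho>"
  obtains c T S where "c \<in> irr_classes C" "T \<in> mor C (rep_of c) \<rho>" "S \<in> mor C \<rho> (rep_of c)"
    "T * S = 1\<^sub>m (hdim C \<rho>)"
proof -
  let ?c = "{\<tau> \<in> objs C. isomorphic_objs C \<rho> \<tau>}"
  have c: "?c \<in> irr_classes C" using irr_class_mem(1)[OF assms] .
  then have "isomorphic_objs C \<rho> (rep_of ?c)" using rep_of_mem(1)[OF c] by blast
  then show ?thesis using that c unfolding isomorphic_objs_def by blast
qed

text \<open>The ranges of the morphisms from irreducible representatives span the space of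
  \<open>\<rho>\<close>. The induction on the dimension uses \<open>split\<close>; an irreducible
  object is reached from its representative by an isomorphism.\<close>

lemma density:
  assumes "\<rho> \<in> objs C" "X \<in> carrier_mat m (hdim C \<rho>)"
    "\<And>c T. c \<in> irr_classes C \<Longrightarrow> T \<in> mor C (rep_of c) \<rho> \<Longrightarrow> X * T = 0\<^sub>m m (hdim C (rep_of c))"
  shows "X = 0\<^sub>m m (hdim C \<rho>)"
  using assms
proof (induction "hdim C \<rho>" arbitrary: \<rho> X rule: less_induct)
  case less
  note X = carrier_matD[OF less.prems(2)]
  consider "hdim C \<rho> = 0" | "irreducible_obj C \<rho>" | "hdim C \<rho> > 0" "\<not> irreducible_obj C \<rho>" by auto
  then show ?case
  proof cases
    case 1
    then show ?thesis using X by (intro eq_matI) auto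
  next
    case 2
    then obtain c T S where c: "c \<in> irr_classes C" "T \<in> mor C (rep_of c) \<rho>" "S \<in> mor C \<rho> (rep_of c)"
      "T * S = 1\<^sub>m (hdim C \<rho>)" by (rule irreducible_rep)
    note [simp] = X mor_dim[OF c(2)] mor_dim[OF c(3)]
    have "X = X * (T * S)" using c(4) by (simp add: mat_simps)
    also have "\<dots> = X * T * S" by (simp add: mat_assoc)
    also have "X * T = 0\<^sub>m m (hdim C (rep_of c))" by (rule less.prems(3)[OF c(1,2)])
    finally show ?thesis by (simp add: mat_simps)
  next
    case 3
    from split[OF less.prems(1) this] obtain \<rho>1 \<rho>2 V1 V2 where o: "\<rho>1 \<in> objs C" "\<rho>2 \<in> objs C"
      and V: "V1 \<in> mor C \<rho>1 \<rho>" "V2 \<in> mor C \<rho>2 \<rho>"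
      and d: "hdim C \<rho>1 < hdim C \<rho>" "hdim C \<rho>2 < hdim C \<rho>"
      and s: "V1 * mat_adjoint V1 + V2 * mat_adjoint V2 = 1\<^sub>m (hdim C \<rho>)" by blast
    have z: "X * V = 0\<^sub>m m (hdim C \<rho>')" if V: "V \<in> mor C \<rho>' \<rho>" "\<rho>' \<in> objs C" "hdim C \<rho>' < hdim C \<rho>" for V \<rho>'
    proof (rule less.hyps[OF that(3,2)])
      note [simp] = X mor_dim[OF V(1)]
      show "X * V \<in> carrier_mat m (hdim C \<rho>')" by (rule carrier_matI) auto
      fix c T assume c: "c \<in> irr_classes C" "T \<in> mor C (rep_of c) \<rho>'"
      have "X * V * T = X * (V * T)" using mor_dim[OF c(2)] by (simp add: mat_assoc)
      also have "\<dots> = 0\<^sub>m m (hdim C (rep_of c))"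
        using less.prems(3)[OF c(1) mor_comp[OF rep_of_mem(2)[OF c(1)] V(2) less.prems(1) c(2) V(1)]] .
      finally show "X * V * T = 0\<^sub>m m (hdim C (rep_of c))" .
    qed
    note [simp] = X mor_dim[OF V(1)] mor_dim[OF V(2)]
    have "X = X * (V1 * mat_adjoint V1 + V2 * mat_adjoint V2)" unfolding s by (simp add: mat_simps)
    also have "\<dots> = (X * V1) * mat_adjoint V1 + (X * V2) * mat_adjoint V2" by (simp add: mat_mult_add mat_assoc)
    finally show ?thesis using z[OF V(1) o(1) d(1)] z[OF V(2) o(2) d(2)] by (simp add: mat_simps)
  qed
qed

lemma acts_unique:
  assumes "\<rho> \<in> objs C" "acts C a \<rho> A" "acts C a \<rho> B"
  shows "A = B"
proof -
  have c: "A \<in> carrier_mat (hdim C \<rho>) (hdim C \<rho>)" "B \<in> carrier_mat (hdim C \<rho>) (hdim C \<rho>)"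
    using assms by (auto simp: acts_def)
  note [simp] = carrier_matD[OF c(1)] carrier_matD[OF c(2)]
  have "A - B = 0\<^sub>m (hdim C \<rho>) (hdim C \<rho>)"
  proof (rule density[OF assms(1)])
    fix d T assume d: "d \<in> irr_classes C" "T \<in> mor C (rep_of d) \<rho>"
    note [simp] = mor_dim[OF d(2)]
    have AT: "A * T = T * a d" "B * T = T * a d" using assms d by (auto simp: acts_def)
    have "(A - B) * T = A * T - B * T" by (rule mat_minus_mult) auto
    also have "\<dots> = A * T - A * T" by (simp only: AT)
    also have "\<dots> = 0\<^sub>m (hdim C \<rho>) (hdim C (rep_of d))" by (rule eq_matI) auto
    finally show "(A - B) * T = 0\<^sub>m (hdim C \<rho>) (hdim C (rep_of d))" .
  qed (use c in auto)
  then show ?thesis using mat_eq_minus_zero[OF c] by simp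
qed

text \<open>On an irreducible object the block is transported along an isomorphism with the
  representative, and \<open>schur\<close> gives compatibility with all other morphisms. On a
  reducible one the actions on the two smaller objects are glued.\<close>

lemma acts_exists:
  assumes a: "\<And>c. c \<in> irr_classes C \<Longrightarrow> a c \<in> carrier_mat (hdim C (rep_of c)) (hdim C (rep_of c))"
    and "\<rho> \<in> objs C"
  shows "\<exists>A. acts C a \<rho> A"
  using assms(2)
proof (induction "hdim C \<rho>" arbitrary: \<rho> rule: less_induct)
  case less
  consider "hdim C \<rho> = 0" | "irreducible_obj C \<rho>" | "hdim C \<rho> > 0" "\<not> irreducible_obj C \<rho>" by auto
  then show ?case
  proof cases
    case 1
    have "acts C a \<rho> (0\<^sub>m 0 0)"
      unfolding acts_def
    proof (intro conjI ballI)
      fix c T assume c: "c \<in> irr_classes C" "T \<in> mor C (rep_of c) \<rho>"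
      show "0\<^sub>m 0 0 * T = T * a c"
        using a[OF c(1)] mor_dim[OF c(2)] 1 by (intro eq_matI) auto
    qed (simp add: 1)
    then show ?thesis ..
  next
    case 2
    then obtain c T S where c: "c \<in> irr_classes C" "T \<in> mor C (rep_of c) \<rho>" "S \<in> mor C \<rho> (rep_of c)"
      "T * S = 1\<^sub>m (hdim C \<rho>)" by (rule irreducible_rep)
    note [simp] = mor_dim[OF c(2)] mor_dim[OF c(3)] carrier_matD[OF a[OF c(1)]]
    have "acts C a \<rho> (T * a c * S)"
      unfolding acts_def
    proof (intro conjI ballI)
      show "T * a c * S \<in> carrier_mat (hdim C \<rho>) (hdim C \<rho>)" by (rule carrier_matI) auto
      fix d T' assume d: "d \<in> irr_classes C" "T' \<in> mor C (rep_of d) \<rho>"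
      note [simp] = mor_dim[OF d(2)] carrier_matD[OF a[OF d(1)]]
      have "T * a c * S * T' = T * (a c * (S * T'))" by (simp add: mat_assoc)
      also have "a c * (S * T') = (S * T') * a d"
        using mor_comp[OF rep_of_mem(2)[OF d(1)] less.prems rep_of_mem(2)[OF c(1)] d(2) c(3)]
        by (intro schur[OF d(1) c(1) _ a]) auto
      also have "T * (S * T' * a d) = (T * S) * T' * a d" by (simp add: mat_assoc)
      finally show "T * a c * S * T' = T' * a d" using c(4) by (simp add: mat_simps)
    qed
    then show ?thesis ..
  next
    case 3
    from split[OF less.prems(1) this] obtain \<rho>1 \<rho>2 V1 V2 where o: "\<rho>1 \<in> objs C" "\<rho>2 \<in> objs C"
      and V: "V1 \<in> mor C \<rho>1 \<rho>" "V2 \<in> mor C \<rho>2 \<rho>"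
      and d: "hdim C \<rho>1 < hdim C \<rho>" "hdim C \<rho>2 < hdim C \<rho>"
      and s: "V1 * mat_adjoint V1 + V2 * mat_adjoint V2 = 1\<^sub>m (hdim C \<rho>)" by blast
    obtain A1 A2 where A: "acts C a \<rho>1 A1" "acts C a \<rho>2 A2" using less.hyps d o by blast
    have c: "A1 \<in> carrier_mat (hdim C \<rho>1) (hdim C \<rho>1)" "A2 \<in> carrier_mat (hdim C \<rho>2) (hdim C \<rho>2)"
      using A by (auto simp: acts_def)
    note [simp] = mor_dim[OF V(1)] mor_dim[OF V(2)] carrier_matD[OF c(1)] carrier_matD[OF c(2)]
    have "acts C a \<rho> (V1 * A1 * mat_adjoint V1 + V2 * A2 * mat_adjoint V2)"
      unfolding acts_def
    proof (intro conjI ballI)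
      show "V1 * A1 * mat_adjoint V1 + V2 * A2 * mat_adjoint V2 \<in> carrier_mat (hdim C \<rho>) (hdim C \<rho>)"
        by (rule carrier_matI) auto
      fix e T assume e: "e \<in> irr_classes C" "T \<in> mor C (rep_of e) \<rho>"
      note [simp] = mor_dim[OF e(2)] carrier_matD[OF a[OF e(1)]]
      \<comment> \<open>\<open>T\<close> followed by the adjoint of \<open>V1\<close> is a morphism
        into the smaller object, where \<open>A1\<close> already satisfies the condition.\<close>
      have 1: "A1 * (mat_adjoint V1 * T) = (mat_adjoint V1 * T) * a e"
        using A(1) e(1) mor_comp[OF rep_of_mem(2)[OF e(1)] less.prems o(1) e(2) mor_adj[OF o(1) less.prems V(1)]]
        by (auto simp: acts_def)
      have 2: "A2 * (mat_adjoint V2 * T) = (mat_adjoint V2 * T) * a e"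
        using A(2) e(1) mor_comp[OF rep_of_mem(2)[OF e(1)] less.prems o(2) e(2) mor_adj[OF o(2) less.prems V(2)]]
        by (auto simp: acts_def)
      have "(V1 * A1 * mat_adjoint V1 + V2 * A2 * mat_adjoint V2) * T
          = V1 * (A1 * (mat_adjoint V1 * T)) + V2 * (A2 * (mat_adjoint V2 * T))"
        by (simp add: mat_add_mult mat_assoc)
      also have "\<dots> = (V1 * mat_adjoint V1 + V2 * mat_adjoint V2) * (T * a e)"
        unfolding 1 2 by (simp add: mat_add_mult mat_assoc)
      finally show "(V1 * A1 * mat_adjoint V1 + V2 * A2 * mat_adjoint V2) * T = T * a e"
        unfolding s by (simp add: mat_simps)
    qed
    then show ?thesis ..
  qed
qed

lemma tk_action_eq:
  assumes "\<rho> \<in> objs C" "acts C a \<rho> A"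
  shows "tk_action C a \<rho> = A"
  unfolding tk_action_acts using acts_unique[OF assms(1)] assms(2) by blast

end

section \<open>Transfer of the reconstruction along an equivalence of fiber categories\<close>

text \<open>A relation instead of a functor: corepresentations are records whose functions have
  arbitrary values off the index set and off C_0, so one quantum automorphism has many partners.
  Corresponding morphism spaces are equal as sets of matrices.\<close>

locale tk_equivalence = fiber_star_cat C for C :: "'o fiber_cat" +
  fixes C' :: "'p fiber_cat" and R :: "'o \<Rightarrow> 'p \<Rightarrow> bool"
  assumes R_obj: "R \<sigma> \<pi> \<Longrightarrow> \<sigma> \<in> objs C \<and> \<pi> \<in> objs C' \<and> hdim C \<sigma> = hdim C' \<pi>"
    and R_total: "\<sigma> \<in> objs C \<Longrightarrow> \<exists>\<pi>. R \<sigma> \<pi>"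
    and R_surj: "\<pi> \<in> objs C' \<Longrightarrow> \<exists>\<sigma>. R \<sigma> \<pi>"
    and R_mor: "R \<sigma> \<pi> \<Longrightarrow> R \<sigma>' \<pi>' \<Longrightarrow> mor C \<sigma> \<sigma>' = mor C' \<pi> \<pi>'"
    and R_tens: "R \<sigma> \<pi> \<Longrightarrow> R \<sigma>' \<pi>' \<Longrightarrow> R (tens C \<sigma> \<sigma>') (tens C' \<pi> \<pi>')"
begin

lemma R_iso: "R \<sigma> \<pi> \<Longrightarrow> R \<sigma>' \<pi>' \<Longrightarrow> isomorphic_objs C \<sigma> \<sigma>' \<longleftrightarrow> isomorphic_objs C' \<pi> \<pi>'"
  using R_obj[of \<sigma> \<pi>] R_obj[of \<sigma>' \<pi>'] R_mor[of \<sigma> \<pi> \<sigma>' \<pi>'] R_mor[of \<sigma>' \<pi>' \<sigma> \<pi>]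
  by (simp add: isomorphic_objs_def)

lemma R_irreducible: "R \<sigma> \<pi> \<Longrightarrow> irreducible_obj C \<sigma> \<longleftrightarrow> irreducible_obj C' \<pi>"
  using R_obj[of \<sigma> \<pi>] R_mor[of \<sigma> \<pi> \<sigma> \<pi>] by (simp add: irreducible_obj_def)

text \<open>Collects all partners of all members, so that no partner has to be chosen.\<close>

definition trans_class :: "'o set \<Rightarrow> 'p set" where
  "trans_class c = {\<pi> \<in> objs C'. \<exists>\<sigma>\<in>c. R \<sigma> \<pi>}"

lemma trans_class_eq:
  assumes "R \<sigma> \<pi>"
  shows "trans_class {\<tau> \<in> objs C. isomorphic_objs C \<sigma> \<tau>} = {\<rho> \<in> objs C'. isomorphic_objs C' \<pi> \<rho>}"
  unfolding trans_class_def using R_iso[OF assms] R_surj R_obj by blast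

lemma bij_trans_class: "bij_betw trans_class (irr_classes C) (irr_classes C')"
proof (rule bij_betw_imageI)
  show "inj_on trans_class (irr_classes C)"
  proof (rule inj_onI)
    fix c d assume c: "c \<in> irr_classes C" "d \<in> irr_classes C" and eq: "trans_class c = trans_class d"
    obtain \<pi> where p: "R (rep_of c) \<pi>" using R_total[OF rep_of_mem(2)[OF c(1)]] by blast
    then have "\<pi> \<in> trans_class c"
      unfolding trans_class_def using rep_of_mem(1)[OF c(1)] R_obj[OF p] by auto
    then have "\<pi> \<in> trans_class d" by (simp only: eq)
    then obtain \<tau> where t: "\<tau> \<in> d" "R \<tau> \<pi>" by (auto simp: trans_class_def)
    have "isomorphic_objs C (rep_of c) \<tau>"
      using R_iso[OF p t(2)] R_iso[OF p p] iso_refl[OF rep_of_mem(2)[OF c(1)]] by simp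
    then have "\<tau> \<in> c"
      using R_obj[OF t(2)] by (subst irr_classes_eq(2)[OF c(1) rep_of_mem(1)[OF c(1)]]) simp
    then show "c = d"
      using irr_classes_eq(2)[OF c(1), of \<tau>] irr_classes_eq(2)[OF c(2) t(1)] by (metis (no_types))
  qed
  show "trans_class ` irr_classes C = irr_classes C'"
  proof (intro equalityI subsetI)
    fix x assume "x \<in> trans_class ` irr_classes C"
    then obtain \<sigma> where s: "irreducible_obj C \<sigma>" "x = trans_class {\<tau> \<in> objs C. isomorphic_objs C \<sigma> \<tau>}"
      by (auto simp: irr_classes_def)
    obtain \<pi> where p: "R \<sigma> \<pi>" using R_total[OF irr_objs[OF s(1)]] by blast
    show "x \<in> irr_classes C'"
      using s R_irreducible[OF p] trans_class_eq[OF p] by (auto simp: irr_classes_def)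
  next
    fix x assume "x \<in> irr_classes C'"
    then obtain \<pi> where p: "irreducible_obj C' \<pi>" "x = {\<tau> \<in> objs C'. isomorphic_objs C' \<pi> \<tau>}"
      by (auto simp: irr_classes_def)
    then have "\<pi> \<in> objs C'" by (simp add: irreducible_obj_def)
    then obtain \<sigma> where s: "R \<sigma> \<pi>" using R_surj by blast
    then have i: "irreducible_obj C \<sigma>" using R_irreducible p by blast
    show "x \<in> trans_class ` irr_classes C"
      using irr_class_mem(1)[OF i] trans_class_eq[OF s] p(2) by blast
  qed
qed

text \<open>The representative of the transported class is chosen without regard to
  \<open>R\<close>, so an object related to it is only isomorphic to \<open>rep_of c\<close>;
  irreducibility improves the isomorphism to a unitary one.\<close>

lemma unitary_to_rep:
  assumes c: "c \<in> irr_classes C"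
  shows "\<exists>\<sigma> U. R \<sigma> (rep_of (trans_class c)) \<and> U \<in> mor C (rep_of c) \<sigma> \<and>
    mat_adjoint U * U = 1\<^sub>m (hdim C (rep_of c)) \<and> U * mat_adjoint U = 1\<^sub>m (hdim C \<sigma>)"
proof -
  obtain \<pi> where p: "R (rep_of c) \<pi>" using R_total[OF rep_of_mem(2)[OF c]] by blast
  then have "\<pi> \<in> trans_class c"
    unfolding trans_class_def using rep_of_mem(1)[OF c] R_obj[OF p] by auto
  then have "rep_of (trans_class c) \<in> trans_class c" unfolding rep_of_def by (rule someI)
  then obtain \<sigma> where s: "\<sigma> \<in> c" "R \<sigma> (rep_of (trans_class c))" by (auto simp: trans_class_def)
  have "\<sigma> \<in> {\<tau> \<in> objs C. isomorphic_objs C (rep_of c) \<tau>}"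
    using s(1) irr_classes_eq(2)[OF c rep_of_mem(1)[OF c]] by (metis (no_types))
  then show ?thesis
    using unitary_of_iso[OF rep_of_mem(3)[OF c] irr_classes_eq(1)[OF c s(1)]] s(2) by blast
qed

text \<open>The isomorphism conjugates each block by the unitary between corresponding
  representatives, and its extension to multipliers conjugates by Kronecker products of these
  unitaries. Elementary tensors are then respected at once; the comultiplication is the real
  issue.\<close>

theorem tk_isomorphic: "dqg_isomorphic (tannaka_krein C) (tannaka_krein C')"
proof -
  define I where "I = irr_classes C"
  define I' where "I' = irr_classes C'"
  obtain s U where sU: "\<And>c. c \<in> I \<Longrightarrow> R (s c) (rep_of (trans_class c)) \<and> U c \<in> mor C (rep_of c) (s c) \<and>
    mat_adjoint (U c) * U c = 1\<^sub>m (hdim C (rep_of c)) \<and> U c * mat_adjoint (U c) = 1\<^sub>m (hdim C (s c))"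
    using unitary_to_rep unfolding I_def by metis
  \<comment> \<open>The inverse of the bijection of classes, since \<open>conj_blocks\<close> pulls
    indices back.\<close>
  define \<Psi> where "\<Psi> = inv_into I trans_class"
  have bij: "bij_betw \<Psi> I' I" unfolding \<Psi>_def I_def I'_def by (rule bij_betw_inv_into[OF bij_trans_class])
  have \<Psi>: "\<Psi> k \<in> I" "trans_class (\<Psi> k) = k" if "k \<in> I'" for k
    using bij that bij_trans_class by (auto simp: bij_betw_def \<Psi>_def I_def I'_def f_inv_into_f)
  define V where "V = (\<lambda>k. U (\<Psi> k))"
  define d where "d = (\<lambda>c. hdim C (rep_of c))"
  define e where "e = (\<lambda>c. hdim C' (rep_of c))"
  define \<Psi>2 where "\<Psi>2 = (\<lambda>(k, l). (\<Psi> k, \<Psi> l))"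
  define V2 where "V2 = (\<lambda>(k, l). kron (V k) (V l))"
  define d2 where "d2 = (\<lambda>(k, l). d k * d l)"
  define e2 where "e2 = (\<lambda>(k, l). e k * e l)"
  have Rk: "R (s (\<Psi> k)) (rep_of k)" if "k \<in> I'" for k
    using sU[OF \<Psi>(1)[OF that]] \<Psi>(2)[OF that] by simp
  have ek: "hdim C (s (\<Psi> k)) = e k" if "k \<in> I'" for k
    using R_obj[OF Rk[OF that]] by (simp add: e_def)
  have Vm: "V k \<in> mor C (rep_of (\<Psi> k)) (s (\<Psi> k))" and V1: "mat_adjoint (V k) * V k = 1\<^sub>m (d (\<Psi> k))"
    and V1': "V k * mat_adjoint (V k) = 1\<^sub>m (e k)" if "k \<in> I'" for k
    using sU[OF \<Psi>(1)[OF that]] ek[OF that] by (auto simp: V_def d_def)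
  have Vc: "V k \<in> carrier_mat (e k) (d (\<Psi> k))" if "k \<in> I'" for k
    using mor_carrier[OF Vm[OF that]] ek[OF that] by (simp add: d_def)
  interpret B1: unitary_blocks I' I \<Psi> V e d
    by unfold_locales (use bij Vc V1 V1' in auto)
  interpret B2: unitary_blocks "I' \<times> I'" "I \<times> I" \<Psi>2 V2 e2 d2
  proof
    show "bij_betw \<Psi>2 (I' \<times> I') (I \<times> I)"
      using bij_betw_map_prod[OF bij bij] by (simp add: \<Psi>2_def map_prod_def)
    fix kl assume kl: "kl \<in> I' \<times> I'"
    obtain k l where eq: "kl = (k, l)" and k: "k \<in> I'" "l \<in> I'" using kl by auto
    note [simp] = carrier_matD[OF Vc[OF k(1)]] carrier_matD[OF Vc[OF k(2)]]
    show "V2 kl \<in> carrier_mat (e2 kl) (d2 (\<Psi>2 kl))"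
      "mat_adjoint (V2 kl) * V2 kl = 1\<^sub>m (d2 (\<Psi>2 kl))"
      "V2 kl * mat_adjoint (V2 kl) = 1\<^sub>m (e2 kl)"
      using Vc[OF k(1)] Vc[OF k(2)] V1[OF k(1)] V1[OF k(2)] V1'[OF k(1)] V1'[OF k(2)]
      by (auto simp: eq V2_def e2_def d2_def \<Psi>2_def kron_adjoint kron_mult kron_one)
  qed
  let ?\<phi> = "conj_blocks I' \<Psi> V" and ?\<theta> = "conj_blocks (I' \<times> I') \<Psi>2 V2"
  have tk: "C0 (tannaka_krein C) = c0_sum I d" "C0 (tannaka_krein C') = c0_sum I' e"
    "M2 (tannaka_krein C) = linf_prod (I \<times> I) d2" "M2 (tannaka_krein C') = linf_prod (I' \<times> I') e2"
    by (simp_all add: C0_def M2_def tannaka_krein_def I_def I'_def d_def[abs_def] e_def[abs_def] d2_def e2_def)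
  have carr: "a c \<in> carrier_mat (d c) (d c)" if "a \<in> elems (c0_sum I d)" "c \<in> I" for a c
    using that by (auto simp: c0_sum_def block_alg_def)
  have tens_eq: "?\<theta> (elem_tensor (tannaka_krein C) a b) = elem_tensor (tannaka_krein C') (?\<phi> a) (?\<phi> b)"
    if ab: "a \<in> elems (c0_sum I d)" "b \<in> elems (c0_sum I d)" for a b
  proof (rule ext)
    fix kl :: "'p set \<times> 'p set"
    obtain k l where eq: "kl = (k, l)" by (cases kl)
    show "?\<theta> (elem_tensor (tannaka_krein C) a b) kl = elem_tensor (tannaka_krein C') (?\<phi> a) (?\<phi> b) kl"
    proof (cases "k \<in> I' \<and> l \<in> I'")
      case True
      note [simp] = carrier_matD[OF Vc[OF True[THEN conjunct1]]] carrier_matD[OF Vc[OF True[THEN conjunct2]]]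
        carrier_matD[OF carr[OF ab(1) \<Psi>(1)[OF True[THEN conjunct1]]]] carrier_matD[OF carr[OF ab(2) \<Psi>(1)[OF True[THEN conjunct2]]]]
      show ?thesis using True \<Psi>(1)[of k] \<Psi>(1)[of l]
        by (simp add: eq conj_blocks_def elem_tensor_def tannaka_krein_def I_def[symmetric] I'_def[symmetric]
            \<Psi>2_def V2_def kron_mult kron_adjoint)
    next
      case False
      then show ?thesis
        by (auto simp: eq conj_blocks_def elem_tensor_def tannaka_krein_def I'_def[symmetric])
    qed
  qed
  have comult_eq: "?\<theta> (comult (tannaka_krein C) a) = comult (tannaka_krein C') (?\<phi> a)"
    if a: "a \<in> elems (c0_sum I d)" for a
  proof (rule ext)
    fix kl :: "'p set \<times> 'p set"
    obtain k l where eq: "kl = (k, l)" by (cases kl)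
    show "?\<theta> (comult (tannaka_krein C) a) kl = comult (tannaka_krein C') (?\<phi> a) kl"
    proof (cases "k \<in> I' \<and> l \<in> I'")
      case True
      then have k: "k \<in> I'" and l: "l \<in> I'" by auto
      define \<rho> where "\<rho> = tens C (rep_of (\<Psi> k)) (rep_of (\<Psi> l))"
      define \<tau> where "\<tau> = tens C (s (\<Psi> k)) (s (\<Psi> l))"
      define \<tau>' where "\<tau>' = tens C' (rep_of k) (rep_of l)"
      \<comment> \<open>A unitary morphism from the tensor product of the representatives in
        \<open>C\<close> to the object related to the tensor product of the representatives in
        \<open>C'\<close>.\<close>
      define W where "W = kron (V k) (V l)"
      have o: "rep_of (\<Psi> k) \<in> objs C" "rep_of (\<Psi> l) \<in> objs C" "s (\<Psi> k) \<in> objs C" "s (\<Psi> l) \<in> objs C"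
        using \<Psi>(1)[OF k] \<Psi>(1)[OF l] rep_of_mem(2) R_obj[OF Rk[OF k]] R_obj[OF Rk[OF l]] by (auto simp: I_def)
      have \<rho>: "\<rho> \<in> objs C" and \<tau>: "\<tau> \<in> objs C" unfolding \<rho>_def \<tau>_def using o by (auto intro: tens_obj)
      have R\<tau>: "R \<tau> \<tau>'" unfolding \<tau>_def \<tau>'_def by (rule R_tens[OF Rk[OF k] Rk[OF l]])
      have W: "W \<in> mor C \<rho> \<tau>" unfolding W_def \<rho>_def \<tau>_def using o Vm[OF k] Vm[OF l] by (intro mor_tens)
      have dW: "dim_row W = hdim C \<tau>" "dim_col W = hdim C \<rho>" using mor_dim[OF W] by auto
      have W1: "mat_adjoint W * W = 1\<^sub>m (hdim C \<rho>)"
        using V1[OF k] V1[OF l] carrier_matD[OF Vc[OF k]] carrier_matD[OF Vc[OF l]]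
        by (simp add: W_def \<rho>_def kron_adjoint kron_mult kron_one tens_dim d_def)
      have W2: "W * mat_adjoint W = 1\<^sub>m (hdim C \<tau>)"
        using V1'[OF k] V1'[OF l] carrier_matD[OF Vc[OF k]] carrier_matD[OF Vc[OF l]]
        by (simp add: W_def \<tau>_def kron_adjoint kron_mult kron_one tens_dim ek[OF k] ek[OF l])
      have ac: "\<And>c. c \<in> irr_classes C \<Longrightarrow> a c \<in> carrier_mat (hdim C (rep_of c)) (hdim C (rep_of c))"
        using carr[OF a] by (simp add: I_def d_def)
      obtain A where A: "acts C a \<rho> A" using acts_exists[of a \<rho>] ac \<rho> by blast
      have Ac: "dim_row A = hdim C \<rho>" "dim_col A = hdim C \<rho>" using A by (auto simp: acts_def)
      define B where "B = W * A * mat_adjoint W"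
      have B: "acts C a \<tau> B"
        unfolding acts_def
      proof (intro conjI ballI)
        show "B \<in> carrier_mat (hdim C \<tau>) (hdim C \<tau>)" unfolding B_def by (rule carrier_matI) (auto simp: dW)
        fix c T assume c: "c \<in> irr_classes C" "T \<in> mor C (rep_of c) \<tau>"
        note [simp] = mor_dim[OF c(2)] dW Ac carrier_matD[OF ac[OF c(1)]]
        have "A * (mat_adjoint W * T) = (mat_adjoint W * T) * a c"
          using A c(1) mor_comp[OF rep_of_mem(2)[OF c(1)] \<tau> \<rho> c(2) mor_adj[OF \<rho> \<tau> W]] by (auto simp: acts_def)
        then have "B * T = W * ((mat_adjoint W * T) * a c)" by (simp add: B_def mat_assoc)
        also have "\<dots> = (W * mat_adjoint W) * (T * a c)" by (simp add: mat_assoc)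
        finally show "B * T = T * a c" using W2 by (simp add: mat_simps)
      qed
      \<comment> \<open>Morphisms on the two sides are the same matrices up to composition with
        \<open>V j\<close>, and the same \<open>V j\<close> conjugates the blocks. The two changes
        cancel, so both definite descriptions name one matrix.\<close>
      have iff: "acts C' (?\<phi> a) \<tau>' X \<longleftrightarrow> acts C a \<tau> X" for X
      proof -
        have dt: "hdim C' \<tau>' = hdim C \<tau>" using R_obj[OF R\<tau>] by simp
        have step: "(\<forall>T'\<in>mor C' (rep_of j) \<tau>'. X * T' = T' * ?\<phi> a j) \<longleftrightarrow>
            (\<forall>T\<in>mor C (rep_of (\<Psi> j)) \<tau>. X * T = T * a (\<Psi> j))"
          if j: "j \<in> I'" and X: "X \<in> carrier_mat (hdim C \<tau>) (hdim C \<tau>)" for j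
        proof -
          have oj: "rep_of (\<Psi> j) \<in> objs C" "s (\<Psi> j) \<in> objs C"
            using \<Psi>(1)[OF j] rep_of_mem(2) R_obj[OF Rk[OF j]] by (auto simp: I_def)
          have m: "mor C' (rep_of j) \<tau>' = mor C (s (\<Psi> j)) \<tau>" using R_mor[OF Rk[OF j] R\<tau>] by simp
          have pa: "?\<phi> a j = V j * a (\<Psi> j) * mat_adjoint (V j)" using j by (simp add: conj_blocks_def)
          note [simp] = carrier_matD[OF Vc[OF j]] carrier_matD[OF carr[OF a \<Psi>(1)[OF j]]] carrier_matD[OF X]
          show ?thesis
          proof (intro iffI ballI)
            fix T assume all: "\<forall>T'\<in>mor C' (rep_of j) \<tau>'. X * T' = T' * ?\<phi> a j" and T: "T \<in> mor C (rep_of (\<Psi> j)) \<tau>"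
            have [simp]: "dim_row T = hdim C \<tau>" "dim_col T = d (\<Psi> j)" using mor_dim[OF T] by (auto simp: d_def)
            have "T * mat_adjoint (V j) \<in> mor C (s (\<Psi> j)) \<tau>"
              by (rule mor_comp[OF oj(2,1) \<tau> mor_adj[OF oj Vm[OF j]] T])
            then have "X * (T * mat_adjoint (V j)) = (T * mat_adjoint (V j)) * (V j * a (\<Psi> j) * mat_adjoint (V j))"
              using all m pa by simp
            then have "X * (T * mat_adjoint (V j)) * V j = (T * mat_adjoint (V j)) * (V j * a (\<Psi> j) * mat_adjoint (V j)) * V j"
              by simp
            then have "X * T * (mat_adjoint (V j) * V j) = T * (mat_adjoint (V j) * V j) * a (\<Psi> j) * (mat_adjoint (V j) * V j)"
              by (simp add: mat_assoc)
            then show "X * T = T * a (\<Psi> j)" using V1[OF j] by (simp add: mat_simps)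
          next
            fix T' assume all: "\<forall>T\<in>mor C (rep_of (\<Psi> j)) \<tau>. X * T = T * a (\<Psi> j)" and "T' \<in> mor C' (rep_of j) \<tau>'"
            then have T': "T' \<in> mor C (s (\<Psi> j)) \<tau>" using m by simp
            have [simp]: "dim_row T' = hdim C \<tau>" "dim_col T' = e j" using mor_dim[OF T'] by (auto simp: ek[OF j])
            have "T' * V j \<in> mor C (rep_of (\<Psi> j)) \<tau>" by (rule mor_comp[OF oj \<tau> Vm[OF j] T'])
            then have "X * (T' * V j) = (T' * V j) * a (\<Psi> j)" using all by simp
            then have "X * (T' * V j) * mat_adjoint (V j) = (T' * V j) * a (\<Psi> j) * mat_adjoint (V j)" by simp
            then have "X * T' * (V j * mat_adjoint (V j)) = T' * ?\<phi> a j" by (simp add: mat_assoc pa)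
            then show "X * T' = T' * ?\<phi> a j" using V1'[OF j] by (simp add: mat_simps)
          qed
        qed
        have I: "I = \<Psi> ` I'" using bij by (simp add: bij_betw_def)
        show ?thesis
        proof (cases "X \<in> carrier_mat (hdim C \<tau>) (hdim C \<tau>)")
          case True
          have "(\<forall>c\<in>I. \<forall>T\<in>mor C (rep_of c) \<tau>. X * T = T * a c) \<longleftrightarrow>
              (\<forall>j\<in>I'. \<forall>T\<in>mor C (rep_of (\<Psi> j)) \<tau>. X * T = T * a (\<Psi> j))"
            unfolding I by (rule ball_simps)
          also have "\<dots> \<longleftrightarrow> (\<forall>j\<in>I'. \<forall>T'\<in>mor C' (rep_of j) \<tau>'. X * T' = T' * ?\<phi> a j)"
            by (rule ball_cong) (simp_all only: step[OF _ True])
          finally show ?thesis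
            using True unfolding acts_def dt I_def[symmetric] I'_def[symmetric] by (simp only: simp_thms)
        qed (simp add: acts_def dt)
      qed
      have "tk_action C' (?\<phi> a) \<tau>' = tk_action C a \<tau>" by (simp add: tk_action_acts iff)
      also have "\<dots> = W * tk_action C a \<rho> * mat_adjoint W"
        using tk_action_eq[OF \<tau> B] tk_action_eq[OF \<rho> A] by (simp add: B_def)
      finally show ?thesis using k l \<Psi>(1)
        by (simp add: eq conj_blocks_def tannaka_krein_def I_def[symmetric] I'_def[symmetric] \<Psi>2_def V2_def
            W_def \<rho>_def \<tau>'_def)
    next
      case False
      then show ?thesis by (auto simp: eq conj_blocks_def tannaka_krein_def I'_def[symmetric])
    qed
  qed
  show ?thesis
    unfolding dqg_isomorphic_def tk
    using B1.star_hom_c0 B1.bij_betw_c0 B2.star_hom_linf tens_eq comult_eq by blast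
qed

end

section \<open>Kernels, projections and commutants\<close>

text \<open>The trace is the tool for counting dimensions: it bounds the number of columns of an
  isometry and the number of orthogonal projections.\<close>

definition ctr :: "complex mat \<Rightarrow> complex" where
  "ctr A = (\<Sum>i<dim_row A. A $$ (i, i))"

lemma ctr_comm:
  assumes "A \<in> carrier_mat m n" "B \<in> carrier_mat n m"
  shows "ctr (A * B) = ctr (B * A)"
proof -
  have "ctr (A * B) = (\<Sum>i<m. \<Sum>k<n. A $$ (i, k) * B $$ (k, i))"
    using assms by (auto simp: ctr_def mult_index_sum simp del: index_mult_mat(1))
  also have "\<dots> = (\<Sum>k<n. \<Sum>i<m. B $$ (k, i) * A $$ (i, k))"
    by (subst sum.swap) (simp add: mult.commute)
  also have "\<dots> = ctr (B * A)"
    using assms by (auto simp: ctr_def mult_index_sum simp del: index_mult_mat(1))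
  finally show ?thesis .
qed

lemma ctr_add: "A \<in> carrier_mat n n \<Longrightarrow> B \<in> carrier_mat n n \<Longrightarrow> ctr (A + B) = ctr A + ctr B"
  by (auto simp: ctr_def sum.distrib)

lemma ctr_one: "ctr (1\<^sub>m n) = of_nat n"
  by (simp add: ctr_def)

lemma ctr_msum: "(\<And>t. t \<in> X \<Longrightarrow> f t \<in> carrier_mat n n) \<Longrightarrow> ctr (msum n n f X) = (\<Sum>t\<in>X. ctr (f t))"
  using sum.swap[of "\<lambda>i t. f t $$ (i, i)" X "{..<n}"] by (auto simp: ctr_def intro!: sum.cong)

lemma ctr_projection:
  assumes "is_projection n p" shows "Re (ctr p) \<ge> 0"
proof -
  note [simp] = is_projectionD[OF assms]
  have "p $$ (i, i) = of_real (\<Sum>k<n. (cmod (p $$ (k, i)))\<^sup>2)" if "i < n" for i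
  proof -
    have "p $$ (i, i) = (mat_adjoint p * p) $$ (i, i)" by simp
    also have "\<dots> = (\<Sum>k<n. cnj (p $$ (k, i)) * p $$ (k, i))"
      using that mat_adjoint_index[of i p]
      by (subst mult_index_sum) (auto simp del: is_projectionD(3)[OF assms])
    also have "\<dots> = of_real (\<Sum>k<n. (cmod (p $$ (k, i)))\<^sup>2)"
      by (simp add: complex_norm_square[symmetric] mult.commute del: of_real_power)
    finally show ?thesis .
  qed
  then show ?thesis by (auto simp: ctr_def intro!: sum_nonneg)
qed

lemma projection_complement:
  assumes "is_projection n p" shows "is_projection n (1\<^sub>m n - p)"
proof -
  note [simp] = is_projectionD[OF assms]
  have "(1\<^sub>m n - p) * (1\<^sub>m n - p) = 1\<^sub>m n - p - (p - p)"
    by (simp add: mat_minus_mult mat_mult_minus mat_simps)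
  also have "\<dots> = 1\<^sub>m n - p" by (rule eq_matI) auto
  finally show ?thesis by (simp add: is_projection_def mat_adjoint_minus carrier_matI)
qed

lemma ctr_projection_le:
  assumes "is_projection n p" shows "Re (ctr p) \<le> n"
proof -
  note [simp] = is_projectionD[OF assms]
  have "1\<^sub>m n - p + p = 1\<^sub>m n" by (rule eq_matI) auto
  then have "ctr (1\<^sub>m n - p) + ctr p = of_nat n"
    using ctr_add[of "1\<^sub>m n - p" n p] ctr_one by (simp add: carrier_matI)
  then have "Re (ctr (1\<^sub>m n - p)) + Re (ctr p) = n" by (metis Re_complex_of_real of_real_of_nat_eq plus_complex.simps(1))
  then show ?thesis using ctr_projection[OF projection_complement[OF assms]] by linarith
qed

lemma projection_isometry:
  assumes V: "V \<in> carrier_mat n m" "mat_adjoint V * V = 1\<^sub>m m"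
  shows "is_projection n (V * mat_adjoint V)" "ctr (V * mat_adjoint V) = of_nat m"
proof -
  note [simp] = carrier_matD[OF V(1)]
  have "V * mat_adjoint V * (V * mat_adjoint V) = V * (mat_adjoint V * V) * mat_adjoint V"
    by (simp add: mat_assoc)
  then show "is_projection n (V * mat_adjoint V)"
    using V(2) by (simp add: is_projection_def mat_simps mat_adjoint_mult carrier_matI)
  show "ctr (V * mat_adjoint V) = of_nat m"
    using ctr_comm[of V n m "mat_adjoint V"] V ctr_one by simp
qed

lemma isometry_le:
  fixes V :: "complex mat"
  assumes "V \<in> carrier_mat n m" "mat_adjoint V * V = 1\<^sub>m m"
  shows "m \<le> n"
  using ctr_projection_le[OF projection_isometry(1)[OF assms]] projection_isometry(2)[OF assms] by simp

text \<open>One Gram-Schmidt step: the normalised vector \<open>X\<close> becomes the last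
  column.\<close>

lemma isometry_extend:
  fixes V M X :: "complex mat"
  assumes V: "V \<in> carrier_mat n m" "mat_adjoint V * V = 1\<^sub>m m" "M * V = 0\<^sub>m r m" and M: "M \<in> carrier_mat r n"
    and X: "X \<in> carrier_mat n 1" "M * X = 0\<^sub>m r 1" "mat_adjoint V * X = 0\<^sub>m m 1" "X \<noteq> 0\<^sub>m n 1"
  shows "\<exists>V'\<in>carrier_mat n (Suc m). mat_adjoint V' * V' = 1\<^sub>m (Suc m) \<and> M * V' = 0\<^sub>m r (Suc m)"
proof -
  note [simp] = carrier_matD[OF V(1)] carrier_matD[OF M] carrier_matD[OF X(1)]
  define c where "c = (\<Sum>k<n. (cmod (X $$ (k, 0)))\<^sup>2)"
  obtain i j where "i < n" "j < 1" "X $$ (i, j) \<noteq> 0"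
    using X(4) eq_matI[of "0\<^sub>m n 1" X] by auto
  then have "c > 0" unfolding c_def by (intro sum_pos2[of _ i]) auto
  define t where "t = complex_of_real (1 / sqrt c)"
  have [simp]: "cnj t = t" by (simp add: t_def)
  define V' where "V' = mat n (Suc m) (\<lambda>(r, s). if s < m then V $$ (r, s) else t * X $$ (r, 0))"
  have [simp]: "dim_row V' = n" "dim_col V' = Suc m" by (simp_all add: V'_def)
  have V'i: "V' $$ (r, s) = V $$ (r, s)" if "r < n" "s < m" for r s using that by (simp add: V'_def)
  have V'm: "V' $$ (r, m) = t * X $$ (r, 0)" if "r < n" for r using that by (simp add: V'_def)
  have VV: "(\<Sum>k<n. cnj (V $$ (k, i)) * V $$ (k, j)) = (if i = j then 1 else 0)" if "i < m" "j < m" for i j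
  proof -
    have "(mat_adjoint V * V) $$ (i, j) = (\<Sum>k<n. cnj (V $$ (k, i)) * V $$ (k, j))"
      using that by (subst mult_index_sum) auto
    then show ?thesis using V(2) that by simp
  qed
  have VX: "(\<Sum>k<n. cnj (V $$ (k, i)) * X $$ (k, 0)) = 0" if "i < m" for i
  proof -
    have "(mat_adjoint V * X) $$ (i, 0) = (\<Sum>k<n. cnj (V $$ (k, i)) * X $$ (k, 0))"
      using that by (subst mult_index_sum) auto
    then show ?thesis using X(3) that by simp
  qed
  have XV: "(\<Sum>k<n. cnj (X $$ (k, 0)) * V $$ (k, i)) = 0" if "i < m" for i
    using arg_cong[OF VX[OF that], of cnj] by (simp add: mult.commute)
  have XX: "(\<Sum>k<n. cnj (X $$ (k, 0)) * X $$ (k, 0)) = of_real c"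
    unfolding c_def by (simp add: complex_norm_square[symmetric] mult.commute del: of_real_power)
  have s: "t * (t * of_real c) = 1"
    using \<open>c > 0\<close> unfolding t_def by (simp flip: of_real_mult add: real_div_sqrt)
  have "mat_adjoint V' * V' = 1\<^sub>m (Suc m)"
  proof (rule eq_matI)
    fix i j assume "i < dim_row (1\<^sub>m (Suc m) :: complex mat)" "j < dim_col (1\<^sub>m (Suc m) :: complex mat)"
    then have ij: "i < Suc m" "j < Suc m" by auto
    have "(mat_adjoint V' * V') $$ (i, j) = (\<Sum>k<n. cnj (V' $$ (k, i)) * V' $$ (k, j))"
      using ij by (subst mult_index_sum) auto
    also have "\<dots> = (if i = j then 1 else 0)"
    proof (cases "i < m")
      case True
      show ?thesis
      proof (cases "j < m")
        case False
        then have "j = m" using ij by simp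
        then show ?thesis
          using True VX[OF True] by (simp add: V'i V'm mult.left_commute sum_distrib_left[symmetric])
      qed (use True VV in \<open>simp add: V'i\<close>)
    next
      case False
      then have i: "i = m" using ij by simp
      show ?thesis
      proof (cases "j < m")
        case True
        then show ?thesis
          using XV[OF True] i by (simp add: V'i V'm mult.assoc sum_distrib_left[symmetric])
      next
        case False
        then have "j = m" using ij by simp
        then have "(\<Sum>k<n. cnj (V' $$ (k, i)) * V' $$ (k, j)) =
            t * (t * (\<Sum>k<n. cnj (X $$ (k, 0)) * X $$ (k, 0)))"
          using i by (simp add: V'm sum_distrib_left mult_ac)
        then show ?thesis using XX s i \<open>j = m\<close> by simp
      qed
    qed
    finally show "(mat_adjoint V' * V') $$ (i, j) = 1\<^sub>m (Suc m) $$ (i, j)" using ij by simp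
  qed auto
  moreover have "M * V' = 0\<^sub>m r (Suc m)"
  proof (rule eq_matI)
    fix i j assume "i < dim_row (0\<^sub>m r (Suc m) :: complex mat)" "j < dim_col (0\<^sub>m r (Suc m) :: complex mat)"
    then have ij: "i < r" "j < Suc m" by auto
    have e: "(M * V') $$ (i, j) = (\<Sum>k<n. M $$ (i, k) * V' $$ (k, j))"
      using ij by (subst mult_index_sum) auto
    show "(M * V') $$ (i, j) = 0\<^sub>m r (Suc m) $$ (i, j)"
    proof (cases "j < m")
      case True
      have "(M * V) $$ (i, j) = (\<Sum>k<n. M $$ (i, k) * V $$ (k, j))"
        using ij True by (subst mult_index_sum) auto
      then show ?thesis using V(3) ij True e by (simp add: V'i)
    next
      case False
      then have "j = m" using ij by simp
      have "(M * X) $$ (i, 0) = (\<Sum>k<n. M $$ (i, k) * X $$ (k, 0))"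
        using ij by (subst mult_index_sum) auto
      then show ?thesis
        using X(2) ij \<open>j = m\<close> e by (simp add: V'm mult.left_commute sum_distrib_left[symmetric])
    qed
  qed auto
  ultimately show ?thesis by (intro bexI[of _ V'] conjI) (auto intro: carrier_matI)
qed

definition col_of :: "complex mat \<Rightarrow> nat \<Rightarrow> complex mat" where
  "col_of W j = mat (dim_row W) 1 (\<lambda>(r, _). W $$ (r, j))"

lemma col_of_mult:
  assumes "dim_col A = dim_row W" "j < dim_col W"
  shows "A * col_of W j = col_of (A * W) j"
  by (rule eq_matI) (use assms in \<open>auto simp: col_of_def mult_index_sum simp del: index_mult_mat(1)\<close>)

text \<open>\<open>V\<close> is an isometry into the kernel with as many columns as possible; the
  trace bounds their number by n. By maximality the range of \<open>V\<close> is the whole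
  kernel.\<close>

lemma kernel_isometry:
  fixes M :: "complex mat"
  assumes M: "M \<in> carrier_mat r n"
  obtains m V where "V \<in> carrier_mat n m" "mat_adjoint V * V = 1\<^sub>m m" "M * V = 0\<^sub>m r m"
    "\<And>k W. W \<in> carrier_mat n k \<Longrightarrow> M * W = 0\<^sub>m r k \<Longrightarrow> V * (mat_adjoint V * W) = W"
proof -
  define P where "P = (\<lambda>m. \<exists>V\<in>carrier_mat n m. mat_adjoint V * V = 1\<^sub>m m \<and> M * V = 0\<^sub>m r m)"
  have "P 0" unfolding P_def by (rule bexI[of _ "0\<^sub>m n 0"]) (use M in auto)
  have bd: "P m \<Longrightarrow> m \<le> n" for m unfolding P_def using isometry_le by blast
  define m where "m = (GREATEST m. P m)"
  have "P m" unfolding m_def by (rule GreatestI_nat[of P 0 n]) (use bd \<open>P 0\<close> in auto)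
  then obtain V where V: "V \<in> carrier_mat n m" "mat_adjoint V * V = 1\<^sub>m m" "M * V = 0\<^sub>m r m"
    unfolding P_def by blast
  note [simp] = carrier_matD[OF M] carrier_matD[OF V(1)]
  \<comment> \<open>Treated for one column first: the component of a kernel vector orthogonal to the
    range of \<open>V\<close> would allow an extension by one column.\<close>
  have col: "V * (mat_adjoint V * W) = W" if W: "W \<in> carrier_mat n 1" "M * W = 0\<^sub>m r 1" for W
  proof (rule ccontr)
    assume ne: "V * (mat_adjoint V * W) \<noteq> W"
    note [simp] = carrier_matD[OF W(1)]
    define X where "X = W - V * (mat_adjoint V * W)"
    have [simp]: "dim_row X = n" "dim_col X = 1" by (simp_all add: X_def)
    have "M * X = M * W - (M * V) * (mat_adjoint V * W)" by (simp add: X_def mat_mult_minus mat_assoc)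
    then have MX: "M * X = 0\<^sub>m r 1" using W(2) V(3) by (simp add: mat_simps)
    have "mat_adjoint V * X = mat_adjoint V * W - (mat_adjoint V * V) * (mat_adjoint V * W)"
      by (simp add: X_def mat_mult_minus mat_assoc)
    then have VX: "mat_adjoint V * X = 0\<^sub>m m 1"
      unfolding V(2) by (simp add: mat_one_mult minus_r_inv_mat[of _ m 1] carrier_matI)
    have "X \<noteq> 0\<^sub>m n 1"
    proof
      assume "X = 0\<^sub>m n 1"
      then have "W = V * (mat_adjoint V * W)"
        using mat_eq_minus_zero[OF W(1), of "V * (mat_adjoint V * W)"] unfolding X_def by (simp add: carrier_matI)
      then show False using ne by simp
    qed
    moreover have "X \<in> carrier_mat n 1" by (rule carrier_matI) auto
    ultimately have "P (Suc m)"
      unfolding P_def using isometry_extend[OF V M _ MX VX] by blast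
    then have "Suc m \<le> m" unfolding m_def by (rule Greatest_le_nat[of P _ n]) (use bd in auto)
    then show False by simp
  qed
  have "V * (mat_adjoint V * W) = W" if W: "W \<in> carrier_mat n k" "M * W = 0\<^sub>m r k" for k W
  proof (rule eq_matI)
    fix i j assume ij: "i < dim_row W" "j < dim_col W"
    note [simp] = carrier_matD[OF W(1)]
    have "M * col_of W j = 0\<^sub>m r 1"
      using ij W(2) by (subst col_of_mult) (auto simp: col_of_def)
    then have "V * (mat_adjoint V * col_of W j) = col_of W j"
      by (intro col) (auto simp: col_of_def)
    then have "col_of (V * (mat_adjoint V * W)) j = col_of W j"
      using ij by (simp add: col_of_mult)
    then have "col_of (V * (mat_adjoint V * W)) j $$ (i, 0) = col_of W j $$ (i, 0)" by simp
    then show "(V * (mat_adjoint V * W)) $$ (i, j) = W $$ (i, j)" using ij by (simp add: col_of_def)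
  qed (use W in auto)
  then show ?thesis using that V by blast
qed

text \<open>\<open>V1\<close> parametrises the kernel of \<open>M\<close>, and \<open>V2\<close> the
  kernel of the adjoint of \<open>V1\<close>, which is the orthogonal complement. Taking traces of
  the two range projections gives the sum of dimensions.\<close>

lemma kernel_decomposition:
  fixes M :: "complex mat"
  assumes M: "M \<in> carrier_mat r n"
  obtains m1 m2 V1 V2 where "V1 \<in> carrier_mat n m1" "V2 \<in> carrier_mat n m2"
    "mat_adjoint V1 * V1 = 1\<^sub>m m1" "mat_adjoint V2 * V2 = 1\<^sub>m m2" "mat_adjoint V1 * V2 = 0\<^sub>m m1 m2"
    "V1 * mat_adjoint V1 + V2 * mat_adjoint V2 = 1\<^sub>m n" "m1 + m2 = n" "M * V1 = 0\<^sub>m r m1"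
    "\<And>k W. W \<in> carrier_mat n k \<Longrightarrow> M * W = 0\<^sub>m r k \<Longrightarrow> V1 * (mat_adjoint V1 * W) = W"
proof -
  obtain m1 V1 where V1: "V1 \<in> carrier_mat n m1" "mat_adjoint V1 * V1 = 1\<^sub>m m1" "M * V1 = 0\<^sub>m r m1"
    "\<And>k W. W \<in> carrier_mat n k \<Longrightarrow> M * W = 0\<^sub>m r k \<Longrightarrow> V1 * (mat_adjoint V1 * W) = W"
    using kernel_isometry[OF M] by metis
  obtain m2 V2 where V2: "V2 \<in> carrier_mat n m2" "mat_adjoint V2 * V2 = 1\<^sub>m m2" "mat_adjoint V1 * V2 = 0\<^sub>m m1 m2"
    "\<And>k W. W \<in> carrier_mat n k \<Longrightarrow> mat_adjoint V1 * W = 0\<^sub>m m1 k \<Longrightarrow> V2 * (mat_adjoint V2 * W) = W"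
    using kernel_isometry[OF mat_adjoint_carrier[OF V1(1)]] by metis
  note [simp] = carrier_matD[OF M] carrier_matD[OF V1(1)] carrier_matD[OF V2(1)]
  have V21: "mat_adjoint V2 * V1 = 0\<^sub>m m2 m1"
    using arg_cong[OF V2(3), of mat_adjoint] by (simp add: mat_adjoint_mult)
  define X where "X = 1\<^sub>m n - V1 * mat_adjoint V1"
  have [simp]: "dim_row X = n" "dim_col X = n" by (simp_all add: X_def)
  have "mat_adjoint V1 * X = mat_adjoint V1 - (mat_adjoint V1 * V1) * mat_adjoint V1"
    by (simp add: X_def mat_mult_minus mat_assoc mat_simps)
  then have "mat_adjoint V1 * X = 0\<^sub>m m1 n"
    unfolding V1(2) by (simp add: mat_one_mult minus_r_inv_mat[of _ m1 n] carrier_matI)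
  then have "X = V2 * (mat_adjoint V2 * X)" by (intro V2(4)[symmetric] carrier_matI) auto
  also have "mat_adjoint V2 * X = mat_adjoint V2 - (mat_adjoint V2 * V1) * mat_adjoint V1"
    by (simp add: X_def mat_mult_minus mat_assoc mat_simps)
  also have "\<dots> = mat_adjoint V2" unfolding V21 by (simp add: mat_simps) (rule eq_matI, auto)
  finally have XV: "X = V2 * mat_adjoint V2" .
  have sum: "V1 * mat_adjoint V1 + V2 * mat_adjoint V2 = 1\<^sub>m n"
    unfolding XV[symmetric] X_def by (rule eq_matI) auto
  have "ctr (V1 * mat_adjoint V1) + ctr (V2 * mat_adjoint V2) = of_nat n"
    using ctr_add[of "V1 * mat_adjoint V1" n "V2 * mat_adjoint V2"] sum ctr_one by (simp add: carrier_matI)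
  then have "(of_nat (m1 + m2) :: complex) = of_nat n"
    using projection_isometry(2)[OF V1(1,2)] projection_isometry(2)[OF V2(1,2)] by simp
  then have "m1 + m2 = n" by (simp only: of_nat_eq_iff)
  then show ?thesis using that V1 V2 sum by blast
qed

lemma eigenvector_exists:
  fixes B :: "complex mat"
  assumes B: "B \<in> carrier_mat m m" "m > 0"
  obtains l x where "x \<in> carrier_mat m 1" "x \<noteq> 0\<^sub>m m 1" "B * x = l \<cdot>\<^sub>m x"
proof -
  obtain l where "eigenvalue B l" using spectrum_non_empty[OF B(1)] B(2) by (auto simp: spectrum_def)
  then obtain v where v: "v \<in> carrier_vec m" "v \<noteq> 0\<^sub>v m" "B *\<^sub>v v = l \<cdot>\<^sub>v v"
    using B by (auto simp: eigenvalue_def eigenvector_def)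
  have "col_mat v \<noteq> 0\<^sub>m m 1"
  proof
    assume z: "col_mat v = 0\<^sub>m m 1"
    have "v = 0\<^sub>v m"
    proof (rule eq_vecI)
      fix i assume "i < dim_vec (0\<^sub>v m)"
      then have "v $ i = col_mat v $$ (i, 0)" using v(1) by (simp add: col_mat_def)
      then show "v $ i = 0\<^sub>v m $ i" using z \<open>i < dim_vec (0\<^sub>v m)\<close> by simp
    qed (use v in auto)
    then show False using v(2) by simp
  qed
  moreover have "B * col_mat v = l \<cdot>\<^sub>m col_mat v"
    unfolding col_mat_mult[OF B(1) v(1), symmetric] v(3) by (rule eq_matI) (auto simp: col_mat_def)
  ultimately show ?thesis using that col_mat_carrier[OF v(1)] by blast
qed

text \<open>An eigenvector is taken for the compression of \<open>H\<close> to the complement of its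
  kernel. Its eigenvalue is nonzero because a nonzero vector of the complement is not in the
  kernel.\<close>

lemma hermitian_nonzero_eigenvalue:
  fixes H :: "complex mat"
  assumes H: "H \<in> carrier_mat n n" "mat_adjoint H = H" "H \<noteq> 0\<^sub>m n n"
  obtains l v where "l \<noteq> 0" "v \<in> carrier_mat n 1" "v \<noteq> 0\<^sub>m n 1" "H * v = l \<cdot>\<^sub>m v"
proof -
  obtain m1 m2 V1 V2 where V: "V1 \<in> carrier_mat n m1" "V2 \<in> carrier_mat n m2"
    "mat_adjoint V1 * V1 = 1\<^sub>m m1" "mat_adjoint V2 * V2 = 1\<^sub>m m2" "mat_adjoint V1 * V2 = 0\<^sub>m m1 m2"
    "V1 * mat_adjoint V1 + V2 * mat_adjoint V2 = 1\<^sub>m n" "m1 + m2 = n" "H * V1 = 0\<^sub>m n m1"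
    and ker: "\<And>k W. W \<in> carrier_mat n k \<Longrightarrow> H * W = 0\<^sub>m n k \<Longrightarrow> V1 * (mat_adjoint V1 * W) = W"
    by (rule kernel_decomposition[OF H(1)]) (rule that)
  note [simp] = carrier_matD[OF H(1)] carrier_matD[OF V(1)] carrier_matD[OF V(2)]
  have "m2 > 0"
  proof (rule ccontr)
    assume "\<not> m2 > 0"
    then have "V2 * mat_adjoint V2 = 0\<^sub>m n n" by (intro eq_matI) (auto simp: scalar_prod_def)
    then have "V1 * mat_adjoint V1 = 1\<^sub>m n" using V(6) by (simp add: carrier_matI)
    then have "H = H * V1 * mat_adjoint V1" by (simp add: mat_assoc mat_simps)
    then show False using H(3) V(8) by (simp add: mat_simps)
  qed
  have "mat_adjoint V2 * H * V2 \<in> carrier_mat m2 m2" by (rule carrier_matI) auto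
  then obtain l x where x: "x \<in> carrier_mat m2 1" "x \<noteq> 0\<^sub>m m2 1" "mat_adjoint V2 * H * V2 * x = l \<cdot>\<^sub>m x"
    using \<open>m2 > 0\<close> by (rule eigenvector_exists)
  note [simp] = carrier_matD[OF x(1)]
  \<comment> \<open>By self-adjointness the range of \<open>H\<close> is orthogonal to the kernel,
    so an eigenvector of the compression is one of \<open>H\<close>.\<close>
  have V1H: "mat_adjoint V1 * H = 0\<^sub>m m1 n"
    using arg_cong[OF V(8), of mat_adjoint] H(2) by (simp add: mat_adjoint_mult)
  have "H * (V2 * x) = (V1 * mat_adjoint V1 + V2 * mat_adjoint V2) * (H * (V2 * x))"
    unfolding V(6) by (simp add: mat_simps)
  also have "\<dots> = V1 * ((mat_adjoint V1 * H) * (V2 * x)) + V2 * (mat_adjoint V2 * H * V2 * x)"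
    by (simp add: mat_add_mult mat_assoc)
  also have "\<dots> = l \<cdot>\<^sub>m (V2 * x)" unfolding V1H x(3) by (simp add: mat_simps) (rule eq_matI, auto)
  finally have ev: "H * (V2 * x) = l \<cdot>\<^sub>m (V2 * x)" .
  have "mat_adjoint V2 * (V2 * x) = (mat_adjoint V2 * V2) * x" by (simp add: mat_assoc)
  then have Vx: "mat_adjoint V2 * (V2 * x) = x" using V(4) by (simp add: mat_simps)
  have ne: "V2 * x \<noteq> 0\<^sub>m n 1"
  proof
    assume "V2 * x = 0\<^sub>m n 1"
    then show False using Vx x(2) by (simp add: mat_simps)
  qed
  have "l \<noteq> 0"
  proof
    assume "l = 0"
    then have "H * (V2 * x) = 0\<^sub>m n 1" using ev mat_smult_zero[of "V2 * x" n 1] by (simp add: carrier_matI)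
    then have "V2 * x = V1 * (mat_adjoint V1 * (V2 * x))" by (intro ker[symmetric]) (auto intro: carrier_matI)
    also have "\<dots> = V1 * ((mat_adjoint V1 * V2) * x)" by (simp add: mat_assoc)
    also have "\<dots> = 0\<^sub>m n 1" unfolding V(5) by (simp add: mat_simps)
    finally show False using ne by simp
  qed
  then show ?thesis using that ev ne by (metis V(2) mult_carrier_mat x(1))
qed

text \<open>A nonzero projection is the range projection of an isometry with at least one column, so
  its trace is at least 1. The sum of the family is again a projection and has trace at most
  n.\<close>

lemma card_orthogonal_projections:
  assumes F: "finite F" and p: "\<And>y. y \<in> F \<Longrightarrow> is_projection n (p y)" "\<And>y. y \<in> F \<Longrightarrow> p y \<noteq> 0\<^sub>m n n"
    and o: "\<And>y z. y \<in> F \<Longrightarrow> z \<in> F \<Longrightarrow> y \<noteq> z \<Longrightarrow> p y * p z = 0\<^sub>m n n"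
  shows "card F \<le> n"
proof -
  have pc: "p y \<in> carrier_mat n n" if "y \<in> F" for y using is_projectionD(1)[OF p(1)[OF that]] .
  have t: "Re (ctr (p y)) \<ge> 1" if y: "y \<in> F" for y
  proof -
    note [simp] = is_projectionD[OF p(1)[OF y]]
    have M: "1\<^sub>m n - p y \<in> carrier_mat n n" by (rule carrier_matI) auto
    obtain m V where V: "V \<in> carrier_mat n m" "mat_adjoint V * V = 1\<^sub>m m" "(1\<^sub>m n - p y) * V = 0\<^sub>m n m"
      "\<And>k W. W \<in> carrier_mat n k \<Longrightarrow> (1\<^sub>m n - p y) * W = 0\<^sub>m n k \<Longrightarrow> V * (mat_adjoint V * W) = W"
      using kernel_isometry[OF M] by metis
    note [simp] = carrier_matD[OF V(1)]
    have "(1\<^sub>m n - p y) * p y = 0\<^sub>m n n" by (simp add: mat_minus_mult mat_simps)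
    then have Vp: "V * mat_adjoint V * p y = p y" using V(4)[of "p y" n] by (simp add: mat_assoc)
    have "V - p y * V = 0\<^sub>m n m" using V(3) by (simp add: mat_minus_mult mat_simps)
    then have "p y * V = V" using mat_eq_minus_zero[OF V(1), of "p y * V"] by (simp add: carrier_matI)
    then have "p y * (V * mat_adjoint V) = V * mat_adjoint V" by (simp add: mat_assoc[symmetric])
    then have "mat_adjoint (p y * (V * mat_adjoint V)) = mat_adjoint (V * mat_adjoint V)" by simp
    then have "V * mat_adjoint V * p y = V * mat_adjoint V" by (simp add: mat_adjoint_mult)
    then have pV: "p y = V * mat_adjoint V" using Vp by simp
    have "m \<noteq> 0"
    proof
      assume "m = 0"
      then have "p y = 0\<^sub>m n n" unfolding pV by (intro eq_matI) (auto simp: scalar_prod_def)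
      then show False using p(2)[OF y] by simp
    qed
    then show ?thesis using projection_isometry(2)[OF V(1,2)] pV by simp
  qed
  have S: "is_projection n (msum n n p F)"
  proof -
    have "msum n n p F * msum n n p F = msum n n (\<lambda>y. msum n n p F * p y) F"
      using pc by (intro msum_mult_left) auto
    also have "\<dots> = msum n n p F"
    proof (rule msum_cong)
      fix y assume y: "y \<in> F"
      have "msum n n p F * p y = msum n n (\<lambda>z. p z * p y) F" using pc y by (intro msum_mult_right) auto
      also have "\<dots> = p y * p y" using F y o mult_carrier_mat[OF pc[OF y] pc[OF y]] by (intro msum_single) auto
      finally show "msum n n p F * p y = p y" using is_projectionD(2)[OF p(1)[OF y]] by simp
    qed
    finally have "msum n n p F * msum n n p F = msum n n p F" .
    moreover have "mat_adjoint (msum n n p F) = msum n n p F"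
      using pc is_projectionD(3)[OF p(1)] by (subst msum_adjoint) (auto intro: msum_cong)
    ultimately show ?thesis by (simp add: is_projection_def)
  qed
  have "real (card F) = (\<Sum>y\<in>F. 1)" by simp
  also have "\<dots> \<le> (\<Sum>y\<in>F. Re (ctr (p y)))" by (rule sum_mono) (rule t)
  also have "\<dots> = Re (ctr (msum n n p F))" using pc by (simp add: ctr_msum)
  also have "\<dots> \<le> n" by (rule ctr_projection_le[OF S])
  finally show ?thesis by simp
qed

text \<open>This is where finite dimension enters: rows, columns and representations of C_0 all have
  finite support because of it.\<close>

lemma finite_orthogonal_projections:
  assumes p: "\<And>y. y \<in> Y \<Longrightarrow> is_projection n (p y)"
    and o: "\<And>y z. y \<in> Y \<Longrightarrow> z \<in> Y \<Longrightarrow> y \<noteq> z \<Longrightarrow> p y * p z = 0\<^sub>m n n"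
  shows "finite {y \<in> Y. p y \<noteq> 0\<^sub>m n n}"
proof (rule ccontr)
  assume "infinite {y \<in> Y. p y \<noteq> 0\<^sub>m n n}"
  then obtain F where F: "finite F" "card F = Suc n" "F \<subseteq> {y \<in> Y. p y \<noteq> 0\<^sub>m n n}"
    using infinite_arbitrarily_large by blast
  have sub: "y \<in> Y" "p y \<noteq> 0\<^sub>m n n" if "y \<in> F" for y using F(3) that by auto
  have "card F \<le> n"
    by (rule card_orthogonal_projections[OF F(1), of n p]) (simp_all add: sub p o)
  then show False using F by simp
qed

text \<open>The splitting is along an eigenspace of \<open>X\<close>, which every operator commuting with \<open>X\<close> preserves.\<close>

lemma commutant_splitting:
  fixes X :: "complex mat"
  assumes X: "X \<in> carrier_mat n n" "n > 0" "\<And>z. X \<noteq> z \<cdot>\<^sub>m 1\<^sub>m n"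
  obtains m1 m2 V1 V2 where "V1 \<in> carrier_mat n m1" "V2 \<in> carrier_mat n m2" "m1 < n" "m2 < n"
    "mat_adjoint V1 * V1 = 1\<^sub>m m1" "mat_adjoint V2 * V2 = 1\<^sub>m m2"
    "V1 * mat_adjoint V1 + V2 * mat_adjoint V2 = 1\<^sub>m n"
    "\<And>u. u \<in> carrier_mat n n \<Longrightarrow> mat_adjoint u = u \<Longrightarrow> X * u = u * X \<Longrightarrow>
      u * V1 = V1 * (mat_adjoint V1 * u * V1) \<and> u * V2 = V2 * (mat_adjoint V2 * u * V2)"
proof -
  obtain l x where x: "x \<in> carrier_mat n 1" "x \<noteq> 0\<^sub>m n 1" "X * x = l \<cdot>\<^sub>m x"
    using eigenvector_exists[OF X(1,2)] by blast
  note [simp] = carrier_matD[OF X(1)] carrier_matD[OF x(1)]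
  define M where "M = X - l \<cdot>\<^sub>m 1\<^sub>m n"
  have M: "M \<in> carrier_mat n n" unfolding M_def by (rule carrier_matI) auto
  note [simp] = carrier_matD[OF M]
  obtain m1 m2 V1 V2 where V: "V1 \<in> carrier_mat n m1" "V2 \<in> carrier_mat n m2"
    "mat_adjoint V1 * V1 = 1\<^sub>m m1" "mat_adjoint V2 * V2 = 1\<^sub>m m2" "mat_adjoint V1 * V2 = 0\<^sub>m m1 m2"
    "V1 * mat_adjoint V1 + V2 * mat_adjoint V2 = 1\<^sub>m n" "m1 + m2 = n" "M * V1 = 0\<^sub>m n m1"
    and ker: "\<And>k W. W \<in> carrier_mat n k \<Longrightarrow> M * W = 0\<^sub>m n k \<Longrightarrow> V1 * (mat_adjoint V1 * W) = W"
    by (rule kernel_decomposition[OF M]) (rule that)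
  note [simp] = carrier_matD[OF V(1)] carrier_matD[OF V(2)]
  have "m1 \<noteq> 0"
  proof
    assume m: "m1 = 0"
    have "M * x = 0\<^sub>m n 1" by (simp add: M_def mat_minus_mult mat_simps x(3)) (rule eq_matI, auto)
    then have "x = V1 * (mat_adjoint V1 * x)" using ker[OF x(1)] by simp
    moreover have "V1 * (mat_adjoint V1 * x) = 0\<^sub>m n 1" using m by (intro eq_matI) (auto simp: scalar_prod_def)
    ultimately show False using x(2) by simp
  qed
  have "m2 \<noteq> 0"
  proof
    assume "m2 = 0"
    then have "V2 * mat_adjoint V2 = 0\<^sub>m n n" by (intro eq_matI) (auto simp: scalar_prod_def)
    then have "V1 * mat_adjoint V1 = 1\<^sub>m n" using V(6) by (simp add: carrier_matI)
    then have "M = M * V1 * mat_adjoint V1" by (simp add: mat_assoc mat_simps)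
    then have "M = 0\<^sub>m n n" using V(8) by (simp add: mat_simps)
    then have "X = l \<cdot>\<^sub>m 1\<^sub>m n" unfolding M_def by (intro mat_eq_minus_zero[OF X(1)]) auto
    then show False using X(3) by blast
  qed
  have "u * V1 = V1 * (mat_adjoint V1 * u * V1) \<and> u * V2 = V2 * (mat_adjoint V2 * u * V2)"
    if u: "u \<in> carrier_mat n n" "mat_adjoint u = u" "X * u = u * X" for u
  proof -
    note [simp] = carrier_matD[OF u(1)]
    have "M * u = u * M" using u(3) by (simp add: M_def mat_minus_mult mat_mult_minus mat_simps)
    then have "M * (u * V1) = u * (M * V1)" by (simp add: mat_assoc[symmetric])
    then have "M * (u * V1) = 0\<^sub>m n m1" using V(8) by (simp add: mat_simps)
    then have 1: "u * V1 = V1 * (mat_adjoint V1 * (u * V1))" by (intro ker[symmetric] carrier_matI) auto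
    \<comment> \<open>Self-adjointness of \<open>u\<close> turns invariance of the eigenspace into
      invariance of its orthogonal complement; \<open>X\<close> itself may fail to be
      normal.\<close>
    have "mat_adjoint V1 * (u * V2) = mat_adjoint (u * V1) * V2" using u(2) by (simp add: mat_adjoint_mult mat_assoc)
    also have "\<dots> = mat_adjoint (mat_adjoint V1 * (u * V1)) * (mat_adjoint V1 * V2)"
      by (subst 1) (simp add: mat_adjoint_mult mat_assoc)
    also have "\<dots> = 0\<^sub>m m1 m2" unfolding V(5) by (simp add: mat_simps)
    finally have z: "mat_adjoint V1 * (u * V2) = 0\<^sub>m m1 m2" .
    have "u * V2 = (V1 * mat_adjoint V1 + V2 * mat_adjoint V2) * (u * V2)" unfolding V(6) by (simp add: mat_simps)
    also have "\<dots> = V1 * (mat_adjoint V1 * (u * V2)) + V2 * (mat_adjoint V2 * (u * V2))"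
      by (simp add: mat_add_mult mat_assoc)
    also have "\<dots> = V2 * (mat_adjoint V2 * (u * V2))" unfolding z by (simp add: mat_simps) (rule eq_matI, auto)
    finally show ?thesis using 1 by (simp add: mat_assoc)
  qed
  then show ?thesis using that V \<open>m1 \<noteq> 0\<close> \<open>m2 \<noteq> 0\<close> by auto
qed

section \<open>Quantum permutations\<close>

text \<open>The variant in which the index of the second leg is chosen first. It resolves columns of
  a tensor product, where the intermediate point is read off from the second factor.\<close>

lemma resol_kron_Sigma':
  assumes r: "resol n X f" and e: "\<And>t. t \<in> X \<Longrightarrow> resol m (Y t) (e t)"
  shows "resol (m * n) (Sigma X Y) (\<lambda>(t, s). kron (e t s) (f t))"
proof -
  note fc = carrier_matD[OF resolD(5)[OF r]]
  have "resol (m * n) (Sigma X Y) (\<lambda>(t, s). kron (1\<^sub>m m) (f t) * kron (e t s) (1\<^sub>m n))"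
  proof (rule resol_Sigma[OF resol_one_kron[OF r] resol_kron_one[OF e]])
    fix t s assume ts: "t \<in> X" "s \<in> Y t"
    note [simp] = fc[OF ts(1)] carrier_matD[OF resolD(5)[OF e[OF ts(1)] ts(2)]]
    show "kron (1\<^sub>m m) (f t) * kron (e t s) (1\<^sub>m n) = kron (e t s) (1\<^sub>m n) * kron (1\<^sub>m m) (f t)"
      by (simp add: kron_mult mat_simps)
  qed
  moreover have "kron (1\<^sub>m m) (f t) * kron (e t s) (1\<^sub>m n) = kron (e t s) (f t)"
    if ts: "t \<in> X" "s \<in> Y t" for t s
    using fc[OF ts(1)] carrier_matD[OF resolD(5)[OF e[OF ts(1)] ts(2)]] by (simp add: kron_mult mat_simps)
  ultimately show ?thesis by (auto elim!: resol_cong)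
qed

section \<open>Resolutions attached to rows and columns, and tensor products\<close>

lemma qpD:
  assumes "quantum_permutation Y \<sigma>"
  shows "\<And>x y. x \<in> Y \<Longrightarrow> y \<in> Y \<Longrightarrow> is_projection (qdim \<sigma>) (qent \<sigma> x y)"
    "\<And>x y z. x \<in> Y \<Longrightarrow> y \<in> Y \<Longrightarrow> z \<in> Y \<Longrightarrow> y \<noteq> z \<Longrightarrow> qent \<sigma> x y * qent \<sigma> x z = 0\<^sub>m (qdim \<sigma>) (qdim \<sigma>)"
    "\<And>x y z. x \<in> Y \<Longrightarrow> y \<in> Y \<Longrightarrow> z \<in> Y \<Longrightarrow> y \<noteq> z \<Longrightarrow> qent \<sigma> y x * qent \<sigma> z x = 0\<^sub>m (qdim \<sigma>) (qdim \<sigma>)"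
    "\<And>x y. x \<in> Y \<Longrightarrow> y \<in> Y \<Longrightarrow> qent \<sigma> x y \<in> carrier_mat (qdim \<sigma>) (qdim \<sigma>)"
  using assms unfolding quantum_permutation_def by (blast intro: is_projectionD(1))+

lemma qp_row_resol:
  assumes q: "quantum_permutation Y \<sigma>" and x: "x \<in> Y"
  shows "resol (qdim \<sigma>) {y \<in> Y. qent \<sigma> x y \<noteq> 0\<^sub>m (qdim \<sigma>) (qdim \<sigma>)} (qent \<sigma> x)" (is "resol _ ?F _")
proof -
  have F: "finite ?F" using qpD[OF q] x by (intro finite_orthogonal_projections) auto
  have "strong_has_sum (\<lambda>y. qent \<sigma> x y) (1\<^sub>m (qdim \<sigma>)) Y"
    using q x unfolding quantum_permutation_def by blast
  then have "msum (qdim \<sigma>) (qdim \<sigma>) (qent \<sigma> x) ?F = 1\<^sub>m (qdim \<sigma>)"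
    by (rule strong_has_sum_finite_unique) (use F in auto)
  then show ?thesis using F qpD[OF q] x unfolding resol_def by auto
qed

lemma qp_col_resol:
  assumes q: "quantum_permutation Y \<sigma>" and y: "y \<in> Y"
  shows "resol (qdim \<sigma>) {x \<in> Y. qent \<sigma> x y \<noteq> 0\<^sub>m (qdim \<sigma>) (qdim \<sigma>)} (\<lambda>x. qent \<sigma> x y)" (is "resol _ ?F _")
proof -
  have F: "finite ?F" using qpD[OF q] y by (intro finite_orthogonal_projections) auto
  have "strong_has_sum (\<lambda>x. qent \<sigma> x y) (1\<^sub>m (qdim \<sigma>)) Y"
    using q y unfolding quantum_permutation_def by blast
  then have "msum (qdim \<sigma>) (qdim \<sigma>) (\<lambda>x. qent \<sigma> x y) ?F = 1\<^sub>m (qdim \<sigma>)"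
    by (rule strong_has_sum_finite_unique) (use F in auto)
  then show ?thesis using F qpD[OF q] y unfolding resol_def by auto
qed

text \<open>Rows and columns get separate test families, since entries from different rows and
  columns do not commute in general. The label of a member names the one entry that keeps
  it.\<close>

lemma quantum_permutationI:
  assumes c: "\<And>x y. x \<in> Y \<Longrightarrow> y \<in> Y \<Longrightarrow> qent \<sigma> x y \<in> carrier_mat (qdim \<sigma>) (qdim \<sigma>)"
    and r: "\<And>x. x \<in> Y \<Longrightarrow> resol (qdim \<sigma>) (X x) (q x)" "\<And>x t. x \<in> Y \<Longrightarrow> t \<in> X x \<Longrightarrow> lab x t \<in> Y"
      "\<And>x t y. x \<in> Y \<Longrightarrow> t \<in> X x \<Longrightarrow> y \<in> Y \<Longrightarrow>
        qent \<sigma> x y * q x t = (if lab x t = y then q x t else 0\<^sub>m (qdim \<sigma>) (qdim \<sigma>))"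
    and r': "\<And>y. y \<in> Y \<Longrightarrow> resol (qdim \<sigma>) (X' y) (q' y)" "\<And>y t. y \<in> Y \<Longrightarrow> t \<in> X' y \<Longrightarrow> lab' y t \<in> Y"
      "\<And>y t x. y \<in> Y \<Longrightarrow> t \<in> X' y \<Longrightarrow> x \<in> Y \<Longrightarrow>
        qent \<sigma> x y * q' y t = (if lab' y t = x then q' y t else 0\<^sub>m (qdim \<sigma>) (qdim \<sigma>))"
  shows "quantum_permutation Y \<sigma>"
  unfolding quantum_permutation_def
proof (intro conjI ballI impI)
  fix x y assume x: "x \<in> Y" and y: "y \<in> Y"
  show "is_projection (qdim \<sigma>) (qent \<sigma> x y)"
    using r(3)[OF x _ y] by (rule projection_of_resol[OF r(1)[OF x] c[OF x y]])
next
  fix x y z assume x: "x \<in> Y" and y: "y \<in> Y" and z: "z \<in> Y" and ne: "y \<noteq> z"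
  show "qent \<sigma> x y * qent \<sigma> x z = 0\<^sub>m (qdim \<sigma>) (qdim \<sigma>)"
    by (rule orthogonal_of_resol[OF r(1)[OF x] c[OF x y] c[OF x z] r(3)[OF x _ y] r(3)[OF x _ z]]) (use ne in auto)
  show "qent \<sigma> y x * qent \<sigma> z x = 0\<^sub>m (qdim \<sigma>) (qdim \<sigma>)"
    by (rule orthogonal_of_resol[OF r'(1)[OF x] c[OF y x] c[OF z x] r'(3)[OF x _ y] r'(3)[OF x _ z]]) (use ne in auto)
next
  fix x assume x: "x \<in> Y"
  show "strong_has_sum (\<lambda>y. qent \<sigma> x y) (1\<^sub>m (qdim \<sigma>)) Y"
    by (rule strong_has_sum_of_resol[OF r(1)[OF x] c[OF x] r(2)[OF x] r(3)[OF x]])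
  show "strong_has_sum (\<lambda>y. qent \<sigma> y x) (1\<^sub>m (qdim \<sigma>)) Y"
    by (rule strong_has_sum_of_resol[OF r'(1)[OF x] c[OF _ x] r'(2)[OF x] r'(3)[OF x]])
qed

text \<open>\<open>F\<close> may be any finite superset of the support, so that two quantum
  permutations can be summed over a common index set.\<close>

lemma qent_tensor_msum:
  assumes \<sigma>: "quantum_permutation Y \<sigma>" and \<tau>: "quantum_permutation Y \<tau>" and xy: "x \<in> Y" "y \<in> Y"
    and F: "finite F" "{z \<in> Y. qent \<sigma> x z \<noteq> 0\<^sub>m (qdim \<sigma>) (qdim \<sigma>)} \<subseteq> F" "F \<subseteq> Y"
  shows "qent_tensor Y \<sigma> \<tau> x y = msum (qdim \<sigma> * qdim \<tau>) (qdim \<sigma> * qdim \<tau>) (\<lambda>z. kron (qent \<sigma> x z) (qent \<tau> z y)) F"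
  unfolding qent_tensor_def
proof (rule strong_sum_finite[OF F(1,3)])
  fix z assume z: "z \<in> Y - F"
  then have "qent \<sigma> x z = 0\<^sub>m (qdim \<sigma>) (qdim \<sigma>)" using F(2) by auto
  then show "kron (qent \<sigma> x z) (qent \<tau> z y) = 0\<^sub>m (qdim \<sigma> * qdim \<tau>) (qdim \<sigma> * qdim \<tau>)"
    using carrier_matD[OF qpD(4)[OF \<tau>, of z y]] z xy by (simp add: kron_zero_left)
qed

lemma qent_tensor_carrier [simp]: "qent_tensor Y \<sigma> \<tau> x y \<in> carrier_mat (qdim \<sigma> * qdim \<tau>) (qdim \<sigma> * qdim \<tau>)"
  by (simp add: qent_tensor_def)

lemma qent_tensor_select:
  assumes \<sigma>: "quantum_permutation Y \<sigma>" and \<tau>: "quantum_permutation Y \<tau>" and xy: "x \<in> Y" "y \<in> Y"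
    and B: "B \<in> carrier_mat (qdim \<sigma> * qdim \<tau>) k" and z0: "z0 \<in> Y"
      "\<And>z. z \<in> Y \<Longrightarrow> z \<noteq> z0 \<Longrightarrow> kron (qent \<sigma> x z) (qent \<tau> z y) * B = 0\<^sub>m (qdim \<sigma> * qdim \<tau>) k"
  shows "qent_tensor Y \<sigma> \<tau> x y * B = kron (qent \<sigma> x z0) (qent \<tau> z0 y) * B"
  unfolding qent_tensor_def
proof (rule strong_sum_mult_select[OF _ _ _ _ B z0])
  show "finite {z \<in> Y. qent \<sigma> x z \<noteq> 0\<^sub>m (qdim \<sigma>) (qdim \<sigma>)}"
    using resolD(1)[OF qp_row_resol[OF \<sigma> xy(1)]] .
  fix z assume z: "z \<in> Y - {z \<in> Y. qent \<sigma> x z \<noteq> 0\<^sub>m (qdim \<sigma>) (qdim \<sigma>)}"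
  then show "kron (qent \<sigma> x z) (qent \<tau> z y) = 0\<^sub>m (qdim \<sigma> * qdim \<tau>) (qdim \<sigma> * qdim \<tau>)"
    using carrier_matD[OF qpD(4)[OF \<tau>, of z y]] xy by (simp add: kron_zero_left)
next
  fix z assume "z \<in> Y"
  then show "kron (qent \<sigma> x z) (qent \<tau> z y) \<in> carrier_mat (qdim \<sigma> * qdim \<tau>) (qdim \<sigma> * qdim \<tau>)"
    using qpD(4)[OF \<sigma>, of x z] qpD(4)[OF \<tau>, of z y] xy by simp
qed auto

text \<open>Orthogonality in row x of the first factor leaves only the summand with intermediate
  point z; row z of the second factor then decides.\<close>

lemma tensor_row_test:
  assumes \<sigma>: "quantum_permutation Y \<sigma>" and \<tau>: "quantum_permutation Y \<tau>"
    and xy: "x \<in> Y" "y \<in> Y" "z \<in> Y" "y' \<in> Y"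
  shows "qent_tensor Y \<sigma> \<tau> x y * kron (qent \<sigma> x z) (qent \<tau> z y') =
    (if y' = y then kron (qent \<sigma> x z) (qent \<tau> z y') else 0\<^sub>m (qdim \<sigma> * qdim \<tau>) (qdim \<sigma> * qdim \<tau>))"
proof -
  note d = carrier_matD[OF qpD(4)[OF \<sigma>]] carrier_matD[OF qpD(4)[OF \<tau>]]
  note [simp] = d(1,2)[OF xy(1,3)] d(3,4)[OF xy(3,2)] d(3,4)[OF xy(3,4)]
  have "qent_tensor Y \<sigma> \<tau> x y * kron (qent \<sigma> x z) (qent \<tau> z y')
      = kron (qent \<sigma> x z) (qent \<tau> z y) * kron (qent \<sigma> x z) (qent \<tau> z y')"
  proof (rule qent_tensor_select[OF \<sigma> \<tau> xy(1,2) _ xy(3)])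
    show "kron (qent \<sigma> x z) (qent \<tau> z y') \<in> carrier_mat (qdim \<sigma> * qdim \<tau>) (qdim \<sigma> * qdim \<tau>)"
      using qpD(4)[OF \<sigma>] qpD(4)[OF \<tau>] xy by simp
    fix z' assume z': "z' \<in> Y" "z' \<noteq> z"
    show "kron (qent \<sigma> x z') (qent \<tau> z' y) * kron (qent \<sigma> x z) (qent \<tau> z y') = 0\<^sub>m (qdim \<sigma> * qdim \<tau>) (qdim \<sigma> * qdim \<tau>)"
      using d(1,2)[OF xy(1) z'(1)] d(3,4)[OF z'(1) xy(2)] qpD(2)[OF \<sigma> xy(1) z'(1) xy(3) z'(2)]
      by (simp add: kron_mult kron_zero_left)
  qed
  then show ?thesis
    using is_projectionD(2)[OF qpD(1)[OF \<sigma> xy(1,3)]] is_projectionD(2)[OF qpD(1)[OF \<tau> xy(3,2)]]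
      qpD(2)[OF \<tau> xy(3,2,4)] by (auto simp: kron_mult kron_zero_right)
qed

text \<open>The mirror image: column y of the second factor singles out z, and column z of the first
  factor decides.\<close>

lemma tensor_col_test:
  assumes \<sigma>: "quantum_permutation Y \<sigma>" and \<tau>: "quantum_permutation Y \<tau>"
    and xy: "x \<in> Y" "y \<in> Y" "z \<in> Y" "x' \<in> Y"
  shows "qent_tensor Y \<sigma> \<tau> x y * kron (qent \<sigma> x' z) (qent \<tau> z y) =
    (if x' = x then kron (qent \<sigma> x' z) (qent \<tau> z y) else 0\<^sub>m (qdim \<sigma> * qdim \<tau>) (qdim \<sigma> * qdim \<tau>))"
proof -
  note d = carrier_matD[OF qpD(4)[OF \<sigma>]] carrier_matD[OF qpD(4)[OF \<tau>]]
  note [simp] = d(1,2)[OF xy(1,3)] d(1,2)[OF xy(4,3)] d(3,4)[OF xy(3,2)]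
  have "qent_tensor Y \<sigma> \<tau> x y * kron (qent \<sigma> x' z) (qent \<tau> z y)
      = kron (qent \<sigma> x z) (qent \<tau> z y) * kron (qent \<sigma> x' z) (qent \<tau> z y)"
  proof (rule qent_tensor_select[OF \<sigma> \<tau> xy(1,2) _ xy(3)])
    show "kron (qent \<sigma> x' z) (qent \<tau> z y) \<in> carrier_mat (qdim \<sigma> * qdim \<tau>) (qdim \<sigma> * qdim \<tau>)"
      using qpD(4)[OF \<sigma>] qpD(4)[OF \<tau>] xy by simp
    fix z' assume z': "z' \<in> Y" "z' \<noteq> z"
    show "kron (qent \<sigma> x z') (qent \<tau> z' y) * kron (qent \<sigma> x' z) (qent \<tau> z y) = 0\<^sub>m (qdim \<sigma> * qdim \<tau>) (qdim \<sigma> * qdim \<tau>)"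
      using d(1,2)[OF xy(1) z'(1)] d(3,4)[OF z'(1) xy(2)] qpD(3)[OF \<tau> xy(2) z'(1) xy(3) z'(2)]
      by (simp add: kron_mult kron_zero_right)
  qed
  then show ?thesis
    using is_projectionD(2)[OF qpD(1)[OF \<sigma> xy(1,3)]] is_projectionD(2)[OF qpD(1)[OF \<tau> xy(3,2)]]
      qpD(3)[OF \<sigma> xy(3,1,4)] by (auto simp: kron_mult kron_zero_left)
qed

lemma tensor_row_resol:
  assumes \<sigma>: "quantum_permutation Y \<sigma>" and \<tau>: "quantum_permutation Y \<tau>" and x: "x \<in> Y"
  shows "resol (qdim \<sigma> * qdim \<tau>)
    (SIGMA z : {z \<in> Y. qent \<sigma> x z \<noteq> 0\<^sub>m (qdim \<sigma>) (qdim \<sigma>)}. {y \<in> Y. qent \<tau> z y \<noteq> 0\<^sub>m (qdim \<tau>) (qdim \<tau>)})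
    (\<lambda>(z, y). kron (qent \<sigma> x z) (qent \<tau> z y))"
  by (rule resol_kron_Sigma[OF qp_row_resol[OF \<sigma> x] qp_row_resol[OF \<tau>]]) auto

lemma tensor_col_resol:
  assumes \<sigma>: "quantum_permutation Y \<sigma>" and \<tau>: "quantum_permutation Y \<tau>" and y: "y \<in> Y"
  shows "resol (qdim \<sigma> * qdim \<tau>)
    (SIGMA z : {z \<in> Y. qent \<tau> z y \<noteq> 0\<^sub>m (qdim \<tau>) (qdim \<tau>)}. {x \<in> Y. qent \<sigma> x z \<noteq> 0\<^sub>m (qdim \<sigma>) (qdim \<sigma>)})
    (\<lambda>(z, x). kron (qent \<sigma> x z) (qent \<tau> z y))"
  by (rule resol_kron_Sigma'[OF qp_col_resol[OF \<tau> y] qp_col_resol[OF \<sigma>]]) auto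

text \<open>\<open>\<rho>\<close> is any record with these two fields, so the lemma covers quantum
  permutations and wreath corepresentations alike.\<close>

lemma quantum_permutation_tensor:
  assumes \<sigma>: "quantum_permutation Y \<sigma>" and \<tau>: "quantum_permutation Y \<tau>"
    and \<rho>: "qdim \<rho> = qdim \<sigma> * qdim \<tau>" "qent \<rho> = qent_tensor Y \<sigma> \<tau>"
  shows "quantum_permutation Y \<rho>"
proof (rule quantum_permutationI, unfold \<rho>)
  fix x y assume "x \<in> Y" "y \<in> Y"
  then show "qent_tensor Y \<sigma> \<tau> x y \<in> carrier_mat (qdim \<sigma> * qdim \<tau>) (qdim \<sigma> * qdim \<tau>)" by simp
next
  fix x assume x: "x \<in> Y"
  show "resol (qdim \<sigma> * qdim \<tau>)
    (SIGMA z : {z \<in> Y. qent \<sigma> x z \<noteq> 0\<^sub>m (qdim \<sigma>) (qdim \<sigma>)}. {y \<in> Y. qent \<tau> z y \<noteq> 0\<^sub>m (qdim \<tau>) (qdim \<tau>)})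
    (\<lambda>(z, y). kron (qent \<sigma> x z) (qent \<tau> z y))" by (rule tensor_row_resol[OF \<sigma> \<tau> x])
  show "resol (qdim \<sigma> * qdim \<tau>)
    (SIGMA z : {z \<in> Y. qent \<tau> z x \<noteq> 0\<^sub>m (qdim \<tau>) (qdim \<tau>)}. {y \<in> Y. qent \<sigma> y z \<noteq> 0\<^sub>m (qdim \<sigma>) (qdim \<sigma>)})
    (\<lambda>(z, y). kron (qent \<sigma> y z) (qent \<tau> z x))" by (rule tensor_col_resol[OF \<sigma> \<tau> x])
next
  fix x t y assume x: "x \<in> Y" and y: "y \<in> Y"
    and t: "t \<in> (SIGMA z : {z \<in> Y. qent \<sigma> x z \<noteq> 0\<^sub>m (qdim \<sigma>) (qdim \<sigma>)}. {y \<in> Y. qent \<tau> z y \<noteq> 0\<^sub>m (qdim \<tau>) (qdim \<tau>)})"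
  show "qent_tensor Y \<sigma> \<tau> x y * (case t of (z, y) \<Rightarrow> kron (qent \<sigma> x z) (qent \<tau> z y)) =
    (if snd t = y then case t of (z, y) \<Rightarrow> kron (qent \<sigma> x z) (qent \<tau> z y) else 0\<^sub>m (qdim \<sigma> * qdim \<tau>) (qdim \<sigma> * qdim \<tau>))"
    using t tensor_row_test[OF \<sigma> \<tau> x y] by (auto split: prod.splits)
next
  fix y t x assume y: "y \<in> Y" and x: "x \<in> Y"
    and t: "t \<in> (SIGMA z : {z \<in> Y. qent \<tau> z y \<noteq> 0\<^sub>m (qdim \<tau>) (qdim \<tau>)}. {x \<in> Y. qent \<sigma> x z \<noteq> 0\<^sub>m (qdim \<sigma>) (qdim \<sigma>)})"
  show "qent_tensor Y \<sigma> \<tau> x y * (case t of (z, x) \<Rightarrow> kron (qent \<sigma> x z) (qent \<tau> z y)) =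
    (if snd t = x then case t of (z, x) \<Rightarrow> kron (qent \<sigma> x z) (qent \<tau> z y) else 0\<^sub>m (qdim \<sigma> * qdim \<tau>) (qdim \<sigma> * qdim \<tau>))"
    using t tensor_col_test[OF \<sigma> \<tau> x y] by (auto split: prod.splits)
qed auto

section \<open>Quantum automorphisms of a graph as a tensor category with complete
  reducibility\<close>

lemma qaD:
  assumes "quantum_automorphism X \<sigma>"
  shows "quantum_permutation (verts X) \<sigma>"
    "\<And>x1 x2 y1 y2. \<lbrakk>x1 \<in> verts X; x2 \<in> verts X; y1 \<in> verts X; y2 \<in> verts X; rel_of X x1 x2 \<noteq> rel_of X y1 y2\<rbrakk>
      \<Longrightarrow> qent \<sigma> x1 y1 * qent \<sigma> x2 y2 = 0\<^sub>m (qdim \<sigma>) (qdim \<sigma>)"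
  using assms unfolding quantum_automorphism_def by blast+

lemma quantum_automorphism_tensor:
  assumes \<sigma>: "quantum_automorphism X \<sigma>" and \<tau>: "quantum_automorphism X \<tau>"
  shows "quantum_automorphism X \<lparr>qdim = qdim \<sigma> * qdim \<tau>, qent = qent_tensor (verts X) \<sigma> \<tau>\<rparr>"
  unfolding quantum_automorphism_def
proof (intro conjI ballI impI)
  note \<sigma>p = qaD(1)[OF \<sigma>] and \<tau>p = qaD(1)[OF \<tau>]
  let ?N = "qdim \<sigma> * qdim \<tau>"
  show "quantum_permutation (verts X) \<lparr>qdim = ?N, qent = qent_tensor (verts X) \<sigma> \<tau>\<rparr>"
    by (rule quantum_permutation_tensor[OF \<sigma>p \<tau>p]) auto
  fix x1 x2 y1 y2
  assume v: "x1 \<in> verts X" "x2 \<in> verts X" "y1 \<in> verts X" "y2 \<in> verts X" and ne: "rel_of X x1 x2 \<noteq> rel_of X y1 y2"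
  let ?w = "qent_tensor (verts X) \<sigma> \<tau>"
  have "?w x1 y1 * ?w x2 y2 = 0\<^sub>m ?N ?N"
  proof (rule resol_eqI[OF tensor_row_resol[OF \<sigma>p \<tau>p v(2)]])
    show "?w x1 y1 * ?w x2 y2 \<in> carrier_mat ?N ?N"
      by (rule mult_carrier_mat[OF qent_tensor_carrier qent_tensor_carrier])
    fix t assume t: "t \<in> (SIGMA z : {z \<in> verts X. qent \<sigma> x2 z \<noteq> 0\<^sub>m (qdim \<sigma>) (qdim \<sigma>)}.
        {y \<in> verts X. qent \<tau> z y \<noteq> 0\<^sub>m (qdim \<tau>) (qdim \<tau>)})"
    obtain z y where eq: "t = (z, y)" and z: "z \<in> verts X" and y: "y \<in> verts X" using t by auto
    note d = carrier_matD[OF qpD(4)[OF \<sigma>p]] carrier_matD[OF qpD(4)[OF \<tau>p]]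
    let ?q = "kron (qent \<sigma> x2 z) (qent \<tau> z y)"
    have qc: "?q \<in> carrier_mat ?N ?N" using qpD(4)[OF \<sigma>p v(2) z] qpD(4)[OF \<tau>p z y] by simp
    note [simp] = carrier_matD[OF qc] carrier_matD[OF qent_tensor_carrier[of "verts X" \<sigma> \<tau>]]
    have "?w x1 y1 * ?w x2 y2 * ?q = 0\<^sub>m ?N ?N"
    proof (cases "y = y2")
      case True
      \<comment> \<open>The relation of (z', z) cannot agree with both that of (x1, x2) and that of
        (y1, y2), so one of the two tensor legs vanishes.\<close>
      have k: "kron (qent \<sigma> x1 z') (qent \<tau> z' y1) * ?q = 0\<^sub>m ?N ?N" if z': "z' \<in> verts X" for z'
      proof (cases "rel_of X x1 x2 = rel_of X z' z")
        case False
        then show ?thesis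
          using qaD(2)[OF \<sigma> v(1,2) z' z] d(1,2)[OF v(1) z'] d(1,2)[OF v(2) z] d(3,4)[OF z' v(3)] d(3,4)[OF z y]
          by (simp add: kron_mult kron_zero_left del: kron_dim)
      next
        case 2: True
        then have "rel_of X z' z \<noteq> rel_of X y1 y" using ne True by simp
        then show ?thesis
          using qaD(2)[OF \<tau> z' z v(3) y] d(1,2)[OF v(1) z'] d(1,2)[OF v(2) z] d(3,4)[OF z' v(3)] d(3,4)[OF z y]
          by (simp add: kron_mult kron_zero_right del: kron_dim)
      qed
      have "?w x1 y1 * ?w x2 y2 * ?q = ?w x1 y1 * (?w x2 y2 * ?q)"
        by (rule mat_assoc) (simp_all del: kron_dim)
      also have "\<dots> = ?w x1 y1 * ?q"
        using tensor_row_test[OF \<sigma>p \<tau>p v(2,4) z y] True by simp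
      \<comment> \<open>All summands vanish on this test projection, so any index may be singled
        out; z is at hand.\<close>
      also have "\<dots> = kron (qent \<sigma> x1 z) (qent \<tau> z y1) * ?q"
        by (rule qent_tensor_select[OF \<sigma>p \<tau>p v(1,3) qc z k])
      finally show ?thesis using k[OF z] by simp
    next
      case False
      then show ?thesis
        using tensor_row_test[OF \<sigma>p \<tau>p v(2,4) z y] by (simp add: mat_assoc mat_simps del: kron_dim)
    qed
    then show "?w x1 y1 * ?w x2 y2 * (case t of (z, y) \<Rightarrow> kron (qent \<sigma> x2 z) (qent \<tau> z y)) =
        0\<^sub>m ?N ?N * (case t of (z, y) \<Rightarrow> kron (qent \<sigma> x2 z) (qent \<tau> z y))"
      by (simp add: eq mat_zero_mult del: kron_dim)
  qed auto
  then show "qent \<lparr>qdim = ?N, qent = ?w\<rparr> x1 y1 * qent \<lparr>qdim = ?N, qent = ?w\<rparr> x2 y2 =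
      0\<^sub>m (qdim \<lparr>qdim = ?N, qent = ?w\<rparr>) (qdim \<lparr>qdim = ?N, qent = ?w\<rparr>)" by simp
qed

lemma intertwiner_tensor:
  assumes q: "quantum_permutation Y \<sigma>" "quantum_permutation Y \<sigma>'" "quantum_permutation Y \<tau>" "quantum_permutation Y \<tau>'"
    and T: "T \<in> qperm_intertwiners Y \<sigma> \<sigma>'" and S: "S \<in> qperm_intertwiners Y \<tau> \<tau>'"
  shows "kron T S \<in> qperm_intertwiners Y \<lparr>qdim = qdim \<sigma> * qdim \<tau>, qent = qent_tensor Y \<sigma> \<tau>\<rparr>
    \<lparr>qdim = qdim \<sigma>' * qdim \<tau>', qent = qent_tensor Y \<sigma>' \<tau>'\<rparr>"
proof -
  have Tc: "T \<in> carrier_mat (qdim \<sigma>') (qdim \<sigma>)" and Sc: "S \<in> carrier_mat (qdim \<tau>') (qdim \<tau>)"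
    using T S by (auto simp: qperm_intertwiners_def)
  note [simp] = carrier_matD[OF Tc] carrier_matD[OF Sc]
  have "kron T S * qent_tensor Y \<sigma> \<tau> x y = qent_tensor Y \<sigma>' \<tau>' x y * kron T S" if xy: "x \<in> Y" "y \<in> Y" for x y
  proof -
    \<comment> \<open>The supports of row x in the source and in the target may differ; their union
      serves both.\<close>
    let ?F = "{z \<in> Y. qent \<sigma> x z \<noteq> 0\<^sub>m (qdim \<sigma>) (qdim \<sigma>)} \<union> {z \<in> Y. qent \<sigma>' x z \<noteq> 0\<^sub>m (qdim \<sigma>') (qdim \<sigma>')}"
    have F: "finite ?F" using resolD(1)[OF qp_row_resol[OF q(1) xy(1)]] resolD(1)[OF qp_row_resol[OF q(2) xy(1)]] by simp
    have "kron T S * qent_tensor Y \<sigma> \<tau> x y = kron T S * msum (qdim \<sigma> * qdim \<tau>) (qdim \<sigma> * qdim \<tau>) (\<lambda>z. kron (qent \<sigma> x z) (qent \<tau> z y)) ?F"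
      by (subst qent_tensor_msum[OF q(1,3) xy F]) auto
    also have "\<dots> = msum (qdim \<sigma>' * qdim \<tau>') (qdim \<sigma> * qdim \<tau>) (\<lambda>z. kron T S * kron (qent \<sigma> x z) (qent \<tau> z y)) ?F"
      using Tc Sc qpD(4)[OF q(1)] qpD(4)[OF q(3)] xy by (intro msum_mult_left) auto
    also have "\<dots> = msum (qdim \<sigma>' * qdim \<tau>') (qdim \<sigma> * qdim \<tau>) (\<lambda>z. kron (qent \<sigma>' x z) (qent \<tau>' z y) * kron T S) ?F"
    proof (rule msum_cong)
      fix z assume "z \<in> ?F"
      then have z: "z \<in> Y" by auto
      note [simp] = carrier_matD[OF qpD(4)[OF q(1) xy(1) z]] carrier_matD[OF qpD(4)[OF q(2) xy(1) z]]
        carrier_matD[OF qpD(4)[OF q(3) z xy(2)]] carrier_matD[OF qpD(4)[OF q(4) z xy(2)]]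
      have "T * qent \<sigma> x z = qent \<sigma>' x z * T" "S * qent \<tau> z y = qent \<tau>' z y * S"
        using T S xy z by (auto simp: qperm_intertwiners_def)
      then show "kron T S * kron (qent \<sigma> x z) (qent \<tau> z y) = kron (qent \<sigma>' x z) (qent \<tau>' z y) * kron T S"
        by (simp add: kron_mult)
    qed
    also have "\<dots> = msum (qdim \<sigma>' * qdim \<tau>') (qdim \<sigma>' * qdim \<tau>') (\<lambda>z. kron (qent \<sigma>' x z) (qent \<tau>' z y)) ?F * kron T S"
      using Tc Sc qpD(4)[OF q(2)] qpD(4)[OF q(4)] xy by (intro msum_mult_right[symmetric]) auto
    also have "\<dots> = qent_tensor Y \<sigma>' \<tau>' x y * kron T S"
      by (subst qent_tensor_msum[OF q(2,4) xy F]) auto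
    finally show ?thesis .
  qed
  then show ?thesis using Tc Sc by (simp add: qperm_intertwiners_def)
qed

text \<open>When the range of \<open>V\<close> is invariant under all entries, compression to it is
  multiplicative on products of entries, so every relation between them survives.\<close>

lemma compression_automorphism:
  assumes \<sigma>: "quantum_automorphism X \<sigma>" and V: "V \<in> carrier_mat (qdim \<sigma>) m" "mat_adjoint V * V = 1\<^sub>m m"
    and inv: "\<And>x y. x \<in> verts X \<Longrightarrow> y \<in> verts X \<Longrightarrow> qent \<sigma> x y * V = V * (mat_adjoint V * qent \<sigma> x y * V)"
  shows "quantum_automorphism X \<lparr>qdim = m, qent = (\<lambda>x y. mat_adjoint V * qent \<sigma> x y * V)\<rparr>"
proof -
  note \<sigma>p = qaD(1)[OF \<sigma>]
  let ?v = "\<lambda>x y. mat_adjoint V * qent \<sigma> x y * V"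
  note [simp] = carrier_matD[OF V(1)]
  note d = carrier_matD[OF qpD(4)[OF \<sigma>p]]
  have vc: "?v x y \<in> carrier_mat m m" for x y by (rule carrier_matI) auto
  have prod: "?v x y * ?v x' y' = mat_adjoint V * (qent \<sigma> x y * qent \<sigma> x' y') * V"
    if xy: "x \<in> verts X" "y \<in> verts X" "x' \<in> verts X" "y' \<in> verts X" for x y x' y'
  proof -
    note [simp] = d[OF xy(1,2)] d[OF xy(3,4)]
    have "?v x y * ?v x' y' = mat_adjoint V * (qent \<sigma> x y * (V * ?v x' y'))" by (simp add: mat_assoc)
    also have "V * ?v x' y' = qent \<sigma> x' y' * V" using inv[OF xy(3,4)] by simp
    finally show ?thesis by (simp add: mat_assoc)
  qed
  have zero: "mat_adjoint V * 0\<^sub>m (qdim \<sigma>) (qdim \<sigma>) * V = 0\<^sub>m m m" by (simp add: mat_simps)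
  have sum: "strong_has_sum (\<lambda>z. mat_adjoint V * f z * V) (1\<^sub>m m) (verts X)"
    if r: "resol (qdim \<sigma>) {z \<in> verts X. f z \<noteq> 0\<^sub>m (qdim \<sigma>) (qdim \<sigma>)} f" for f
  proof -
    let ?F = "{z \<in> verts X. f z \<noteq> 0\<^sub>m (qdim \<sigma>) (qdim \<sigma>)}"
    have "strong_has_sum (\<lambda>z. mat_adjoint V * f z * V) (msum m m (\<lambda>z. mat_adjoint V * f z * V) ?F) (verts X)"
      by (rule strong_has_sum_finite) (use resolD(1)[OF r] zero in auto)
    moreover have "msum m m (\<lambda>z. mat_adjoint V * f z * V) ?F = msum m (qdim \<sigma>) (\<lambda>z. mat_adjoint V * f z) ?F * V"
      using V resolD(5)[OF r] by (intro msum_mult_right[symmetric] mult_carrier_mat[of _ _ "qdim \<sigma>"]) auto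
    moreover have "msum m (qdim \<sigma>) (\<lambda>z. mat_adjoint V * f z) ?F = mat_adjoint V * msum (qdim \<sigma>) (qdim \<sigma>) f ?F"
      using V resolD(5)[OF r] by (intro msum_mult_left[symmetric]) auto
    ultimately show ?thesis using resolD(4)[OF r] V by (simp add: mat_simps)
  qed
  have "is_projection m (?v x y)" if xy: "x \<in> verts X" "y \<in> verts X" for x y
  proof -
    note p = is_projectionD[OF qpD(1)[OF \<sigma>p xy]]
    have "?v x y * ?v x y = ?v x y" using prod[OF xy xy] p(2) by simp
    moreover have "mat_adjoint (?v x y) = ?v x y" using p(3-5) by (simp add: mat_adjoint_mult mat_assoc)
    ultimately show ?thesis unfolding is_projection_def using vc by blast
  qed
  moreover have "?v x y * ?v x' y' = 0\<^sub>m m m"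
    if xy: "x \<in> verts X" "y \<in> verts X" "x' \<in> verts X" "y' \<in> verts X"
      and z: "qent \<sigma> x y * qent \<sigma> x' y' = 0\<^sub>m (qdim \<sigma>) (qdim \<sigma>)" for x y x' y'
    using prod[OF xy] z zero by simp
  ultimately show ?thesis
    unfolding quantum_automorphism_def quantum_permutation_def
    using qpD(2,3)[OF \<sigma>p] qaD(2)[OF \<sigma>] sum[OF qp_row_resol[OF \<sigma>p]] sum[OF qp_col_resol[OF \<sigma>p]]
    by simp
qed

lemma Qut_cat_simps [simp]:
  "objs (Qut_cat X) = {\<sigma>. quantum_automorphism X \<sigma>}" "hdim (Qut_cat X) = qdim"
  "mor (Qut_cat X) = qperm_intertwiners (verts X)"
  "tens (Qut_cat X) \<sigma> \<tau> = \<lparr>qdim = qdim \<sigma> * qdim \<tau>, qent = qent_tensor (verts X) \<sigma> \<tau>\<rparr>"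
  "tunit (Qut_cat X) = \<lparr>qdim = 1, qent = qent_unit\<rparr>"
  by (simp_all add: Qut_cat_def)

lemma intertwinersD:
  assumes "T \<in> qperm_intertwiners Y \<sigma> \<tau>"
  shows "T \<in> carrier_mat (qdim \<tau>) (qdim \<sigma>)" "\<And>x y. x \<in> Y \<Longrightarrow> y \<in> Y \<Longrightarrow> T * qent \<sigma> x y = qent \<tau> x y * T"
  using assms by (auto simp: qperm_intertwiners_def)

text \<open>Reducibility means that some self-intertwiner is not scalar. The entries are
  self-adjoint and commute with it, so they preserve one of its eigenspaces and the orthogonal
  complement.\<close>

lemma Qut_cat_split:
  assumes \<rho>: "quantum_automorphism X \<rho>" "qdim \<rho> > 0" "\<not> irreducible_obj (Qut_cat X) \<rho>"
  shows "\<exists>\<rho>1\<in>objs (Qut_cat X). \<exists>\<rho>2\<in>objs (Qut_cat X). \<exists>V1\<in>mor (Qut_cat X) \<rho>1 \<rho>. \<exists>V2\<in>mor (Qut_cat X) \<rho>2 \<rho>.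
    hdim (Qut_cat X) \<rho>1 < hdim (Qut_cat X) \<rho> \<and> hdim (Qut_cat X) \<rho>2 < hdim (Qut_cat X) \<rho> \<and>
    V1 * mat_adjoint V1 + V2 * mat_adjoint V2 = 1\<^sub>m (hdim (Qut_cat X) \<rho>)"
proof -
  note \<rho>p = qaD(1)[OF \<rho>(1)]
  note d = carrier_matD[OF qpD(4)[OF \<rho>p]]
  have "z \<cdot>\<^sub>m 1\<^sub>m (qdim \<rho>) \<in> qperm_intertwiners (verts X) \<rho> \<rho>" for z
    unfolding qperm_intertwiners_def using d by (auto simp: mat_simps)
  then obtain H where H: "H \<in> qperm_intertwiners (verts X) \<rho> \<rho>" "\<And>z. H \<noteq> z \<cdot>\<^sub>m 1\<^sub>m (qdim \<rho>)"
    using \<rho> unfolding irreducible_obj_def by auto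
  obtain m1 m2 V1 V2 where V: "V1 \<in> carrier_mat (qdim \<rho>) m1" "V2 \<in> carrier_mat (qdim \<rho>) m2" "m1 < qdim \<rho>" "m2 < qdim \<rho>"
    "mat_adjoint V1 * V1 = 1\<^sub>m m1" "mat_adjoint V2 * V2 = 1\<^sub>m m2"
    "V1 * mat_adjoint V1 + V2 * mat_adjoint V2 = 1\<^sub>m (qdim \<rho>)"
    and inv: "\<And>u. u \<in> carrier_mat (qdim \<rho>) (qdim \<rho>) \<Longrightarrow> mat_adjoint u = u \<Longrightarrow> H * u = u * H \<Longrightarrow>
      u * V1 = V1 * (mat_adjoint V1 * u * V1) \<and> u * V2 = V2 * (mat_adjoint V2 * u * V2)"
    by (rule commutant_splitting[OF intertwinersD(1)[OF H(1)] \<rho>(2) H(2)]) (rule that)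
  have inv': "qent \<rho> x y * V1 = V1 * (mat_adjoint V1 * qent \<rho> x y * V1)"
    "qent \<rho> x y * V2 = V2 * (mat_adjoint V2 * qent \<rho> x y * V2)" if xy: "x \<in> verts X" "y \<in> verts X" for x y
    using inv[OF qpD(4)[OF \<rho>p xy] is_projectionD(3)[OF qpD(1)[OF \<rho>p xy]] intertwinersD(2)[OF H(1) xy]] by auto
  let ?\<rho>1 = "\<lparr>qdim = m1, qent = (\<lambda>x y. mat_adjoint V1 * qent \<rho> x y * V1)\<rparr>"
  let ?\<rho>2 = "\<lparr>qdim = m2, qent = (\<lambda>x y. mat_adjoint V2 * qent \<rho> x y * V2)\<rparr>"
  have "?\<rho>1 \<in> objs (Qut_cat X)" "?\<rho>2 \<in> objs (Qut_cat X)"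
    using compression_automorphism[OF \<rho>(1) V(1,5) inv'(1)] compression_automorphism[OF \<rho>(1) V(2,6) inv'(2)] by auto
  moreover have "V1 \<in> mor (Qut_cat X) ?\<rho>1 \<rho>" "V2 \<in> mor (Qut_cat X) ?\<rho>2 \<rho>"
    using V inv'[symmetric] by (auto simp: qperm_intertwiners_def)
  ultimately show ?thesis using V by (intro bexI[of _ ?\<rho>1] bexI[of _ ?\<rho>2] bexI[of _ V1] bexI[of _ V2]) auto
qed

lemma fiber_star_cat_Qut: "fiber_star_cat (Qut_cat X)"
proof
  fix \<sigma> \<tau> T assume "T \<in> mor (Qut_cat X) \<sigma> \<tau>"
  then show "T \<in> carrier_mat (hdim (Qut_cat X) \<tau>) (hdim (Qut_cat X) \<sigma>)" by (simp add: intertwinersD)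
next
  fix \<sigma> assume "\<sigma> \<in> objs (Qut_cat X)"
  then have q: "quantum_permutation (verts X) \<sigma>" by (auto dest: qaD(1))
  show "1\<^sub>m (hdim (Qut_cat X) \<sigma>) \<in> mor (Qut_cat X) \<sigma> \<sigma>"
    using carrier_matD[OF qpD(4)[OF q]] by (auto simp: qperm_intertwiners_def mat_simps)
next
  fix \<sigma> \<tau> \<rho> T S
  assume o: "\<sigma> \<in> objs (Qut_cat X)" "\<tau> \<in> objs (Qut_cat X)" "\<rho> \<in> objs (Qut_cat X)"
    and T: "T \<in> mor (Qut_cat X) \<sigma> \<tau>" and S: "S \<in> mor (Qut_cat X) \<tau> \<rho>"
  have q: "quantum_permutation (verts X) \<sigma>" "quantum_permutation (verts X) \<tau>" "quantum_permutation (verts X) \<rho>"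
    using o by (auto dest: qaD(1))
  have T': "T \<in> qperm_intertwiners (verts X) \<sigma> \<tau>" "S \<in> qperm_intertwiners (verts X) \<tau> \<rho>" using T S by auto
  note [simp] = carrier_matD[OF intertwinersD(1)[OF T'(1)]] carrier_matD[OF intertwinersD(1)[OF T'(2)]]
  have "S * T * qent \<sigma> x y = qent \<rho> x y * (S * T)" if xy: "x \<in> verts X" "y \<in> verts X" for x y
  proof -
    note [simp] = carrier_matD[OF qpD(4)[OF q(1) xy]] carrier_matD[OF qpD(4)[OF q(2) xy]] carrier_matD[OF qpD(4)[OF q(3) xy]]
    have "S * T * qent \<sigma> x y = (S * qent \<tau> x y) * T" using intertwinersD(2)[OF T'(1) xy] by (simp add: mat_assoc)
    then show ?thesis using intertwinersD(2)[OF T'(2) xy] by (simp add: mat_assoc)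
  qed
  moreover have "S * T \<in> carrier_mat (qdim \<rho>) (qdim \<sigma>)" by (rule carrier_matI) auto
  ultimately show "S * T \<in> mor (Qut_cat X) \<sigma> \<rho>" by (simp add: qperm_intertwiners_def)
next
  fix \<sigma> \<tau> T assume o: "\<sigma> \<in> objs (Qut_cat X)" "\<tau> \<in> objs (Qut_cat X)" and T: "T \<in> mor (Qut_cat X) \<sigma> \<tau>"
  have q: "quantum_permutation (verts X) \<sigma>" "quantum_permutation (verts X) \<tau>" using o by (auto dest: qaD(1))
  have T': "T \<in> qperm_intertwiners (verts X) \<sigma> \<tau>" using T by auto
  note [simp] = carrier_matD[OF intertwinersD(1)[OF T']]
  have "mat_adjoint T * qent \<tau> x y = qent \<sigma> x y * mat_adjoint T" if xy: "x \<in> verts X" "y \<in> verts X" for x y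
  proof -
    note [simp] = is_projectionD(3-5)[OF qpD(1)[OF q(1) xy]] is_projectionD(3-5)[OF qpD(1)[OF q(2) xy]]
    have "mat_adjoint (T * qent \<sigma> x y) = mat_adjoint (qent \<tau> x y * T)" using intertwinersD(2)[OF T' xy] by simp
    then show ?thesis by (simp add: mat_adjoint_mult)
  qed
  then show "mat_adjoint T \<in> mor (Qut_cat X) \<tau> \<sigma>"
    using intertwinersD(1)[OF T'] by (simp add: qperm_intertwiners_def)
  fix z
  have "(z \<cdot>\<^sub>m T) * qent \<sigma> x y = qent \<tau> x y * (z \<cdot>\<^sub>m T)" if xy: "x \<in> verts X" "y \<in> verts X" for x y
    using intertwinersD(2)[OF T' xy] carrier_matD[OF qpD(4)[OF q(1) xy]] carrier_matD[OF qpD(4)[OF q(2) xy]]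
    by (simp add: mat_smult_mult mat_mult_smult)
  then show "z \<cdot>\<^sub>m T \<in> mor (Qut_cat X) \<sigma> \<tau>"
    using intertwinersD(1)[OF T'] by (simp add: qperm_intertwiners_def)
next
  fix \<sigma> \<tau> assume "\<sigma> \<in> objs (Qut_cat X)" "\<tau> \<in> objs (Qut_cat X)"
  then show "tens (Qut_cat X) \<sigma> \<tau> \<in> objs (Qut_cat X)" by (simp add: quantum_automorphism_tensor)
next
  fix \<sigma> \<tau> show "hdim (Qut_cat X) (tens (Qut_cat X) \<sigma> \<tau>) = hdim (Qut_cat X) \<sigma> * hdim (Qut_cat X) \<tau>" by simp
next
  fix \<sigma> \<sigma>' \<tau> \<tau>' T S
  assume o: "\<sigma> \<in> objs (Qut_cat X)" "\<sigma>' \<in> objs (Qut_cat X)" "\<tau> \<in> objs (Qut_cat X)" "\<tau>' \<in> objs (Qut_cat X)"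
    and "T \<in> mor (Qut_cat X) \<sigma> \<sigma>'" "S \<in> mor (Qut_cat X) \<tau> \<tau>'"
  then show "kron T S \<in> mor (Qut_cat X) (tens (Qut_cat X) \<sigma> \<tau>) (tens (Qut_cat X) \<sigma>' \<tau>')"
    by (simp add: intertwiner_tensor qaD(1))
next
  fix \<rho> assume "\<rho> \<in> objs (Qut_cat X)" "hdim (Qut_cat X) \<rho> > 0" "\<not> irreducible_obj (Qut_cat X) \<rho>"
  then show "\<exists>\<rho>1\<in>objs (Qut_cat X). \<exists>\<rho>2\<in>objs (Qut_cat X). \<exists>V1\<in>mor (Qut_cat X) \<rho>1 \<rho>. \<exists>V2\<in>mor (Qut_cat X) \<rho>2 \<rho>.
    hdim (Qut_cat X) \<rho>1 < hdim (Qut_cat X) \<rho> \<and> hdim (Qut_cat X) \<rho>2 < hdim (Qut_cat X) \<rho> \<and>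
    V1 * mat_adjoint V1 + V2 * mat_adjoint V2 = 1\<^sub>m (hdim (Qut_cat X) \<rho>)"
    using Qut_cat_split[of X \<rho>] by simp
qed

section \<open>Contragredients\<close>

definition cconj :: "complex mat \<Rightarrow> complex mat" where
  "cconj A = map_mat cnj A"

lemma cconj_dim [simp]: "dim_row (cconj A) = dim_row A" "dim_col (cconj A) = dim_col A"
  by (simp_all add: cconj_def)

lemma cconj_carrier [simp, intro]: "A \<in> carrier_mat m n \<Longrightarrow> cconj A \<in> carrier_mat m n"
  by (simp add: cconj_def)

lemma cconj_index [simp]: "i < dim_row A \<Longrightarrow> j < dim_col A \<Longrightarrow> cconj A $$ (i, j) = cnj (A $$ (i, j))"
  by (simp add: cconj_def)

lemma cconj_mult: "dim_col A = dim_row B \<Longrightarrow> cconj (A * B) = cconj A * cconj B"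
  by (rule eq_matI) (auto simp: mult_index_sum simp del: index_mult_mat(1))

lemma cconj_adjoint: "mat_adjoint (cconj A) = cconj (mat_adjoint A)"
  by (rule eq_matI) auto

lemma cconj_zero [simp]: "cconj (0\<^sub>m m n) = 0\<^sub>m m n"
  by (rule eq_matI) auto

lemma cconj_one [simp]: "cconj (1\<^sub>m n) = 1\<^sub>m n"
  by (rule eq_matI) auto

lemma cconj_msum:
  assumes "\<And>t. t \<in> X \<Longrightarrow> f t \<in> carrier_mat m n"
  shows "cconj (msum m n f X) = msum m n (\<lambda>t. cconj (f t)) X"
proof (rule eq_matI)
  fix i j assume "i < dim_row (msum m n (\<lambda>t. cconj (f t)) X)" "j < dim_col (msum m n (\<lambda>t. cconj (f t)) X)"
  then have ij: "i < m" "j < n" by auto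
  have "cconj (f t) $$ (i, j) = cnj (f t $$ (i, j))" if "t \<in> X" for t
    using ij carrier_matD[OF assms[OF that]] by simp
  then show "cconj (msum m n f X) $$ (i, j) = msum m n (\<lambda>t. cconj (f t)) X $$ (i, j)" using ij by simp
qed auto

lemma cconj_projection: "is_projection n p \<Longrightarrow> is_projection n (cconj p)"
  using cconj_mult[of p p] by (auto simp: is_projection_def cconj_adjoint)

text \<open>In coordinates the conjugate Hilbert space turns an operator into its entrywise
  conjugate. Besides giving conjugate objects, the exchange of rows and columns yields the reverse
  inequality in \<open>qa_distance\<close>.\<close>

definition contragredient :: "'y qperm \<Rightarrow> 'y qperm" where
  "contragredient \<sigma> = \<lparr>qdim = qdim \<sigma>, qent = (\<lambda>x y. cconj (qent \<sigma> y x))\<rparr>"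

lemma contragredient_simps [simp]:
  "qdim (contragredient \<sigma>) = qdim \<sigma>" "qent (contragredient \<sigma>) x y = cconj (qent \<sigma> y x)"
  by (simp_all add: contragredient_def)

lemma strong_has_sum_cconj:
  assumes r: "resol n {z \<in> Y. f z \<noteq> 0\<^sub>m n n} f"
  shows "strong_has_sum (\<lambda>z. cconj (f z)) (1\<^sub>m n) Y"
proof -
  have "strong_has_sum (\<lambda>z. cconj (f z)) (msum n n (\<lambda>z. cconj (f z)) {z \<in> Y. f z \<noteq> 0\<^sub>m n n}) Y"
    by (rule strong_has_sum_finite) (use resolD(1)[OF r] in auto)
  moreover have "msum n n (\<lambda>z. cconj (f z)) {z \<in> Y. f z \<noteq> 0\<^sub>m n n} = 1\<^sub>m n"
    using cconj_msum[of "{z \<in> Y. f z \<noteq> 0\<^sub>m n n}" f n n, OF resolD(5)[OF r]] resolD(4)[OF r] by simp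
  ultimately show ?thesis by simp
qed

text \<open>Entrywise conjugation, unlike the transpose, keeps the order of products, so vanishing
  products stay zero; the graph relations are symmetric in rows and columns.\<close>

lemma contragredient_automorphism:
  assumes \<sigma>: "quantum_automorphism X \<sigma>"
  shows "quantum_automorphism X (contragredient \<sigma>)"
proof -
  note q = qaD(1)[OF \<sigma>]
  have z: "cconj (qent \<sigma> x y) * cconj (qent \<sigma> x' y') = 0\<^sub>m (qdim \<sigma>) (qdim \<sigma>)"
    if xy: "x \<in> verts X" "y \<in> verts X" "x' \<in> verts X" "y' \<in> verts X"
      and z: "qent \<sigma> x y * qent \<sigma> x' y' = 0\<^sub>m (qdim \<sigma>) (qdim \<sigma>)" for x y x' y'
    using cconj_mult[of "qent \<sigma> x y" "qent \<sigma> x' y'"] z carrier_matD[OF qpD(4)[OF q xy(1,2)]]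
      carrier_matD[OF qpD(4)[OF q xy(3,4)]] by simp
  have row: "strong_has_sum (qent (contragredient \<sigma>) x) (1\<^sub>m (qdim \<sigma>)) (verts X)" if "x \<in> verts X" for x
    using strong_has_sum_cconj[OF qp_col_resol[OF q that]] by (simp add: contragredient_def)
  have col: "strong_has_sum (\<lambda>y. qent (contragredient \<sigma>) y x) (1\<^sub>m (qdim \<sigma>)) (verts X)" if "x \<in> verts X" for x
    using strong_has_sum_cconj[OF qp_row_resol[OF q that]] by (simp add: contragredient_def)
  have "quantum_permutation (verts X) (contragredient \<sigma>)"
    unfolding quantum_permutation_def
    using z qpD(2,3)[OF q] cconj_projection[OF qpD(1)[OF q]] row col by simp
  moreover have "qent (contragredient \<sigma>) x1 y1 * qent (contragredient \<sigma>) x2 y2 = 0\<^sub>m (qdim \<sigma>) (qdim \<sigma>)"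
    if "x1 \<in> verts X" "x2 \<in> verts X" "y1 \<in> verts X" "y2 \<in> verts X" "rel_of X x1 x2 \<noteq> rel_of X y1 y2" for x1 x2 y1 y2
    using that(5) z[OF that(3,1,4,2) qaD(2)[OF \<sigma> that(3,4,1,2)]] by simp
  ultimately show ?thesis
    unfolding quantum_automorphism_def by simp
qed

section \<open>The maximally entangled vector and the conjugate equations\<close>

text \<open>The unnormalised sum of e_a tensor e_a over the standard basis. It serves as both
  solutions of the conjugate equations.\<close>

definition max_entangled :: "nat \<Rightarrow> complex mat" where
  "max_entangled n = mat (n * n) 1 (\<lambda>(i, _). if i div n = i mod n then 1 else 0)"

lemma max_entangled_carrier [simp]: "max_entangled n \<in> carrier_mat (n * n) 1"
  by (simp add: max_entangled_def)

lemma max_entangled_dim [simp]: "dim_row (max_entangled n) = n * n" "dim_col (max_entangled n) = 1"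
  by (simp_all add: max_entangled_def)

lemma kron_max_entangled:
  assumes A: "A \<in> carrier_mat n n" "B \<in> carrier_mat n n" and i: "i < n * n"
  shows "(kron A B * max_entangled n) $$ (i, 0) = (\<Sum>a<n. A $$ (i div n, a) * B $$ (i mod n, a))"
proof -
  note [simp] = carrier_matD[OF A(1)] carrier_matD[OF A(2)]
  have "(kron A B * max_entangled n) $$ (i, 0) =
      (\<Sum>k<n * n. A $$ (i div n, k div n) * B $$ (i mod n, k mod n) * (if k div n = k mod n then 1 else 0))"
    using i by (subst mult_index_sum) (auto simp: kron_index max_entangled_def)
  also have "\<dots> = (\<Sum>a<n. \<Sum>b<n. A $$ (i div n, a) * B $$ (i mod n, b) * (if a = b then 1 else 0))"
    by (rule sum_div_mod)
  also have "\<dots> = (\<Sum>a<n. A $$ (i div n, a) * B $$ (i mod n, a))"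
    by (intro sum.cong) (auto simp: if_distrib cong: if_cong)
  finally show ?thesis .
qed

text \<open>Applied to this vector, a tensor product becomes the vectorisation of an ordinary
  product, to which the orthogonality relations of rows and columns apply.\<close>

lemma kron_cconj_left:
  assumes A: "A \<in> carrier_mat n n" "B \<in> carrier_mat n n"
  shows "kron (cconj A) B * max_entangled n = mat (n * n) 1 (\<lambda>(i, _). (B * mat_adjoint A) $$ (i mod n, i div n))"
proof (rule eq_matI)
  fix i j assume "i < dim_row (mat (n * n) 1 (\<lambda>(i, _). (B * mat_adjoint A) $$ (i mod n, i div n)))"
    "j < dim_col (mat (n * n) 1 (\<lambda>(i, _). (B * mat_adjoint A) $$ (i mod n, i div n)))"
  then have i: "i < n * n" "j = 0" by auto
  show "(kron (cconj A) B * max_entangled n) $$ (i, j) = mat (n * n) 1 (\<lambda>(i, _). (B * mat_adjoint A) $$ (i mod n, i div n)) $$ (i, j)"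
    using A i div_mod_less[OF i(1)] kron_max_entangled[OF cconj_carrier[OF A(1)] A(2) i(1)]
    by (simp add: mult_index_sum mult.commute del: index_mult_mat(1))
qed (use A in auto)

lemma kron_cconj_right:
  assumes A: "A \<in> carrier_mat n n" "B \<in> carrier_mat n n"
  shows "kron A (cconj B) * max_entangled n = mat (n * n) 1 (\<lambda>(i, _). (A * mat_adjoint B) $$ (i div n, i mod n))"
proof (rule eq_matI)
  fix i j assume "i < dim_row (mat (n * n) 1 (\<lambda>(i, _). (A * mat_adjoint B) $$ (i div n, i mod n)))"
    "j < dim_col (mat (n * n) 1 (\<lambda>(i, _). (A * mat_adjoint B) $$ (i div n, i mod n)))"
  then have i: "i < n * n" "j = 0" by auto
  show "(kron A (cconj B) * max_entangled n) $$ (i, j) = mat (n * n) 1 (\<lambda>(i, _). (A * mat_adjoint B) $$ (i div n, i mod n)) $$ (i, j)"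
    using A i div_mod_less[OF i(1)] kron_max_entangled[OF A(1) cconj_carrier[OF A(2)] i(1)]
    by (simp add: mult_index_sum del: index_mult_mat(1))
qed (use A in auto)

lemma max_entangled_intertwiner:
  assumes q: "quantum_permutation Y \<sigma>" "quantum_permutation Y \<tau>" and n: "qdim \<sigma> = n" "qdim \<tau> = n"
    and eq: "\<And>x y z. x \<in> Y \<Longrightarrow> y \<in> Y \<Longrightarrow> z \<in> Y \<Longrightarrow>
      kron (qent \<sigma> x z) (qent \<tau> z y) * max_entangled n =
        (if x = y then kron (qent \<sigma> x z) (1\<^sub>m n) * max_entangled n else 0\<^sub>m (n * n) 1)"
  shows "max_entangled n \<in> qperm_intertwiners Y \<lparr>qdim = 1, qent = qent_unit\<rparr> \<lparr>qdim = qdim \<sigma> * qdim \<tau>, qent = qent_tensor Y \<sigma> \<tau>\<rparr>"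
proof -
  have "max_entangled n * qent_unit x y = qent_tensor Y \<sigma> \<tau> x y * max_entangled n" if xy: "x \<in> Y" "y \<in> Y" for x y
  proof -
    let ?F = "{z \<in> Y. qent \<sigma> x z \<noteq> 0\<^sub>m (qdim \<sigma>) (qdim \<sigma>)}"
    note r = qp_row_resol[OF q(1) xy(1)]
    have "qent_tensor Y \<sigma> \<tau> x y * max_entangled n = msum (n * n) (n * n) (\<lambda>z. kron (qent \<sigma> x z) (qent \<tau> z y)) ?F * max_entangled n"
      by (subst qent_tensor_msum[OF q xy resolD(1)[OF r]]) (use n in auto)
    also have "\<dots> = msum (n * n) 1 (\<lambda>z. kron (qent \<sigma> x z) (qent \<tau> z y) * max_entangled n) ?F"
      using qpD(4)[OF q(1)] qpD(4)[OF q(2)] xy n by (intro msum_mult_right) auto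
    also have "\<dots> = max_entangled n * qent_unit x y"
    proof (cases "x = y")
      case False
      then have "msum (n * n) 1 (\<lambda>z. kron (qent \<sigma> x z) (qent \<tau> z y) * max_entangled n) ?F = 0\<^sub>m (n * n) 1"
        using eq xy by (intro msum_zero) auto
      then show ?thesis using False by (simp add: qent_unit_def mat_simps)
    next
      case True
      have "msum (n * n) 1 (\<lambda>z. kron (qent \<sigma> x z) (qent \<tau> z y) * max_entangled n) ?F =
          msum (n * n) 1 (\<lambda>z. kron (qent \<sigma> x z) (1\<^sub>m n) * max_entangled n) ?F"
        using eq xy True by (intro msum_cong) auto
      also have "\<dots> = msum (n * n) (n * n) (\<lambda>z. kron (qent \<sigma> x z) (1\<^sub>m n)) ?F * max_entangled n"
        using qpD(4)[OF q(1)] xy n by (intro msum_mult_right[symmetric]) auto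
      also have "msum (n * n) (n * n) (\<lambda>z. kron (qent \<sigma> x z) (1\<^sub>m n)) ?F = 1\<^sub>m (n * n)"
        using resolD(4)[OF resol_kron_one[OF r, of n]] n by simp
      finally show ?thesis using True by (simp add: qent_unit_def mat_simps)
    qed
    finally show ?thesis by simp
  qed
  then show ?thesis using n max_entangled_carrier[of n] by (simp add: qperm_intertwiners_def)
qed

lemma zigzag: "kron (mat_adjoint (max_entangled n)) (1\<^sub>m n) * kron (1\<^sub>m n) (max_entangled n) = 1\<^sub>m n"
proof (rule eq_matI)
  fix a b assume "a < dim_row (1\<^sub>m n :: complex mat)" "b < dim_col (1\<^sub>m n :: complex mat)"
  then have ab: "a < n" "b < n" by auto
  let ?d = "\<lambda>P. if P then 1 else 0 :: complex"
  have "(kron (mat_adjoint (max_entangled n)) (1\<^sub>m n) * kron (1\<^sub>m n) (max_entangled n)) $$ (a, b)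
     = (\<Sum>k<n * (n * n). kron (mat_adjoint (max_entangled n)) (1\<^sub>m n) $$ (a, k) * kron (1\<^sub>m n) (max_entangled n) $$ (k, b))"
    using ab by (subst mult_index_sum) (auto simp: mult.assoc)
  also have "\<dots> = (\<Sum>k<(n * n) * n. ?d ((k div n) div n = (k div n) mod n) * ?d (a = k mod n) *
      (?d ((k div n) div n = b) * ?d ((k div n) mod n = k mod n)))"
  proof (rule sum.cong)
    fix k assume "k \<in> {..<(n * n) * n}"
    then have k: "k < (n * n) * n" by simp
    have n: "n > 0" using ab by simp
    have k1: "k div n < n * n" "k mod n < n" using div_mod_less[OF k] by auto
    have k2: "k div n div n < n" "k div n mod n < n" using div_mod_less[OF k1(1)] by auto
    \<comment> \<open>The index k is read as three digits in base n. The left factor groups them as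
      two and one, the right factor as one and two; these equations reconcile the groupings.\<close>
    have e: "k div (n * n) = k div n div n" by (simp add: div_mult2_eq)
    have e2: "k mod (n * n) = n * (k div n mod n) + k mod n" by (simp add: mod_mult2_eq)
    have lt: "k mod (n * n) < n * n" using n by simp
    have e3: "k mod (n * n) div n = k div n mod n" "k mod (n * n) mod n = k mod n"
      unfolding e2 using k1 n by auto
    have "kron (mat_adjoint (max_entangled n)) (1\<^sub>m n) $$ (a, k) = ?d ((k div n) div n = (k div n) mod n) * ?d (a = k mod n)"
      using ab k k1 by (subst kron_index) (auto simp: max_entangled_def)
    moreover have "kron (1\<^sub>m n) (max_entangled n) $$ (k, b) = ?d ((k div n) div n = b) * ?d ((k div n) mod n = k mod n)"
      using ab k k2 lt by (subst kron_index) (auto simp: e e3 mult_ac max_entangled_def)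
    ultimately show "kron (mat_adjoint (max_entangled n)) (1\<^sub>m n) $$ (a, k) * kron (1\<^sub>m n) (max_entangled n) $$ (k, b) =
      ?d ((k div n) div n = (k div n) mod n) * ?d (a = k mod n) * (?d ((k div n) div n = b) * ?d ((k div n) mod n = k mod n))"
      by simp
  qed (simp add: mult.assoc)
  also have "\<dots> = (\<Sum>s<n * n. \<Sum>r<n. ?d (s div n = s mod n) * ?d (a = r) * (?d (s div n = b) * ?d (s mod n = r)))"
    by (rule sum_div_mod)
  also have "\<dots> = (\<Sum>s<n * n. ?d (s div n = s mod n) * ?d (s div n = b) * ?d (s mod n = a))"
  proof (rule sum.cong)
    fix s
    have "(\<Sum>r<n. ?d (s div n = s mod n) * ?d (a = r) * (?d (s div n = b) * ?d (s mod n = r)))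
        = (\<Sum>r<n. if a = r then ?d (s div n = s mod n) * ?d (s div n = b) * ?d (s mod n = a) else 0)"
      by (intro sum.cong) auto
    then show "(\<Sum>r<n. ?d (s div n = s mod n) * ?d (a = r) * (?d (s div n = b) * ?d (s mod n = r)))
        = ?d (s div n = s mod n) * ?d (s div n = b) * ?d (s mod n = a)" using ab by simp
  qed simp
  also have "\<dots> = (\<Sum>p<n. \<Sum>q<n. ?d (p = q) * ?d (p = b) * ?d (q = a))"
    by (rule sum_div_mod)
  also have "\<dots> = (\<Sum>p<n. if p = b then ?d (a = b) else 0)"
  proof (rule sum.cong)
    fix p
    have "(\<Sum>q<n. ?d (p = q) * ?d (p = b) * ?d (q = a)) = (\<Sum>q<n. if a = q then ?d (p = a) * ?d (p = b) else 0)"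
      by (intro sum.cong) auto
    then show "(\<Sum>q<n. ?d (p = q) * ?d (p = b) * ?d (q = a)) = (if p = b then ?d (a = b) else 0)" using ab by auto
  qed simp
  also have "\<dots> = 1\<^sub>m n $$ (a, b)" using ab by simp
  finally show "(kron (mat_adjoint (max_entangled n)) (1\<^sub>m n) * kron (1\<^sub>m n) (max_entangled n)) $$ (a, b) = 1\<^sub>m n $$ (a, b)" .
qed auto

text \<open>Transported along the equivalence, this gives dualisability of every wreath
  corepresentation.\<close>

lemma Qut_dualisable:
  assumes \<sigma>: "quantum_automorphism X \<sigma>"
  shows "dualisable (Qut_cat X) \<sigma>"
proof -
  let ?\<tau> = "contragredient \<sigma>" and ?n = "qdim \<sigma>" and ?Y = "verts X"
  note \<tau> = contragredient_automorphism[OF \<sigma>]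
  note q = qaD(1)[OF \<sigma>] and q' = qaD(1)[OF \<tau>]
  have "max_entangled ?n \<in> mor (Qut_cat X) (tunit (Qut_cat X)) (tens (Qut_cat X) ?\<tau> \<sigma>)"
    unfolding Qut_cat_simps
  proof (rule max_entangled_intertwiner[OF q' q])
    fix x y z assume xy: "x \<in> ?Y" "y \<in> ?Y" "z \<in> ?Y"
    note p = is_projectionD[OF qpD(1)[OF q xy(3,1)]]
    have 1: "kron (qent ?\<tau> x z) (qent \<sigma> z y) * max_entangled ?n =
        mat (?n * ?n) 1 (\<lambda>(i, _). (qent \<sigma> z y * qent \<sigma> z x) $$ (i mod ?n, i div ?n))"
      using kron_cconj_left[OF p(1) qpD(4)[OF q xy(3,2)]] p(3) by simp
    have 2: "kron (qent ?\<tau> x z) (1\<^sub>m ?n) * max_entangled ?n =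
        mat (?n * ?n) 1 (\<lambda>(i, _). (qent \<sigma> z x) $$ (i mod ?n, i div ?n))"
      using kron_cconj_left[OF p(1), of "1\<^sub>m ?n"] p by (simp add: mat_simps)
    have 3: "mat (?n * ?n) 1 (\<lambda>(i, _). (0\<^sub>m ?n ?n) $$ (i mod ?n, i div ?n)) = (0\<^sub>m (?n * ?n) 1 :: complex mat)"
      by (rule eq_matI) (auto simp: div_mod_less)
    show "kron (qent ?\<tau> x z) (qent \<sigma> z y) * max_entangled ?n =
        (if x = y then kron (qent ?\<tau> x z) (1\<^sub>m ?n) * max_entangled ?n else 0\<^sub>m (?n * ?n) 1)"
      unfolding 1 2 using p(2) qpD(2)[OF q xy(3,2,1)] 3 by auto
  qed auto
  moreover have "max_entangled ?n \<in> mor (Qut_cat X) (tunit (Qut_cat X)) (tens (Qut_cat X) \<sigma> ?\<tau>)"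
    unfolding Qut_cat_simps
  proof (rule max_entangled_intertwiner[OF q q'])
    fix x y z assume xy: "x \<in> ?Y" "y \<in> ?Y" "z \<in> ?Y"
    note p = is_projectionD[OF qpD(1)[OF q xy(1,3)]]
    note p' = is_projectionD[OF qpD(1)[OF q xy(2,3)]]
    have 1: "kron (qent \<sigma> x z) (qent ?\<tau> z y) * max_entangled ?n =
        mat (?n * ?n) 1 (\<lambda>(i, _). (qent \<sigma> x z * qent \<sigma> y z) $$ (i div ?n, i mod ?n))"
      using kron_cconj_right[OF p(1) p'(1)] p'(3) by simp
    have 2: "kron (qent \<sigma> x z) (1\<^sub>m ?n) * max_entangled ?n =
        mat (?n * ?n) 1 (\<lambda>(i, _). (qent \<sigma> x z) $$ (i div ?n, i mod ?n))"
      using kron_cconj_right[OF p(1), of "1\<^sub>m ?n"] p by (simp add: mat_simps)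
    have 3: "mat (?n * ?n) 1 (\<lambda>(i, _). (0\<^sub>m ?n ?n) $$ (i div ?n, i mod ?n)) = (0\<^sub>m (?n * ?n) 1 :: complex mat)"
      by (rule eq_matI) (auto simp: div_mod_less)
    show "kron (qent \<sigma> x z) (qent ?\<tau> z y) * max_entangled ?n =
        (if x = y then kron (qent \<sigma> x z) (1\<^sub>m ?n) * max_entangled ?n else 0\<^sub>m (?n * ?n) 1)"
      unfolding 1 2 using p(2) qpD(3)[OF q xy(3,1,2)] 3 by auto
  qed auto
  ultimately show ?thesis
    unfolding dualisable_def using \<tau> zigzag[of ?n]
    by (intro bexI[of _ ?\<tau>] bexI[of _ "max_entangled ?n"] conjI) auto
qed

section \<open>Representations of \<open>C\<^sub>0\<close> of a discrete group\<close>

lemma hnorm_1: "v \<in> carrier_vec 1 \<Longrightarrow> hnorm v = cmod (v $ 0)"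
  by (auto simp: hnorm_def scalar_prod_def cmod_def power2_eq_square)

lemma op_norm_1:
  assumes A: "A \<in> carrier_mat 1 1" shows "op_norm A = cmod (A $$ (0, 0))"
proof -
  have e: "hnorm (A *\<^sub>v v) = cmod (A $$ (0, 0)) * cmod (v $ 0)" if "v \<in> carrier_vec 1" for v
    using that A by (subst hnorm_1) (auto simp: scalar_prod_def norm_mult)
  have "(SUP v \<in> {v \<in> carrier_vec 1. hnorm v \<le> 1}. hnorm (A *\<^sub>v v)) = cmod (A $$ (0, 0))"
  proof (rule cSup_eq_maximum)
    have "hnorm (A *\<^sub>v vec 1 (\<lambda>_. 1)) = cmod (A $$ (0, 0))" by (subst e) auto
    moreover have "hnorm (vec 1 (\<lambda>_. 1)) \<le> 1" by (subst hnorm_1) auto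
    ultimately show "cmod (A $$ (0, 0)) \<in> (\<lambda>v. hnorm (A *\<^sub>v v)) ` {v \<in> carrier_vec 1. hnorm v \<le> 1}"
      by (intro image_eqI[of _ _ "vec 1 (\<lambda>_. 1)"]) auto
  next
    fix x assume "x \<in> (\<lambda>v. hnorm (A *\<^sub>v v)) ` {v \<in> carrier_vec 1. hnorm v \<le> 1}"
    then obtain v where v: "v \<in> carrier_vec 1" "hnorm v \<le> 1" "x = hnorm (A *\<^sub>v v)" by auto
    then show "x \<le> cmod (A $$ (0, 0))"
      using hnorm_1[OF v(1)] e[OF v(1)] by (simp add: mult_left_le)
  qed
  then show ?thesis using A by (simp add: op_norm_def)
qed

section \<open>Functions vanishing at infinity on a discrete group, as families of one-dimensional
  blocks\<close>

definition fn :: "'g set \<Rightarrow> ('g \<Rightarrow> complex) \<Rightarrow> 'g blocks" where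
  "fn \<Gamma> h = (\<lambda>g\<in>\<Gamma>. mat 1 1 (\<lambda>_. h g))"

definition vanishing :: "'g set \<Rightarrow> ('g \<Rightarrow> complex) \<Rightarrow> bool" where
  "vanishing \<Gamma> h \<longleftrightarrow> (\<forall>\<epsilon>>0. finite {g\<in>\<Gamma>. cmod (h g) \<ge> \<epsilon>})"

lemma fn_apply [simp]: "g \<in> \<Gamma> \<Longrightarrow> fn \<Gamma> h g = mat 1 1 (\<lambda>_. h g)"
  by (simp add: fn_def)

lemma fn_cong: "(\<And>g. g \<in> \<Gamma> \<Longrightarrow> h g = k g) \<Longrightarrow> fn \<Gamma> h = fn \<Gamma> k"
  by (auto simp: fn_def)

lemma C0_group_eq:
  "C0 (dqg_of_group \<Gamma>) = c0_sum (carrier \<Gamma>) (\<lambda>_. 1)"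
  by (simp add: C0_def dqg_of_group_def)

lemma fn_in_C0: "fn (carrier \<Gamma>) h \<in> elems (C0 (dqg_of_group \<Gamma>)) \<longleftrightarrow> vanishing (carrier \<Gamma>) h"
proof -
  have "{g \<in> carrier \<Gamma>. \<epsilon> \<le> op_norm (fn (carrier \<Gamma>) h g)} = {g \<in> carrier \<Gamma>. \<epsilon> \<le> cmod (h g)}" for \<epsilon>
    by (auto simp: op_norm_1)
  moreover have "fn (carrier \<Gamma>) h \<in> (\<Pi>\<^sub>E g\<in>carrier \<Gamma>. carrier_mat 1 1)" by (auto simp: fn_def)
  ultimately show ?thesis by (auto simp: C0_group_eq c0_sum_def block_alg_def vanishing_def)
qed

lemma C0_fn:
  assumes "f \<in> elems (C0 (dqg_of_group \<Gamma>))"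
  shows "f = fn (carrier \<Gamma>) (\<lambda>g. f g $$ (0, 0))" "vanishing (carrier \<Gamma>) (\<lambda>g. f g $$ (0, 0))"
proof -
  have f: "f \<in> (\<Pi>\<^sub>E g\<in>carrier \<Gamma>. carrier_mat 1 1)" using assms by (simp add: C0_group_eq c0_sum_def block_alg_def)
  show "f = fn (carrier \<Gamma>) (\<lambda>g. f g $$ (0, 0))"
  proof (rule ext)
    fix g
    show "f g = fn (carrier \<Gamma>) (\<lambda>g. f g $$ (0, 0)) g"
    proof (cases "g \<in> carrier \<Gamma>")
      case True
      then have "f g \<in> carrier_mat 1 1" using f by auto
      then show ?thesis using True by (intro eq_matI) auto
    next
      case False
      then show ?thesis using f by (auto simp: fn_def)
    qed
  qed
  then show "vanishing (carrier \<Gamma>) (\<lambda>g. f g $$ (0, 0))" using assms fn_in_C0[of \<Gamma> "\<lambda>g. f g $$ (0, 0)"] by simp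
qed

lemma C0_plus: "plus_of (C0 (dqg_of_group \<Gamma>)) (fn (carrier \<Gamma>) h) (fn (carrier \<Gamma>) k) = fn (carrier \<Gamma>) (\<lambda>g. h g + k g)"
  by (auto simp: C0_group_eq c0_sum_def block_alg_def fn_def fun_eq_iff)

lemma C0_times: "times_of (C0 (dqg_of_group \<Gamma>)) (fn (carrier \<Gamma>) h) (fn (carrier \<Gamma>) k) = fn (carrier \<Gamma>) (\<lambda>g. h g * k g)"
  by (auto simp: C0_group_eq c0_sum_def block_alg_def fn_def fun_eq_iff scalar_prod_def intro!: eq_matI)

lemma C0_scale: "scale_of (C0 (dqg_of_group \<Gamma>)) z (fn (carrier \<Gamma>) h) = fn (carrier \<Gamma>) (\<lambda>g. z * h g)"
  by (auto simp: C0_group_eq c0_sum_def block_alg_def fn_def fun_eq_iff intro!: eq_matI)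

lemma C0_star: "star_of (C0 (dqg_of_group \<Gamma>)) (fn (carrier \<Gamma>) h) = fn (carrier \<Gamma>) (\<lambda>g. cnj (h g))"
  by (auto simp: C0_group_eq c0_sum_def block_alg_def fn_def fun_eq_iff intro!: eq_matI)

lemma vanishing_finite: "finite {g\<in>\<Gamma>. h g \<noteq> 0} \<Longrightarrow> vanishing \<Gamma> h"
  unfolding vanishing_def by (auto elim!: rev_finite_subset)

lemma vanishing_dominated:
  assumes h: "vanishing \<Gamma> h" and C: "C > 0" "\<And>g. g \<in> \<Gamma> \<Longrightarrow> cmod (k g) \<le> C * cmod (h g)"
  shows "vanishing \<Gamma> k"
  unfolding vanishing_def
proof (intro allI impI)
  fix \<epsilon> :: real assume "\<epsilon> > 0"
  then have "finite {g\<in>\<Gamma>. cmod (h g) \<ge> \<epsilon> / C}" using h C by (simp add: vanishing_def)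
  then show "finite {g\<in>\<Gamma>. cmod (k g) \<ge> \<epsilon>}"
    by (rule rev_finite_subset) (use C in \<open>force simp: divide_simps mult.commute\<close>)
qed

lemma vanishing_add:
  assumes "vanishing \<Gamma> h" "vanishing \<Gamma> k" shows "vanishing \<Gamma> (\<lambda>g. h g + k g)"
  unfolding vanishing_def
proof (intro allI impI)
  fix \<epsilon> :: real assume "\<epsilon> > 0"
  then have "finite ({g\<in>\<Gamma>. cmod (h g) \<ge> \<epsilon> / 2} \<union> {g\<in>\<Gamma>. cmod (k g) \<ge> \<epsilon> / 2})"
    using assms half_gt_zero[of \<epsilon>] unfolding vanishing_def by blast
  then show "finite {g\<in>\<Gamma>. cmod (h g + k g) \<ge> \<epsilon>}"
  proof (rule rev_finite_subset)
    show "{g \<in> \<Gamma>. \<epsilon> \<le> cmod (h g + k g)} \<subseteq> {g \<in> \<Gamma>. \<epsilon> / 2 \<le> cmod (h g)} \<union> {g \<in> \<Gamma>. \<epsilon> / 2 \<le> cmod (k g)}"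
    proof
      fix g assume "g \<in> {g \<in> \<Gamma>. \<epsilon> \<le> cmod (h g + k g)}"
      then show "g \<in> {g \<in> \<Gamma>. \<epsilon> / 2 \<le> cmod (h g)} \<union> {g \<in> \<Gamma>. \<epsilon> / 2 \<le> cmod (k g)}"
        using norm_triangle_ineq[of "h g" "k g"] by auto
    qed
  qed
qed

lemma vanishing_bounded:
  assumes "vanishing \<Gamma> h" obtains C where "C > 0" "\<And>g. g \<in> \<Gamma> \<Longrightarrow> cmod (h g) \<le> C"
proof -
  define F where "F = {g\<in>\<Gamma>. cmod (h g) \<ge> 1}"
  have F: "finite F" using assms by (simp add: vanishing_def F_def)
  have "cmod (h g) \<le> 1 + (\<Sum>x\<in>F. cmod (h x))" if "g \<in> \<Gamma>" for g
  proof (cases "g \<in> F")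
    case True
    then have "cmod (h g) \<le> (\<Sum>x\<in>F. cmod (h x))" using F by (intro member_le_sum) auto
    then show ?thesis by simp
  next
    case False
    then have "cmod (h g) \<le> 1" using that by (simp add: F_def)
    then show ?thesis using sum_nonneg[of F "\<lambda>x. cmod (h x)"] by simp
  qed
  moreover have "1 + (\<Sum>x\<in>F. cmod (h x)) > 0" using sum_nonneg[of F "\<lambda>x. cmod (h x)"] by (simp add: add_pos_nonneg)
  ultimately show ?thesis using that by blast
qed

lemma vanishing_mult:
  assumes "vanishing \<Gamma> h" "vanishing \<Gamma> k" shows "vanishing \<Gamma> (\<lambda>g. h g * k g)"
proof -
  obtain C where "C > 0" "\<And>g. g \<in> \<Gamma> \<Longrightarrow> cmod (h g) \<le> C" by (rule vanishing_bounded[OF assms(1)]) (rule that)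
  then show ?thesis by (intro vanishing_dominated[OF assms(2), of C]) (auto simp: norm_mult mult_right_mono)
qed

lemma vanishing_scale: "vanishing \<Gamma> h \<Longrightarrow> vanishing \<Gamma> (\<lambda>g. z * h g)"
  by (rule vanishing_dominated[of \<Gamma> h "cmod z + 1"]) (auto simp: norm_mult mult_right_mono add_nonneg_pos)

lemma vanishing_cnj: "vanishing \<Gamma> h \<Longrightarrow> vanishing \<Gamma> (\<lambda>g. cnj (h g))"
  by (rule vanishing_dominated[of \<Gamma> h 1]) auto

definition unit_fn :: "'g set \<Rightarrow> 'g \<Rightarrow> 'g blocks" where
  "unit_fn \<Gamma> g = fn \<Gamma> (\<lambda>x. if x = g then 1 else 0)"

lemma vanishing_unit: "vanishing \<Gamma> (\<lambda>x. if x = g then 1 else 0)"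
  by (rule vanishing_finite) simp

lemma unit_fn_C0: "unit_fn (carrier \<Gamma>) g \<in> elems (C0 (dqg_of_group \<Gamma>))"
  by (simp add: unit_fn_def fn_in_C0 vanishing_unit)

lemma star_hom_matrixD:
  assumes "star_hom A (matrix_alg n) \<phi>"
  shows "\<And>a. a \<in> elems A \<Longrightarrow> \<phi> a \<in> carrier_mat n n"
    "\<And>a b. a \<in> elems A \<Longrightarrow> b \<in> elems A \<Longrightarrow> \<phi> (plus_of A a b) = \<phi> a + \<phi> b"
    "\<And>a b. a \<in> elems A \<Longrightarrow> b \<in> elems A \<Longrightarrow> \<phi> (times_of A a b) = \<phi> a * \<phi> b"
    "\<And>a z. a \<in> elems A \<Longrightarrow> \<phi> (scale_of A z a) = z \<cdot>\<^sub>m \<phi> a"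
    "\<And>a. a \<in> elems A \<Longrightarrow> \<phi> (star_of A a) = mat_adjoint (\<phi> a)"
  using assms by (auto simp: star_hom_def matrix_alg_def)

text \<open>Only a star homomorphism into matrices is given, with no continuity; that it is carried
  by finitely many points follows from \<open>rep_vanish\<close>.\<close>

locale group_rep =
  fixes \<Gamma> :: "('g, 'm) monoid_scheme" and n :: nat and \<pi> :: "'g blocks \<Rightarrow> complex mat"
  assumes hom: "star_hom (C0 (dqg_of_group \<Gamma>)) (matrix_alg n) \<pi>"
begin

abbreviation "\<Phi> h \<equiv> \<pi> (fn (carrier \<Gamma>) h)"
abbreviation "p g \<equiv> \<pi> (unit_fn (carrier \<Gamma>) g)"

lemma carrier_rep: "vanishing (carrier \<Gamma>) h \<Longrightarrow> \<Phi> h \<in> carrier_mat n n"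
  using star_hom_matrixD(1)[OF hom, of "fn (carrier \<Gamma>) h"] by (simp add: fn_in_C0)

lemma rep_plus: "vanishing (carrier \<Gamma>) h \<Longrightarrow> vanishing (carrier \<Gamma>) k \<Longrightarrow> \<Phi> (\<lambda>g. h g + k g) = \<Phi> h + \<Phi> k"
  using star_hom_matrixD(2)[OF hom, of "fn (carrier \<Gamma>) h" "fn (carrier \<Gamma>) k"] by (simp add: fn_in_C0 C0_plus)

lemma rep_times: "vanishing (carrier \<Gamma>) h \<Longrightarrow> vanishing (carrier \<Gamma>) k \<Longrightarrow> \<Phi> (\<lambda>g. h g * k g) = \<Phi> h * \<Phi> k"
  using star_hom_matrixD(3)[OF hom, of "fn (carrier \<Gamma>) h" "fn (carrier \<Gamma>) k"] by (simp add: fn_in_C0 C0_times)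

lemma rep_scale: "vanishing (carrier \<Gamma>) h \<Longrightarrow> \<Phi> (\<lambda>g. z * h g) = z \<cdot>\<^sub>m \<Phi> h"
  using star_hom_matrixD(4)[OF hom, of "fn (carrier \<Gamma>) h"] by (simp add: fn_in_C0 C0_scale)

lemma rep_star: "vanishing (carrier \<Gamma>) h \<Longrightarrow> \<Phi> (\<lambda>g. cnj (h g)) = mat_adjoint (\<Phi> h)"
  using star_hom_matrixD(5)[OF hom, of "fn (carrier \<Gamma>) h"] by (simp add: fn_in_C0 C0_star)

lemma rep_zero: "\<Phi> (\<lambda>_. 0) = 0\<^sub>m n n"
proof -
  have v: "vanishing (carrier \<Gamma>) (\<lambda>_. 0)" by (rule vanishing_finite) simp
  have "\<Phi> (\<lambda>g. 0 * 0) = (0 :: complex) \<cdot>\<^sub>m \<Phi> (\<lambda>_. 0)" by (rule rep_scale[OF v])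
  then show ?thesis using mat_smult_zero[OF carrier_rep[OF v]] by simp
qed

lemma p_mult:
  assumes "vanishing (carrier \<Gamma>) h" "g \<in> carrier \<Gamma>"
  shows "\<Phi> h * p g = h g \<cdot>\<^sub>m p g"
proof -
  have "\<Phi> h * p g = \<Phi> (\<lambda>x. h x * (if x = g then 1 else 0))"
    unfolding unit_fn_def by (rule rep_times[OF assms(1) vanishing_unit, symmetric])
  also have "(\<lambda>x. h x * (if x = g then 1 else 0)) = (\<lambda>x. h g * (if x = g then 1 else 0))" by auto
  also have "\<Phi> \<dots> = h g \<cdot>\<^sub>m p g" unfolding unit_fn_def by (rule rep_scale[OF vanishing_unit])
  finally show ?thesis .
qed

lemma p_projection: assumes g: "g \<in> carrier \<Gamma>" shows "is_projection n (p g)"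
  unfolding is_projection_def
proof (intro conjI)
  show "p g \<in> carrier_mat n n" unfolding unit_fn_def by (rule carrier_rep[OF vanishing_unit])
  show "p g * p g = p g" using p_mult[OF vanishing_unit g, of g] by (simp add: unit_fn_def)
  have "(\<lambda>x. cnj (if x = g then 1 else 0)) = (\<lambda>x. if x = g then 1 else 0)" by auto
  then show "mat_adjoint (p g) = p g" using rep_star[OF vanishing_unit, of g] by (simp add: unit_fn_def)
qed

lemma p_orth:
  assumes "g \<in> carrier \<Gamma>" "k \<in> carrier \<Gamma>" "g \<noteq> k" shows "p g * p k = 0\<^sub>m n n"
  using p_mult[OF vanishing_unit assms(2), of g] assms mat_smult_zero[OF is_projectionD(1)[OF p_projection[OF assms(2)]]]
  by (simp add: unit_fn_def)

definition supp where "supp = {g \<in> carrier \<Gamma>. p g \<noteq> 0\<^sub>m n n}"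

lemma finite_supp: "finite supp"
  unfolding supp_def using p_projection p_orth by (rule finite_orthogonal_projections)

lemma rep_indicator:
  assumes "finite E" shows "\<Phi> (\<lambda>g. if g \<in> E then 1 else 0) = msum n n p E"
  using assms
proof (induction E)
  case empty
  have "msum n n p {} = 0\<^sub>m n n" by (rule msum_zero) simp
  then show ?case using rep_zero by simp
next
  case (insert x E)
  have v: "vanishing (carrier \<Gamma>) (\<lambda>g. if g \<in> E then 1 else 0)"
    by (rule vanishing_finite) (use insert(1) in auto)
  have "\<Phi> (\<lambda>g. if g \<in> insert x E then 1 else 0) = \<Phi> (\<lambda>g. (if g = x then 1 else 0) + (if g \<in> E then 1 else 0))"
    using insert(2) by (intro arg_cong[of _ _ \<pi>] fn_cong) auto
  also have "\<dots> = p x + msum n n p E" using rep_plus[OF vanishing_unit v, of x] by (simp only: insert(3) unit_fn_def)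
  also have "\<dots> = msum n n p (insert x E)"
    using insert(1,2) carrier_matD[OF carrier_rep[OF vanishing_unit, of x]] by (intro eq_matI) (auto simp: unit_fn_def)
  finally show ?case .
qed

text \<open>A nonzero eigenvalue \<open>l\<close> of \<open>\<pi>(|h|\<^sup>2)\<close> is impossible: the finitely many values of \<open>|h|\<^sup>2\<close> equal to \<open>l\<close> do not
  contribute, and after removing them \<open>|h|\<^sup>2/l\<close> becomes quasi-invertible in \<open>C\<^sub>0\<close>.\<close>

lemma rep_vanish:
  assumes h: "vanishing (carrier \<Gamma>) h" and z: "\<And>g. g \<in> supp \<Longrightarrow> h g = 0"
  shows "\<Phi> h = 0\<^sub>m n n"
proof (rule ccontr)
  assume ne: "\<Phi> h \<noteq> 0\<^sub>m n n"
  \<comment> \<open>The image of |h|^2 is self-adjoint, and nonzero by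
    \<open>frobenius_zero\<close>, so it has a nonzero eigenvalue.\<close>
  define f where "f = (\<lambda>g. cnj (h g) * h g)"
  have f: "vanishing (carrier \<Gamma>) f" unfolding f_def by (rule vanishing_mult[OF vanishing_cnj[OF h] h])
  have fH: "\<Phi> f = mat_adjoint (\<Phi> h) * \<Phi> h"
    unfolding f_def rep_times[OF vanishing_cnj[OF h] h] rep_star[OF h] ..
  have "\<Phi> f \<noteq> 0\<^sub>m n n" using frobenius_zero[OF carrier_rep[OF h]] ne fH by auto
  moreover have "mat_adjoint (\<Phi> f) = \<Phi> f" unfolding fH using carrier_matD[OF carrier_rep[OF h]] by (simp add: mat_adjoint_mult)
  ultimately obtain l v where l: "l \<noteq> 0" and v: "v \<in> carrier_mat n 1" "v \<noteq> 0\<^sub>m n 1" "\<Phi> f * v = l \<cdot>\<^sub>m v"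
    using hermitian_nonzero_eigenvalue[OF carrier_rep[OF f]] by metis
  define E where "E = {g \<in> carrier \<Gamma>. f g = l}"
  have E: "finite E"
  proof -
    have "finite {g \<in> carrier \<Gamma>. cmod (f g) \<ge> cmod l}" using f l by (simp add: vanishing_def)
    then show ?thesis by (rule rev_finite_subset) (auto simp: E_def)
  qed
  define b where "b = (\<lambda>g. (1 / l) * f g + (- 1) * (if g \<in> E then 1 else 0))"
  have vE: "vanishing (carrier \<Gamma>) (\<lambda>g. if g \<in> E then 1 else 0)" by (rule vanishing_finite) (use E in auto)
  have b: "vanishing (carrier \<Gamma>) b"
    unfolding b_def by (rule vanishing_add[OF vanishing_scale[OF f] vanishing_scale[OF vE]])
  have "p g = 0\<^sub>m n n" if "g \<in> E" for g
    using that z[of g] l by (cases "p g = 0\<^sub>m n n") (auto simp: E_def f_def supp_def)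
  then have "msum n n p E = 0\<^sub>m n n" by (rule msum_zero)
  then have Eb: "\<Phi> (\<lambda>g. if g \<in> E then 1 else 0) = 0\<^sub>m n n" using rep_indicator[OF E] by simp
  have "\<Phi> b = (1 / l) \<cdot>\<^sub>m \<Phi> f + (- 1) \<cdot>\<^sub>m \<Phi> (\<lambda>g. if g \<in> E then 1 else 0)"
    unfolding b_def using rep_plus[OF vanishing_scale[OF f, of "1 / l"] vanishing_scale[OF vE, of "- 1"]]
      rep_scale[OF f, of "1 / l"] rep_scale[OF vE, of "- 1"] by simp
  also have "\<dots> = (1 / l) \<cdot>\<^sub>m \<Phi> f" unfolding Eb using carrier_matD[OF carrier_rep[OF f]] by (intro eq_matI) auto
  finally have "\<Phi> b * v = (1 / l) \<cdot>\<^sub>m (\<Phi> f * v)"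
    using carrier_matD[OF carrier_rep[OF f]] carrier_matD[OF v(1)] by (simp add: mat_smult_mult)
  then have bv: "\<Phi> b * v = v" unfolding v(3) using l by simp
  have b1: "b g \<noteq> 1" if "g \<in> carrier \<Gamma>" for g
    using that l by (auto simp: b_def E_def)
  \<comment> \<open>The quasi-inverse of b, satisfying b + c = c b. It replaces the inverse of 1 -
    b, since C_0 has no unit for an infinite group. Applied to an eigenvector of
    \<open>\<Phi> b\<close> for the eigenvalue 1, the identity forces the vector to be zero.\<close>
  define c where "c = (\<lambda>g. b g / (b g - 1))"
  have c: "vanishing (carrier \<Gamma>) c"
    unfolding vanishing_def
  proof (intro allI impI)
    fix \<epsilon> :: real assume e: "\<epsilon> > 0"
    \<comment> \<open>Where |b| is below 1/2 the denominator of c has modulus at least 1/2, so |c|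
      is at most 2|b|; hence the two bounds 1/2 and \<open>\<epsilon> / 2\<close>.\<close>
    then have "finite {g \<in> carrier \<Gamma>. cmod (b g) \<ge> min (1 / 2) (\<epsilon> / 2)}" using b by (simp add: vanishing_def)
    then show "finite {g \<in> carrier \<Gamma>. cmod (c g) \<ge> \<epsilon>}"
    proof (rule rev_finite_subset, intro subsetI CollectI conjI)
      fix g assume g: "g \<in> {g \<in> carrier \<Gamma>. cmod (c g) \<ge> \<epsilon>}"
      show "cmod (b g) \<ge> min (1 / 2) (\<epsilon> / 2)"
      proof (rule ccontr)
        assume "\<not> cmod (b g) \<ge> min (1 / 2) (\<epsilon> / 2)"
        then have lt: "cmod (b g) < 1 / 2" "cmod (b g) < \<epsilon> / 2" by auto
        have "cmod (b g - 1) \<ge> 1 / 2" using norm_triangle_ineq2[of 1 "b g"] lt by (simp add: norm_minus_commute)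
        then have "cmod (b g) / cmod (b g - 1) \<le> cmod (b g) / (1 / 2)" by (intro divide_left_mono) auto
        then have "cmod (c g) \<le> 2 * cmod (b g)" by (simp add: c_def norm_divide)
        then show False using lt g by simp
      qed
    qed auto
  qed
  have "\<Phi> b + \<Phi> c = \<Phi> (\<lambda>g. b g + c g)" by (rule rep_plus[OF b c, symmetric])
  also have "\<dots> = \<Phi> (\<lambda>g. c g * b g)"
  proof (intro arg_cong[of _ _ \<pi>] fn_cong)
    fix g assume "g \<in> carrier \<Gamma>"
    then have "b g - 1 \<noteq> 0" using b1 by simp
    then show "b g + c g = c g * b g" by (simp add: c_def field_simps)
  qed
  also have "\<dots> = \<Phi> c * \<Phi> b" by (rule rep_times[OF c b])
  finally have "\<Phi> b * v + \<Phi> c * v = \<Phi> c * (\<Phi> b * v)"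
    using carrier_matD[OF carrier_rep[OF b]] carrier_matD[OF carrier_rep[OF c]] carrier_matD[OF v(1)]
    by (simp add: mat_assoc[symmetric] mat_add_mult[symmetric])
  then have eq: "v + \<Phi> c * v = \<Phi> c * v" by (simp only: bv)
  have "v = 0\<^sub>m n 1"
  proof (rule eq_matI)
    fix i j assume ij: "i < dim_row (0\<^sub>m n 1 :: complex mat)" "j < dim_col (0\<^sub>m n 1 :: complex mat)"
    have "(v + \<Phi> c * v) $$ (i, j) = v $$ (i, j) + (\<Phi> c * v) $$ (i, j)"
      using ij carrier_matD[OF carrier_rep[OF c]] carrier_matD[OF v(1)] by (intro index_add_mat) auto
    then show "v $$ (i, j) = 0\<^sub>m n 1 $$ (i, j)" using eq ij by simp
  qed (use v in auto)
  then show False using v(2) by simp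
qed

text \<open>A function minus its restriction to the support vanishes there, so
  \<open>rep_vanish\<close> kills the difference.\<close>

lemma rep_supp:
  assumes h: "vanishing (carrier \<Gamma>) h" shows "msum n n p supp * \<Phi> h = \<Phi> h"
proof -
  let ?s = "\<lambda>g. if g \<in> supp then 1 else 0 :: complex"
  have vs: "vanishing (carrier \<Gamma>) ?s" by (rule vanishing_finite) (use finite_supp in auto)
  have vp: "vanishing (carrier \<Gamma>) (\<lambda>g. ?s g * h g)" by (rule vanishing_mult[OF vs h])
  let ?k = "\<lambda>g. h g + (- 1) * (?s g * h g)"
  have vk: "vanishing (carrier \<Gamma>) ?k" by (rule vanishing_add[OF h vanishing_scale[OF vp]])
  have "\<Phi> h = \<Phi> (\<lambda>g. ?k g + ?s g * h g)" by (intro arg_cong[of _ _ \<pi>] fn_cong) auto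
  also have "\<dots> = \<Phi> ?k + \<Phi> (\<lambda>g. ?s g * h g)" by (rule rep_plus[OF vk vp])
  also have "\<Phi> ?k = 0\<^sub>m n n" by (rule rep_vanish[OF vk]) simp
  also have "0\<^sub>m n n + \<Phi> (\<lambda>g. ?s g * h g) = \<Phi> (\<lambda>g. ?s g * h g)"
    by (rule left_add_zero_mat[OF carrier_rep[OF vp]])
  also have "\<dots> = \<Phi> ?s * \<Phi> h" by (rule rep_times[OF vs h])
  finally have "\<Phi> h = \<Phi> ?s * \<Phi> h" .
  then show ?thesis unfolding rep_indicator[OF finite_supp] by (rule sym)
qed

end

text \<open>The sum of the point projections fixes the range of every operator in the image, and by
  nondegeneracy these ranges span the space.\<close>

lemma nondegenerate_rep_resol:
  assumes nd: "nondegenerate_rep (dqg_of_group \<Gamma>) n \<pi>"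
  shows "resol n {g \<in> carrier \<Gamma>. \<pi> (unit_fn (carrier \<Gamma>) g) \<noteq> 0\<^sub>m n n} (\<lambda>g. \<pi> (unit_fn (carrier \<Gamma>) g))"
proof -
  interpret group_rep \<Gamma> n \<pi> by unfold_locales (use nd in \<open>simp add: nondegenerate_rep_def\<close>)
  define e where "e = msum n n p supp"
  have ec: "e \<in> carrier_mat n n" by (simp add: e_def)
  have ew: "e *\<^sub>v w = w" if w: "w \<in> carrier_vec n" for w
  proof -
    obtain m f v where fv: "\<And>k. k < (m :: nat) \<Longrightarrow> f k \<in> elems (C0 (dqg_of_group \<Gamma>)) \<and> v k \<in> carrier_vec n"
      and ws: "\<And>r. r < n \<Longrightarrow> w $ r = (\<Sum>k<m. (\<pi> (f k) *\<^sub>v v k) $ r)"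
      using nd w unfolding nondegenerate_rep_def by blast
    have fc: "\<pi> (f k) \<in> carrier_mat n n" and ef: "e * \<pi> (f k) = \<pi> (f k)" if "k < m" for k
    proof -
      let ?h = "\<lambda>g. f k g $$ (0, 0)"
      have f: "f k \<in> elems (C0 (dqg_of_group \<Gamma>))" using fv[OF that] by simp
      have "e * \<Phi> ?h = \<Phi> ?h" unfolding e_def by (rule rep_supp[OF C0_fn(2)[OF f]])
      moreover have "\<Phi> ?h \<in> carrier_mat n n" by (rule carrier_rep[OF C0_fn(2)[OF f]])
      ultimately show "\<pi> (f k) \<in> carrier_mat n n" "e * \<pi> (f k) = \<pi> (f k)" using C0_fn(1)[OF f] by simp_all
    qed
    show ?thesis
    proof (rule eq_vecI)
      fix r assume "r < dim_vec w"
      then have r: "r < n" using w by simp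
      have "(e *\<^sub>v w) $ r = (\<Sum>s<n. e $$ (r, s) * w $ s)"
        using r ec w by (auto simp: scalar_prod_def atLeast0LessThan)
      also have "\<dots> = (\<Sum>s<n. \<Sum>k<m. e $$ (r, s) * (\<pi> (f k) *\<^sub>v v k) $ s)"
        by (intro sum.cong) (simp_all add: ws sum_distrib_left)
      also have "\<dots> = (\<Sum>k<m. \<Sum>s<n. e $$ (r, s) * (\<pi> (f k) *\<^sub>v v k) $ s)" by (rule sum.swap)
      also have "\<dots> = (\<Sum>k<m. (\<pi> (f k) *\<^sub>v v k) $ r)"
      proof (rule sum.cong)
        fix k assume "k \<in> {..<m}"
        then have k: "k < m" by simp
        have vk: "v k \<in> carrier_vec n" using fv[OF k] by simp
        have "(\<Sum>s<n. e $$ (r, s) * (\<pi> (f k) *\<^sub>v v k) $ s) = (e *\<^sub>v (\<pi> (f k) *\<^sub>v v k)) $ r"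
          using r ec fc[OF k] by (auto simp: scalar_prod_def atLeast0LessThan)
        also have "e *\<^sub>v (\<pi> (f k) *\<^sub>v v k) = (e * \<pi> (f k)) *\<^sub>v v k"
          by (rule assoc_mult_mat_vec[OF ec fc[OF k] vk, symmetric])
        finally show "(\<Sum>s<n. e $$ (r, s) * (\<pi> (f k) *\<^sub>v v k) $ s) = (\<pi> (f k) *\<^sub>v v k) $ r"
          by (simp only: ef[OF k])
      qed simp
      finally show "(e *\<^sub>v w) $ r = w $ r" using ws[OF r] by simp
    qed (use ec w in auto)
  qed
  have "e = 1\<^sub>m n"
  proof (rule eq_matI)
    fix i j assume "i < dim_row (1\<^sub>m n :: complex mat)" "j < dim_col (1\<^sub>m n :: complex mat)"
    then have ij: "i < n" "j < n" by auto
    have "e $$ (i, j) = (e *\<^sub>v unit_vec n j) $ i" using ij ec by simp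
    also have "\<dots> = unit_vec n j $ i" by (subst ew) simp_all
    finally show "e $$ (i, j) = 1\<^sub>m n $$ (i, j)" using ij by (auto simp: unit_vec_def)
  qed (use ec in auto)
  then show ?thesis
    using finite_supp p_projection p_orth by (auto simp: resol_def e_def supp_def)
qed

lemma nondegenerate_rep_carrier:
  assumes "nondegenerate_rep G n \<pi>" "f \<in> elems (C0 G)"
  shows "\<pi> f \<in> carrier_mat n n"
  using star_hom_matrixD(1)[of "C0 G" n \<pi> f] assms by (simp add: nondegenerate_rep_def)

lemma nondegenerate_rep_projection:
  assumes nd: "nondegenerate_rep (dqg_of_group \<Gamma>) n \<pi>" and g: "g \<in> carrier \<Gamma>"
  shows "is_projection n (\<pi> (unit_fn (carrier \<Gamma>) g))"
proof -
  interpret group_rep \<Gamma> n \<pi> by unfold_locales (use nd in \<open>simp add: nondegenerate_rep_def\<close>)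
  show ?thesis by (rule p_projection[OF g])
qed

lemma nondegenerate_rep_mult:
  assumes nd: "nondegenerate_rep (dqg_of_group \<Gamma>) n \<pi>" and f: "f \<in> elems (C0 (dqg_of_group \<Gamma>))" and g: "g \<in> carrier \<Gamma>"
  shows "\<pi> f * \<pi> (unit_fn (carrier \<Gamma>) g) = f g $$ (0, 0) \<cdot>\<^sub>m \<pi> (unit_fn (carrier \<Gamma>) g)"
proof -
  interpret group_rep \<Gamma> n \<pi> by unfold_locales (use nd in \<open>simp add: nondegenerate_rep_def\<close>)
  have "\<pi> f = \<Phi> (\<lambda>g. f g $$ (0, 0))" using C0_fn(1)[OF f] by simp
  then show ?thesis using p_mult[OF C0_fn(2)[OF f] g] by simp
qed

lemma diag_add:
  assumes r: "resol n X q" shows "diag n X q c + diag n X q d = diag n X q (\<lambda>t. c t + d t)"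
proof (rule eq_diagI[OF r])
  fix t assume t: "t \<in> X"
  note [simp] = carrier_matD[OF resolD(5)[OF r t]]
  have "(diag n X q c + diag n X q d) * q t = c t \<cdot>\<^sub>m q t + d t \<cdot>\<^sub>m q t"
    by (simp add: mat_add_mult diag_mult[OF r t])
  also have "\<dots> = (c t + d t) \<cdot>\<^sub>m q t" by (rule eq_matI) (auto simp: distrib_right)
  finally show "(diag n X q c + diag n X q d) * q t = (c t + d t) \<cdot>\<^sub>m q t" .
qed auto

lemma diag_smult:
  assumes r: "resol n X q" shows "z \<cdot>\<^sub>m diag n X q c = diag n X q (\<lambda>t. z * c t)"
proof (rule eq_diagI[OF r])
  fix t assume t: "t \<in> X"
  note [simp] = carrier_matD[OF resolD(5)[OF r t]]
  show "z \<cdot>\<^sub>m diag n X q c * q t = (z * c t) \<cdot>\<^sub>m q t"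
    by (simp add: mat_smult_mult diag_mult[OF r t])
qed auto

lemma diag_cong: "(\<And>t. t \<in> X \<Longrightarrow> c t = d t) \<Longrightarrow> diag n X q c = diag n X q d"
  unfolding diag_def by (rule msum_cong) simp

text \<open>Evaluations at the labels, placed on the members of a resolution. It is applied to C_0
  of the group and to bounded functions of two variables.\<close>

lemma star_hom_diag:
  assumes r: "resol n X q" and lab: "\<And>t. t \<in> X \<Longrightarrow> lab t \<in> J" and E: "E \<subseteq> (\<Pi>\<^sub>E j\<in>J. carrier_mat 1 1)"
  shows "star_hom (block_alg J E) (matrix_alg n) (\<lambda>M. diag n X q (\<lambda>t. M (lab t) $$ (0, 0)))"
proof -
  have c: "a (lab t) \<in> carrier_mat 1 1" if "a \<in> E" "t \<in> X" for a t using that E lab[OF that(2)] by auto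
  show ?thesis
    unfolding star_hom_def block_alg_def matrix_alg_def star_alg.simps
  proof (intro conjI ballI allI)
    show "(\<lambda>M. diag n X q (\<lambda>t. M (lab t) $$ (0, 0))) \<in> E \<rightarrow> carrier_mat n n" by auto
    fix a assume a: "a \<in> E"
    have [simp]: "dim_row (a (lab t)) = 1" "dim_col (a (lab t)) = 1" if "t \<in> X" for t
      using c[OF a that] by auto
    show "diag n X q (\<lambda>t. (\<lambda>j\<in>J. z \<cdot>\<^sub>m a j) (lab t) $$ (0, 0)) = z \<cdot>\<^sub>m diag n X q (\<lambda>t. a (lab t) $$ (0, 0))" for z
      unfolding diag_smult[OF r] by (rule diag_cong) (simp add: lab)
    show "diag n X q (\<lambda>t. (\<lambda>j\<in>J. mat_adjoint (a j)) (lab t) $$ (0, 0)) = mat_adjoint (diag n X q (\<lambda>t. a (lab t) $$ (0, 0)))"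
      unfolding diag_adjoint[OF r] by (rule diag_cong) (simp add: lab)
    fix b assume b: "b \<in> E"
    have [simp]: "dim_row (b (lab t)) = 1" "dim_col (b (lab t)) = 1" if "t \<in> X" for t
      using c[OF b that] by auto
    show "diag n X q (\<lambda>t. (\<lambda>j\<in>J. a j + b j) (lab t) $$ (0, 0)) =
        diag n X q (\<lambda>t. a (lab t) $$ (0, 0)) + diag n X q (\<lambda>t. b (lab t) $$ (0, 0))"
      unfolding diag_add[OF r] by (rule diag_cong) (simp add: lab)
    show "diag n X q (\<lambda>t. (\<lambda>j\<in>J. a j * b j) (lab t) $$ (0, 0)) =
        diag n X q (\<lambda>t. a (lab t) $$ (0, 0)) * diag n X q (\<lambda>t. b (lab t) $$ (0, 0))"
      unfolding diag_times[OF r] by (rule diag_cong) (simp add: lab mult_index_sum del: index_mult_mat(1))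
  qed
qed

lemma C0_closed:
  assumes "f \<in> elems (C0 (dqg_of_group \<Gamma>))" "g \<in> elems (C0 (dqg_of_group \<Gamma>))"
  shows "plus_of (C0 (dqg_of_group \<Gamma>)) f g \<in> elems (C0 (dqg_of_group \<Gamma>))"
    "times_of (C0 (dqg_of_group \<Gamma>)) f g \<in> elems (C0 (dqg_of_group \<Gamma>))"
    "scale_of (C0 (dqg_of_group \<Gamma>)) z f \<in> elems (C0 (dqg_of_group \<Gamma>))"
    "star_of (C0 (dqg_of_group \<Gamma>)) f \<in> elems (C0 (dqg_of_group \<Gamma>))"
proof -
  note f = C0_fn[OF assms(1)] and g = C0_fn[OF assms(2)]
  obtain h where h: "f = fn (carrier \<Gamma>) h" "vanishing (carrier \<Gamma>) h" using f by blast
  obtain k where k: "g = fn (carrier \<Gamma>) k" "vanishing (carrier \<Gamma>) k" using g by blast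
  show "plus_of (C0 (dqg_of_group \<Gamma>)) f g \<in> elems (C0 (dqg_of_group \<Gamma>))"
    "times_of (C0 (dqg_of_group \<Gamma>)) f g \<in> elems (C0 (dqg_of_group \<Gamma>))"
    "scale_of (C0 (dqg_of_group \<Gamma>)) z f \<in> elems (C0 (dqg_of_group \<Gamma>))"
    "star_of (C0 (dqg_of_group \<Gamma>)) f \<in> elems (C0 (dqg_of_group \<Gamma>))"
    using h(2) k(2) unfolding h(1) k(1) C0_plus C0_times C0_scale C0_star fn_in_C0
    by (auto intro: vanishing_add vanishing_mult vanishing_scale vanishing_cnj)
qed

text \<open>The hypotheses make \<open>\<pi>\<close> the sum of evaluations at the labels. The
  indicator of the finite set of labels lies in C_0 and acts as 1, so one summand suffices for
  nondegeneracy.\<close>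

lemma nondegenerate_repI:
  assumes r: "resol n X q" and lab: "\<And>t. t \<in> X \<Longrightarrow> lab t \<in> carrier \<Gamma>"
    and c: "\<And>f. f \<in> elems (C0 (dqg_of_group \<Gamma>)) \<Longrightarrow> \<pi> f \<in> carrier_mat n n"
    and t: "\<And>f t. f \<in> elems (C0 (dqg_of_group \<Gamma>)) \<Longrightarrow> t \<in> X \<Longrightarrow> \<pi> f * q t = f (lab t) $$ (0, 0) \<cdot>\<^sub>m q t"
  shows "nondegenerate_rep (dqg_of_group \<Gamma>) n \<pi>"
  unfolding nondegenerate_rep_def
proof (intro conjI ballI)
  let ?A = "C0 (dqg_of_group \<Gamma>)" and ?D = "\<lambda>f. diag n X q (\<lambda>t. f (lab t) $$ (0, 0))"
  have eq: "\<pi> f = ?D f" if "f \<in> elems ?A" for f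
    by (rule eq_diagI[OF r c[OF that] t[OF that]])
  have "star_hom ?A (matrix_alg n) ?D"
    unfolding C0_group_eq c0_sum_def by (rule star_hom_diag[OF r lab]) auto
  note D = star_hom_matrixD[OF this]
  show "star_hom ?A (matrix_alg n) \<pi>"
    unfolding star_hom_def
    using c by (auto simp: matrix_alg_def eq C0_closed D(2-5))
  fix w :: "complex vec" assume w: "w \<in> carrier_vec n"
  let ?f = "fn (carrier \<Gamma>) (\<lambda>g. if g \<in> lab ` X then 1 else 0)"
  have f: "?f \<in> elems ?A"
    unfolding fn_in_C0 by (rule vanishing_finite) (use resolD(1)[OF r] in auto)
  have "\<pi> ?f = 1\<^sub>m n"
  proof (rule resol_eqI[OF r c[OF f]])
    fix t assume "t \<in> X"
    then show "\<pi> ?f * q t = 1\<^sub>m n * q t"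
      using t[OF f] lab left_mult_one_mat[OF resolD(5)[OF r]] by simp
  qed simp
  then show "\<exists>(m::nat) f v. (\<forall>k<m. f k \<in> elems ?A \<and> v k \<in> carrier_vec n) \<and>
      (\<forall>r<n. w $ r = (\<Sum>k<m. (\<pi> (f k) *\<^sub>v v k) $ r))"
    using f w by (intro exI[of _ 1] exI[of _ "\<lambda>_. ?f"] exI[of _ "\<lambda>_. w"]) auto
qed

lemma M2_group_eq:
  "M2 (dqg_of_group \<Gamma>) = linf_prod (carrier \<Gamma> \<times> carrier \<Gamma>) (\<lambda>_. 1)"
proof -
  have "(\<lambda>(i, j). bdim (dqg_of_group \<Gamma>) i * bdim (dqg_of_group \<Gamma>) j) = (\<lambda>_. 1)"
    by (auto simp: dqg_of_group_def)
  moreover have "irr (dqg_of_group \<Gamma>) = carrier \<Gamma>" by (simp add: dqg_of_group_def)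
  ultimately show ?thesis by (simp add: M2_def)
qed

lemma fn_in_M2:
  assumes "\<And>t. t \<in> carrier \<Gamma> \<times> carrier \<Gamma> \<Longrightarrow> cmod (h t) \<le> C"
  shows "fn (carrier \<Gamma> \<times> carrier \<Gamma>) h \<in> elems (M2 (dqg_of_group \<Gamma>))"
proof -
  have "\<forall>t\<in>carrier \<Gamma> \<times> carrier \<Gamma>. op_norm (fn (carrier \<Gamma> \<times> carrier \<Gamma>) h t) \<le> C"
  proof
    fix t assume t: "t \<in> carrier \<Gamma> \<times> carrier \<Gamma>"
    then show "op_norm (fn (carrier \<Gamma> \<times> carrier \<Gamma>) h t) \<le> C"
      unfolding fn_apply[OF t] using assms[OF t] by (subst op_norm_1) auto
  qed
  moreover have "fn (carrier \<Gamma> \<times> carrier \<Gamma>) h \<in> (\<Pi>\<^sub>E g\<in>carrier \<Gamma> \<times> carrier \<Gamma>. carrier_mat 1 1)"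
    by (auto simp: fn_def)
  ultimately show ?thesis unfolding M2_group_eq linf_prod_def block_alg_def by auto
qed

text \<open>\<open>E\<close> is the delta function at (g, k), so multiplying by it evaluates
  \<open>M\<close> there; this determines a homomorphism on bounded functions from its values on
  elementary tensors.\<close>

lemma M2_times_scale:
  fixes \<Gamma> :: "('g, 'm) monoid_scheme"
  assumes M: "M \<in> elems (M2 (dqg_of_group \<Gamma>))" and gk: "g \<in> carrier \<Gamma>" "k \<in> carrier \<Gamma>"
  defines "E \<equiv> elem_tensor (dqg_of_group \<Gamma>) (unit_fn (carrier \<Gamma>) g) (unit_fn (carrier \<Gamma>) k)"
  shows "E \<in> elems (M2 (dqg_of_group \<Gamma>))"
    "times_of (M2 (dqg_of_group \<Gamma>)) M E = scale_of (M2 (dqg_of_group \<Gamma>)) (M (g, k) $$ (0, 0)) E"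
proof -
  let ?J = "carrier \<Gamma> \<times> carrier \<Gamma>"
  have E: "E = fn ?J (\<lambda>t. if t = (g, k) then 1 else 0)"
  proof (rule ext)
    fix t :: "'g \<times> 'g"
    obtain x y where t: "t = (x, y)" by (cases t)
    show "E t = fn ?J (\<lambda>t. if t = (g, k) then 1 else 0) t"
    proof (cases "t \<in> ?J")
      case True
      then show ?thesis
        by (auto simp: t E_def elem_tensor_def dqg_of_group_def unit_fn_def kron_def fn_def intro!: eq_matI)
    qed (auto simp: t E_def elem_tensor_def dqg_of_group_def fn_def)
  qed
  show "E \<in> elems (M2 (dqg_of_group \<Gamma>))"
    unfolding E by (rule fn_in_M2[of _ _ 1]) auto
  have Mc: "M t \<in> carrier_mat 1 1" if "t \<in> ?J" for t
    using M that by (auto simp: M2_group_eq linf_prod_def block_alg_def)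
  show "times_of (M2 (dqg_of_group \<Gamma>)) M E = scale_of (M2 (dqg_of_group \<Gamma>)) (M (g, k) $$ (0, 0)) E"
    unfolding M2_group_eq linf_prod_def block_alg_def star_alg.simps
  proof (rule restrict_ext)
    fix t assume t: "t \<in> ?J"
    show "M t * E t = M (g, k) $$ (0, 0) \<cdot>\<^sub>m E t"
      unfolding E fn_apply[OF t] using Mc[OF t] by (intro eq_matI) (auto simp: scalar_prod_def)
  qed
qed

text \<open>\<open>rep_tensor\<close> is defined by choice, so an extension has to be exhibited:
  evaluations at the pairs of support points, placed on the Kronecker products of the point
  projections.\<close>

lemma rep_tensor_spec:
  assumes \<pi>: "nondegenerate_rep (dqg_of_group \<Gamma>) m \<pi>" and \<rho>: "nondegenerate_rep (dqg_of_group \<Gamma>) n \<rho>"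
  shows "star_hom (M2 (dqg_of_group \<Gamma>)) (matrix_alg (m * n)) (rep_tensor (dqg_of_group \<Gamma>) m n \<pi> \<rho>)"
    "\<And>a b. a \<in> elems (C0 (dqg_of_group \<Gamma>)) \<Longrightarrow> b \<in> elems (C0 (dqg_of_group \<Gamma>)) \<Longrightarrow>
      rep_tensor (dqg_of_group \<Gamma>) m n \<pi> \<rho> (elem_tensor (dqg_of_group \<Gamma>) a b) = kron (\<pi> a) (\<rho> b)"
proof -
  let ?G = "dqg_of_group \<Gamma>"
  let ?p = "\<lambda>g. \<pi> (unit_fn (carrier \<Gamma>) g)" and ?q = "\<lambda>g. \<rho> (unit_fn (carrier \<Gamma>) g)"
  define X where "X = {g \<in> carrier \<Gamma>. ?p g \<noteq> 0\<^sub>m m m} \<times> {g \<in> carrier \<Gamma>. ?q g \<noteq> 0\<^sub>m n n}"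
  define Q where "Q = (\<lambda>(g, k). kron (?p g) (?q k))"
  have r: "resol (m * n) X Q"
    unfolding X_def Q_def by (rule resol_kron_Sigma[OF nondegenerate_rep_resol[OF \<pi>] nondegenerate_rep_resol[OF \<rho>]])
  let ?\<theta> = "\<lambda>M. diag (m * n) X Q (\<lambda>t. M (id t) $$ (0, 0))"
  have 1: "star_hom (M2 ?G) (matrix_alg (m * n)) ?\<theta>"
    unfolding M2_group_eq linf_prod_def by (rule star_hom_diag[OF r]) (auto simp: X_def)
  have 2: "?\<theta> (elem_tensor ?G a b) = kron (\<pi> a) (\<rho> b)" if ab: "a \<in> elems (C0 ?G)" "b \<in> elems (C0 ?G)" for a b
  proof (rule eq_diagI[OF r, symmetric])
    note c = nondegenerate_rep_carrier[OF \<pi> ab(1)] nondegenerate_rep_carrier[OF \<rho> ab(2)]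
    have irrG: "irr ?G = carrier \<Gamma>" by (simp add: dqg_of_group_def)
    fix t assume "t \<in> X"
    then obtain g k where t: "t = (g, k)" and gk: "g \<in> carrier \<Gamma>" "k \<in> carrier \<Gamma>" by (auto simp: X_def)
    have ac: "a g \<in> carrier_mat 1 1" "b k \<in> carrier_mat 1 1"
      using ab gk by (auto simp: C0_group_eq c0_sum_def block_alg_def)
    note [simp] = carrier_matD[OF c(1)] carrier_matD[OF c(2)] carrier_matD[OF ac(1)] carrier_matD[OF ac(2)]
      carrier_matD[OF is_projectionD(1)[OF nondegenerate_rep_projection[OF \<pi> gk(1)]]]
      carrier_matD[OF is_projectionD(1)[OF nondegenerate_rep_projection[OF \<rho> gk(2)]]]
    have e: "elem_tensor ?G a b t $$ (0, 0) = a g $$ (0, 0) * b k $$ (0, 0)"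
      using gk by (simp add: t elem_tensor_def irrG kron_def)
    have "kron (\<pi> a) (\<rho> b) * Q t = kron (\<pi> a * ?p g) (\<rho> b * ?q k)"
      unfolding t Q_def prod.case by (rule kron_mult) simp_all
    also have "\<dots> = elem_tensor ?G a b t $$ (0, 0) \<cdot>\<^sub>m Q t"
      unfolding e nondegenerate_rep_mult[OF \<pi> ab(1) gk(1)] nondegenerate_rep_mult[OF \<rho> ab(2) gk(2)]
      by (simp add: t Q_def kron_smult_left kron_smult_right mult.commute)
    finally show "kron (\<pi> a) (\<rho> b) * Q t = elem_tensor ?G a b (id t) $$ (0, 0) \<cdot>\<^sub>m Q t" by simp
  qed (use nondegenerate_rep_carrier[OF \<pi> ab(1)] nondegenerate_rep_carrier[OF \<rho> ab(2)] in auto)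
  have "\<exists>\<theta>. star_hom (M2 ?G) (matrix_alg (m * n)) \<theta> \<and>
      (\<forall>a\<in>elems (C0 ?G). \<forall>b\<in>elems (C0 ?G). \<theta> (elem_tensor ?G a b) = kron (\<pi> a) (\<rho> b))"
    using 1 2 by (intro exI[of _ ?\<theta>]) blast
  from someI_ex[OF this] show "star_hom (M2 ?G) (matrix_alg (m * n)) (rep_tensor ?G m n \<pi> \<rho>)"
    "\<And>a b. a \<in> elems (C0 ?G) \<Longrightarrow> b \<in> elems (C0 ?G) \<Longrightarrow>
      rep_tensor ?G m n \<pi> \<rho> (elem_tensor ?G a b) = kron (\<pi> a) (\<rho> b)"
    unfolding rep_tensor_def by blast+
qed

text \<open>The chosen homomorphism is applied to the equation of \<open>M2_times_scale\<close>;
  whichever extension was chosen, its values on the test projections are the same.\<close>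

lemma rep_tensor_mult:
  assumes \<pi>: "nondegenerate_rep (dqg_of_group \<Gamma>) m \<pi>" and \<rho>: "nondegenerate_rep (dqg_of_group \<Gamma>) n \<rho>"
    and M: "M \<in> elems (M2 (dqg_of_group \<Gamma>))" and gk: "g \<in> carrier \<Gamma>" "k \<in> carrier \<Gamma>"
  shows "rep_tensor (dqg_of_group \<Gamma>) m n \<pi> \<rho> M \<in> carrier_mat (m * n) (m * n)"
    "rep_tensor (dqg_of_group \<Gamma>) m n \<pi> \<rho> M * kron (\<pi> (unit_fn (carrier \<Gamma>) g)) (\<rho> (unit_fn (carrier \<Gamma>) k)) =
      M (g, k) $$ (0, 0) \<cdot>\<^sub>m kron (\<pi> (unit_fn (carrier \<Gamma>) g)) (\<rho> (unit_fn (carrier \<Gamma>) k))"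
proof -
  note h = star_hom_matrixD[OF rep_tensor_spec(1)[OF \<pi> \<rho>]]
  note e = rep_tensor_spec(2)[OF \<pi> \<rho> unit_fn_C0 unit_fn_C0, of g k]
  note ts = M2_times_scale[OF M gk]
  show "rep_tensor (dqg_of_group \<Gamma>) m n \<pi> \<rho> M \<in> carrier_mat (m * n) (m * n)" by (rule h(1)[OF M])
  show "rep_tensor (dqg_of_group \<Gamma>) m n \<pi> \<rho> M * kron (\<pi> (unit_fn (carrier \<Gamma>) g)) (\<rho> (unit_fn (carrier \<Gamma>) k)) =
      M (g, k) $$ (0, 0) \<cdot>\<^sub>m kron (\<pi> (unit_fn (carrier \<Gamma>) g)) (\<rho> (unit_fn (carrier \<Gamma>) k))"
    using h(3)[OF M ts(1)] h(4)[OF ts(1)] unfolding ts(2) e by metis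
qed

lemma comult_group_M2:
  fixes \<Gamma> :: "('g, 'm) monoid_scheme"
  assumes closed: "\<And>g k. g \<in> carrier \<Gamma> \<Longrightarrow> k \<in> carrier \<Gamma> \<Longrightarrow> g \<otimes>\<^bsub>\<Gamma>\<^esub> k \<in> carrier \<Gamma>"
    and f: "f \<in> elems (C0 (dqg_of_group \<Gamma>))"
  shows "comult (dqg_of_group \<Gamma>) f \<in> elems (M2 (dqg_of_group \<Gamma>))"
    "g \<in> carrier \<Gamma> \<Longrightarrow> k \<in> carrier \<Gamma> \<Longrightarrow> comult (dqg_of_group \<Gamma>) f (g, k) = f (g \<otimes>\<^bsub>\<Gamma>\<^esub> k)"
proof -
  let ?h = "\<lambda>g. f g $$ (0, 0)"
  obtain C where C: "\<And>g. g \<in> carrier \<Gamma> \<Longrightarrow> cmod (?h g) \<le> C"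
    using vanishing_bounded[OF C0_fn(2)[OF f]] by metis
  have "comult (dqg_of_group \<Gamma>) f = fn (carrier \<Gamma> \<times> carrier \<Gamma>) (\<lambda>(g, k). ?h (g \<otimes>\<^bsub>\<Gamma>\<^esub> k))"
  proof (rule ext)
    fix t :: "'g \<times> 'g"
    obtain g k where t: "t = (g, k)" by (cases t)
    have "f (g \<otimes>\<^bsub>\<Gamma>\<^esub> k) = mat 1 1 (\<lambda>_. ?h (g \<otimes>\<^bsub>\<Gamma>\<^esub> k))" if "g \<in> carrier \<Gamma>" "k \<in> carrier \<Gamma>"
      using fun_cong[OF C0_fn(1)[OF f], of "g \<otimes>\<^bsub>\<Gamma>\<^esub> k"] closed[OF that] by simp
    then show "comult (dqg_of_group \<Gamma>) f t = fn (carrier \<Gamma> \<times> carrier \<Gamma>) (\<lambda>(g, k). ?h (g \<otimes>\<^bsub>\<Gamma>\<^esub> k)) t"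
      by (auto simp: t dqg_of_group_def fn_def)
  qed
  then show "comult (dqg_of_group \<Gamma>) f \<in> elems (M2 (dqg_of_group \<Gamma>))"
    using C closed by (simp only:) (rule fn_in_M2[of _ _ C], auto)
  show "g \<in> carrier \<Gamma> \<Longrightarrow> k \<in> carrier \<Gamma> \<Longrightarrow> comult (dqg_of_group \<Gamma>) f (g, k) = f (g \<otimes>\<^bsub>\<Gamma>\<^esub> k)"
    by (simp add: dqg_of_group_def)
qed

section \<open>The automorphism group of the line, and cosets of the integers\<close>

abbreviation "AutL \<equiv> carrier (Aut L)"

lemma AutL_iff: "g \<in> AutL \<longleftrightarrow> bij g \<and> (\<forall>x y. \<bar>g x - g y\<bar> = 1 \<longleftrightarrow> \<bar>x - y\<bar> = 1)"
  by (auto simp: Aut_def L_def Bij_def)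

text \<open>Consecutive increments are 1 or -1, and injectivity forbids turning back, so all
  increments equal the first one.\<close>

lemma AutL_affine:
  assumes "g \<in> AutL" obtains e where "e = 1 \<or> e = - 1" "\<And>l. g l = g 0 + e * l"
proof -
  have inj: "g x = g y \<Longrightarrow> x = y" for x y using assms by (auto simp: AutL_iff bij_def inj_def)
  have s: "\<bar>g (l + 1) - g l\<bar> = 1" for l using assms by (simp add: AutL_iff)
  have step: "g (l + 1 + 1) - g (l + 1) = g (l + 1) - g l" for l
    using s[of l] s[of "l + 1"] inj[of "l + 1 + 1" l] by (auto simp: abs_if split: if_splits)
  define e where "e = g 1 - g 0"
  have d: "g (l + 1) - g l = e" for l
  proof (induction l rule: int_induct[where k = 0])
    case (step1 i)
    then show ?case using step[of i] by simp
  next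
    case (step2 i)
    then show ?case using step[of "i - 1"] by simp
  qed (simp add: e_def)
  have "g l = g 0 + e * l" for l
  proof (induction l rule: int_induct[where k = 0])
    case (step1 i)
    then show ?case using d[of i] by (simp add: algebra_simps)
  next
    case (step2 i)
    then show ?case using d[of "i - 1"] by (simp add: algebra_simps)
  qed simp
  moreover have "e = 1 \<or> e = - 1" using s[of 0] by (auto simp: e_def abs_if split: if_splits)
  ultimately show ?thesis using that by blast
qed

lemma affine_AutL:
  assumes "e = 1 \<or> e = - 1" shows "(\<lambda>l. c + e * l) \<in> AutL"
proof -
  have "bij (\<lambda>l. c + e * l)"
    by (rule bij_betw_byWitness[where f' = "\<lambda>k. e * (k - c)"]) (use assms in auto)
  moreover have "\<bar>(c + e * x) - (c + e * y)\<bar> = \<bar>x - y\<bar>" for x y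
    using assms by (auto simp: abs_if)
  ultimately show ?thesis by (simp add: AutL_iff)
qed

lemma AutL_eqI:
  assumes "g \<in> AutL" "h \<in> AutL" "g 0 = h 0" "g 1 = h 1" shows "g = h"
proof -
  obtain e where e: "\<And>l. g l = g 0 + e * l" using AutL_affine[OF assms(1)] by metis
  obtain d where d: "\<And>l. h l = h 0 + d * l" using AutL_affine[OF assms(2)] by metis
  have "e = d" using e[of 1] d[of 1] assms(3,4) by simp
  show ?thesis
  proof
    fix l show "g l = h l" using e[of l] d[of l] \<open>e = d\<close> assms(3) by simp
  qed
qed

text \<open>A translation and a reflection are the only candidates. Finiteness puts the indicator
  \<open>chi\<close> into C_0.\<close>

lemma AutL_fiber_finite: "finite {g \<in> AutL. g l = k}"
proof (rule finite_subset)
  show "{g \<in> AutL. g l = k} \<subseteq> {\<lambda>x. (k - l) + 1 * x, \<lambda>x. (k + l) + (- 1) * x}"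
  proof
    fix g assume g: "g \<in> {g \<in> AutL. g l = k}"
    then obtain e where e: "e = 1 \<or> e = - 1" "\<And>l. g l = g 0 + e * l" using AutL_affine[of g] by auto
    have "g 0 = k - e * l" using e(2)[of l] g by simp
    then have "g x = k - e * l + e * x" for x using e(2)[of x] by simp
    then show "g \<in> {\<lambda>x. (k - l) + 1 * x, \<lambda>x. (k + l) + (- 1) * x}" using e(1) by (auto simp: fun_eq_iff)
  qed
qed simp

lemma AutL_inv: "g \<in> AutL \<Longrightarrow> g l = k \<longleftrightarrow> l = inv_into UNIV g k"
  by (auto simp: AutL_iff bij_inv_eq_iff)

lemma AutL_mult:
  assumes "g \<in> AutL" "h \<in> AutL"
  shows "(g \<otimes>\<^bsub>Aut L\<^esub> h) l = g (h l)" "g \<otimes>\<^bsub>Aut L\<^esub> h \<in> AutL"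
proof -
  have "g \<otimes>\<^bsub>Aut L\<^esub> h = (\<lambda>l. g (h l))"
    using assms by (auto simp: Aut_def L_def BijGroup_def compose_def)
  moreover have "bij (\<lambda>l. g (h l))"
    using assms bij_comp[of h g] by (auto simp: AutL_iff o_def)
  ultimately show "(g \<otimes>\<^bsub>Aut L\<^esub> h) l = g (h l)" "g \<otimes>\<^bsub>Aut L\<^esub> h \<in> AutL"
    using assms by (auto simp: AutL_iff)
qed

lemma AutL_one: "\<one>\<^bsub>Aut L\<^esub> = (\<lambda>l. l)" "\<one>\<^bsub>Aut L\<^esub> \<in> AutL"
proof -
  show 1: "\<one>\<^bsub>Aut L\<^esub> = (\<lambda>l. l)" by (auto simp: Aut_def L_def BijGroup_def)
  show "\<one>\<^bsub>Aut L\<^esub> \<in> AutL" unfolding 1 using bij_id by (simp add: AutL_iff id_def)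
qed

abbreviation "GL \<equiv> dqg_of_group (Aut L)"

text \<open>The matrix coefficient (k, l) of the permutation action of Aut(L) on the
  integers.\<close>

definition chi :: "int \<Rightarrow> int \<Rightarrow> (int \<Rightarrow> int) blocks" where
  "chi k l = fn AutL (\<lambda>g. if g l = k then 1 else 0)"

lemma chi_C0: "chi k l \<in> elems (C0 GL)"
  unfolding chi_def fn_in_C0
  by (rule vanishing_finite) (use AutL_fiber_finite[of l k] in \<open>auto elim!: rev_finite_subset\<close>)

lemma chi_apply: "g \<in> AutL \<Longrightarrow> chi k l g $$ (0, 0) = (if g l = k then 1 else 0)"
  by (simp add: chi_def)

text \<open>Two adjacent values determine a symmetry of the line, so two matrix coefficients suffice
  to isolate one group element.\<close>

lemma chi_times_unit:
  assumes "g \<in> AutL"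
  shows "times_of (C0 GL) (chi (g 0) 0) (chi (g 1) 1) = unit_fn AutL g"
  unfolding chi_def C0_times unit_fn_def by (rule fn_cong) (use assms AutL_eqI in auto)

section \<open>Coordinates on the reals: a coset of the integers and an integer offset\<close>

definition cls :: "real \<Rightarrow> real set" where
  "cls x = {y. x - y \<in> \<int>}"

text \<open>An arbitrary base point in each coset identifies the coset with the line
  \<open>L\<close>.\<close>

definition base :: "real set \<Rightarrow> real" where
  "base i = (SOME x. x \<in> i)"

definition off :: "real \<Rightarrow> int" where
  "off x = \<lfloor>x - base (cls x)\<rfloor>"

definition pt :: "real set \<Rightarrow> int \<Rightarrow> real" where
  "pt i k = base i + of_int k"

lemma cls_in [simp]: "cls x \<in> R_mod_Z"
  unfolding R_mod_Z_def quotient_def cls_def by auto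

lemma cls_eq_iff: "cls x = cls y \<longleftrightarrow> x - y \<in> \<int>"
proof
  assume "cls x = cls y"
  moreover have "y \<in> cls y" by (simp add: cls_def)
  ultimately show "x - y \<in> \<int>" by (auto simp: cls_def)
next
  assume xy: "x - y \<in> \<int>"
  have "x - z \<in> \<int> \<longleftrightarrow> y - z \<in> \<int>" for z
    using Ints_diff[OF _ xy, of "x - z"] Ints_add[OF xy, of "y - z"] by auto
  then show "cls x = cls y" by (auto simp: cls_def)
qed

lemma cls_base:
  assumes "i \<in> R_mod_Z" shows "cls (base i) = i"
proof -
  obtain x where i: "i = cls x" using assms by (auto simp: R_mod_Z_def quotient_def cls_def)
  have "x \<in> i" by (simp add: i cls_def)
  then have "base i \<in> i" unfolding base_def by (rule someI)
  then have "x - base i \<in> \<int>" by (simp add: i cls_def)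
  then show ?thesis using cls_eq_iff i by metis
qed

lemma cls_pt [simp]: "i \<in> R_mod_Z \<Longrightarrow> cls (pt i k) = i"
  using cls_eq_iff[of "pt i k" "base i"] cls_base[of i] by (simp add: pt_def)

lemma off_pt [simp]: "i \<in> R_mod_Z \<Longrightarrow> off (pt i k) = k"
  by (simp add: off_def) (simp add: pt_def)

lemma pt_off [simp]: "pt (cls x) (off x) = x"
proof -
  have "x - base (cls x) \<in> \<int>" using cls_base[of "cls x"] cls_eq_iff[of x "base (cls x)"] by simp
  then obtain k where "x - base (cls x) = of_int k" by (auto elim: Ints_cases)
  then show ?thesis by (simp add: off_def pt_def)
qed

lemma eq_pt_iff: "i \<in> R_mod_Z \<Longrightarrow> x = pt i k \<longleftrightarrow> cls x = i \<and> off x = k"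
  using pt_off[of x] by auto

lemma pt_add: "pt i k + of_int m = pt i (k + m)"
  by (simp add: pt_def)

lemma U1_simps [simp]: "verts U1 = UNIV" "adj U1 x y \<longleftrightarrow> \<bar>x - y\<bar> = 1"
  by (simp_all add: U1_def)

text \<open>The unit distance graph is a disjoint union of copies of the line, one for each
  coset.\<close>

lemma adj_iff: "\<bar>x - y\<bar> = 1 \<longleftrightarrow> cls x = cls y \<and> \<bar>off x - off y\<bar> = 1"
proof -
  have d: "x - y = of_int (off x - off y)" if "cls x = cls y"
    using pt_off[of x] pt_off[of y] that by (simp add: pt_def)
  have "cls x = cls y" if "\<bar>x - y\<bar> = 1"
  proof -
    have "x - y = 1 \<or> x - y = - 1" using that by (auto simp: abs_if split: if_splits)
    then show ?thesis unfolding cls_eq_iff by auto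
  qed
  then show ?thesis using d by (auto simp: abs_if split: if_splits) 
qed

lemma rel_of_aut:
  assumes c: "cls x1 = cls x2" "cls y1 = cls y2" and g: "g \<in> AutL" "g (off y1) = off x1" "g (off y2) = off x2"
  shows "rel_of U1 x1 x2 = rel_of U1 y1 y2"
proof -
  have "x1 = x2 \<longleftrightarrow> off x1 = off x2" using c(1) pt_off[of x1] pt_off[of x2] by metis
  moreover have "y1 = y2 \<longleftrightarrow> off y1 = off y2" using c(2) pt_off[of y1] pt_off[of y2] by metis
  moreover have "off x1 = off x2 \<longleftrightarrow> off y1 = off y2" using g by (auto simp: AutL_iff bij_def inj_def)
  moreover have "\<bar>off x1 - off x2\<bar> = 1 \<longleftrightarrow> \<bar>off y1 - off y2\<bar> = 1"
    using g(1) unfolding AutL_iff g(2,3)[symmetric] by blast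
  ultimately show ?thesis using c by (simp add: rel_of_def adj_iff)
qed

text \<open>Points of different cosets are distinct and non-adjacent, so pairs of cosets impose no
  relation of their own.\<close>

lemma rel_of_cls:
  assumes "cls x1 \<noteq> cls x2" "cls y1 \<noteq> cls y2"
  shows "rel_of U1 x1 x2 = rel_of U1 y1 y2"
  using assms by (auto simp: rel_of_def adj_iff)

section \<open>From wreath corepresentations to quantum automorphisms\<close>

abbreviation "II \<equiv> R_mod_Z"

definition grp_proj :: "(real set, int \<Rightarrow> int) wcorep \<Rightarrow> real set \<Rightarrow> (int \<Rightarrow> int) \<Rightarrow> complex mat" where
  "grp_proj \<pi> i g = wrep \<pi> i (unit_fn AutL g)"

text \<open>The event that coset i is matched with coset m through the symmetry g. For fixed i these
  are the joint spectral projections of everything that belongs to row i.\<close>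

definition block_proj :: "(real set, int \<Rightarrow> int) wcorep \<Rightarrow> real set \<Rightarrow> real set \<Rightarrow> (int \<Rightarrow> int) \<Rightarrow> complex mat" where
  "block_proj \<pi> i m g = qent \<pi> i m * grp_proj \<pi> i g"

locale wreath =
  fixes \<pi> :: "(real set, int \<Rightarrow> int) wcorep"
  assumes corep: "wreath_corep GL II \<pi>"
begin

abbreviation "n \<equiv> qdim \<pi>"

lemma qp: "quantum_permutation II \<pi>"
  and nd: "i \<in> II \<Longrightarrow> nondegenerate_rep GL n (wrep \<pi> i)"
  and comm: "f \<in> elems (C0 GL) \<Longrightarrow> i \<in> II \<Longrightarrow> j \<in> II \<Longrightarrow> wrep \<pi> i f * qent \<pi> i j = qent \<pi> i j * wrep \<pi> i f"
  using corep by (auto simp: wreath_corep_def)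

lemma ent_carrier: "i \<in> II \<Longrightarrow> j \<in> II \<Longrightarrow> qent \<pi> i j \<in> carrier_mat n n"
  by (rule qpD(4)[OF qp])

lemmas ent_dim = carrier_matD[OF ent_carrier]

lemma rep_carrier: "i \<in> II \<Longrightarrow> f \<in> elems (C0 GL) \<Longrightarrow> wrep \<pi> i f \<in> carrier_mat n n"
  by (rule nondegenerate_rep_carrier[OF nd])

lemmas rep_dim = carrier_matD[OF rep_carrier]

lemma grp_proj: "i \<in> II \<Longrightarrow> g \<in> AutL \<Longrightarrow> is_projection n (grp_proj \<pi> i g)"
  unfolding grp_proj_def by (rule nondegenerate_rep_projection[OF nd])

lemma grp_carrier: "i \<in> II \<Longrightarrow> grp_proj \<pi> i g \<in> carrier_mat n n"
  unfolding grp_proj_def by (rule rep_carrier[OF _ unit_fn_C0])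

lemmas grp_dim = carrier_matD[OF grp_carrier]

lemma rep_grp:
  "i \<in> II \<Longrightarrow> f \<in> elems (C0 GL) \<Longrightarrow> g \<in> AutL \<Longrightarrow> wrep \<pi> i f * grp_proj \<pi> i g = f g $$ (0, 0) \<cdot>\<^sub>m grp_proj \<pi> i g"
  unfolding grp_proj_def by (rule nondegenerate_rep_mult[OF nd])

lemma ent_grp_comm: "i \<in> II \<Longrightarrow> m \<in> II \<Longrightarrow> qent \<pi> i m * grp_proj \<pi> i g = grp_proj \<pi> i g * qent \<pi> i m"
  unfolding grp_proj_def using comm[OF unit_fn_C0] by simp

definition gsupp where "gsupp i = {g \<in> AutL. grp_proj \<pi> i g \<noteq> 0\<^sub>m n n}"

lemma grp_resol: "i \<in> II \<Longrightarrow> resol n (gsupp i) (grp_proj \<pi> i)"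
  using nondegenerate_rep_resol[OF nd] unfolding gsupp_def grp_proj_def by blast

definition rsupp where "rsupp i = {m \<in> II. qent \<pi> i m \<noteq> 0\<^sub>m n n}"

definition csupp where "csupp j = {i \<in> II. qent \<pi> i j \<noteq> 0\<^sub>m n n}"

lemma gsupp_in: "g \<in> gsupp i \<Longrightarrow> g \<in> AutL" by (simp add: gsupp_def)
lemma rsupp_in: "m \<in> rsupp i \<Longrightarrow> m \<in> II" by (simp add: rsupp_def)
lemma csupp_in: "m \<in> csupp i \<Longrightarrow> m \<in> II" by (simp add: csupp_def)

lemma row_resol:
  assumes "i \<in> II"
  shows "resol n (SIGMA m : rsupp i. gsupp i) (\<lambda>(m, g). block_proj \<pi> i m g)"
  unfolding block_proj_def
proof (rule resol_Sigma)
  show "resol n (rsupp i) (qent \<pi> i)" unfolding rsupp_def by (rule qp_row_resol[OF qp assms])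
  show "resol n (gsupp i) (grp_proj \<pi> i)" by (rule grp_resol[OF assms])
  show "qent \<pi> i m * grp_proj \<pi> i g = grp_proj \<pi> i g * qent \<pi> i m" if "m \<in> rsupp i" for m g
    by (rule ent_grp_comm[OF assms rsupp_in[OF that]])
qed

text \<open>In a column the representation changes with the row index i, so only the fibrewise
  commutation of \<open>resol_Sigma\<close> is available.\<close>

lemma col_resol:
  assumes "j \<in> II"
  shows "resol n (SIGMA i : csupp j. gsupp i) (\<lambda>(i, g). block_proj \<pi> i j g)"
  unfolding block_proj_def
proof (rule resol_Sigma)
  show "resol n (csupp j) (\<lambda>i. qent \<pi> i j)" unfolding csupp_def by (rule qp_col_resol[OF qp assms])
  show "resol n (gsupp i) (grp_proj \<pi> i)" if "i \<in> csupp j" for i by (rule grp_resol[OF csupp_in[OF that]])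
  show "qent \<pi> i j * grp_proj \<pi> i g = grp_proj \<pi> i g * qent \<pi> i j" if "i \<in> csupp j" for i g
    by (rule ent_grp_comm[OF csupp_in[OF that] assms])
qed

lemma block_carrier: "i \<in> II \<Longrightarrow> m \<in> II \<Longrightarrow> block_proj \<pi> i m g \<in> carrier_mat n n"
  unfolding block_proj_def by (rule mult_carrier_mat[OF ent_carrier grp_carrier])

lemmas block_dim = carrier_matD[OF block_carrier]

lemma ent_block:
  assumes "i \<in> II" "j \<in> II" "m \<in> II"
  shows "qent \<pi> i j * block_proj \<pi> i m g = (if m = j then block_proj \<pi> i m g else 0\<^sub>m n n)"
proof -
  have "qent \<pi> i j * block_proj \<pi> i m g = (qent \<pi> i j * qent \<pi> i m) * grp_proj \<pi> i g"
    using assms by (simp add: block_proj_def mat_assoc ent_dim grp_dim)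
  then show ?thesis
    using is_projectionD(2)[OF qpD(1)[OF qp assms(1,2)]] qpD(2)[OF qp assms] grp_dim[OF assms(1)]
    by (auto simp: block_proj_def mat_simps)
qed

lemma rep_block:
  assumes "i \<in> II" "m \<in> II" "f \<in> elems (C0 GL)" "g \<in> AutL"
  shows "wrep \<pi> i f * block_proj \<pi> i m g = f g $$ (0, 0) \<cdot>\<^sub>m block_proj \<pi> i m g"
proof -
  have "wrep \<pi> i f * block_proj \<pi> i m g = qent \<pi> i m * (wrep \<pi> i f * grp_proj \<pi> i g)"
    using assms comm[OF assms(3,1,2)] by (simp add: block_proj_def mat_assoc[symmetric] ent_dim grp_dim rep_dim)
  then show ?thesis
    using assms by (simp add: rep_grp block_proj_def mat_mult_smult ent_dim grp_dim)
qed

lemma rep_chi_block: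
  assumes "i \<in> II" "m \<in> II" "g \<in> AutL"
  shows "wrep \<pi> i (chi k l) * block_proj \<pi> i m g = (if g l = k then block_proj \<pi> i m g else 0\<^sub>m n n)"
  using rep_block[OF assms(1,2) chi_C0 assms(3)] assms(3) mat_smult_zero[OF block_carrier[OF assms(1,2)]]
  by (simp add: chi_apply)

definition uent where "uent x y = qent \<pi> (cls x) (cls y) * wrep \<pi> (cls x) (chi (off x) (off y))"

lemma uent_carrier: "uent x y \<in> carrier_mat n n"
  unfolding uent_def by (rule mult_carrier_mat[OF ent_carrier rep_carrier]) (auto simp: chi_C0)

lemma uent_block:
  assumes "m \<in> II" "g \<in> AutL"
  shows "uent x y * block_proj \<pi> (cls x) m g =
    (if m = cls y \<and> g (off y) = off x then block_proj \<pi> (cls x) m g else 0\<^sub>m n n)"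
proof -
  have "uent x y * block_proj \<pi> (cls x) m g = qent \<pi> (cls x) (cls y) * (wrep \<pi> (cls x) (chi (off x) (off y)) * block_proj \<pi> (cls x) m g)"
    unfolding uent_def using assms by (simp add: mat_assoc ent_dim rep_dim block_dim chi_C0)
  then show ?thesis using assms by (simp add: rep_chi_block ent_block mat_mult_zero ent_dim)
qed

text \<open>For another row coset the representation is first moved to the left, so that two
  orthogonal entries of one column of P meet.\<close>

lemma uent_col:
  assumes i: "i \<in> II" and g: "g \<in> AutL"
  shows "uent x y * block_proj \<pi> i (cls y) g =
    (if i = cls x \<and> g (off y) = off x then block_proj \<pi> i (cls y) g else 0\<^sub>m n n)"
proof (cases "i = cls x")
  case True
  then show ?thesis using uent_block[of "cls y" g x y] g by simp
next
  case False
  let ?r = "wrep \<pi> (cls x) (chi (off x) (off y))"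
  note [simp] = ent_dim[OF i cls_in[of y]] ent_dim[OF cls_in[of x] cls_in[of y]] grp_dim[OF i]
    rep_dim[OF cls_in[of x] chi_C0[of "off x" "off y"]]
  have "uent x y * block_proj \<pi> i (cls y) g = ?r * (qent \<pi> (cls x) (cls y) * qent \<pi> i (cls y)) * grp_proj \<pi> i g"
    unfolding uent_def block_proj_def comm[OF chi_C0 cls_in cls_in, symmetric] by (simp add: mat_assoc)
  also have "\<dots> = 0\<^sub>m n n"
    using qpD(3)[OF qp cls_in[of y] cls_in[of x] i] False by (simp add: mat_simps)
  finally show ?thesis using False by simp
qed

lemma uent_automorphism: "quantum_automorphism U1 \<lparr>qdim = n, qent = uent\<rparr>"
  unfolding quantum_automorphism_def
proof (intro conjI ballI impI)
  show "quantum_permutation (verts U1) \<lparr>qdim = n, qent = uent\<rparr>"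
  proof (rule quantum_permutationI)
    fix x y
    show "qent \<lparr>qdim = n, qent = uent\<rparr> x y \<in> carrier_mat (qdim \<lparr>qdim = n, qent = uent\<rparr>) (qdim \<lparr>qdim = n, qent = uent\<rparr>)"
      by (simp add: uent_carrier)
  next
    fix x
    show "resol (qdim \<lparr>qdim = n, qent = uent\<rparr>) (SIGMA m : rsupp (cls x). gsupp (cls x)) (\<lambda>(m, g). block_proj \<pi> (cls x) m g)"
      using row_resol[of "cls x"] by simp
    show "resol (qdim \<lparr>qdim = n, qent = uent\<rparr>) (SIGMA i : csupp (cls x). gsupp i) (\<lambda>(i, g). block_proj \<pi> i (cls x) g)"
      using col_resol[of "cls x"] by simp
  next
    fix x t y assume t: "t \<in> (SIGMA m : rsupp (cls x). gsupp (cls x))"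
    then obtain m g where eq: "t = (m, g)" and m: "m \<in> II" and g: "g \<in> AutL" by (auto dest: rsupp_in gsupp_in)
    \<comment> \<open>For a fixed row point x the label is its preimage under g in coset m; for a
      fixed column point y below, it is the image under g.\<close>
    have "pt m (inv_into UNIV g (off x)) = y \<longleftrightarrow> m = cls y \<and> g (off y) = off x"
      using eq_pt_iff[OF m, of y] AutL_inv[OF g, of "off y" "off x"] by metis
    then show "qent \<lparr>qdim = n, qent = uent\<rparr> x y * (case t of (m, g) \<Rightarrow> block_proj \<pi> (cls x) m g) =
      (if (case t of (m, g) \<Rightarrow> pt m (inv_into UNIV g (off x))) = y then case t of (m, g) \<Rightarrow> block_proj \<pi> (cls x) m g
       else 0\<^sub>m (qdim \<lparr>qdim = n, qent = uent\<rparr>) (qdim \<lparr>qdim = n, qent = uent\<rparr>))"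
      using uent_block[OF m g, of x y] by (simp add: eq)
  next
    fix y t x assume t: "t \<in> (SIGMA i : csupp (cls y). gsupp i)"
    then obtain i g where eq: "t = (i, g)" and i: "i \<in> II" and g: "g \<in> AutL" by (auto dest: csupp_in gsupp_in)
    have "pt i (g (off y)) = x \<longleftrightarrow> i = cls x \<and> g (off y) = off x"
      using eq_pt_iff[OF i, of x] by metis
    then show "qent \<lparr>qdim = n, qent = uent\<rparr> x y * (case t of (i, g) \<Rightarrow> block_proj \<pi> i (cls y) g) =
      (if (case t of (i, g) \<Rightarrow> pt i (g (off y))) = x then case t of (i, g) \<Rightarrow> block_proj \<pi> i (cls y) g
       else 0\<^sub>m (qdim \<lparr>qdim = n, qent = uent\<rparr>) (qdim \<lparr>qdim = n, qent = uent\<rparr>))"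
      using uent_col[OF i g, of x y] by (simp add: eq)
  qed auto
  fix x1 x2 y1 y2 assume ne: "rel_of U1 x1 x2 \<noteq> rel_of U1 y1 y2"
  let ?r = "\<lambda>x y. wrep \<pi> (cls x) (chi (off x) (off y))"
  have "uent x1 y1 * uent x2 y2 = 0\<^sub>m n n"
  \<comment> \<open>In one coset both entries are diagonal in the same row family, and a symmetry of
    the line preserves the relation. In different cosets a mismatch of relations forces y1 and y2
    into one coset, and the column relations of P apply.\<close>
  proof (cases "cls x1 = cls x2")
    case True
    show ?thesis
    proof (rule resol_eqI[OF row_resol[OF cls_in[of x2]]])
      fix t assume "t \<in> (SIGMA m : rsupp (cls x2). gsupp (cls x2))"
      then obtain m g where eq: "t = (m, g)" and m: "m \<in> II" and g: "g \<in> AutL" by (auto dest: rsupp_in gsupp_in)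
      note [simp] = carrier_matD[OF uent_carrier] block_dim[OF cls_in[of x2] m]
      have "uent x1 y1 * uent x2 y2 * block_proj \<pi> (cls x2) m g = uent x1 y1 * (uent x2 y2 * block_proj \<pi> (cls x2) m g)"
        by (simp add: mat_assoc)
      also have "\<dots> = 0\<^sub>m n n"
        using uent_block[OF m g, of x2 y2] uent_block[OF m g, of x1 y1] True rel_of_aut[OF True _ g, of y1 y2] ne
        by (auto simp: mat_simps)
      finally show "uent x1 y1 * uent x2 y2 * (case t of (m, g) \<Rightarrow> block_proj \<pi> (cls x2) m g) =
          0\<^sub>m n n * (case t of (m, g) \<Rightarrow> block_proj \<pi> (cls x2) m g)" by (simp add: eq mat_simps)
    qed (auto intro: mult_carrier_mat uent_carrier)
  next
    case False
    then have y: "cls y1 = cls y2" using ne rel_of_cls by blast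
    note [simp] = ent_dim[OF cls_in cls_in] rep_dim[OF cls_in chi_C0]
    have "uent x1 y1 * uent x2 y2 = ?r x1 y1 * (qent \<pi> (cls x1) (cls y1) * qent \<pi> (cls x2) (cls y2)) * ?r x2 y2"
      unfolding uent_def comm[OF chi_C0 cls_in[of x1] cls_in[of y1], symmetric] by (simp add: mat_assoc)
    then show ?thesis using qpD(3)[OF qp cls_in[of y2] cls_in[of x1] cls_in[of x2] False] y by (simp add: mat_simps)
  qed
  then show "qent \<lparr>qdim = n, qent = uent\<rparr> x1 y1 * qent \<lparr>qdim = n, qent = uent\<rparr> x2 y2 =
      0\<^sub>m (qdim \<lparr>qdim = n, qent = uent\<rparr>) (qdim \<lparr>qdim = n, qent = uent\<rparr>)" by simp
qed

end

section \<open>From quantum automorphisms to wreath corepresentations\<close>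

text \<open>Row z sums to 1 and may be inserted between the factors; if the product is nonzero, some
  entry must pass on both sides.\<close>

lemma qa_insert:
  assumes q: "quantum_permutation Y \<sigma>" and z: "z \<in> Y"
    and A: "A \<in> carrier_mat m (qdim \<sigma>)" and B: "B \<in> carrier_mat (qdim \<sigma>) k" and ne: "A * B \<noteq> 0\<^sub>m m k"
  shows "\<exists>w\<in>Y. A * qent \<sigma> z w \<noteq> 0\<^sub>m m (qdim \<sigma>) \<and> qent \<sigma> z w * B \<noteq> 0\<^sub>m (qdim \<sigma>) k"
proof (rule ccontr)
  assume "\<not> ?thesis"
  then have z0: "A * qent \<sigma> z w = 0\<^sub>m m (qdim \<sigma>) \<or> qent \<sigma> z w * B = 0\<^sub>m (qdim \<sigma>) k" if "w \<in> Y" for w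
    using that by blast
  note r = resolD[OF qp_row_resol[OF q z]]
  let ?F = "{y \<in> Y. qent \<sigma> z y \<noteq> 0\<^sub>m (qdim \<sigma>) (qdim \<sigma>)}"
  note [simp] = carrier_matD[OF A] carrier_matD[OF B]
  have "A * B = A * (msum (qdim \<sigma>) (qdim \<sigma>) (qent \<sigma> z) ?F * B)" using r(4) by (simp add: mat_simps)
  also have "msum (qdim \<sigma>) (qdim \<sigma>) (qent \<sigma> z) ?F * B = msum (qdim \<sigma>) k (\<lambda>w. qent \<sigma> z w * B) ?F"
    by (rule msum_mult_right[OF B r(5)])
  also have "A * \<dots> = msum m k (\<lambda>w. A * (qent \<sigma> z w * B)) ?F"
    by (rule msum_mult_left[OF A mult_carrier_mat[OF r(5) B]])
  also have "\<dots> = 0\<^sub>m m k"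
  proof (rule msum_zero)
    fix w assume w: "w \<in> ?F"
    note [simp] = carrier_matD[OF r(5)[OF w]]
    have "A * (qent \<sigma> z w * B) = A * qent \<sigma> z w * B" by (simp add: mat_assoc)
    then show "A * (qent \<sigma> z w * B) = 0\<^sub>m m k"
      using z0[of w] w by (auto simp: mat_simps)
  qed
  finally show False using ne by simp
qed

text \<open>The entries of row x sum to 1, so when all but one annihilate \<open>B\<close>, the
  remaining one fixes it.\<close>

lemma qp_row_select:
  assumes q: "quantum_permutation Y \<sigma>" and x: "x \<in> Y" and w0: "w0 \<in> Y"
    and B: "B \<in> carrier_mat (qdim \<sigma>) k"
    and z: "\<And>w. w \<in> Y \<Longrightarrow> w \<noteq> w0 \<Longrightarrow> qent \<sigma> x w * B = 0\<^sub>m (qdim \<sigma>) k"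
  shows "qent \<sigma> x w0 * B = B"
proof -
  note r = resolD[OF qp_row_resol[OF q x]]
  let ?F = "{y \<in> Y. qent \<sigma> x y \<noteq> 0\<^sub>m (qdim \<sigma>) (qdim \<sigma>)}"
  note [simp] = carrier_matD[OF B] carrier_matD[OF qpD(4)[OF q x]]
  have "B = msum (qdim \<sigma>) (qdim \<sigma>) (qent \<sigma> x) ?F * B" using r(4) by (simp add: mat_simps)
  also have "\<dots> = msum (qdim \<sigma>) k (\<lambda>w. qent \<sigma> x w * B) ?F" by (rule msum_mult_right[OF B r(5)])
  also have "\<dots> = msum (qdim \<sigma>) k (\<lambda>w. qent \<sigma> x w * B) (insert w0 ?F)"
    by (rule msum_neutral[symmetric]) (use r(1) in \<open>auto simp: mat_simps w0\<close>)
  also have "\<dots> = qent \<sigma> x w0 * B"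
    by (rule msum_single) (use r(1) z w0 mult_carrier_mat[OF qpD(4)[OF q x w0] B] in auto)
  finally show ?thesis by simp
qed

text \<open>Rows are inserted at the successive points of the path from x1. Neighbours can only be
  matched with neighbours, so the column point moves by one at each step, forwards or
  backwards.\<close>

lemma qa_walk:
  assumes \<sigma>: "quantum_automorphism U1 \<sigma>" and s: "s = 1 \<or> s = (- 1 :: int)"
    and ne: "qent \<sigma> x1 y1 * qent \<sigma> (x1 + of_int (s * int m)) y2 \<noteq> 0\<^sub>m (qdim \<sigma>) (qdim \<sigma>)"
  shows "\<exists>l. y2 = y1 + of_int l \<and> \<bar>l\<bar> \<le> int m"
  using ne
proof (induction m arbitrary: y2)
  case 0
  have "y2 = y1"
  proof (rule ccontr)
    assume "y2 \<noteq> y1"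
    then show False using 0 qpD(2)[OF qaD(1)[OF \<sigma>], of x1 y1 y2] by simp
  qed
  then show ?case by (intro exI[of _ 0]) simp
next
  case (Suc m)
  note q = qaD(1)[OF \<sigma>]
  have c: "qent \<sigma> x y \<in> carrier_mat (qdim \<sigma>) (qdim \<sigma>)" for x y using qpD(4)[OF q] by simp
  let ?z = "x1 + of_int (s * int m)" and ?x2 = "x1 + of_int (s * int (Suc m))"
  obtain w where w: "qent \<sigma> x1 y1 * qent \<sigma> ?z w \<noteq> 0\<^sub>m (qdim \<sigma>) (qdim \<sigma>)"
    "qent \<sigma> ?z w * qent \<sigma> ?x2 y2 \<noteq> 0\<^sub>m (qdim \<sigma>) (qdim \<sigma>)"
    using qa_insert[OF q, of ?z, OF _ c c Suc.prems] by auto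
  obtain l where l: "w = y1 + of_int l" "\<bar>l\<bar> \<le> int m" using Suc.IH[OF w(1)] by blast
  have "?z - ?x2 = - of_int s" by (simp add: algebra_simps)
  then have "\<bar>?z - ?x2\<bar> = 1" using s by auto
  then have "rel_of U1 ?z ?x2 = Adjacent" by (auto simp: rel_of_def)
  then have "rel_of U1 w y2 = Adjacent" using qaD(2)[OF \<sigma>, of ?z ?x2 w y2] w(2) by auto
  then have "\<bar>w - y2\<bar> = 1" by (simp add: rel_of_def split: if_splits)
  then consider "y2 = w + 1" | "y2 = w - 1" by (auto simp: abs_if split: if_splits)
  then show ?case
  proof cases
    case 1
    then show ?thesis using l by (intro exI[of _ "l + 1"]) auto
  next
    case 2
    then show ?thesis using l by (intro exI[of _ "l - 1"]) auto
  qed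
qed

lemma qa_walk_int:
  assumes \<sigma>: "quantum_automorphism U1 \<sigma>"
    and ne: "qent \<sigma> x1 y1 * qent \<sigma> (x1 + of_int k) y2 \<noteq> 0\<^sub>m (qdim \<sigma>) (qdim \<sigma>)"
  shows "\<exists>l. y2 = y1 + of_int l \<and> \<bar>l\<bar> \<le> \<bar>k\<bar>"
proof -
  have "k = (if k \<ge> 0 then 1 else - 1) * int (nat \<bar>k\<bar>)" by auto
  then show ?thesis
    using qa_walk[OF \<sigma>, of "if k \<ge> 0 then 1 else - 1" x1 y1 "nat \<bar>k\<bar>" y2] ne by (auto split: if_splits)
qed

text \<open>A walk gives only an upper bound for the distance of the column points. The
  contragredient exchanges row and column points and gives the opposite bound.\<close>

lemma qa_distance:
  assumes \<sigma>: "quantum_automorphism U1 \<sigma>"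
    and ne: "qent \<sigma> x1 y1 * qent \<sigma> (x1 + of_int k) y2 \<noteq> 0\<^sub>m (qdim \<sigma>) (qdim \<sigma>)"
  shows "\<exists>l. y2 = y1 + of_int l \<and> \<bar>l\<bar> = \<bar>k\<bar>"
proof -
  obtain l where l: "y2 = y1 + of_int l" "\<bar>l\<bar> \<le> \<bar>k\<bar>" using qa_walk_int[OF \<sigma> ne] by blast
  let ?x2 = "x1 + of_int k"
  note \<tau> = contragredient_automorphism[OF \<sigma>]
  note d = carrier_matD[OF qpD(4)[OF qaD(1)[OF \<sigma>]]]
  have "cconj (qent \<sigma> x1 y1) * cconj (qent \<sigma> ?x2 y2) \<noteq> 0\<^sub>m (qdim \<sigma>) (qdim \<sigma>)"
  proof
    assume "cconj (qent \<sigma> x1 y1) * cconj (qent \<sigma> ?x2 y2) = 0\<^sub>m (qdim \<sigma>) (qdim \<sigma>)"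
    then have "cconj (qent \<sigma> x1 y1 * qent \<sigma> ?x2 y2) = 0\<^sub>m (qdim \<sigma>) (qdim \<sigma>)" using d by (simp add: cconj_mult)
    then have "cconj (cconj (qent \<sigma> x1 y1 * qent \<sigma> ?x2 y2)) = 0\<^sub>m (qdim \<sigma>) (qdim \<sigma>)" by simp
    moreover have "cconj (cconj A) = A" for A by (rule eq_matI) auto
    ultimately show False using ne by simp
  qed
  then have "qent (contragredient \<sigma>) y1 x1 * qent (contragredient \<sigma>) (y1 + of_int l) ?x2 \<noteq>
      0\<^sub>m (qdim (contragredient \<sigma>)) (qdim (contragredient \<sigma>))" using l by simp
  from qa_walk_int[OF \<tau> this] have "\<bar>k\<bar> \<le> \<bar>l\<bar>" by auto
  then show ?thesis using l by (intro exI[of _ l]) auto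
qed

text \<open>Quantum automorphisms of a line are classical: choose \<open>N\<close> such that no two points of the finite support of row \<open>r\<close>
  have distance \<open>2N\<close>. Then the value at \<open>r + N\<close> determines the value at \<open>r\<close>, hence the orientation, hence
  the whole component.\<close>

lemma qa_row_component:
  assumes \<sigma>: "quantum_automorphism U1 \<sigma>" and i: "i \<in> II"
  shows "\<exists>X q lab. resol (qdim \<sigma>) X q \<and> (\<forall>y\<in>X. lab y \<in> AutL) \<and>
    (\<forall>y\<in>X. \<forall>k z. qent \<sigma> (pt i k) z * q y = (if cls y = cls z \<and> lab y (off z) = k then q y else 0\<^sub>m (qdim \<sigma>) (qdim \<sigma>)))"
proof -
  let ?n = "qdim \<sigma>" and ?u = "\<lambda>k. qent \<sigma> (pt i k)"
  note q = qaD(1)[OF \<sigma>]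
  have c: "qent \<sigma> x y \<in> carrier_mat ?n ?n" for x y using qpD(4)[OF q] by simp
  note [simp] = carrier_matD[OF c]
  define F where "F = {y. ?u 0 y \<noteq> 0\<^sub>m ?n ?n}"
  have F: "finite F" using resolD(1)[OF qp_row_resol[OF q, of "pt i 0"]] by (simp add: F_def)
  have "finite {N :: nat. \<exists>a\<in>F. \<exists>b\<in>F. b - a = 2 * real N}"
  proof (rule finite_subset)
    show "{N :: nat. \<exists>a\<in>F. \<exists>b\<in>F. b - a = 2 * real N} \<subseteq> (\<lambda>(a, b). nat \<lfloor>(b - a) / 2\<rfloor>) ` (F \<times> F)"
    proof
      fix N :: nat assume "N \<in> {N. \<exists>a\<in>F. \<exists>b\<in>F. b - a = 2 * real N}"
      then obtain a b where ab: "a \<in> F" "b \<in> F" "b - a = 2 * real N" by blast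
      then have "N = nat \<lfloor>(b - a) / 2\<rfloor>" by simp
      then show "N \<in> (\<lambda>(a, b). nat \<lfloor>(b - a) / 2\<rfloor>) ` (F \<times> F)" using ab(1,2) by (intro image_eqI[of _ _ "(a, b)"]) auto
    qed
  qed (use F in simp)
  \<comment> \<open>N = 0 is excluded as well: the points at offsets 0 and N must be different, so
    that their two distances pin down a point of the line.\<close>
  then have "finite (insert 0 {N :: nat. \<exists>a\<in>F. \<exists>b\<in>F. b - a = 2 * real N})" by simp
  from ex_new_if_finite[OF infinite_UNIV_nat this]
  obtain N :: nat where N: "N \<notin> insert 0 {N. \<exists>a\<in>F. \<exists>b\<in>F. b - a = 2 * real N}" by blast
  define X where "X = {y. ?u (int N) y \<noteq> 0\<^sub>m ?n ?n}"
  have r: "resol ?n X (?u (int N))" using qp_row_resol[OF q, of "pt i (int N)"] by (simp add: X_def)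
  have "\<exists>e. (e = 1 \<or> e = (- 1 :: int)) \<and> ?u 0 (y - of_int (e * int N)) * ?u (int N) y = ?u (int N) y"
    if y: "y \<in> X" for y
  proof -
    have near: "w = y - real N \<or> w = y + real N" if nz: "?u 0 w * ?u (int N) y \<noteq> 0\<^sub>m ?n ?n" for w
    proof -
      obtain l where "y = w + of_int l" "\<bar>l\<bar> = int N"
        using qa_distance[OF \<sigma>, of "pt i 0" w "int N" y] nz by (auto simp: pt_def)
      then show ?thesis by (auto simp: abs_if split: if_splits)
    qed
    have "\<not> (y - real N \<in> F \<and> y + real N \<in> F)"
    proof
      assume "y - real N \<in> F \<and> y + real N \<in> F"
      moreover have "(y + real N) - (y - real N) = 2 * real N" by simp
      ultimately show False using N by blast
    qed
    then consider "y - real N \<notin> F" | "y + real N \<notin> F" by blast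
    then show ?thesis
    proof cases
      case 1
      have "?u 0 (y + real N) * ?u (int N) y = ?u (int N) y"
      proof (rule qp_row_select[OF q _ _ c])
        fix w assume "w \<noteq> y + real N"
        then show "?u 0 w * ?u (int N) y = 0\<^sub>m ?n ?n" using near[of w] 1 by (cases "w = y - real N") (auto simp: F_def mat_simps)
      qed auto
      then show ?thesis by (intro exI[of _ "- 1"]) auto
    next
      case 2
      have "?u 0 (y - real N) * ?u (int N) y = ?u (int N) y"
      proof (rule qp_row_select[OF q _ _ c])
        fix w assume "w \<noteq> y - real N"
        then show "?u 0 w * ?u (int N) y = 0\<^sub>m ?n ?n" using near[of w] 2 by (cases "w = y + real N") (auto simp: F_def mat_simps)
      qed auto
      then show ?thesis by (intro exI[of _ 1]) auto
    qed
  qed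
  then obtain e where e: "\<And>y. y \<in> X \<Longrightarrow> (e y = 1 \<or> e y = (- 1 :: int)) \<and>
      ?u 0 (y - of_int (e y * int N)) * ?u (int N) y = ?u (int N) y" by metis
  \<comment> \<open>The affine map of slope \<open>e y\<close> that takes the offset of y to N; it
    sends column offsets to row offsets.\<close>
  define lab where "lab = (\<lambda>y l. (int N - e y * off y) + e y * l)"
  have zero: "?u k z * ?u (int N) y = 0\<^sub>m ?n ?n" if y: "y \<in> X" and ne: "z \<noteq> y + of_int (e y * (k - int N))" for y k z
  proof (rule ccontr)
    assume nz: "?u k z * ?u (int N) y \<noteq> 0\<^sub>m ?n ?n"
    let ?y' = "y - of_int (e y * int N)"
    \<comment> \<open>The entry of row 0 fixes this member, so the distances from row k to row 0 and
      to row N constrain z at the same time.\<close>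
    have "?u k z * ?u (int N) y = ?u k z * ?u 0 ?y' * ?u (int N) y"
      using e[OF y] by (simp add: mat_assoc)
    then have "?u k z * ?u 0 ?y' \<noteq> 0\<^sub>m ?n ?n" using nz by (auto simp: mat_simps)
    moreover have "pt i 0 = pt i k + of_int (- k)" by (simp add: pt_def)
    ultimately obtain l where l: "?y' = z + of_int l" "\<bar>l\<bar> = \<bar>k\<bar>"
      using qa_distance[OF \<sigma>, of "pt i k" z "- k" ?y'] by auto
    have "pt i (int N) = pt i k + of_int (int N - k)" by (simp add: pt_def)
    then obtain l' where l': "y = z + of_int l'" "\<bar>l'\<bar> = \<bar>int N - k\<bar>"
      using qa_distance[OF \<sigma>, of "pt i k" z "int N - k" y] nz by auto
    have "of_int l' = (of_int (l + e y * int N) :: real)" using l(1) l'(1) by simp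
    then have "l' = l + e y * int N" by (simp only: of_int_eq_iff)
    \<comment> \<open>Squaring |l| = |k| and |l + e N| = |N - k| and subtracting gives e l N = - k
      N, and N is positive.\<close>
    then have "l = - (e y * k)" using l(2) l'(2) e[OF y] N by (auto simp: abs_if split: if_splits)
    then have "z = y + of_int (e y * (k - int N))" using l(1) by (simp add: algebra_simps)
    then show False using ne by simp
  qed
  have ev: "?u k z * ?u (int N) y = (if z = y + of_int (e y * (k - int N)) then ?u (int N) y else 0\<^sub>m ?n ?n)" if y: "y \<in> X" for y k z
  proof (cases "z = y + of_int (e y * (k - int N))")
    case True
    have "?u k z * ?u (int N) y = ?u (int N) y"
      by (rule qp_row_select[OF q _ _ c]) (use zero[OF y] True in auto)
    then show ?thesis using True by simp
  qed (use zero[OF y] in simp)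
  have iff: "z = y + of_int (e y * (k - int N)) \<longleftrightarrow> cls y = cls z \<and> lab y (off z) = k" if y: "y \<in> X" for y k z
  proof -
    have shift: "y + of_int (e y * (k - int N)) = pt (cls y) (off y + e y * (k - int N))"
      unfolding pt_add[symmetric] pt_off ..
    have "z = y + of_int (e y * (k - int N)) \<longleftrightarrow> cls z = cls y \<and> off z = off y + e y * (k - int N)"
      unfolding shift by (rule eq_pt_iff[OF cls_in])
    moreover have "off z = off y + e y * (k - int N) \<longleftrightarrow> lab y (off z) = k"
      using e[OF y] by (auto simp: lab_def)
    ultimately show ?thesis by auto
  qed
  have "lab y \<in> AutL" if "y \<in> X" for y unfolding lab_def by (rule affine_AutL) (use e[OF that] in auto)
  moreover have "?u k z * ?u (int N) y = (if cls y = cls z \<and> lab y (off z) = k then ?u (int N) y else 0\<^sub>m ?n ?n)" if "y \<in> X" for y k z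
    using ev[OF that] iff[OF that] by simp
  ultimately show ?thesis using r by blast
qed

definition wreath_rel :: "real qperm \<Rightarrow> (real set, int \<Rightarrow> int) wcorep \<Rightarrow> bool" where
  "wreath_rel \<sigma> \<pi> \<longleftrightarrow> quantum_automorphism U1 \<sigma> \<and> wreath_corep GL II \<pi> \<and> qdim \<sigma> = qdim \<pi> \<and>
     (\<forall>x y. qent \<sigma> x y = qent \<pi> (cls x) (cls y) * wrep \<pi> (cls x) (chi (off x) (off y)))"

lemma wreath_rel_surj:
  assumes "wreath_corep GL II \<pi>" shows "\<exists>\<sigma>. wreath_rel \<sigma> \<pi>"
proof -
  interpret wreath \<pi> by unfold_locales (rule assms)
  show ?thesis
    unfolding wreath_rel_def using uent_automorphism assms
    by (intro exI[of _ "\<lparr>qdim = n, qent = uent\<rparr>"]) (auto simp: uent_def)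
qed

text \<open>Each coset receives its own finite family from \<open>qa_row_component\<close>. The
  families of different cosets are unrelated and are chosen simultaneously.\<close>

lemma wreath_rel_total:
  assumes \<sigma>: "quantum_automorphism U1 \<sigma>" shows "\<exists>\<pi>. wreath_rel \<sigma> \<pi>"
proof -
  let ?n = "qdim \<sigma>"
  note q = qaD(1)[OF \<sigma>]
  have c: "qent \<sigma> x y \<in> carrier_mat ?n ?n" for x y using qpD(4)[OF q] by simp
  have h: "mat_adjoint (qent \<sigma> x y) = qent \<sigma> x y" for x y using is_projectionD(3)[OF qpD(1)[OF q]] by simp
  have "\<forall>i. \<exists>X p lab. i \<in> II \<longrightarrow> resol ?n X p \<and> (\<forall>y\<in>X. lab y \<in> AutL) \<and>
    (\<forall>y\<in>X. \<forall>k z. qent \<sigma> (pt i k) z * p y = (if cls y = cls z \<and> lab y (off z) = k then p y else 0\<^sub>m ?n ?n))"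
    using qa_row_component[OF \<sigma>] by blast
  then obtain X p lab where all: "\<forall>i. i \<in> II \<longrightarrow> resol ?n (X i) (p i) \<and> (\<forall>y\<in>X i. lab i y \<in> AutL) \<and>
    (\<forall>y\<in>X i. \<forall>k z. qent \<sigma> (pt i k) z * p i y = (if cls y = cls z \<and> lab i y (off z) = k then p i y else 0\<^sub>m ?n ?n))"
    unfolding choice_iff by blast
  then have r: "resol ?n (X i) (p i)" and lab: "y \<in> X i \<Longrightarrow> lab i y \<in> AutL"
    and ev: "y \<in> X i \<Longrightarrow> qent \<sigma> (pt i k) z * p i y = (if cls y = cls z \<and> lab i y (off z) = k then p i y else 0\<^sub>m ?n ?n)"
    if "i \<in> II" for i y k z using that by blast+
  \<comment> \<open>The projection P_ij collects the members whose column point lies in coset j, and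
    \<open>W\<close> evaluates a function at their symmetries. Both are diagonal in the same family,
    hence commute.\<close>
  define E where "E = (\<lambda>i j. diag ?n (X i) (p i) (\<lambda>y. if cls y = j then 1 else 0))"
  define W where "W = (\<lambda>i f. diag ?n (X i) (p i) (\<lambda>y. f (lab i y) $$ (0, 0)))"
  define \<pi> :: "(real set, int \<Rightarrow> int) wcorep" where "\<pi> = \<lparr>qdim = ?n, qent = E, wrep = W\<rparr>"
  have pc: "p i y \<in> carrier_mat ?n ?n" if "i \<in> II" "y \<in> X i" for i y using resolD(5)[OF r[OF that(1)] that(2)] .
  have Et: "E i j * p i y = (if cls y = j then p i y else 0\<^sub>m ?n ?n)" if "i \<in> II" "y \<in> X i" for i j y
    using diag_mult[OF r[OF that(1)] that(2)] mat_smult_zero[OF pc[OF that]] by (simp add: E_def)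
  have Wt: "W i f * p i y = f (lab i y) $$ (0, 0) \<cdot>\<^sub>m p i y" if "i \<in> II" "y \<in> X i" for i f y
    using diag_mult[OF r[OF that(1)] that(2)] by (simp add: W_def)
  have Eproj: "is_projection ?n (E i j)" if "i \<in> II" for i j
    by (rule projection_of_resol[OF r[OF that]]) (use Et[OF that] in \<open>auto simp: E_def\<close>)
  \<comment> \<open>The column relations of P involve several unrelated row families. They are
    tested on the column of \<open>\<sigma>\<close> at one point of coset j: P_ij keeps its entries
    with row point in coset i and kills the others.\<close>
  have Ecol: "E i j * qent \<sigma> x (pt j 0) = (if cls x = i then qent \<sigma> x (pt j 0) else 0\<^sub>m ?n ?n)" if i: "i \<in> II" and j: "j \<in> II" for i j x
  proof (cases "cls x = i")
    case True
    have "E i j * qent \<sigma> x (pt j 0) = qent \<sigma> x (pt j 0)"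
    proof (rule resol_eqI[OF r[OF i]])
      fix y assume y: "y \<in> X i"
      have x: "x = pt i (off x)" using True pt_off[of x] by simp
      have "E i j * qent \<sigma> x (pt j 0) * p i y = E i j * (qent \<sigma> x (pt j 0) * p i y)"
        using carrier_matD[OF c] carrier_matD[OF pc[OF i y]] by (simp add: mat_assoc E_def)
      then show "E i j * qent \<sigma> x (pt j 0) * p i y = qent \<sigma> x (pt j 0) * p i y"
        using ev[OF i y, of "off x" "pt j 0"] Et[OF i y, of j] x j by (auto simp: E_def mat_simps)
    qed (auto simp: E_def intro: c mult_carrier_mat[of _ _ ?n])
    then show ?thesis using True by simp
  next
    case False
    \<comment> \<open>Members of the row family can only be tested on the right, so the product is
      treated in reverse order and turned round by the adjoint.\<close>
    have "qent \<sigma> x (pt j 0) * E i j = 0\<^sub>m ?n ?n"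
    proof (rule resol_eqI[OF r[OF i]])
      fix y assume y: "y \<in> X i"
      note [simp] = carrier_matD[OF c] carrier_matD[OF pc[OF i y]]
      \<comment> \<open>An entry of the same column fixes this member, and its row point lies in
        coset i. It differs from x, so the two entries are orthogonal.\<close>
      have "qent \<sigma> x (pt j 0) * p i y = 0\<^sub>m ?n ?n" if cy: "cls y = j"
      proof -
        let ?k = "lab i y 0"
        have "qent \<sigma> x (pt j 0) * p i y = qent \<sigma> x (pt j 0) * (qent \<sigma> (pt i ?k) (pt j 0) * p i y)"
          using ev[OF i y, of ?k "pt j 0"] j cy by simp
        also have "\<dots> = (qent \<sigma> x (pt j 0) * qent \<sigma> (pt i ?k) (pt j 0)) * p i y" by (simp add: mat_assoc)
        also have "qent \<sigma> x (pt j 0) * qent \<sigma> (pt i ?k) (pt j 0) = 0\<^sub>m ?n ?n"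
          using False i by (intro qpD(3)[OF q]) auto
        finally show ?thesis by (simp add: mat_simps)
      qed
      moreover have "qent \<sigma> x (pt j 0) * E i j * p i y = qent \<sigma> x (pt j 0) * (E i j * p i y)"
        by (simp add: mat_assoc E_def)
      ultimately show "qent \<sigma> x (pt j 0) * E i j * p i y = 0\<^sub>m ?n ?n * p i y"
        using Et[OF i y, of j] by (auto simp: mat_simps)
    qed (auto simp: E_def intro: c mult_carrier_mat[of _ _ ?n])
    then have "mat_adjoint (qent \<sigma> x (pt j 0) * E i j) = 0\<^sub>m ?n ?n" by simp
    then show ?thesis
      using False is_projectionD(3)[OF Eproj[OF i, of j]] h carrier_matD[OF c]
      by (simp add: mat_adjoint_mult E_def)
  qed
  have qp: "quantum_permutation II \<pi>"
  proof (rule quantum_permutationI)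
    fix i j assume "i \<in> II" "j \<in> II"
    show "qent \<pi> i j \<in> carrier_mat (qdim \<pi>) (qdim \<pi>)" by (simp add: \<pi>_def E_def)
  next
    fix i assume i: "i \<in> II"
    show "resol (qdim \<pi>) (X i) (p i)" using r[OF i] by (simp add: \<pi>_def)
    show "cls t \<in> II" for t by simp
    show "resol (qdim \<pi>) {x. qent \<sigma> x (pt i 0) \<noteq> 0\<^sub>m ?n ?n} (\<lambda>x. qent \<sigma> x (pt i 0))"
      using qp_col_resol[OF q, of "pt i 0"] by (simp add: \<pi>_def)
    fix y j
    show "qent \<pi> i j * p i y = (if cls y = j then p i y else 0\<^sub>m (qdim \<pi>) (qdim \<pi>))" if "y \<in> X i"
      using Et[OF i that] by (simp add: \<pi>_def)
  next
    fix j x i assume "j \<in> II" "i \<in> II"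
    then show "qent \<pi> i j * qent \<sigma> x (pt j 0) = (if cls x = i then qent \<sigma> x (pt j 0) else 0\<^sub>m (qdim \<pi>) (qdim \<pi>))"
      using Ecol by (simp add: \<pi>_def)
  qed auto
  have nd: "nondegenerate_rep GL ?n (W i)" if i: "i \<in> II" for i
    by (rule nondegenerate_repI[OF r[OF i] lab[OF i]]) (use Wt[OF i] in \<open>auto simp: W_def\<close>)
  have comm: "W i f * E i j = E i j * W i f" if "i \<in> II" for i j f
    unfolding W_def E_def diag_times[OF r[OF that]] by (simp add: mult.commute)
  have rel: "qent \<sigma> x y = E (cls x) (cls y) * W (cls x) (chi (off x) (off y))" for x y
  proof (rule resol_eqI[OF r[OF cls_in[of x]]])
    fix t assume t: "t \<in> X (cls x)"
    note [simp] = carrier_matD[OF pc[OF cls_in t]]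
    have "E (cls x) (cls y) * W (cls x) (chi (off x) (off y)) * p (cls x) t = E (cls x) (cls y) * (W (cls x) (chi (off x) (off y)) * p (cls x) t)"
      by (simp add: mat_assoc E_def W_def)
    also have "\<dots> = (if cls t = cls y \<and> lab (cls x) t (off y) = off x then p (cls x) t else 0\<^sub>m ?n ?n)"
      unfolding Wt[OF cls_in t] using lab[OF cls_in t] mat_smult_zero[OF pc[OF cls_in t]] Et[OF cls_in t, of "cls y"]
      by (auto simp: chi_apply E_def mat_simps)
    also have "\<dots> = qent \<sigma> x y * p (cls x) t" using ev[OF cls_in t, of "off x" y] by simp
    finally show "qent \<sigma> x y * p (cls x) t = E (cls x) (cls y) * W (cls x) (chi (off x) (off y)) * p (cls x) t" by simp
  qed (auto simp: E_def W_def intro: c mult_carrier_mat[of _ _ ?n])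
  have "wreath_corep GL II \<pi>"
    unfolding wreath_corep_def using qp nd comm by (simp add: \<pi>_def)
  then show ?thesis
    unfolding wreath_rel_def using \<sigma> rel by (intro exI[of _ \<pi>]) (simp add: \<pi>_def)
qed

section \<open>The equivalence of tensor categories\<close>

lemma (in wreath) rep_times: "i \<in> II \<Longrightarrow> f \<in> elems (C0 GL) \<Longrightarrow> f' \<in> elems (C0 GL) \<Longrightarrow>
    wrep \<pi> i (times_of (C0 GL) f f') = wrep \<pi> i f * wrep \<pi> i f'"
  using nd[of i] star_hom_matrixD(3)[of "C0 GL" n "wrep \<pi> i"] by (simp add: nondegenerate_rep_def)

text \<open>By \<open>chi_times_unit\<close> the delta function at g is a product of the
  coefficients at 0 and 1. Thus the joint projections of a row can be recovered from the entries of
  the quantum automorphism.\<close>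

lemma (in wreath) block_uent:
  assumes i: "i \<in> II" and m: "m \<in> II" and g: "g \<in> AutL"
  shows "block_proj \<pi> i m g = uent (pt i (g 0)) (pt m 0) * uent (pt i (g 1)) (pt m 1)"
proof -
  let ?E = "qent \<pi> i m" and ?W = "\<lambda>k l. wrep \<pi> i (chi k l)"
  note [simp] = ent_dim[OF i m] rep_dim[OF i chi_C0]
  have "uent (pt i (g 0)) (pt m 0) * uent (pt i (g 1)) (pt m 1) = ?E * (?W (g 0) 0 * ?E) * ?W (g 1) 1"
    using i m by (simp add: uent_def mat_assoc)
  also have "\<dots> = (?E * ?E) * (?W (g 0) 0 * ?W (g 1) 1)"
    unfolding comm[OF chi_C0 i m] by (simp add: mat_assoc)
  also have "\<dots> = block_proj \<pi> i m g"
    unfolding rep_times[OF i chi_C0 chi_C0, symmetric] chi_times_unit[OF g] is_projectionD(2)[OF qpD(1)[OF qp i m]]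
    by (simp add: block_proj_def grp_proj_def)
  finally show ?thesis by simp
qed

lemma wreath_rel_uent:
  assumes "wreath_rel \<sigma> \<pi>"
  shows "wreath \<pi>" "qdim \<sigma> = qdim \<pi>" "qent \<sigma> x y = wreath.uent \<pi> x y" "quantum_automorphism U1 \<sigma>"
proof -
  show w: "wreath \<pi>" by unfold_locales (use assms in \<open>simp add: wreath_rel_def\<close>)
  show "qdim \<sigma> = qdim \<pi>" "quantum_automorphism U1 \<sigma>" using assms by (simp_all add: wreath_rel_def)
  show "qent \<sigma> x y = wreath.uent \<pi> x y" using assms by (simp add: wreath_rel_def wreath.uent_def[OF w])
qed

text \<open>An intertwiner of entries also intertwines products of two entries, that is, the
  projections of \<open>block_uent\<close>; both P_ij and p_i(f) are diagonal in these with
  coefficients common to the two objects.\<close>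

lemma wreath_rel_mor:
  assumes r: "wreath_rel \<sigma> \<pi>" and r': "wreath_rel \<sigma>' \<pi>'"
  shows "qperm_intertwiners UNIV \<sigma> \<sigma>' = wreath_intertwiners GL II \<pi> \<pi>'"
proof -
  interpret A: wreath \<pi> by (rule wreath_rel_uent(1)[OF r])
  interpret B: wreath \<pi>' by (rule wreath_rel_uent(1)[OF r'])
  note u = wreath_rel_uent(3)[OF r] wreath_rel_uent(3)[OF r']
  note nn = wreath_rel_uent(2)[OF r] wreath_rel_uent(2)[OF r']
  show ?thesis
  proof (intro equalityI subsetI)
    fix T assume T: "T \<in> wreath_intertwiners GL II \<pi> \<pi>'"
    then have Tc: "T \<in> carrier_mat (qdim \<pi>') (qdim \<pi>)" by (auto simp: wreath_intertwiners_def qperm_intertwiners_def)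
    have "T * A.uent x y = B.uent x y * T" for x y
    proof -
      note [simp] = carrier_matD[OF Tc] A.ent_dim[OF cls_in cls_in] B.ent_dim[OF cls_in cls_in]
        A.rep_dim[OF cls_in chi_C0] B.rep_dim[OF cls_in chi_C0]
      have 1: "T * qent \<pi> (cls x) (cls y) = qent \<pi>' (cls x) (cls y) * T"
        "T * wrep \<pi> (cls x) (chi (off x) (off y)) = wrep \<pi>' (cls x) (chi (off x) (off y)) * T"
        using T by (auto simp: wreath_intertwiners_def qperm_intertwiners_def chi_C0)
      have "T * A.uent x y = (T * qent \<pi> (cls x) (cls y)) * wrep \<pi> (cls x) (chi (off x) (off y))"
        by (simp add: A.uent_def mat_assoc)
      also have "\<dots> = qent \<pi>' (cls x) (cls y) * (T * wrep \<pi> (cls x) (chi (off x) (off y)))"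
        unfolding 1(1) by (simp add: mat_assoc)
      finally show ?thesis unfolding 1(2) by (simp add: B.uent_def mat_assoc)
    qed
    then show "T \<in> qperm_intertwiners UNIV \<sigma> \<sigma>'" using Tc by (simp add: qperm_intertwiners_def u nn)
  next
    fix T assume T: "T \<in> qperm_intertwiners UNIV \<sigma> \<sigma>'"
    then have Tc: "T \<in> carrier_mat (qdim \<pi>') (qdim \<pi>)" by (auto simp: qperm_intertwiners_def nn)
    have Tu: "T * A.uent x y = B.uent x y * T" for x y using T by (auto simp: qperm_intertwiners_def u)
    have Tb: "T * block_proj \<pi> i m g = block_proj \<pi>' i m g * T" if i: "i \<in> II" "m \<in> II" "g \<in> AutL" for i m g
    proof -
      note [simp] = carrier_matD[OF Tc] carrier_matD[OF A.uent_carrier] carrier_matD[OF B.uent_carrier]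
      let ?x0 = "pt i (g 0)" and ?y0 = "pt m 0" and ?x1 = "pt i (g 1)" and ?y1 = "pt m 1"
      have "T * block_proj \<pi> i m g = (T * A.uent ?x0 ?y0) * A.uent ?x1 ?y1"
        unfolding A.block_uent[OF i] by (simp add: mat_assoc)
      also have "\<dots> = B.uent ?x0 ?y0 * (T * A.uent ?x1 ?y1)"
        unfolding Tu[of ?x0 ?y0] by (simp add: mat_assoc)
      also have "\<dots> = block_proj \<pi>' i m g * T"
        unfolding Tu[of ?x1 ?y1] B.block_uent[OF i] by (simp add: mat_assoc)
      finally show ?thesis .
    qed
    have "T * qent \<pi> i j = qent \<pi>' i j * T" if ij: "i \<in> II" "j \<in> II" for i j
    proof (rule resol_intertwine[OF A.row_resol[OF ij(1)] Tc A.ent_carrier[OF ij] B.ent_carrier[OF ij]])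
      fix t assume "t \<in> (SIGMA m : A.rsupp i. A.gsupp i)"
      then obtain m g where t: "t = (m, g)" and m: "m \<in> II" and g: "g \<in> AutL" by (auto dest: A.rsupp_in A.gsupp_in)
      show "(case t of (m, g) \<Rightarrow> block_proj \<pi>' i m g) \<in> carrier_mat (qdim \<pi>') (qdim \<pi>')"
        using B.block_carrier[OF ij(1) m] by (simp add: t)
      show "T * (case t of (m, g) \<Rightarrow> block_proj \<pi> i m g) = (case t of (m, g) \<Rightarrow> block_proj \<pi>' i m g) * T"
        using Tb[OF ij(1) m g] by (simp add: t)
      show "qent \<pi> i j * (case t of (m, g) \<Rightarrow> block_proj \<pi> i m g) =
          (if fst t = j then 1 else 0) \<cdot>\<^sub>m (case t of (m, g) \<Rightarrow> block_proj \<pi> i m g)"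
        using A.ent_block[OF ij m] mat_smult_zero[OF A.block_carrier[OF ij(1) m]] by (simp add: t)
      show "qent \<pi>' i j * (case t of (m, g) \<Rightarrow> block_proj \<pi>' i m g) =
          (if fst t = j then 1 else 0) \<cdot>\<^sub>m (case t of (m, g) \<Rightarrow> block_proj \<pi>' i m g)"
        using B.ent_block[OF ij m] mat_smult_zero[OF B.block_carrier[OF ij(1) m]] by (simp add: t)
    qed
    moreover have "T * wrep \<pi> i f = wrep \<pi>' i f * T" if i: "i \<in> II" and f: "f \<in> elems (C0 GL)" for i f
    proof (rule resol_intertwine[OF A.row_resol[OF i] Tc A.rep_carrier[OF i f] B.rep_carrier[OF i f]])
      fix t assume "t \<in> (SIGMA m : A.rsupp i. A.gsupp i)"
      then obtain m g where t: "t = (m, g)" and m: "m \<in> II" and g: "g \<in> AutL" by (auto dest: A.rsupp_in A.gsupp_in)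
      show "(case t of (m, g) \<Rightarrow> block_proj \<pi>' i m g) \<in> carrier_mat (qdim \<pi>') (qdim \<pi>')"
        using B.block_carrier[OF i m] by (simp add: t)
      show "T * (case t of (m, g) \<Rightarrow> block_proj \<pi> i m g) = (case t of (m, g) \<Rightarrow> block_proj \<pi>' i m g) * T"
        using Tb[OF i m g] by (simp add: t)
      show "wrep \<pi> i f * (case t of (m, g) \<Rightarrow> block_proj \<pi> i m g) =
          f (snd t) $$ (0, 0) \<cdot>\<^sub>m (case t of (m, g) \<Rightarrow> block_proj \<pi> i m g)"
        using A.rep_block[OF i m f g] by (simp add: t)
      show "wrep \<pi>' i f * (case t of (m, g) \<Rightarrow> block_proj \<pi>' i m g) =
          f (snd t) $$ (0, 0) \<cdot>\<^sub>m (case t of (m, g) \<Rightarrow> block_proj \<pi>' i m g)"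
        using B.rep_block[OF i m f g] by (simp add: t)
    qed
    ultimately show "T \<in> wreath_intertwiners GL II \<pi> \<pi>'"
      using Tc by (simp add: wreath_intertwiners_def qperm_intertwiners_def)
  qed
qed

section \<open>Tensor products of corresponding objects\<close>

locale wreath_pair = A: wreath \<pi> + B: wreath \<pi>' for \<pi> \<pi>' :: "(real set, int \<Rightarrow> int) wcorep"
begin

abbreviation "N \<equiv> A.n * B.n"

text \<open>The test projections for row i of a tensor product. The first factor leads from i to m
  by g, and the second representation is then evaluated at m, not at i: this is the twist of the
  wreath product.\<close>

definition tproj where "tproj i m g h = kron (block_proj \<pi> i m g) (grp_proj \<pi>' m h)"

lemma tproj_carrier: "i \<in> II \<Longrightarrow> m \<in> II \<Longrightarrow> tproj i m g h \<in> carrier_mat N N"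
  unfolding tproj_def by (rule kron_carrier[OF A.block_carrier B.grp_carrier])

definition tidx where "tidx i = (SIGMA t : (SIGMA m : A.rsupp i. A.gsupp i). B.gsupp (fst t))"

lemma tidxD: "((m, g), h) \<in> tidx i \<Longrightarrow> m \<in> II \<and> g \<in> AutL \<and> h \<in> AutL"
  by (auto simp: tidx_def dest: A.rsupp_in A.gsupp_in B.gsupp_in)

lemma tproj_resol:
  assumes "i \<in> II" shows "resol N (tidx i) (\<lambda>t. tproj i (fst (fst t)) (snd (fst t)) (snd t))"
proof -
  have "resol N (tidx i) (\<lambda>(t, h). kron ((\<lambda>(m, g). block_proj \<pi> i m g) t) (grp_proj \<pi>' (fst t) h))"
    unfolding tidx_def by (rule resol_kron_Sigma[OF A.row_resol[OF assms] B.grp_resol]) (auto dest: A.rsupp_in)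
  then show ?thesis by (rule resol_cong) (auto simp: tproj_def)
qed

lemma tproj_eqI:
  assumes i: "i \<in> II" and X: "X \<in> carrier_mat N N" "Y \<in> carrier_mat N N"
    and eq: "\<And>m g h. m \<in> II \<Longrightarrow> g \<in> AutL \<Longrightarrow> h \<in> AutL \<Longrightarrow> X * tproj i m g h = Y * tproj i m g h"
  shows "X = Y"
proof (rule resol_eqI[OF tproj_resol[OF i] X])
  fix t assume t: "t \<in> tidx i"
  obtain m g h where "t = ((m, g), h)" by (metis surj_pair)
  then show "X * tproj i (fst (fst t)) (snd (fst t)) (snd t) = Y * tproj i (fst (fst t)) (snd (fst t)) (snd t)"
    using tidxD t eq by auto
qed

abbreviation "rt i j f \<equiv> rep_tensor GL A.n B.n (wrep \<pi> i) (wrep \<pi>' j) (comult GL f)"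

lemma comult_GL:
  assumes "f \<in> elems (C0 GL)"
  shows "comult GL f \<in> elems (M2 GL)"
    "g \<in> AutL \<Longrightarrow> h \<in> AutL \<Longrightarrow> comult GL f (g, h) = f (g \<otimes>\<^bsub>Aut L\<^esub> h)"
  by (rule comult_group_M2(1)[OF _ assms], rule AutL_mult(2)) (auto intro!: comult_group_M2(2)[OF _ assms] AutL_mult(2))

lemma rt_mult:
  assumes "i \<in> II" "j \<in> II" "f \<in> elems (C0 GL)" "g \<in> AutL" "h \<in> AutL"
  shows "rt i j f \<in> carrier_mat N N"
    "rt i j f * kron (grp_proj \<pi> i g) (grp_proj \<pi>' j h) = f (g \<otimes>\<^bsub>Aut L\<^esub> h) $$ (0, 0) \<cdot>\<^sub>m kron (grp_proj \<pi> i g) (grp_proj \<pi>' j h)"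
proof -
  note c = comult_GL[OF assms(3)]
  show "rt i j f \<in> carrier_mat N N"
    by (rule rep_tensor_mult(1)[OF A.nd[OF assms(1)] B.nd[OF assms(2)] c(1) assms(4,5)])
  show "rt i j f * kron (grp_proj \<pi> i g) (grp_proj \<pi>' j h) = f (g \<otimes>\<^bsub>Aut L\<^esub> h) $$ (0, 0) \<cdot>\<^sub>m kron (grp_proj \<pi> i g) (grp_proj \<pi>' j h)"
    using rep_tensor_mult(2)[OF A.nd[OF assms(1)] B.nd[OF assms(2)] c(1) assms(4,5)] c(2)[OF assms(4,5)]
    unfolding grp_proj_def by simp
qed

lemma rt_carrier: "i \<in> II \<Longrightarrow> j \<in> II \<Longrightarrow> f \<in> elems (C0 GL) \<Longrightarrow> rt i j f \<in> carrier_mat N N"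
  using rt_mult(1)[OF _ _ _ AutL_one(2) AutL_one(2)] .

text \<open>P_ij commutes with p_i, so both operators can be compared on the joint projections of
  the two representations. The lemma brings P_ij next to the test projection, where it selects a
  single summand.\<close>

lemma rt_comm:
  assumes i: "i \<in> II" and j: "j \<in> II" and f: "f \<in> elems (C0 GL)"
  shows "kron (qent \<pi> i j) (1\<^sub>m B.n) * rt i j f = rt i j f * kron (qent \<pi> i j) (1\<^sub>m B.n)"
proof -
  let ?K = "kron (qent \<pi> i j) (1\<^sub>m B.n)"
  have K: "?K \<in> carrier_mat N N" by (rule kron_carrier[OF A.ent_carrier[OF i j]]) simp
  note rc = rt_carrier[OF i j f]
  show ?thesis
  proof (rule resol_eqI[OF resol_kron_Sigma[OF A.grp_resol[OF i] B.grp_resol[OF j]]])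
    fix t assume "t \<in> A.gsupp i \<times> B.gsupp j"
    then obtain g h where t: "t = (g, h)" and g: "g \<in> AutL" and h: "h \<in> AutL" by (auto dest: A.gsupp_in B.gsupp_in)
    let ?q = "kron (grp_proj \<pi> i g) (grp_proj \<pi>' j h)"
    note [simp] = A.ent_dim[OF i j] A.grp_dim[OF i] B.grp_dim[OF j] carrier_matD[OF rc]
    have Kq: "?K * ?q = ?q * ?K"
      using A.ent_grp_comm[OF i j] by (simp add: kron_mult mat_simps)
    have "?K * rt i j f * ?q = ?K * (rt i j f * ?q)" by (simp add: mat_assoc)
    also have "\<dots> = (f (g \<otimes>\<^bsub>Aut L\<^esub> h) $$ (0, 0) \<cdot>\<^sub>m ?q) * ?K"
      unfolding rt_mult(2)[OF i j f g h] by (simp add: mat_mult_smult mat_smult_mult Kq)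
    also have "\<dots> = rt i j f * (?K * ?q)"
      unfolding rt_mult(2)[OF i j f g h, symmetric] Kq by (simp add: mat_assoc)
    also have "\<dots> = rt i j f * ?K * ?q" by (simp add: mat_assoc)
    finally show "?K * rt i j f * (case t of (g, h) \<Rightarrow> kron (grp_proj \<pi> i g) (grp_proj \<pi>' j h)) =
        rt i j f * ?K * (case t of (g, h) \<Rightarrow> kron (grp_proj \<pi> i g) (grp_proj \<pi>' j h))" by (simp add: t)
  qed (rule mult_carrier_mat[OF K rc] mult_carrier_mat[OF rc K])+
qed

abbreviation "wt i f \<equiv> wrep (wreath_tensor GL II \<pi> \<pi>') i f"

lemma wt_carrier: "wt i f \<in> carrier_mat N N"
  by (simp add: wreath_tensor_def)

text \<open>Only the summand j = m survives, and on it the extension of the two representations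
  evaluates the comultiplication of f at (g, h).\<close>

lemma wt_tproj:
  assumes i: "i \<in> II" and f: "f \<in> elems (C0 GL)" and m: "m \<in> II" and g: "g \<in> AutL" and h: "h \<in> AutL"
  shows "wt i f * tproj i m g h = f (g \<otimes>\<^bsub>Aut L\<^esub> h) $$ (0, 0) \<cdot>\<^sub>m tproj i m g h"
proof -
  let ?K = "\<lambda>j. kron (qent \<pi> i j) (1\<^sub>m B.n)" and ?q = "kron (grp_proj \<pi> i g) (grp_proj \<pi>' m h)"
  have K: "?K j \<in> carrier_mat N N" if "j \<in> II" for j
    by (rule kron_carrier[OF A.ent_carrier[OF i that]]) simp
  note [simp] = A.ent_dim[OF i] A.grp_dim[OF i] B.grp_dim[OF m] A.block_dim[OF i m]
  have Kt: "?K j * tproj i m g h = (if j = m then tproj i m g h else 0\<^sub>m N N)" if j: "j \<in> II" for j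
    using A.ent_block[OF i j m] j by (auto simp: tproj_def kron_mult mat_simps kron_zero_left)
  have tm: "?K j * rt i j f * tproj i m g h = (if j = m then rt i m f * tproj i m g h else 0\<^sub>m N N)" if j: "j \<in> II" for j
  proof -
    have "?K j * rt i j f * tproj i m g h = rt i j f * (?K j * tproj i m g h)"
      unfolding rt_comm[OF i j f] using carrier_matD[OF rt_carrier[OF i j f]] carrier_matD[OF K[OF j]] carrier_matD[OF tproj_carrier[OF i m]]
      by (simp add: mat_assoc del: kron_dim)
    then show ?thesis using Kt[OF j] carrier_matD[OF rt_carrier[OF i j f]] by (auto simp: mat_simps)
  qed
  have "wt i f * tproj i m g h = ?K m * rt i m f * tproj i m g h"
    unfolding wreath_tensor_def wcorep.simps
  proof (rule strong_sum_mult_select)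
    show "finite (A.rsupp i)" using resolD(1)[OF qp_row_resol[OF A.qp i]] by (simp add: A.rsupp_def)
    show "A.rsupp i \<subseteq> II" by (auto simp: A.rsupp_def)
    fix j assume "j \<in> II - A.rsupp i"
    then show "?K j * rt i j f = 0\<^sub>m N N"
      using carrier_matD[OF rt_carrier[OF i _ f]] by (auto simp: A.rsupp_def kron_zero_left mat_simps)
  next
    fix j assume "j \<in> II"
    then show "?K j * rt i j f \<in> carrier_mat N N" by (intro mult_carrier_mat[OF K rt_carrier[OF i _ f]])
  next
    fix j assume "j \<in> II" "j \<noteq> m"
    then show "?K j * rt i j f * tproj i m g h = 0\<^sub>m N N" using tm by simp
  qed (use tproj_carrier[OF i m] m in auto)
  also have "\<dots> = rt i m f * tproj i m g h" using tm[OF m] by simp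
  also have "tproj i m g h = ?q * ?K m"
    using m by (simp add: tproj_def block_proj_def A.ent_grp_comm[OF i m] kron_mult mat_simps)
  also have "rt i m f * (?q * ?K m) = rt i m f * ?q * ?K m"
    using m carrier_matD[OF rt_carrier[OF i m f]] by (simp add: mat_assoc)
  also have "\<dots> = f (g \<otimes>\<^bsub>Aut L\<^esub> h) $$ (0, 0) \<cdot>\<^sub>m (?q * ?K m)"
    unfolding rt_mult(2)[OF i m f g h] using m by (simp add: mat_smult_mult)
  finally show ?thesis
    using m by (simp add: tproj_def block_proj_def A.ent_grp_comm[OF i m] kron_mult mat_simps)
qed

abbreviation "we \<equiv> qent_tensor II \<pi> \<pi>'"

text \<open>The first form moves the entry to the right of the test projection, which gives
  commutation with the representation; the second identifies the result for comparison with the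
  tensor product on the graph side.\<close>

lemma we_tproj:
  assumes i: "i \<in> II" and j: "j \<in> II" and m: "m \<in> II"
  shows "we i j * tproj i m g h = tproj i m g h * kron (1\<^sub>m A.n) (qent \<pi>' m j)"
    "we i j * tproj i m g h = kron (block_proj \<pi> i m g) (block_proj \<pi>' m j h)"
proof -
  note [simp] = A.ent_dim[OF i] B.ent_dim[OF m j] B.grp_dim[OF m] A.block_dim[OF i m]
  have "we i j * tproj i m g h = kron (qent \<pi> i m) (qent \<pi>' m j) * tproj i m g h"
  proof (rule qent_tensor_select[OF A.qp B.qp i j tproj_carrier[OF i m] m])
    fix z assume "z \<in> II" "z \<noteq> m"
    then show "kron (qent \<pi> i z) (qent \<pi>' z j) * tproj i m g h = 0\<^sub>m N N"
      using A.ent_block[OF i _ m, of z] B.ent_dim[OF _ j] by (simp add: tproj_def kron_mult kron_zero_left)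
  qed
  also have 1: "\<dots> = kron (block_proj \<pi> i m g) (block_proj \<pi>' m j h)"
    using A.ent_block[OF i m m] m by (simp add: tproj_def kron_mult block_proj_def[of \<pi>'])
  finally show "we i j * tproj i m g h = kron (block_proj \<pi> i m g) (block_proj \<pi>' m j h)" .
  then show "we i j * tproj i m g h = tproj i m g h * kron (1\<^sub>m A.n) (qent \<pi>' m j)"
    by (simp add: tproj_def kron_mult mat_simps block_proj_def[of \<pi>'] B.ent_grp_comm[OF m j])
qed

lemma tensor_corep: "wreath_corep GL II (wreath_tensor GL II \<pi> \<pi>')"
  unfolding wreath_corep_def
proof (intro conjI ballI)
  have simps: "qdim (wreath_tensor GL II \<pi> \<pi>') = N" "qent (wreath_tensor GL II \<pi> \<pi>') = we"
    by (simp_all add: wreath_tensor_def)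
  show "quantum_permutation II (wreath_tensor GL II \<pi> \<pi>')"
    by (rule quantum_permutation_tensor[OF A.qp B.qp simps])
  fix i assume i: "i \<in> II"
  show "nondegenerate_rep GL (qdim (wreath_tensor GL II \<pi> \<pi>')) (wrep (wreath_tensor GL II \<pi> \<pi>') i)"
    unfolding simps
  proof (rule nondegenerate_repI[OF tproj_resol[OF i], where lab = "\<lambda>t. snd (fst t) \<otimes>\<^bsub>Aut L\<^esub> snd t"])
    fix t assume t: "t \<in> tidx i"
    obtain m g h where eq: "t = ((m, g), h)" by (metis surj_pair)
    note d = tidxD[OF t[unfolded eq]]
    show "(snd (fst t) \<otimes>\<^bsub>Aut L\<^esub> snd t) \<in> AutL" using d AutL_mult(2) by (simp add: eq)
    fix f assume "f \<in> elems (C0 GL)"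
    then show "wt i f * tproj i (fst (fst t)) (snd (fst t)) (snd t) =
        f (snd (fst t) \<otimes>\<^bsub>Aut L\<^esub> snd t) $$ (0, 0) \<cdot>\<^sub>m tproj i (fst (fst t)) (snd (fst t)) (snd t)"
      using wt_tproj[OF i] d by (simp add: eq)
  qed (rule wt_carrier)
next
  fix f i j assume f: "f \<in> elems (C0 GL)" and i: "i \<in> II" and j: "j \<in> II"
  note [simp] = carrier_matD[OF wt_carrier] carrier_matD[OF qent_tensor_carrier[of II \<pi> \<pi>']]
  have "wt i f * we i j = we i j * wt i f"
  proof (rule tproj_eqI[OF i])
    fix m g h assume m: "m \<in> II" and g: "g \<in> AutL" and h: "h \<in> AutL"
    let ?q = "tproj i m g h" and ?c = "f (g \<otimes>\<^bsub>Aut L\<^esub> h) $$ (0, 0)" and ?E = "kron (1\<^sub>m A.n) (qent \<pi>' m j)"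
    note [simp] = carrier_matD[OF tproj_carrier[OF i m]] B.ent_dim[OF m j]
    have "wt i f * we i j * ?q = wt i f * (?q * ?E)" using we_tproj(1)[OF i j m] by (simp add: mat_assoc)
    also have "\<dots> = wt i f * ?q * ?E" by (simp add: mat_assoc)
    also have "\<dots> = ?c \<cdot>\<^sub>m (?q * ?E)" unfolding wt_tproj[OF i f m g h] by (simp add: mat_smult_mult)
    also have "\<dots> = we i j * (wt i f * ?q)"
      unfolding wt_tproj[OF i f m g h] we_tproj(1)[OF i j m, symmetric] by (simp add: mat_mult_smult)
    finally show "wt i f * we i j * ?q = we i j * wt i f * ?q" by (simp add: mat_assoc)
  qed (rule mult_carrier_mat[OF wt_carrier qent_tensor_carrier] mult_carrier_mat[OF qent_tensor_carrier wt_carrier])+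
  then show "wt i f * qent (wreath_tensor GL II \<pi> \<pi>') i j = qent (wreath_tensor GL II \<pi> \<pi>') i j * wt i f"
    by (simp add: wreath_tensor_def)
qed

lemma tensor_uent:
  assumes r: "wreath_rel \<sigma> \<pi>" and r': "wreath_rel \<sigma>' \<pi>'"
  shows "qent_tensor UNIV \<sigma> \<sigma>' x y = we (cls x) (cls y) * wt (cls x) (chi (off x) (off y))"
proof (rule tproj_eqI[OF cls_in[of x]])
  note u = wreath_rel_uent(3)[OF r] wreath_rel_uent(3)[OF r']
  note nn = wreath_rel_uent(2)[OF r] wreath_rel_uent(2)[OF r']
  have q: "quantum_permutation UNIV \<sigma>" "quantum_permutation UNIV \<sigma>'"
    using qaD(1)[OF wreath_rel_uent(4)[OF r]] qaD(1)[OF wreath_rel_uent(4)[OF r']] by auto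
  let ?i = "cls x" and ?j = "cls y"
  show "qent_tensor UNIV \<sigma> \<sigma>' x y \<in> carrier_mat N N" using qent_tensor_carrier[of UNIV \<sigma> \<sigma>' x y] by (simp add: nn)
  show "we ?i ?j * wt ?i (chi (off x) (off y)) \<in> carrier_mat N N" by (rule mult_carrier_mat[OF qent_tensor_carrier wt_carrier])
  fix m g h assume m: "m \<in> II" and g: "g \<in> AutL" and h: "h \<in> AutL"
  \<comment> \<open>\<open>?z\<close> is the only intermediate point that contributes on this test
    projection: it lies in coset m, and g takes its offset to that of x.\<close>
  let ?q = "tproj ?i m g h" and ?z = "pt m (inv_into UNIV g (off x))" and ?b = "block_proj \<pi> ?i m g"
  note tc = tproj_carrier[OF cls_in[of x] m]
  note [simp] = carrier_matD[OF wt_carrier] carrier_matD[OF qent_tensor_carrier[of II \<pi> \<pi>']] carrier_matD[OF tc]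
    carrier_matD[OF A.uent_carrier] carrier_matD[OF B.uent_carrier] A.block_dim[OF cls_in[of x] m] B.grp_dim[OF m]
    B.ent_dim[OF m cls_in[of y]] B.rep_dim[OF m chi_C0]
  have gz: "g (off ?z) = off x" using AutL_inv[OF g, of "off ?z" "off x"] m by simp
  have zu: "z = ?z" if "m = cls z" "g (off z) = off x" for z
    using eq_pt_iff[OF m, of z] that AutL_inv[OF g, of "off z" "off x"] by simp
  have ub: "A.uent x z * ?b = (if z = ?z then ?b else 0\<^sub>m A.n A.n)" for z
    using A.uent_block[OF m g, of x z] zu[of z] gz m by auto
  have "qent_tensor UNIV \<sigma> \<sigma>' x y * ?q = kron (qent \<sigma> x ?z) (qent \<sigma>' ?z y) * ?q"
  proof (rule qent_tensor_select[OF q])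
    fix z assume "z \<noteq> ?z"
    then show "kron (qent \<sigma> x z) (qent \<sigma>' z y) * ?q = 0\<^sub>m (qdim \<sigma> * qdim \<sigma>') N"
      using ub[of z] by (simp add: u nn tproj_def kron_mult kron_zero_left del: kron_dim)
  qed (use tc in \<open>simp_all add: nn\<close>)
  also have "\<dots> = kron ?b (B.uent ?z y * grp_proj \<pi>' m h)"
    using ub[of ?z] by (simp add: u tproj_def kron_mult)
  also have "B.uent ?z y * grp_proj \<pi>' m h = qent \<pi>' m ?j * (wrep \<pi>' m (chi (off ?z) (off y)) * grp_proj \<pi>' m h)"
    using m by (simp add: B.uent_def mat_assoc)
  also have "wrep \<pi>' m (chi (off ?z) (off y)) * grp_proj \<pi>' m h = (if h (off y) = off ?z then 1 else 0) \<cdot>\<^sub>m grp_proj \<pi>' m h"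
    unfolding B.rep_grp[OF m chi_C0 h] chi_apply[OF h] ..
  also have "qent \<pi>' m ?j * \<dots> = (if h (off y) = off ?z then 1 else 0) \<cdot>\<^sub>m block_proj \<pi>' m ?j h"
    by (simp add: mat_mult_smult block_proj_def)
  also have "kron ?b \<dots> = (if h (off y) = off ?z then 1 else 0) \<cdot>\<^sub>m (we ?i ?j * ?q)"
    unfolding we_tproj(2)[OF cls_in cls_in m] by (rule kron_smult_right)
  \<comment> \<open>Since g takes the offset of the intermediate point to that of x, the two
    conditions compose to one on the product gh, as in the comultiplication of
    \<open>chi\<close>.\<close>
  also have "h (off y) = off ?z \<longleftrightarrow> (g \<otimes>\<^bsub>Aut L\<^esub> h) (off y) = off x"
    using AutL_inv[OF g, of "h (off y)" "off x"] m by (simp add: AutL_mult(1)[OF g h])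
  also have "(if (g \<otimes>\<^bsub>Aut L\<^esub> h) (off y) = off x then 1 else 0) \<cdot>\<^sub>m (we ?i ?j * ?q) = we ?i ?j * (wt ?i (chi (off x) (off y)) * ?q)"
    unfolding wt_tproj[OF cls_in chi_C0 m g h] chi_apply[OF AutL_mult(2)[OF g h]] by (simp add: mat_mult_smult)
  also have "\<dots> = we ?i ?j * wt ?i (chi (off x) (off y)) * ?q" by (simp add: mat_assoc)
  finally show "qent_tensor UNIV \<sigma> \<sigma>' x y * ?q = we ?i ?j * wt ?i (chi (off x) (off y)) * ?q" .
qed

end

lemma wreath_rel_tensor:
  assumes r: "wreath_rel \<sigma> \<pi>" and r': "wreath_rel \<sigma>' \<pi>'"
  shows "wreath_rel (tens (Qut_cat U1) \<sigma> \<sigma>') (wreath_tensor GL II \<pi> \<pi>')"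
proof -
  interpret wreath_pair \<pi> \<pi>'
    using wreath_rel_uent(1)[OF r] wreath_rel_uent(1)[OF r'] by (simp add: wreath_pair_def)
  have s: "qent (wreath_tensor GL II \<pi> \<pi>') = we" "qdim (wreath_tensor GL II \<pi> \<pi>') = N"
    by (simp_all add: wreath_tensor_def)
  have "quantum_automorphism U1 (tens (Qut_cat U1) \<sigma> \<sigma>')"
    using quantum_automorphism_tensor[OF wreath_rel_uent(4)[OF r] wreath_rel_uent(4)[OF r']] by simp
  then show ?thesis
    unfolding wreath_rel_def
    using tensor_corep tensor_uent[OF r r'] wreath_rel_uent(2)[OF r] wreath_rel_uent(2)[OF r'] by (simp add: s)
qed

text \<open>Solutions of the conjugate equations are morphisms out of the unit, so the unit objects
  must correspond before these solutions can be transported.\<close>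

lemma wreath_rel_unit: "wreath_rel (tunit (Qut_cat U1)) (wreath_unit GL)"
proof -
  let ?\<pi> = "wreath_unit GL :: (real set, int \<Rightarrow> int) wcorep"
  have s: "qdim ?\<pi> = 1" "qent ?\<pi> = qent_unit" "wrep ?\<pi> = (\<lambda>i f. f \<one>\<^bsub>Aut L\<^esub> $$ (0, 0) \<cdot>\<^sub>m 1\<^sub>m 1)"
    by (simp_all add: wreath_unit_def dqg_of_group_def)
  have r: "resol 1 {t} (\<lambda>_. 1\<^sub>m 1)" for t :: 'a
    using msum_single[of "{t}" t "\<lambda>_. 1\<^sub>m 1" 1 1] by (simp add: resol_def projection_one del: One_nat_def)
  have c: "wreath_corep GL II ?\<pi>"
    unfolding wreath_corep_def s
  proof (intro conjI ballI)
    show "quantum_permutation II ?\<pi>"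
    proof (rule quantum_permutationI, unfold s)
      show "resol 1 {x} (\<lambda>_. 1\<^sub>m 1)" "resol 1 {x} (\<lambda>_. 1\<^sub>m 1)" for x :: "real set" by (rule r)+
      show "qent_unit x y \<in> carrier_mat 1 1" for x y :: "real set" by (auto simp: qent_unit_def)
      show "qent_unit x y * 1\<^sub>m 1 = (if t = y then 1\<^sub>m 1 else 0\<^sub>m 1 1)" if "t \<in> {x}" for x y t :: "real set"
        using that by (auto simp: qent_unit_def)
      show "qent_unit x y * 1\<^sub>m 1 = (if t = x then 1\<^sub>m 1 else 0\<^sub>m 1 1)" if "t \<in> {y}" for x y t :: "real set"
        using that by (auto simp: qent_unit_def)
    qed auto
    show "nondegenerate_rep GL 1 (\<lambda>f. f \<one>\<^bsub>Aut L\<^esub> $$ (0, 0) \<cdot>\<^sub>m 1\<^sub>m 1)"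
      by (rule nondegenerate_repI[OF r[of "()"], where lab = "\<lambda>_. \<one>\<^bsub>Aut L\<^esub>"]) (auto simp: AutL_one(2) mat_smult_mult)
    show "f \<one>\<^bsub>Aut L\<^esub> $$ (0, 0) \<cdot>\<^sub>m 1\<^sub>m 1 * qent_unit i j = qent_unit i j * (f \<one>\<^bsub>Aut L\<^esub> $$ (0, 0) \<cdot>\<^sub>m 1\<^sub>m 1)"
      for f :: "(int \<Rightarrow> int) blocks" and i j :: "real set"
      by (auto simp: qent_unit_def mat_simps)
  qed
  interpret wreath ?\<pi> by unfold_locales (rule c)
  have e: "qent_unit x y = qent ?\<pi> (cls x) (cls y) * wrep ?\<pi> (cls x) (chi (off x) (off y))" for x y
  proof -
    have "x = y \<longleftrightarrow> cls x = cls y \<and> off x = off y" using pt_off[of x] pt_off[of y] by metis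
    then show ?thesis using mat_smult_zero[of "1\<^sub>m 1" 1 1]
      by (auto simp: s chi_apply[OF AutL_one(2), unfolded AutL_one(1)] AutL_one(1) qent_unit_def mat_simps)
  qed
  then have "tunit (Qut_cat U1) = \<lparr>qdim = n, qent = uent\<rparr>"
    by (simp add: s uent_def fun_eq_iff)
  then show ?thesis
    unfolding wreath_rel_def using uent_automorphism c e by (simp add: s)
qed

lemma wreath_cat_simps [simp]:
  "objs (wreath_cat G I) = {\<pi>. wreath_corep G I \<pi>}" "hdim (wreath_cat G I) = qdim"
  "mor (wreath_cat G I) = wreath_intertwiners G I" "tens (wreath_cat G I) = wreath_tensor G I"
  "tunit (wreath_cat G I) = wreath_unit G"
  by (simp_all add: wreath_cat_def)

text \<open>The contragredient of a related quantum automorphism supplies the conjugate.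
  Corresponding morphism spaces consist of the same matrices, so the solutions of the conjugate
  equations carry over unchanged.\<close>

lemma wreath_dualisable:
  assumes "wreath_corep GL II \<pi>" shows "dualisable (wreath_cat GL II) \<pi>"
proof -
  obtain \<sigma> where r: "wreath_rel \<sigma> \<pi>" using wreath_rel_surj[OF assms] by blast
  obtain \<tau> R R' where t: "quantum_automorphism U1 \<tau>"
    and R: "R \<in> qperm_intertwiners UNIV (tunit (Qut_cat U1)) (tens (Qut_cat U1) \<tau> \<sigma>)"
      "R' \<in> qperm_intertwiners UNIV (tunit (Qut_cat U1)) (tens (Qut_cat U1) \<sigma> \<tau>)"
    and eq: "kron (mat_adjoint R') (1\<^sub>m (qdim \<sigma>)) * kron (1\<^sub>m (qdim \<sigma>)) R = 1\<^sub>m (qdim \<sigma>)"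
      "kron (mat_adjoint R) (1\<^sub>m (qdim \<tau>)) * kron (1\<^sub>m (qdim \<tau>)) R' = 1\<^sub>m (qdim \<tau>)"
    using Qut_dualisable[OF wreath_rel_uent(4)[OF r]] unfolding dualisable_def by auto
  obtain \<pi>' where r': "wreath_rel \<tau> \<pi>'" using wreath_rel_total[OF t] by blast
  have "R \<in> wreath_intertwiners GL II (wreath_unit GL) (wreath_tensor GL II \<pi>' \<pi>)"
    "R' \<in> wreath_intertwiners GL II (wreath_unit GL) (wreath_tensor GL II \<pi> \<pi>')"
    using R wreath_rel_mor[OF wreath_rel_unit wreath_rel_tensor[OF r' r]]
      wreath_rel_mor[OF wreath_rel_unit wreath_rel_tensor[OF r r']] by blast+
  moreover have "wreath_corep GL II \<pi>'" using r' by (simp add: wreath_rel_def)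
  ultimately show ?thesis
    unfolding dualisable_def using eq wreath_rel_uent(2)[OF r] wreath_rel_uent(2)[OF r'] by auto
qed

theorem proposition7p10:
  shows "dqg_isomorphic (Qut U1) (free_wreath (dqg_of_group (Aut L)) R_mod_Z)"
proof -
  \<comment> \<open>By \<open>wreath_dualisable\<close> the restriction to dualisable objects
    removes nothing, so the relation covers all objects on both sides.\<close>
  let ?C' = "(wreath_cat GL II)\<lparr>objs := {\<pi> \<in> objs (wreath_cat GL II). dualisable (wreath_cat GL II) \<pi>}\<rparr>"
  interpret fiber_star_cat "Qut_cat U1" by (rule fiber_star_cat_Qut)
  interpret tk_equivalence "Qut_cat U1" ?C' wreath_rel
  proof
    fix \<sigma> \<pi> assume r: "wreath_rel \<sigma> \<pi>"
    show "\<sigma> \<in> objs (Qut_cat U1) \<and> \<pi> \<in> objs ?C' \<and> hdim (Qut_cat U1) \<sigma> = hdim ?C' \<pi>"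
      using r wreath_dualisable by (auto simp: wreath_rel_def)
    fix \<sigma>' \<pi>' assume r': "wreath_rel \<sigma>' \<pi>'"
    show "mor (Qut_cat U1) \<sigma> \<sigma>' = mor ?C' \<pi> \<pi>'"
      using wreath_rel_mor[OF r r'] by simp
    show "wreath_rel (tens (Qut_cat U1) \<sigma> \<sigma>') (tens ?C' \<pi> \<pi>')"
      using wreath_rel_tensor[OF r r'] by simp
  next
    fix \<sigma> assume "\<sigma> \<in> objs (Qut_cat U1)"
    then show "\<exists>\<pi>. wreath_rel \<sigma> \<pi>" using wreath_rel_total by simp
  next
    fix \<pi> assume "\<pi> \<in> objs ?C'"
    then show "\<exists>\<sigma>. wreath_rel \<sigma> \<pi>" using wreath_rel_surj by simp
  qed
  show ?thesis unfolding Qut_def free_wreath_def by (rule tk_isomorphic)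
qed

end
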